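(* Let $f\in H^2(\mathcal{B})$. 1. (Fatou type theorem) For $r\to1^-$, and for almost all $\varphi\in[0,2\pi]$ and $\theta\in\mathbb{S}^{d-1}$, the function $f(re^{i\varphi}\theta)$ has a radial limit, denoted $f^*(e^{i\varphi},\theta)$, which satisfies $f^*\in L^2(\mathbb{S}\times\mathbb{S}^{d-1})$. If the expansion of $f$ is $$f(z,\theta)=\sum_{k=0}^{\infty}\sum_{\ell=1}^{a_k}\sum_{j=0}^{\infty}f_{k,\ell;j}z^{k+2j}Y_{k,\ell}(\theta)\qquad\text{for all }|z|<1,\ \theta\in\mathbb{S}^{d-1},$$ then $f^*$ is given by the Laplace–Fourier series $$f^*(e^{i\varphi},\theta)=\sum_{k=0}^{\infty}\sum_{\ell=1}^{a_k}\sum_{j=0}^{\infty}f_{k,\ell;j}z^{k+2j}Y_{k,\ell}(\theta)\qquad\text{for }z=e^{i\varphi}.$$ 2. The following limiting relation holds: $$\lim_{r\to1}\frac1{2\pi}\int_0^{2\pi}\int_{\mathbb{S}^{d-1}}\left|f(re^{i\varphi}\theta)-f^*(e^{i\varphi}\theta)\right|^2d\varphi\,d\theta=0.$$ 3. Let $f^*(e^{i\varphi},\theta)=\sum_{k=0}^{\infty}\sum_{\ell=1}^{a_k}f^*_{k,\ell}(e^{i\varphi})Y_{k,\ell}(\theta)$ be the Laplace–Fourier series of $f^*\in L^2(\mathbb{S}\times\mathbb{S}^{d-1})$, and let $f^*_{k,\ell;j}$, $j\in\mathbb{Z}$, be the Fourier coefficients of $f^*_{k,\ell}(e^{i\varphi})$.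 Then these satisfy the following zero conditions, called Riesz type conditions: $$f^*_{k,\ell;j}=0\qquad\text{for all }j\ne k,k+2,k+4,\dots.$$ These conditions are equivalent to $$\int_0^{2\pi}\int_{\mathbb{S}^{d-1}}f^*(e^{i\varphi},\theta)e^{-ij\varphi}Y_{k,\ell}(\theta)\,d\varphi\,d\theta=0\qquad\text{for all }j\ne k,k+2,k+4,\dots.$$ 4. The following Cauchy–Hua–Aronszajn formula holds: $$\begin{aligned}f(\zeta,\theta')&=\frac1{2\pi i}\int_{\Gamma_1}\int_{\mathbb{S}^{d-1}}H(\zeta,\theta';z,\theta)f^*(z,\theta)\,dz\,d\theta\\&=\frac1{2\pi\omega_d}\int_0^{2\pi}\int_{\mathbb{S}^{d-1}}K\Big(\zeta,\theta';\frac1z,\theta\Big)f^*(z,\theta)\,d\varphi\,d\theta\\&=\frac1{2\pi\omega_d}\int_0^{2\pi}P_{r^2}(2\varphi-2\varphi')\int_{\mathbb{S}^{d-1}}K_P\Big(\frac\zeta z,\theta,\theta'\Big)f^*(z,\theta)\,d\theta\,d\varphi,\end{aligned}$$ where $z=e^{i\varphi}$ and $\zeta=re^{i\varphi'}$, $K$ is the Cauchy type kernel, and $P_r(\varphi)$ is the usual two-dimensional Poisson kernel. The kernel $P_{r^2}(2\varphi-2\varphi')K_P(\zeta/z,\theta,\theta')$ is called the modified Poisson type kernel. Here the contour $\Gamma_1$ is the positively oriented circle $\mathbb{S}^1$, or a bigger contour which encircles it. 5. (Dirichlet problem with $L^2$ data) If a function $f^*(e^{i\varphi},\theta)\in L^2(\mathbb{S}\times\mathbb{S}^{d-1})$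 satisfies the Riesz type conditions $f^*_{k,\ell;j}=0$ for all $j\neq k,k+2,k+4,\dots$, then there exists a unique function $f\in H^2(\mathcal{B})$ which has as a "non-tangential limit" the function $f^*$ in the sense $$\lim_{r\to1}\int_{\mathbb{S}^{d-1}}\int_0^{2\pi}\left|f(re^{i\varphi},\theta)-f^*(e^{i\varphi},\theta)\right|^2d\varphi\,d\theta=0.$$ 6. Every function $f^*\in L^2(\mathbb{S}^1\times\mathbb{S}^{d-1})$ which satisfies the Riesz type conditions belongs to $L^2(\mathbb{S}^1\times\mathbb{S}^{d-1}/\mathbb{Z}_2)$. The map $f\mapsto f^*$ is an isometry between $H^2(\mathcal{B})$ and the subspace of $L^2(\mathbb{S}^1\times\mathbb{S}^{d-1}/\mathbb{Z}_2)$ of functions satisfying the Riesz type conditions. 7. The norm is given by $$\|f\|^2_{H^2(\mathcal{B})}=\frac1{2\pi}\int_{\mathbb{S}^{d-1}}\int_0^{2\pi}\left|f^*(e^{i\varphi}\theta')\right|^2d\varphi\,d\theta'.$$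
   Context: $\mathbb{D}=\{z\in\mathbb{C}:|z|<1\}$; $\mathbb{S}=\mathbb{S}^1$ is the unit circle. $\mathbb{S}^{d-1}$ is the unit sphere of $\mathbb{R}^d$ endowed with the rotation invariant measure $d\theta$, and $\omega_d=\pi^{d/2}/\Gamma(d/2)$. $\mathcal{H}_k(\mathbb{R}^d)$ is the space of harmonic homogeneous complex-valued polynomials of degree $k$, $a_k=\dim\mathcal{H}_k(\mathbb{R}^d)$, and $Y_{k,\ell}:\mathbb{R}^d\to\mathbb{C}$, $\ell=1,\dots,a_k$, is an orthonormal basis of $\mathcal{H}_k(\mathbb{R}^d)$ with respect to $\int_{\mathbb{S}^{d-1}}f(\theta)\overline{g(\theta)}\,d\theta$. The unit ball of the Klein–Dirac quadric is $\mathcal{B}=\{z\theta:|z|<1,\theta\in\mathbb{S}^{d-1}\}=\mathbb{D}\times\mathbb{S}^{d-1}/\mathbb{Z}_2$, where the factor $\mathbb{Z}_2$ means that $(z,\theta)$ and $(-z,-\theta)$ are identified (likewise for $\mathbb{S}^1\times\mathbb{S}^{d-1}/\mathbb{Z}_2$); one writes $f(z\theta)=f(z,\theta)$. $H^2(\mathbb{D})$ is the classical Hardy space with norm $\|g\|_{H^2(\mathbb{D})}=\sup_{r<1}\left(\frac1{2\pi}\int_0^{2\pi}|g(re^{i\varphi})|^2d\varphi\right)^{1/2}$, and $H^{2,k}(\mathbb{D})=\{g:g(z)=g_1(z^2)z^k,\ g_1\in H^2(\mathbb{D})\}$ with the norm inherited from $H^2(\mathbb{D})$. The polyharmonic Hardy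 space $H^2(\mathcal{B})$ is the space of functions $f(z,\theta)=\sum_{k=0}^\infty\sum_{\ell=1}^{a_k}f_{k,\ell}(z)Y_{k,\ell}(\theta)$ with $f_{k,\ell}\in H^{2,k}(\mathbb{D})$ and $\|f\|_{H^2(\mathcal{B})}=\big(\sum_{k,\ell}\|f_{k,\ell}\|^2_{H^2(\mathbb{D})}\big)^{1/2}<\infty$. Kernels. The Cauchy type kernel is $$K(\zeta,\theta';z,\theta)=\sum_{j\ge0}\sum_{k=0}^{\infty}\sum_{\ell=1}^{a_k}\zeta^{2j+k}Y_{k,\ell}(\theta')z^{2j+k}Y_{k,\ell}(\theta),$$ absolutely convergent for $|\zeta z|<1$. The complexified Poisson kernel is $K_P(w,\theta,\theta')=\dfrac{1-w^2}{(1-2w\langle\theta,\theta'\rangle+w^2)^{d/2}}$, $|w|<1$. The Hua–Aronszajn kernel is $$H(\zeta,\theta';z,\theta)=\frac1{\omega_d}\frac{z^{d-1}}{(\zeta^2-2\zeta z\langle\theta,\theta'\rangle+z^2)^{d/2}}=\frac1{\omega_d}\frac1z\frac1{\left(1-2\frac\zeta z\langle\theta,\theta'\rangle+\frac{\zeta^2}{z^2}\right)^{d/2}}.$$ The powers are the analytic branches equal to $1$ at $w=0$, respectively at $\zeta/z=0$ in the last expression. The two-dimensional Poisson kernel is $P_r(\varphi)=\sum_{j=-\infty}^{\infty}r^{|j|}e^{ij\varphi}$.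
   Formalization: In item 4 the second formula has the constant 1/(2π) instead of 1/(2πω_d), and K has its factor Y_{k,ℓ}(θ) conjugated; dθ has total mass ω_d; on a bigger contour f* is read as an extension of f that lies in the Hardy space of a larger ball. *)

theory Defs
  imports "HOL-Complex_Analysis.Complex_Analysis" "HOL-Library.Function_Algebras"
begin

section \<open>Spherical harmonics\<close>

text \<open>Complex-valued functions as a complex vector space; provides \<open>cfun.span\<close> and
  \<open>cfun.dim\<close> (over the complex numbers).\<close>

global_interpretation cfun: vector_space "\<lambda>(c::complex) (f::'a \<Rightarrow> complex) x. c * f x"
  by unfold_locales (auto simp: fun_eq_iff algebra_simps)

definition partial_deriv :: "'n \<Rightarrow> (real^'n \<Rightarrow> complex) \<Rightarrow> real^'n \<Rightarrow> complex" where
  "partial_deriv i p x = frechet_derivative p (at x) (axis i 1)"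

definition laplacian :: "(real^'n \<Rightarrow> complex) \<Rightarrow> real^'n \<Rightarrow> complex" where
  "laplacian p x = (\<Sum>i\<in>UNIV. partial_deriv i (partial_deriv i p) x)"

definition harmonic_homogeneous :: "nat \<Rightarrow> (real^'n \<Rightarrow> complex) set" where
  "harmonic_homogeneous k =
     {p. polynomial_function p \<and> (\<forall>t x. p (t *\<^sub>R x) = t ^ k *\<^sub>R p x) \<and> (\<forall>x. laplacian p x = 0)}"

text \<open>The number $a_k$.\<close>

definition harm_dim :: "'n::finite itself \<Rightarrow> nat \<Rightarrow> nat" where
  "harm_dim _ k = cfun.dim (harmonic_homogeneous k :: (real^'n \<Rightarrow> complex) set)"

definition omega :: "nat \<Rightarrow> real" where
  "omega d = pi powr (real d / 2) / Gamma (real d / 2)"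

text \<open>The rotation invariant measure $d\theta$ on the unit sphere, obtained as the cone measure
  and normalised to have total mass $\omega_d$.  Since $\omega_d = \pi^{d/2}/\Gamma(d/2)$ is half of
  the Euclidean area of the sphere, this is half of the Euclidean surface measure; it is
  the normalisation for which the reproducing formulas with the constant $1/\omega_d$ hold.\<close>

definition sphere_measure :: "(real^'n) measure" where
  "sphere_measure =
     scale_measure (ennreal (omega CARD('n) / measure lborel (ball (0::real^'n) 1)))
       (distr (restrict_space lborel (ball 0 1 - {0})) (restrict_space borel (sphere 0 1))
          (\<lambda>x. x /\<^sub>R norm x))"

lemma sphere_measure_total_mass:
  "emeasure sphere_measure (sphere (0::real^'n) 1) = ennreal (omega CARD('n))"
proof -
  let ?B = "ball (0::real^'n) 1"
  have om: "omega CARD('n) > 0"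
    unfolding omega_def by (simp add: Gamma_real_pos)
  have pos: "measure lborel ?B > 0"
    by (simp add: content_ball_pos)
  have meas: "(\<lambda>x. x /\<^sub>R norm x) \<in>
      restrict_space lborel (?B - {0}) \<rightarrow>\<^sub>M restrict_space borel (sphere 0 1)"
    by (rule measurable_restrict_space2)
      (auto simp: space_restrict_space intro!: measurable_restrict_space1)
  have v: "(\<lambda>x::real^'n. x /\<^sub>R norm x) -` sphere 0 1 \<inter> (?B - {0}) = ?B - {0}"
    by auto
  have "emeasure lborel (?B - {0}) = emeasure lborel ?B"
    by (rule emeasure_Diff_null_set) auto
  also have "\<dots> = ennreal (measure lborel ?B)"
    by (simp add: emeasure_ball content_ball)
  finally have e: "emeasure lborel (?B - {0}) = ennreal (measure lborel ?B)" .
  have "emeasure (distr (restrict_space lborel (?B - {0})) (restrict_space borel (sphere 0 1))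
      (\<lambda>x. x /\<^sub>R norm x)) (sphere 0 1) = ennreal (measure lborel ?B)"
    by (subst emeasure_distr[OF meas])
      (use v e in \<open>simp_all add: sets_restrict_space_iff space_restrict_space emeasure_restrict_space\<close>)
  then show ?thesis
    unfolding sphere_measure_def using pos om by (simp flip: ennreal_mult)
qed

text \<open>\<open>Y k l\<close> for \<open>1 \<le> l \<le> a\<^sub>k\<close> is an orthonormal basis of the space of harmonic
  homogeneous polynomials of degree \<open>k\<close>.\<close>

definition orthonormal_harmonics :: "(nat \<Rightarrow> nat \<Rightarrow> real^'n \<Rightarrow> complex) \<Rightarrow> bool" where
  "orthonormal_harmonics Y \<longleftrightarrow>
     (\<forall>k. (\<forall>l\<in>{1..harm_dim TYPE('n) k}. Y k l \<in> harmonic_homogeneous k) \<and>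
          (\<forall>l\<in>{1..harm_dim TYPE('n) k}. \<forall>m\<in>{1..harm_dim TYPE('n) k}.
             (LINT \<theta>|sphere_measure. Y k l \<theta> * cnj (Y k m \<theta>)) = (if l = m then 1 else 0)) \<and>
          cfun.span (Y k ` {1..harm_dim TYPE('n) k}) = harmonic_homogeneous k)"


section \<open>Hardy spaces\<close>

text \<open>The measure $d\varphi$ on $[0,2\pi]$.\<close>

definition angle_measure :: "real measure" where
  "angle_measure = restrict_space lborel {0..2*pi}"

definition hardy_mean :: "(complex \<Rightarrow> complex) \<Rightarrow> real \<Rightarrow> real" where
  "hardy_mean g r = sqrt (1 / (2*pi) * (LINT \<phi>|angle_measure. (cmod (g (of_real r * cis \<phi>)))\<^sup>2))"

definition hardy_disc :: "(complex \<Rightarrow> complex) set" where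
  "hardy_disc = {g. g holomorphic_on ball 0 1 \<and> bdd_above (hardy_mean g ` {0..<1})}"

definition hardy_disc_norm :: "(complex \<Rightarrow> complex) \<Rightarrow> real" where
  "hardy_disc_norm g = (SUP r\<in>{0..<1}. hardy_mean g r)"

definition hardy_disc_deg :: "nat \<Rightarrow> (complex \<Rightarrow> complex) set" where
  "hardy_disc_deg k = {g. \<exists>g1\<in>hardy_disc. \<forall>z\<in>ball 0 1. g z = g1 (z\<^sup>2) * z ^ k}"

text \<open>The point $z\theta$ of $\mathbb{C}^d$; the points $(z,\theta)$ and $(-z,-\theta)$ are
  identified.  A function on the ball of the quadric is a function of the point $z\theta$.\<close>

definition kd_point :: "complex \<Rightarrow> real^'n \<Rightarrow> complex^'n" where
  "kd_point z \<theta> = (\<chi> i. z * of_real (\<theta> $ i))"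

definition klein_dirac_ball :: "(complex^'n) set" where
  "klein_dirac_ball = {kd_point z \<theta> | z \<theta>. z \<in> ball 0 1 \<and> \<theta> \<in> sphere 0 1}"

definition hardy_expansion ::
    "(nat \<Rightarrow> nat \<Rightarrow> real^'n \<Rightarrow> complex) \<Rightarrow> (complex^'n \<Rightarrow> complex) \<Rightarrow>
     (nat \<Rightarrow> nat \<Rightarrow> complex \<Rightarrow> complex) \<Rightarrow> bool" where
  "hardy_expansion Y f F \<longleftrightarrow>
     (\<forall>k. \<forall>l\<in>{1..harm_dim TYPE('n) k}. F k l \<in> hardy_disc_deg k) \<and>
     (\<forall>z\<in>ball 0 1. \<forall>\<theta>\<in>sphere 0 1.
        (\<lambda>k. \<Sum>l=1..harm_dim TYPE('n) k. F k l z * Y k l \<theta>) sums f (kd_point z \<theta>)) \<and>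
     summable (\<lambda>k. \<Sum>l=1..harm_dim TYPE('n) k. (hardy_disc_norm (F k l))\<^sup>2)"

definition hardy_ball ::
    "(nat \<Rightarrow> nat \<Rightarrow> real^'n \<Rightarrow> complex) \<Rightarrow> (complex^'n \<Rightarrow> complex) set" where
  "hardy_ball Y = {f. \<exists>F. hardy_expansion Y f F}"

text \<open>Well defined, since the component functions are determined by \<open>f\<close> on the disc.\<close>

definition hardy_ball_norm ::
    "(nat \<Rightarrow> nat \<Rightarrow> real^'n \<Rightarrow> complex) \<Rightarrow> (complex^'n \<Rightarrow> complex) \<Rightarrow> real" where
  "hardy_ball_norm Y f =
     (THE N. \<exists>F. hardy_expansion Y f F \<and>
        N = sqrt (\<Sum>k. \<Sum>l=1..harm_dim TYPE('n) k. (hardy_disc_norm (F k l))\<^sup>2))"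

definition harm_index :: "'n::finite itself \<Rightarrow> (nat \<times> nat \<times> nat) set" where
  "harm_index _ = {(k, l, j). l \<in> {1..harm_dim TYPE('n) k}}"

definition power_expansion ::
    "(nat \<Rightarrow> nat \<Rightarrow> real^'n \<Rightarrow> complex) \<Rightarrow> (complex^'n \<Rightarrow> complex) \<Rightarrow>
     (nat \<Rightarrow> nat \<Rightarrow> nat \<Rightarrow> complex) \<Rightarrow> bool" where
  "power_expansion Y f c \<longleftrightarrow>
     (\<forall>z\<in>ball 0 1. \<forall>\<theta>\<in>sphere 0 1.
        ((\<lambda>(k, l, j). c k l j * z ^ (k + 2*j) * Y k l \<theta>) has_sum f (kd_point z \<theta>))
          (harm_index TYPE('n)))"


section \<open>Square integrable functions on the product of the circle and the sphere\<close>

definition circle_sphere_measure :: "(real \<times> (real^'n)) measure" where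
  "circle_sphere_measure = angle_measure \<Otimes>\<^sub>M sphere_measure"

definition l2_circle_sphere :: "(complex \<Rightarrow> real^'n \<Rightarrow> complex) set" where
  "l2_circle_sphere =
     {g. (\<lambda>(\<phi>, \<theta>). g (cis \<phi>) \<theta>) \<in> borel_measurable circle_sphere_measure \<and>
         integrable circle_sphere_measure (\<lambda>(\<phi>, \<theta>). (cmod (g (cis \<phi>) \<theta>))\<^sup>2)}"

definition l2_norm :: "(complex \<Rightarrow> real^'n \<Rightarrow> complex) \<Rightarrow> real" where
  "l2_norm g = sqrt (1 / (2*pi) * (LINT (\<phi>, \<theta>)|circle_sphere_measure. (cmod (g (cis \<phi>) \<theta>))\<^sup>2))"

definition ae_equal ::
    "(complex \<Rightarrow> real^'n \<Rightarrow> complex) \<Rightarrow> (complex \<Rightarrow> real^'n \<Rightarrow> complex) \<Rightarrow> bool" where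
  "ae_equal g h \<longleftrightarrow> (AE (\<phi>, \<theta>) in circle_sphere_measure. g (cis \<phi>) \<theta> = h (cis \<phi>) \<theta>)"

definition l2_circle_sphere_Z2 :: "(complex \<Rightarrow> real^'n \<Rightarrow> complex) set" where
  "l2_circle_sphere_Z2 = {g \<in> l2_circle_sphere. ae_equal (\<lambda>z \<theta>. g (- z) (- \<theta>)) g}"

definition laplace_comp ::
    "(nat \<Rightarrow> nat \<Rightarrow> real^'n \<Rightarrow> complex) \<Rightarrow> (complex \<Rightarrow> real^'n \<Rightarrow> complex) \<Rightarrow>
     nat \<Rightarrow> nat \<Rightarrow> complex \<Rightarrow> complex" where
  "laplace_comp Y g k l z = (LINT \<theta>|sphere_measure. g z \<theta> * cnj (Y k l \<theta>))"

definition laplace_fourier_coeff ::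
    "(nat \<Rightarrow> nat \<Rightarrow> real^'n \<Rightarrow> complex) \<Rightarrow> (complex \<Rightarrow> real^'n \<Rightarrow> complex) \<Rightarrow>
     nat \<Rightarrow> nat \<Rightarrow> int \<Rightarrow> complex" where
  "laplace_fourier_coeff Y g k l j =
     1 / (2*pi) * (LINT \<phi>|angle_measure. laplace_comp Y g k l (cis \<phi>) * cis (- (of_int j * \<phi>)))"

text \<open>The series converges to \<open>g\<close> in $L^2$, unconditionally (for the net of finite partial sums).\<close>

definition laplace_fourier_sums ::
    "(nat \<Rightarrow> nat \<Rightarrow> real^'n \<Rightarrow> complex) \<Rightarrow> (nat \<Rightarrow> nat \<Rightarrow> nat \<Rightarrow> complex) \<Rightarrow>
     (complex \<Rightarrow> real^'n \<Rightarrow> complex) \<Rightarrow> bool" where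
  "laplace_fourier_sums Y c g \<longleftrightarrow>
     ((\<lambda>A. l2_norm (\<lambda>z \<theta>. g z \<theta> - (\<Sum>(k, l, j)\<in>A. c k l j * z ^ (k + 2*j) * Y k l \<theta>))) \<longlongrightarrow> 0)
       (finite_subsets_at_top (harm_index TYPE('n)))"

definition riesz_indices :: "nat \<Rightarrow> int set" where
  "riesz_indices k = {int (k + 2*i) | i. True}"

definition riesz_conditions ::
    "(nat \<Rightarrow> nat \<Rightarrow> real^'n \<Rightarrow> complex) \<Rightarrow> (complex \<Rightarrow> real^'n \<Rightarrow> complex) \<Rightarrow> bool" where
  "riesz_conditions Y g \<longleftrightarrow>
     (\<forall>k. \<forall>l\<in>{1..harm_dim TYPE('n) k}. \<forall>j. j \<notin> riesz_indices k \<longrightarrow>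
        laplace_fourier_coeff Y g k l j = 0)"

text \<open>Pointwise radial limit, with a fixed unspecified value where it does not exist.\<close>

definition boundary_value :: "(complex^'n \<Rightarrow> complex) \<Rightarrow> complex \<Rightarrow> real^'n \<Rightarrow> complex" where
  "boundary_value f z \<theta> = Lim (at_left 1) (\<lambda>r. f (kd_point (of_real r * z) \<theta>))"


section \<open>Kernels\<close>

text \<open>The second harmonic is conjugated, as the harmonics may be complex-valued (for real-valued
  harmonics the conjugation has no effect).  The harmonics being orthonormal for $d\theta$, this
  kernel reproduces without a further factor $1/\omega_d$: one has
  $K(\zeta,\theta';1/z,\theta) = \omega_d^{-1}(1 - 2w\langle\theta,\theta'\rangle + w^2)^{-d/2}$
  with $w = \zeta/z$.\<close>

definition cauchy_kernel ::
    "(nat \<Rightarrow> nat \<Rightarrow> real^'n \<Rightarrow> complex) \<Rightarrow> complex \<Rightarrow> real^'n \<Rightarrow> complex \<Rightarrow> real^'n \<Rightarrow> complex" where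
  "cauchy_kernel Y \<zeta> \<theta>' z \<theta> =
     (\<Sum>\<^sub>\<infinity>(k, l, j)\<in>harm_index TYPE('n).
        \<zeta> ^ (2*j + k) * Y k l \<theta>' * z ^ (2*j + k) * cnj (Y k l \<theta>))"

text \<open>For \<open>cmod w < 1\<close> and $\langle\theta,\theta'\rangle = \cos\alpha$ one has
  $1 - 2w\cos\alpha + w^2 = (1 - we^{i\alpha})(1 - we^{-i\alpha})$ with both factors in the right half
  plane, so the argument never lies on the negative real axis and the principal power is the
  analytic branch which is 1 at \<open>w = 0\<close>.\<close>

definition poisson_denominator :: "complex \<Rightarrow> real^'n \<Rightarrow> real^'n \<Rightarrow> complex" where
  "poisson_denominator w \<theta> \<theta>' =
     (1 - 2 * w * of_real (\<theta> \<bullet> \<theta>') + w\<^sup>2) powr (of_real (real CARD('n) / 2))"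

definition complex_poisson_kernel :: "complex \<Rightarrow> real^'n \<Rightarrow> real^'n \<Rightarrow> complex" where
  "complex_poisson_kernel w \<theta> \<theta>' = (1 - w\<^sup>2) / poisson_denominator w \<theta> \<theta>'"

definition hua_aronszajn_kernel ::
    "complex \<Rightarrow> real^'n \<Rightarrow> complex \<Rightarrow> real^'n \<Rightarrow> complex" where
  "hua_aronszajn_kernel \<zeta> \<theta>' z \<theta> =
     1 / of_real (omega CARD('n)) * (1 / z) * (1 / poisson_denominator (\<zeta> / z) \<theta> \<theta>')"

definition poisson_kernel_2d :: "real \<Rightarrow> real \<Rightarrow> complex" where
  "poisson_kernel_2d r \<phi> =
     (\<Sum>\<^sub>\<infinity>j\<in>(UNIV::int set). of_real (r ^ nat \<bar>j\<bar>) * cis (of_int j * \<phi>))"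

end

theory Submission
  imports Defs
begin

text \<open>Everything is read off the family \<open>c\<close> of Taylor coefficients of \<open>f\<close> with respect to the
  orthonormal harmonics: by Parseval, \<open>f\<close> lies in the Hardy space iff \<open>c\<close> is square summable, and
  the Hardy norm is its $\ell^2$ norm.

  For fixed \<open>\<theta>\<close>, the function \<open>f (z\<theta>)\<close> is a power series in \<open>z\<close> whose coefficients are square
  summable for almost every \<open>\<theta>\<close>, so the radial limits come from the disc.  There they follow from the
  $L^2$ bound for the radial maximal function: after linearising the radius, the norm of the adjoint
  is controlled by $P_r * P_s = P_{rs} \le 8 (P_r + P_s)$.  Fatou's lemma then turns the Parseval
  identities for finite radii into mean square estimates for the limit.

  The generating function of the zonal harmonics gives the Poisson integral on the sphere, an
  approximate identity; this yields the reproducing property, hence the closed form of the kernels,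
  and the density of the harmonics.  The modified Poisson kernel differs from the Cauchy kernel
  by terms whose frequencies the Riesz conditions exclude.  On a bigger contour the integral over the
  sphere is $z \Psi(z^2) / (z^2 - \zeta^2)$ with a holomorphic $\Psi$, to which Cauchy's formula
  applies at $\pm\zeta$.\<close>


text \<open>Orthonormality is assumed within each degree only, and all that is used of the measure
  on the sphere is its total mass and its invariance under orthogonal maps. So orthogonality of
  different degrees has to be proved. Instead of Green's formula, the maximum principle does it: the
  Poisson integral of a harmonic homogeneous \<open>p\<close> is close to a multiple of
  \<open>p\<close> near the boundary, the maximum principle carries this to smaller radii, and
  comparing powers of the radius separates the degrees. Every rearrangement rests on one growth
  fact: Cauchy estimates for the generating function on circles of radius below 1 show that zonal
  harmonics, hence sup norms and dimensions, grow more slowly than any exponential. A factor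
  \<open>r ^ hdeg i\<close> with \<open>r < 1\<close> then makes everything absolutely summable.
  Convergence is first known slice by slice, at almost every angle for almost every
  \<open>\<theta>\<close>. Passing to the product needs a measurable set of convergence, so radii
  are reduced to rational ones.\<close>

abbreviation (input) "dA \<equiv> angle_measure"
abbreviation (input) "dS \<equiv> sphere_measure"
abbreviation (input) "dM \<equiv> circle_sphere_measure"
abbreviation (input) "bmeas M \<equiv> borel_measurable M"

lemmas lint_cong = Bochner_Integration.integral_cong
lemmas lint_cong_AE = Bochner_Integration.integral_cong_AE
lemmas lint_sum = Bochner_Integration.integral_sum
lemmas integrable_bound = Bochner_Integration.integrable_bound

section \<open>Orthogonal invariance of the sphere measure\<close>

text \<open>The image measure is again translation invariant, and two such measures are proportional
  by Fubini's theorem. The unit ball, whose preimage under \<open>U\<close> is itself, fixes the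
  factor.\<close>

lemma lborel_orthogonal_invariant:
 fixes U :: "'a::euclidean_space => 'a"
 assumes U: "orthogonal_transformation U"
 shows "distr lborel borel U = lborel"
proof -
 have lin: "linear U" using U by (rule orthogonal_transformation_linear)
 have surj: "surj U" by (rule orthogonal_transformation_surj[OF U])
 have Um[measurable]: "U : borel_measurable borel"
  using lin by (intro borel_measurable_continuous_onI linear_continuous_on) (simp add: linear_linear)
 define N where "N = distr lborel borel U"
 have sN[simp, measurable_cong]: "sets N = sets borel" by (simp add: N_def)
 have spN[simp]: "space N = UNIV" by (simp add: N_def)
 have vim: "U -` ball 0 r = ball 0 r" for r
  using orthogonal_transformation_norm[OF U] by auto
 have eN: "emeasure N A = emeasure lborel (U -` A)" if "A : sets borel" for A
  using that by (simp add: N_def emeasure_distr)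
 have trans: "(\<integral>\<^sup>+y. g (y + a) \<partial>N) = (\<integral>\<^sup>+y. g y \<partial>N)" if [measurable]: "g : borel_measurable borel"
  for g :: "'a => ennreal" and a
 proof -
  obtain b where b: "a = U b" using surj by auto
  have "(\<integral>\<^sup>+y. g (y + a) \<partial>N) = (\<integral>\<^sup>+x. g (U (x + b)) \<partial>lborel)"
   unfolding N_def by (subst nn_integral_distr) (auto simp: b linear_add[OF lin])
  also have "... = (\<integral>\<^sup>+x. g (U x) \<partial>distr lborel borel (%x. b + x))"
   by (subst nn_integral_distr) (auto simp: add.commute)
  also have "... = (\<integral>\<^sup>+y. g y \<partial>N)"
   unfolding N_def by (subst lborel_distr_plus, subst nn_integral_distr) auto
  finally show ?thesis .
 qed
 \<comment> \<open>In the comparison below the substitution replaces \<open>B\<close> by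
   \<open>y - B\<close>, so invariance under reflections is needed too.\<close>
 have refl: "emeasure lborel {x. y - x : B} = emeasure lborel B" if [measurable]: "B : sets borel" for B and y :: 'a
 proof -
  have "emeasure lborel B = emeasure (distr lborel borel (%x. y + (SUM j:Basis. (-1 * (x \<bullet> j)) *\<^sub>R j))) B"
   by (subst lborel_affine_euclidean[where c="%_. -1" and t=y])
     (auto simp: emeasure_density nn_integral_distr emeasure_distr)
  also have "(%x. y + (SUM j:Basis. (-1 * (x \<bullet> j)) *\<^sub>R j)) = (%x::'a. y - x)"
   by (auto simp: sum_negf euclidean_representation)
  also have "emeasure (distr lborel borel (%x. y - x)) B = emeasure lborel {x. y - x : B}"
   by (subst emeasure_distr) (auto simp: vimage_def)
  finally show ?thesis by simp
 qed
 interpret N: sigma_finite_measure N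
 proof
  show "EX A. countable A & A <= sets N & \<Union> A = space N & (ALL a:A. emeasure N a ~= \<infinity>)"
  proof (intro exI conjI)
   show "countable (range (%n. ball (0::'a) (real n)))" by simp
   show "\<Union> (range (%n. ball (0::'a) (real n))) = space N"
    by (auto simp: reals_Archimedean2)
   show "ALL a:range (%n. ball (0::'a) (real n)). emeasure N a ~= \<infinity>"
    by (auto simp: eN vim emeasure_ball)
  qed auto
 qed
 interpret pair_sigma_finite lborel N ..
 \<comment> \<open>Both sides equal the double integral of
   \<open>indicator A (y + x) * indicator B y\<close>: integrating over \<open>x\<close> at once
   gives the left-hand side, translating \<open>y\<close> by \<open>x\<close> before that gives the
   right-hand side.\<close>
 have key: "emeasure lborel A * emeasure N B = emeasure lborel B * emeasure N A"
  if [measurable]: "A : sets borel" "B : sets borel" for A B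
 proof -
  have "emeasure lborel A * emeasure N B = (\<integral>\<^sup>+y. emeasure lborel A * indicator B y \<partial>N)"
   by (simp add: nn_integral_cmult_indicator)
  also have "... = (\<integral>\<^sup>+y. (\<integral>\<^sup>+x. indicator A (y + x) * indicator B y \<partial>lborel) \<partial>N)"
  proof (intro nn_integral_cong)
   fix y
   have "emeasure lborel A = (\<integral>\<^sup>+x. indicator A x \<partial>distr lborel borel (%x. y + x))"
    by (subst lborel_distr_plus) simp
   also have "... = (\<integral>\<^sup>+x. indicator A (y + x) \<partial>lborel)"
    by (subst nn_integral_distr) auto
   finally show "emeasure lborel A * indicator B y = (\<integral>\<^sup>+x. indicator A (y + x) * indicator B y \<partial>lborel)"
    by (simp add: nn_integral_multc)
  qed
  also have "... = (\<integral>\<^sup>+x. (\<integral>\<^sup>+y. indicator A (y + x) * indicator B y \<partial>N) \<partial>lborel)"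
   by (rule Fubini') measurable
  also have "... = (\<integral>\<^sup>+x. (\<integral>\<^sup>+y. indicator A y * indicator B (y - x) \<partial>N) \<partial>lborel)"
  proof (rule nn_integral_cong)
   fix x
   show "(\<integral>\<^sup>+y. indicator A (y + x) * indicator B y \<partial>N) = (\<integral>\<^sup>+y. indicator A y * indicator B (y - x) \<partial>N)"
    using trans[of "%y. indicator A y * indicator B (y - x)" x] by simp
  qed
  also have "... = (\<integral>\<^sup>+y. (\<integral>\<^sup>+x. indicator A y * indicator B (y - x) \<partial>lborel) \<partial>N)"
   by (rule Fubini'[symmetric]) measurable
  also have "... = (\<integral>\<^sup>+y. indicator A y * emeasure lborel B \<partial>N)"
  proof (intro nn_integral_cong)
   fix y
   have "(\<integral>\<^sup>+x. indicator B (y - x) \<partial>lborel) = (\<integral>\<^sup>+x. indicator {x. y - x : B} x \<partial>lborel)"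
    by (auto intro!: nn_integral_cong simp: indicator_def)
   also have "... = emeasure lborel B" by (subst nn_integral_indicator) (auto simp: refl)
   finally show "(\<integral>\<^sup>+x. indicator A y * indicator B (y - x) \<partial>lborel) = indicator A y * emeasure lborel B"
    by (simp add: nn_integral_cmult)
  qed
  also have "... = emeasure lborel B * emeasure N A"
   by (simp add: nn_integral_multc mult.commute)
  finally show ?thesis .
 qed
 have "N = lborel"
 proof (rule measure_eqI)
  fix A assume "A : sets N"
  then have A: "A : sets borel" by simp
  let ?b = "emeasure lborel (ball (0::'a) 1)"
  have nz: "?b ~= 0" "?b ~= top"
   using less_imp_neq[OF unit_ball_vol_pos[of "real DIM('a)", OF of_nat_0_le_iff]] by (auto simp: emeasure_ball measure_def)
  have "?b * emeasure lborel A = ?b * emeasure N A"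
   using key[OF A, of "ball 0 1"] by (simp add: eN[of "ball 0 1"] vim mult.commute)
  then show "emeasure N A = emeasure lborel A"
   using nz unfolding ennreal_mult_cancel_left by simp
 qed simp
 then show ?thesis by (simp add: N_def)
qed

section \<open>The cone measure on the sphere\<close>

lemma omega_pos: "d > 0 ==> omega d > 0"
 unfolding omega_def by (simp add: Gamma_real_pos)

lemma space_sphere_measure[simp]: "space (dS :: (real^'n) measure) = sphere 0 1"
 by (simp add: sphere_measure_def space_restrict_space space_scale_measure)

lemma sets_sphere_measure:
 "sets (dS :: (real^'n) measure) = sets (restrict_space borel (sphere 0 1))"
 by (simp add: sphere_measure_def)

lemma finite_sphere_measure: "finite_measure (dS :: (real^'n) measure)"
 by (rule finite_measureI) (simp add: sphere_measure_total_mass)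

lemma measure_sphere_measure:
 "measure (dS :: (real^'n) measure) (sphere 0 1) = omega CARD('n)"
 using omega_pos[of "CARD('n)"] by (simp add: measure_def sphere_measure_total_mass)

lemma measurable_normalise:
 "(%x::real^'n. x /\<^sub>R norm x) \<in>
   restrict_space lborel (ball 0 1 - {0}) \<rightarrow>\<^sub>M restrict_space borel (sphere 0 1)"
 by (rule measurable_restrict_space2)
  (auto simp: space_restrict_space intro!: measurable_restrict_space1)

text \<open>An orthogonal map commutes with the radial projection and preserves Lebesgue measure on
  the punctured ball, so it preserves the cone measure.\<close>

lemma distr_sphere_measure_orthogonal:
 fixes U :: "real^'n => real^'n"
 assumes U: "orthogonal_transformation U"
 shows "distr dS dS U = dS"
proof -
 let ?R = "restrict_space lborel (ball (0::real^'n) 1 - {0})"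
 let ?S = "restrict_space borel (sphere (0::real^'n) 1)"
 have lin: "linear U" using U by (rule orthogonal_transformation_linear)
 have nU: "norm (U x) = norm x" for x using U by (rule orthogonal_transformation_norm)
 have U0[simp]: "U x = 0 \<longleftrightarrow> x = 0" for x by (metis nU norm_eq_zero)
 have Um[measurable]: "U : borel_measurable borel"
  using lin by (intro borel_measurable_continuous_onI linear_continuous_on) (simp add: linear_linear)
 have US: "U : ?S \<rightarrow>\<^sub>M ?S"
  by (rule measurable_restrict_space2) (auto simp: space_restrict_space nU intro!: measurable_restrict_space1)
 have UR: "U : ?R \<rightarrow>\<^sub>M ?R"
  by (rule measurable_restrict_space2) (auto simp: space_restrict_space nU dist_norm intro!: measurable_restrict_space1)
 have vim: "U -` (ball 0 1 - {0}) = ball 0 1 - {0}"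
  by (auto simp: nU)
 have dR: "distr ?R ?R U = ?R"
 proof (rule measure_eqI)
  fix A assume "A : sets (distr ?R ?R U)"
  then have A: "A : sets borel" "A <= ball 0 1 - {0}"
   by (auto simp: sets_restrict_space_iff)
  have "emeasure (distr ?R ?R U) A = emeasure ?R (U -` A Int (ball 0 1 - {0}))"
   using UR A by (subst emeasure_distr) (auto simp: sets_restrict_space_iff space_restrict_space)
  also have "U -` A Int (ball 0 1 - {0}) = U -` A"
   using A(2) vim by blast
  also have "emeasure ?R (U -` A) = emeasure lborel (U -` A)"
   using A(2) vim by (subst emeasure_restrict_space) auto
  also have "... = emeasure (distr lborel borel U) A"
   using A(1) by (subst emeasure_distr) auto
  also have "... = emeasure ?R A"
   using A by (subst lborel_orthogonal_invariant[OF U], subst emeasure_restrict_space) auto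
  finally show "emeasure (distr ?R ?R U) A = emeasure ?R A" .
 qed simp
 let ?ny = "%x::real^'n. x /\<^sub>R norm x"
 have "distr (distr ?R ?S ?ny) ?S U = distr ?R ?S (U \<circ> ?ny)"
  by (rule distr_distr[OF US measurable_normalise])
 also have "U \<circ> ?ny = ?ny \<circ> U"
  by (auto simp: fun_eq_iff nU linear_cmul[OF lin])
 also have "distr ?R ?S (?ny \<circ> U) = distr (distr ?R ?R U) ?S ?ny"
  by (rule distr_distr[OF measurable_normalise UR, symmetric])
 finally have *: "distr (distr ?R ?S ?ny) ?S U = distr ?R ?S ?ny" by (simp add: dR)
 show ?thesis
  unfolding sphere_measure_def
 proof (rule measure_eqI)
  fix A let ?c = "ennreal (omega CARD('n) / measure lborel (ball (0::real^'n) 1))"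
  assume "A : sets (distr (scale_measure ?c (distr ?R ?S ?ny)) (scale_measure ?c (distr ?R ?S ?ny)) U)"
  then have A: "A : sets ?S" by simp
  have US': "U : measurable (scale_measure ?c (distr ?R ?S ?ny)) (scale_measure ?c (distr ?R ?S ?ny))"
   "U : measurable (distr ?R ?S ?ny) ?S"
   using US by (auto cong: measurable_cong_sets)
  have "emeasure (distr ?R ?S ?ny) (U -` A Int space ?S) = emeasure (distr (distr ?R ?S ?ny) ?S U) A"
   using US'(2) A by (subst emeasure_distr) auto
  then show "emeasure (distr (scale_measure ?c (distr ?R ?S ?ny)) (scale_measure ?c (distr ?R ?S ?ny)) U) A
    = emeasure (scale_measure ?c (distr ?R ?S ?ny)) A"
   using US'(1) A * by (subst emeasure_distr) (auto simp: space_scale_measure)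
 qed simp
qed

section \<open>Zonal polynomials\<close>

text \<open>Coefficients, in powers of \<open>t\<close>, of the Taylor coefficient of
  \<open>w^n\<close> in \<open>(1 - w^2) * (1 - 2*w*t + w^2) powr (-ny)\<close>. At
  \<open>n = 0\<close> truncated subtraction would make the general formula \<open>ny - 1\<close>,
  hence the separate value.\<close>

definition zonal_coeff :: "real => nat => nat => real" where
 "zonal_coeff ny n j = (if n = 0 then 1 else
   (-1)^j * 2^(n-2*j) * pochhammer ny (n-1-j) * (ny + real n - 1) / (fact j * fact (n-2*j)))"

text \<open>The variable \<open>s\<close> homogenises: at \<open>t = x \<bullet> te\<close> and
  \<open>s = x \<bullet> x\<close> the sum is a homogeneous polynomial of degree \<open>n\<close> in
  \<open>x\<close>, and \<open>s = 1\<close> gives its restriction to the sphere.\<close>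

definition zonal :: "real => nat => real => real => real" where
 "zonal ny n t s = (\<Sum>j\<le>n div 2. zonal_coeff ny n j * t^(n-2*j) * s^j)"

text \<open>The classical coefficients of the Gegenbauer polynomials, generated by
  \<open>(1 - 2*w*t + w^2) powr (-ny)\<close>.\<close>

definition gegenbauer_coeff :: "real => nat => nat => real" where
 "gegenbauer_coeff ny n j = (-1)^j * 2^(n-2*j) * pochhammer ny (n-j) / (fact j * fact (n-2*j))"

definition gegenbauer :: "real => nat => real => real" where
 "gegenbauer ny n t = (\<Sum>j\<le>n div 2. gegenbauer_coeff ny n j * t^(n-2*j))"

text \<open>Multiplying the generating function by \<open>1 - w^2\<close> subtracts the coefficient
  two places earlier. Coefficientwise the identity reduces to
  \<open>(ny + (m - i)) + (i + 1) = ny + n - 1\<close> with \<open>n = m + 2\<close>.\<close>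

lemma zonal_eq_gegenbauer:
 "zonal ny n t 1 = gegenbauer ny n t - (if n < 2 then 0 else gegenbauer ny (n-2) t)"
proof (cases "n < 2")
 case True
 then have "n = 0 \<or> n = 1" by auto
 then show ?thesis
  by (auto simp: zonal_def gegenbauer_def zonal_coeff_def gegenbauer_coeff_def)
next
 case False
 then obtain m where n: "n = m + 2" by (metis le_add_diff_inverse2 not_less)
 have nd: "n div 2 = Suc (m div 2)" by (simp add: n)
 have "gegenbauer ny m t = (\<Sum>j\<le>m div 2. gegenbauer_coeff ny m j * t^(m-2*j))"
  by (simp add: gegenbauer_def)
 also have "... = (\<Sum>j\<le>n div 2. (if j = 0 then 0 else gegenbauer_coeff ny m (j-1) * t^(n-2*j)))"
  unfolding nd by (subst sum.atMost_Suc_shift) (simp add: n)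
 finally have "gegenbauer ny n t - gegenbauer ny m t =
   (\<Sum>j\<le>n div 2. gegenbauer_coeff ny n j * t^(n-2*j) - (if j = 0 then 0 else gegenbauer_coeff ny m (j-1) * t^(n-2*j)))"
  by (simp add: gegenbauer_def sum_subtractf)
 also have "... = (\<Sum>j\<le>n div 2. zonal_coeff ny n j * t^(n-2*j) * 1^j)"
 proof (rule sum.cong[OF refl])
  fix j assume "j : {..n div 2}"
  then have j: "2*j <= n" by auto
  show "gegenbauer_coeff ny n j * t^(n-2*j) - (if j = 0 then 0 else gegenbauer_coeff ny m (j-1) * t^(n-2*j))
   = zonal_coeff ny n j * t^(n-2*j) * 1^j"
  proof (cases j)
   case 0
   then show ?thesis
    by (simp add: gegenbauer_coeff_def zonal_coeff_def n pochhammer_Suc algebra_simps)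
  next
   case (Suc i)
   have i: "i <= m" using j Suc n by auto
   have e1: "n - j = Suc (m - i)" "n - 1 - j = m - i" "n - 2*j = m - 2*i"
    using j Suc n by auto
   have f: "fact j = (real i + 1) * (fact i :: real)" by (simp add: Suc)
   have "gegenbauer_coeff ny n j - gegenbauer_coeff ny m i
     = (-1)^j * 2^(m-2*i) * pochhammer ny (m-i) / (fact j * fact (m-2*i)) * ((ny + (m-i)) + (i+1))"
   proof -
    define A where "A = (-1)^i * 2^(m-2*i) * pochhammer ny (m-i)"
    define D1 D2 where "D1 = (fact i :: real)" and "D2 = (fact (m-2*i) :: real)"
    have nz: "D1 ~= 0" "D2 ~= 0" "real i + 1 ~= 0" by (auto simp: D1_def D2_def)
    have x1: "gegenbauer_coeff ny n j = - A * (ny + (m-i)) / ((real i + 1) * D1 * D2)"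
     unfolding gegenbauer_coeff_def e1 pochhammer_Suc f A_def D1_def D2_def by (simp add: Suc)
    have x2: "gegenbauer_coeff ny m i = A / (D1 * D2)"
     unfolding gegenbauer_coeff_def A_def D1_def D2_def by simp
    have x3: "(-1)^j * 2^(m-2*i) * pochhammer ny (m-i) / (fact j * fact (m-2*i)) = - A / ((real i + 1) * D1 * D2)"
     unfolding f A_def D1_def D2_def by (simp add: Suc)
    show ?thesis unfolding x1 x2 x3 using nz by (simp add: divide_simps) (simp add: algebra_simps)
   qed
   also have "(ny + (m-i)) + (i+1) = ny + real n - 1" using i by (simp add: n of_nat_diff)
   finally have "gegenbauer_coeff ny n j - gegenbauer_coeff ny m i = zonal_coeff ny n j"
    unfolding zonal_coeff_def e1 by (simp add: n)
   then show ?thesis by (simp add: Suc algebra_simps)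
  qed
 qed
 finally show ?thesis using False by (simp add: zonal_def n)
qed

text \<open>The inner series is \<open>X * (X - 2*t)\<close>, so its \<open>i\<close>-th power
  starts at degree \<open>i\<close> and only finitely many powers reach degree \<open>n\<close>. The
  substitution \<open>j = n - i\<close> turns the resulting sum into the Gegenbauer form.\<close>

lemma gegenbauer_fps:
 fixes t ny :: real
 defines "G \<equiv> fps_X^2 - fps_const (2 * complex_of_real t) * fps_X"
 shows "fps_compose (fps_binomial (- complex_of_real ny)) G $ n = of_real (gegenbauer ny n t)"
proof -
 define a where "a = - (2 * complex_of_real t)"
 have G: "G = fps_X * (fps_X + fps_const a)"
  unfolding G_def a_def fps_const_neg[symmetric] by (simp only: power2_eq_square distrib_left right_diff_distrib mult_minus_right add_uminus_conv_diff mult.commute)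
 have binom: "((fps_X + fps_const a)^i) $ m = of_nat (i choose m) * a^(i-m)" for i m
 proof -
  have "(fps_X + fps_const a)^i = (\<Sum>k\<le>i. of_nat (i choose k) * fps_X^k * fps_const a^(i-k))"
   by (rule binomial_ring)
  also have "... = (\<Sum>k\<le>i. fps_const (of_nat (i choose k) * a^(i-k)) * fps_X^k)"
   by (simp add: fps_of_nat[symmetric] fps_const_power mult_ac flip: fps_const_mult)
  finally have "((fps_X + fps_const a)^i) $ m = (\<Sum>k\<le>i. of_nat (i choose k) * a^(i-k) * (if m = k then 1 else 0))"
   by (simp add: fps_sum_nth fps_X_power_nth)
  also have "... = of_nat (i choose m) * a^(i-m)"
   by (cases "m <= i") (simp_all add: sum.delta if_distrib cong: if_cong)
  finally show ?thesis .
 qed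
 have pw: "(G^i) $ n = of_nat (i choose (n-i)) * a^(i-(n-i))" if "i <= n" for i
  using that by (simp add: G power_mult_distrib fps_X_power_mult_nth binom)
 have "fps_compose (fps_binomial (- complex_of_real ny)) G $ n
   = (\<Sum>i=0..n. ((- complex_of_real ny) gchoose i) * (of_nat (i choose (n-i)) * a^(i-(n-i))))"
  by (simp add: fps_compose_nth pw)
 also have "... = (\<Sum>j=0..n. ((- complex_of_real ny) gchoose (n-j)) * (of_nat ((n-j) choose j) * a^(n-2*j)))"
  by (rule sum.reindex_bij_witness[of _ "%j. n-j" "%j. n-j"]) (auto simp: diff_diff_eq mult_2)
 also have "... = (\<Sum>j\<le>n div 2. ((- complex_of_real ny) gchoose (n-j)) * (of_nat ((n-j) choose j) * a^(n-2*j)))"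
  by (rule sum.mono_neutral_right) (auto simp: binomial_eq_0)
 also have "... = (\<Sum>j\<le>n div 2. of_real (gegenbauer_coeff ny n j * t^(n-2*j)))"
 proof (rule sum.cong[OF refl])
  fix j assume "j : {..n div 2}"
  then have j: "2*j <= n" by auto
  have c: "((n-j) choose j) = fact (n-j) / (fact j * fact (n-2*j) :: complex)"
   using j by (subst binomial_fact) (auto simp: diff_diff_eq mult_2)
  have s: "(-1)^(n-j) * (-1)^(n-2*j) = ((-1)^j :: complex)"
  proof -
   have "(-1)^(n-j) * (-1)^(n-2*j) = ((-1)^(j + 2*(n-2*j)) :: complex)"
    unfolding power_add[symmetric] using j by (intro arg_cong[where f="power (-1)"]) simp
   then show ?thesis by (simp add: power_add power_mult)
  qed
  have "((- complex_of_real ny) gchoose (n-j)) * (of_nat ((n-j) choose j) * a^(n-2*j))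
   = ((-1)^(n-j) * (-1)^(n-2*j)) * pochhammer (of_real ny) (n-j) / (fact j * fact (n-2*j)) * (2 * of_real t)^(n-2*j)"
   unfolding gbinomial_pochhammer c a_def by (subst power_minus) (simp add: mult_ac)
  also have "... = of_real (gegenbauer_coeff ny n j * t^(n-2*j))"
   unfolding s gegenbauer_coeff_def by (simp add: power_mult_distrib pochhammer_of_real)
  finally show "((- complex_of_real ny) gchoose (n-j)) * (of_nat ((n-j) choose j) * a^(n-2*j)) = ..." .
 qed
 finally show ?thesis by (simp add: gegenbauer_def)
qed

text \<open>For \<open>w = x + i*y\<close> the imaginary part is \<open>2*y*(x - t)\<close>. If
  \<open>y = 0\<close>, the real part is \<open>(x - t)^2 + (1 - t^2)\<close> and can only be
  nonpositive when \<open>x = t\<close> and \<open>t^2 = 1\<close>, against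
  \<open>cmod w < 1\<close>. If \<open>x = t\<close>, the real part is
  \<open>1 - x^2 - y^2 > 0\<close>.\<close>

lemma poisson_denominator_base:
 fixes t :: real and w :: complex
 assumes t: "\<bar>t\<bar> <= 1" and w: "cmod w < 1"
 shows "1 - 2 * w * of_real t + w^2 ~: \<real>\<^sub>\<le>\<^sub>0"
proof
 assume "1 - 2 * w * of_real t + w^2 : \<real>\<^sub>\<le>\<^sub>0"
 then have im: "Im (1 - 2 * w * of_real t + w^2) = 0" and re: "Re (1 - 2 * w * of_real t + w^2) <= 0"
  by (auto simp: complex_nonpos_Reals_iff)
 define x y where "x = Re w" and "y = Im w"
 have lt: "x^2 + y^2 < 1"
  using w by (simp add: cmod_def x_def y_def real_sqrt_less_iff[of _ 1, simplified])
 have i: "y * (x - t) = 0" using im by (simp add: x_def y_def power2_eq_square algebra_simps)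
 have r: "1 - 2*x*t + x^2 - y^2 <= 0" using re by (simp add: x_def y_def power2_eq_square algebra_simps)
 have t2: "t^2 <= 1" using t by (simp add: abs_square_le_1)
 from i consider "y = 0" | "x = t" by auto
 then show False
 proof cases
  case 1
  have "(x - t)^2 + (1 - t^2) <= 0" using r 1 by (simp add: power2_eq_square algebra_simps)
  then have "(x - t)^2 = 0 & 1 - t^2 = 0" using t2 zero_le_power2[of "x - t"] by linarith
  then show False using lt 1 by auto
 next
  case 2
  then show False using r lt by (simp add: power2_eq_square algebra_simps)
 qed
qed

lemma zonal_has_fps_expansion:
 "(%w. (1 - w^2) * (1 - 2 * w * of_real t + w^2) powr (- of_real ny))
   has_fps_expansion Abs_fps (%n. complex_of_real (zonal ny n t 1))"
proof -
 define G where "G = fps_X^2 - fps_const (2 * complex_of_real t) * fps_X"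
 define F where "F = fps_compose (fps_binomial (- complex_of_real ny)) G"
 have "(%w::complex. (1 - w^2) * ((%x. (1 + x) powr (- of_real ny)) \<circ> (%w. w^2 - 2 * of_real t * w)) w)
  has_fps_expansion (1 - fps_X^2) * F"
  unfolding F_def G_def by (intro fps_expansion_intros) auto
 moreover have "(1 - fps_X^2) * F = Abs_fps (%n. complex_of_real (zonal ny n t 1))"
  using gegenbauer_fps[of ny t]
  by (intro fps_ext)
    (simp add: left_diff_distrib fps_X_power_mult_nth zonal_eq_gegenbauer F_def G_def)
 moreover have "1 + (w^2 - 2 * of_real t * w) = 1 - 2 * w * of_real t + w^2" for w :: complex
  by (simp add: algebra_simps)
 ultimately show ?thesis by (simp only: o_def)
qed

lemma zonal_holomorphic:
 assumes t: "\<bar>t\<bar> <= 1"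
 shows "(%w. (1 - w^2) * (1 - 2 * w * of_real t + w^2) powr (- of_real ny)) holomorphic_on ball 0 1"
 using poisson_denominator_base[OF t] by (intro holomorphic_intros) auto

text \<open>The generating function is holomorphic in the whole unit disc, so its Taylor series
  converges to it there.\<close>

lemma zonal_generating_function:
 fixes t ny :: real and w :: complex
 assumes t: "\<bar>t\<bar> <= 1" and w: "cmod w < 1"
 shows "(%n. of_real (zonal ny n t 1) * w^n) sums ((1 - w^2) / ((1 - 2 * w * of_real t + w^2) powr of_real ny))"
proof -
 have e: "eball 0 1 = ball (0::complex) 1" by (auto simp: in_eball_iff one_ereal_def)
 have "(%n. fps_nth (Abs_fps (%n. complex_of_real (zonal ny n t 1))) n * w^n) sums
   ((1 - w^2) * (1 - 2 * w * of_real t + w^2) powr (- of_real ny))"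
  by (rule has_fps_expansion_imp_sums_complex[OF zonal_has_fps_expansion, where r = 1])
    (use w zonal_holomorphic[OF t] e in auto)
 then show ?thesis by (simp add: powr_minus divide_simps)
qed

text \<open>With \<open>a\<close> on the unit circle and of real part \<open>t\<close>, the
  expression factors as \<open>(1 - a*w) * (1 - cnj a * w)\<close>, and each factor has modulus at
  least \<open>1 - cmod w\<close>.\<close>

lemma poisson_denominator_lower_bound:
 fixes w :: complex
 assumes t: "\<bar>t\<bar> <= 1" and w: "cmod w < 1"
 shows "(1 - cmod w)^2 <= cmod (1 - 2 * w * of_real t + w^2)"
proof -
 define a where "a = Complex t (sqrt (1 - t^2))"
 have t2: "t^2 <= 1" using t by (simp add: abs_square_le_1)
 have na: "cmod a = 1" using t2 by (simp add: a_def cmod_def)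
 have "a * cnj a = 1" using na by (simp add: complex_norm_square[symmetric])
 moreover have "a + cnj a = 2 * of_real t" by (simp add: a_def complex_eq_iff)
 moreover have "(1 - a * w) * (1 - cnj a * w) = 1 - (a + cnj a) * w + (a * cnj a) * w^2"
  by (simp add: algebra_simps power2_eq_square)
 ultimately have "(1 - a * w) * (1 - cnj a * w) = 1 - 2 * w * of_real t + w^2"
  by (simp add: mult_ac)
 moreover have "1 - cmod w <= cmod (1 - a * w)" "1 - cmod w <= cmod (1 - cnj a * w)"
  using norm_triangle_ineq2[of 1 "a * w"] norm_triangle_ineq2[of 1 "cnj a * w"]
  by (simp_all add: norm_mult na)
 ultimately show ?thesis
  using w mult_mono[of "1 - cmod w" "cmod (1 - a * w)" "1 - cmod w" "cmod (1 - cnj a * w)"]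
  by (simp add: power2_eq_square flip: norm_mult)
qed

text \<open>Cauchy's inequality on the circle of radius \<open>rh\<close>, where the generating
  function is bounded uniformly in \<open>t\<close>. As \<open>rh\<close> may be any number between
  0 and 1, the growth in \<open>n\<close> is slower than any exponential.\<close>

lemma zonal_bound:
 assumes rh: "0 < rh" "rh < 1" and ny: "ny >= 0"
 obtains M where "M > 0" "!!n t. \<bar>t\<bar> <= 1 ==> \<bar>zonal ny n t 1\<bar> <= M / rh^n"
proof
 \<comment> \<open>The numerator has modulus at most 2, and the base of the power has modulus at
   least \<open>(1 - rh)^2\<close>.\<close>
 define M where "M = 2 * ((1 - rh)^2) powr (- ny)"
 show "M > 0" using rh by (simp add: M_def)
 fix n and t :: real assume t: "\<bar>t\<bar> <= 1"
 define f where "f = (%w. (1 - w^2) * (1 - 2 * w * of_real t + w^2) powr (- complex_of_real ny))"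
 have hol: "f holomorphic_on ball 0 1" using zonal_holomorphic[OF t] by (simp add: f_def)
 have c: "cmod ((deriv ^^ n) f 0) <= fact n * M / rh^n"
 proof (rule Cauchy_inequality)
  show "f holomorphic_on ball 0 rh" using hol rh by (rule_tac holomorphic_on_subset) auto
  show "continuous_on (cball 0 rh) f"
   using hol rh by (intro holomorphic_on_imp_continuous_on holomorphic_on_subset[OF hol]) auto
  fix w assume "cmod (0 - w) = rh"
  then have w: "cmod w = rh" by simp
  have "cmod (1 - w^2) <= 2"
   using norm_triangle_ineq4[of 1 "w^2"] rh w power_le_one[of rh 2] by (simp add: norm_power)
  moreover have "cmod ((1 - 2 * w * of_real t + w^2) powr (- complex_of_real ny)) <= ((1 - rh)^2) powr (- ny)"
  proof -
   have "1 - 2 * w * of_real t + w^2 ~= 0"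
    using poisson_denominator_base[OF t, of w] w rh by auto
   then have "cmod ((1 - 2 * w * of_real t + w^2) powr (- complex_of_real ny)) = cmod (1 - 2 * w * of_real t + w^2) powr (- ny)"
    using norm_powr_real_powr'[of "complex_of_real (- ny)" "1 - 2 * w * of_real t + w^2"] by simp
   also have "... <= ((1 - rh)^2) powr (- ny)"
    using poisson_denominator_lower_bound[OF t, of w] w rh ny by (intro powr_mono2') auto
   finally show ?thesis .
  qed
  ultimately show "cmod (f w) <= M"
   unfolding f_def M_def norm_mult by (intro mult_mono) auto
 qed (use rh in auto)
 have d: "(deriv ^^ n) f 0 / fact n = complex_of_real (zonal ny n t 1)"
  using fps_nth_fps_expansion[OF zonal_has_fps_expansion[of t ny], of n] by (simp add: f_def)
 show "\<bar>zonal ny n t 1\<bar> <= M / rh^n"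
 proof -
  have "\<bar>zonal ny n t 1\<bar> = cmod ((deriv ^^ n) f 0) / fact n"
   unfolding norm_of_real[where 'a = complex, symmetric] d[symmetric] by (simp add: norm_divide)
  also have "... <= fact n * M / rh^n / fact n"
   using c by (intro divide_right_mono) auto
  finally show ?thesis by simp
 qed
qed

section \<open>Harmonic polynomials\<close>

lemma real_polynomial_partial:
 fixes p :: "real^'n => real"
 assumes "real_polynomial_function p"
 shows "real_polynomial_function (%x. frechet_derivative p (at x) v)"
 using assms
proof (induction rule: real_polynomial_function.induct)
 case (linear f)
 have "frechet_derivative f (at x) = f" for x
  by (rule frechet_derivative_at[symmetric, OF bounded_linear_imp_has_derivative[OF linear]])
 then show ?case by (simp add: real_polynomial_function.intros(2))
next
 case (const c)
 then show ?case by (simp add: real_polynomial_function.intros(2))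
next
 case (add f g)
 have d: "f differentiable at x" "g differentiable at x" for x
  using add by (auto intro: differentiable_at_real_polynomial_function)
 have "frechet_derivative (%x. f x + g x) (at x) v = frechet_derivative f (at x) v + frechet_derivative g (at x) v" for x
  by (subst frechet_derivative_at[symmetric, OF has_derivative_add[OF d[THEN iffD1[OF frechet_derivative_works]]]]) simp
 then show ?case using add by (auto intro: real_polynomial_function.intros(3))
next
 case (mult f g)
 have d: "f differentiable at x" "g differentiable at x" for x
  using mult by (auto intro: differentiable_at_real_polynomial_function)
 have "frechet_derivative (%x. f x * g x) (at x) v
   = f x * frechet_derivative g (at x) v + frechet_derivative f (at x) v * g x" for x
  by (subst frechet_derivative_at[symmetric, OF has_derivative_mult[OF d[THEN iffD1[OF frechet_derivative_works]]]]) simp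
 then show ?case using mult by (simp add: real_polynomial_function.intros(3,4))
qed

lemma frechet_derivative_bounded_linear:
 assumes "bounded_linear L" "p differentiable at x"
 shows "frechet_derivative (%x. L (p x)) (at x) v = L (frechet_derivative p (at x) v)"
 by (rule frechet_derivative_at[symmetric, THEN fun_cong,
   OF bounded_linear.has_derivative[OF assms(1) iffD1[OF frechet_derivative_works assms(2)]]])

lemma polynomial_function_partial_deriv:
 fixes p :: "real^'n => complex"
 assumes p: "polynomial_function p"
 shows "polynomial_function (partial_deriv i p)"
 unfolding polynomial_function_def
proof (intro allI impI)
 fix f :: "complex => real" assume f: "bounded_linear f"
 have "f \<circ> partial_deriv i p = (%x. frechet_derivative (%x. f (p x)) (at x) (axis i 1))"
  using frechet_derivative_bounded_linear[OF f differentiable_at_polynomial_function[OF p]]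
  by (auto simp: partial_deriv_def)
 moreover have "real_polynomial_function (%x. f (p x))"
  using p f by (auto simp: polynomial_function_def o_def)
 ultimately show "real_polynomial_function (f \<circ> partial_deriv i p)"
  by (simp add: real_polynomial_partial)
qed

lemma partial_deriv_eqI:
 "(p has_derivative D) (at x) ==> partial_deriv i p x = D (axis i 1)"
 by (simp add: partial_deriv_def frechet_derivative_at[symmetric])

lemma partial_deriv_has_derivative:
 fixes p :: "real^'n => complex"
 shows "polynomial_function p ==> (p has_derivative frechet_derivative p (at x)) (at x)"
 by (simp add: frechet_derivative_works[symmetric] differentiable_at_polynomial_function)

lemma partial_deriv_bounded_linear:
 fixes p :: "real^'n => complex"
 assumes "bounded_linear L" "polynomial_function p"
 shows "partial_deriv i (%x. L (p x)) = (%x. L (partial_deriv i p x))"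
 using frechet_derivative_bounded_linear[OF assms(1) differentiable_at_polynomial_function[OF assms(2)]]
 by (auto simp: partial_deriv_def)

lemma partial_deriv_add:
 fixes p q :: "real^'n => complex"
 assumes "polynomial_function p" "polynomial_function q"
 shows "partial_deriv i (%x. p x + q x) = (%x. partial_deriv i p x + partial_deriv i q x)"
proof
 fix x show "partial_deriv i (%x. p x + q x) x = partial_deriv i p x + partial_deriv i q x"
  by (subst partial_deriv_eqI[OF has_derivative_add[OF assms[THEN partial_deriv_has_derivative]]])
    (simp add: partial_deriv_def)
qed

lemma laplacian_add:
 fixes p q :: "real^'n => complex"
 assumes "polynomial_function p" "polynomial_function q"
 shows "laplacian (%x. p x + q x) x = laplacian p x + laplacian q x"
 unfolding laplacian_def
 by (simp add: partial_deriv_add assms polynomial_function_partial_deriv sum.distrib)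

lemma laplacian_bounded_linear:
 fixes p :: "real^'n => complex"
 assumes "bounded_linear L" "polynomial_function p"
 shows "laplacian (%x. L (p x)) x = L (laplacian p x)"
 unfolding laplacian_def
 by (simp add: partial_deriv_bounded_linear assms polynomial_function_partial_deriv
    bounded_linear.linear linear_sum)

lemma polynomial_function_bounded_linear_compose:
 "bounded_linear L ==> polynomial_function p ==> polynomial_function (%x. L (p x))"
 using polynomial_function_compose[of p L] by (simp add: o_def polynomial_function_bounded_linear)

lemma partial_deriv_const: "partial_deriv i (%x. c) = (%x. 0)"
 by (rule ext, subst partial_deriv_eqI[OF has_derivative_const]) simp

lemma laplacian_const: "laplacian (%x. c) x = 0"
 by (simp add: laplacian_def partial_deriv_const)

lemma laplacian_sum:
 fixes p :: "'a => real^'n => complex"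
 assumes "finite A" "!!a. a : A ==> polynomial_function (p a)"
 shows "laplacian (%x. SUM a:A. p a x) x = (SUM a:A. laplacian (p a) x)"
 using assms
proof (induction A rule: finite_induct)
 case empty
 then show ?case by (simp add: laplacian_const)
next
 case (insert a A)
 then show ?case by (simp add: laplacian_add polynomial_function_sum)
qed


section \<open>Harmonic polynomials of one degree and the maximum principle\<close>

lemma harmonic_homogeneousD:
 assumes "p : harmonic_homogeneous k"
 shows "polynomial_function p" "p (t *\<^sub>R x) = t ^ k *\<^sub>R p x" "laplacian p x = 0"
 using assms by (auto simp: harmonic_homogeneous_def)

lemma harmonic_homogeneous_cnj:
 assumes "p : harmonic_homogeneous k"
 shows "(%x. cnj (p x)) : harmonic_homogeneous k"
 using assms
 by (auto simp: harmonic_homogeneous_def laplacian_bounded_linear bounded_linear_cnj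
   polynomial_function_bounded_linear_compose)

text \<open>A positive second derivative at the critical point 0 would make \<open>g\<close>
  increase strictly to the right of it.\<close>

lemma second_derivative_local_max:
 fixes g :: "real => real"
 assumes g: "!!s. (g has_real_derivative g' s) (at s)"
  and g': "(g' has_real_derivative D) (at 0)"
  and mx: "ep > 0" "!!s. \<bar>s\<bar> < ep ==> g s <= g 0"
 shows "D <= 0"
proof (rule ccontr)
 assume D: "\<not> D <= 0"
 have "g' 0 = 0"
  by (rule DERIV_local_max[OF g mx(1)]) (use mx(2) in auto)
 obtain d where d: "d > 0" "!!h. 0 < h ==> h < d ==> g' 0 < g' (0 + h)"
  using DERIV_pos_inc_right[OF g'] D by auto
 define h where "h = min d ep / 2"
 have h: "0 < h" "h < d" "h < ep" using d(1) mx(1) by (auto simp: h_def)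
 have "g 0 < g h"
 proof (rule DERIV_pos_imp_increasing_open[OF h(1)])
  show "EX y. (g has_real_derivative y) (at x) & 0 < y" if "0 < x" "x < h" for x
   using g[of x] d(2)[of x] h that \<open>g' 0 = 0\<close> by (intro exI[of _ "g' x"]) auto
  show "continuous_on {0..h} g"
   by (rule DERIV_continuous_on[of _ g g']) (rule has_field_derivative_at_within[OF g])
 qed
 with mx(2)[of h] h show False by auto
qed

text \<open>At an interior maximum every pure second derivative of the real part is nonpositive,
  hence so is their sum, against \<open>lap\<close>. The maximum over the closed ball is therefore
  attained on its boundary.\<close>

lemma maximum_principle_strict:
 fixes p :: "real^'n => complex"
 assumes p: "polynomial_function p" and lap: "!!x. Re (laplacian p x) > 0"
  and x: "norm x <= r"
  and bd: "!!y. norm y = r ==> Re (p y) <= M"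
 shows "Re (p x) <= M"
proof -
 have cont: "continuous_on (cball 0 r) (%x. Re (p x))"
  by (intro continuous_intros continuous_on_polymonial_function p)
 have ne: "cball 0 r ~= ({} :: (real^'n) set)" using x by (metis empty_iff mem_cball_0)
 obtain x0 where x0: "x0 : cball 0 r" "!!y. y : cball 0 r ==> Re (p y) <= Re (p x0)"
  using continuous_attains_sup[OF compact_cball ne cont] by blast
 have "norm x0 = r"
 proof (rule ccontr)
  assume "norm x0 ~= r"
  then have lt: "norm x0 < r" using x0(1) by auto
  have "Re (partial_deriv i (partial_deriv i p) x0) <= 0" for i
  proof (rule second_derivative_local_max)
   let ?l = "%s. x0 + s *\<^sub>R (axis i 1 :: real^'n)"
   have dl: "(?l has_derivative (%h. h *\<^sub>R axis i 1)) (at s)" for s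
    by (auto intro!: derivative_eq_intros)
   have *: "((%s. Re (q (?l s))) has_real_derivative Re (partial_deriv i q (?l s))) (at s)"
    if q: "polynomial_function q" for q s
   proof -
    have "((%s. Re (q (?l s))) has_derivative (%h. Re (frechet_derivative q (at (?l s)) (h *\<^sub>R axis i 1)))) (at s)"
     by (rule bounded_linear.has_derivative[OF bounded_linear_Re])
       (rule has_derivative_compose[OF dl partial_deriv_has_derivative[OF q]])
    moreover have "frechet_derivative q (at (?l s)) (h *\<^sub>R axis i 1) = h *\<^sub>R partial_deriv i q (?l s)" for h
     using has_derivative_linear[OF partial_deriv_has_derivative[OF q]]
     by (simp add: linear_cmul partial_deriv_def)
    ultimately show ?thesis
     by (simp add: has_field_derivative_def mult.commute[of _ "Re _"])
   qed
   show "((%s. Re (p (?l s))) has_real_derivative Re (partial_deriv i p (?l s))) (at s)" for s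
    by (rule *[OF p])
   show "((%s. Re (partial_deriv i p (?l s))) has_real_derivative Re (partial_deriv i (partial_deriv i p) x0)) (at 0)"
    using *[OF polynomial_function_partial_deriv[OF p], of i 0] by simp
   show "r - norm x0 > 0" using lt by simp
   fix s :: real assume s: "\<bar>s\<bar> < r - norm x0"
   have "norm (?l s) <= norm x0 + \<bar>s\<bar>"
    using norm_triangle_ineq[of x0 "s *\<^sub>R axis i 1"] by simp
   then show "Re (p (?l s)) <= Re (p (?l 0))" using s x0(2)[of "?l s"] by simp
  qed
  then have "Re (laplacian p x0) <= 0" by (auto simp: laplacian_def intro: sum_nonpos)
  with lap[of x0] show False by simp
 qed
 then show ?thesis using bd[of x0] x0(2)[of x] x by auto
qed

lemma laplacian_norm_square:
 "polynomial_function (%x::real^'n. complex_of_real (x \<bullet> x))"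
 "laplacian (%x::real^'n. complex_of_real (x \<bullet> x)) x = of_nat (2 * CARD('n))"
proof -
 have 1: "partial_deriv i (%x::real^'n. complex_of_real (x \<bullet> x)) = (%x. 2 * of_real (x $ i))" for i
 proof
  fix x :: "real^'n"
  show "partial_deriv i (%x::real^'n. complex_of_real (x \<bullet> x)) x = 2 * of_real (x $ i)"
  proof -
   have "((%x::real^'n. x \<bullet> x) has_derivative (%h. x \<bullet> h + h \<bullet> x)) (at x)"
    by (rule has_derivative_inner[OF has_derivative_ident has_derivative_ident])
   from partial_deriv_eqI[OF bounded_linear.has_derivative[OF bounded_linear_of_real this], of i]
   have "partial_deriv i (%x::real^'n. complex_of_real (x \<bullet> x)) x = of_real (x \<bullet> axis i 1 + axis i 1 \<bullet> x)" .
   also have "x \<bullet> axis i 1 + axis i 1 \<bullet> x = 2 * x $ i"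
    by (simp only: inner_axis inner_axis') simp
   finally show ?thesis by simp
  qed
 qed
 have 2: "partial_deriv i (%x::real^'n. 2 * complex_of_real (x $ i)) x = 2" for i
  by (subst partial_deriv_eqI[where D = "%h. 2 * complex_of_real (h $ i)"])
    (auto intro!: bounded_linear_imp_has_derivative bounded_linear_const_mult
     bounded_linear_compose[OF bounded_linear_of_real bounded_linear_vec_nth])
 show "laplacian (%x::real^'n. complex_of_real (x \<bullet> x)) x = of_nat (2 * CARD('n))"
  by (simp add: laplacian_def 1 2)
 have "polynomial_function (%x::real^'n. x \<bullet> x)" 
  unfolding real_polynomial_function_eq[symmetric] inner_vec_def inner_real_def
  by (intro real_polynomial_function_sum real_polynomial_function.intros(4)
     real_polynomial_function.intros(1) bounded_linear_vec_nth finite)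
 then show "polynomial_function (%x::real^'n. complex_of_real (x \<bullet> x))"
  by (rule polynomial_function_bounded_linear_compose[OF bounded_linear_of_real])
qed

text \<open>The perturbation by \<open>c * (x \<bullet> x)\<close> makes the Laplacian positive, which an
 interior maximum excludes.\<close>

lemma maximum_principle:
 fixes p :: "real^'n => complex"
 assumes p: "polynomial_function p" and lap: "!!x. laplacian p x = 0"
  and x: "norm x <= r"
  and bd: "!!y. norm y = r ==> Re (p y) <= M"
 shows "Re (p x) <= M"
proof (rule field_le_epsilon)
 fix e :: real assume e: "e > 0"
 define c where "c = e / (r^2 + 1)"
 have pos: "r^2 + 1 > 0" using zero_le_power2[of r] by linarith
 have c: "c > 0" using e pos by (simp add: c_def)
 let ?q = "%x::real^'n. complex_of_real c * of_real (x \<bullet> x)"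
 have q: "polynomial_function ?q"
 proof -
  have "bounded_linear (%z. complex_of_real c * z)" by (rule bounded_linear_mult_right)
  from polynomial_function_bounded_linear_compose[OF this laplacian_norm_square(1)]
  show ?thesis by simp
 qed
 have ql: "laplacian ?q x = of_real c * of_nat (2 * CARD('n))" for x
  by (subst laplacian_bounded_linear[OF bounded_linear_mult_right laplacian_norm_square(1)])
    (simp add: laplacian_norm_square)
 have "Re (p x + ?q x) <= M + c * r^2"
 proof (rule maximum_principle_strict[OF _ _ x])
  show "polynomial_function (%x. p x + ?q x)" using p q by (rule polynomial_function_add)
  show "Re (laplacian (%x. p x + ?q x) x) > 0" for x
   using c by (simp add: laplacian_add[OF p q] lap ql)
  show "Re (p y + ?q y) <= M + c * r^2" if "norm y = r" for y
   using bd[OF that] that c by (simp add: dot_square_norm)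
 qed
 moreover have "c * r^2 <= e" using e pos by (simp add: c_def field_simps)
 moreover have "Re (p x) <= Re (p x + ?q x)" using c by simp
 ultimately show "Re (p x) <= M + e" by linarith
qed

text \<open>Multiplying \<open>p\<close> by the conjugate phase of its value at \<open>x\<close>
  makes that value real and nonnegative, and the principle for real parts applies.\<close>

lemma maximum_principle_cmod:
 fixes p :: "real^'n => complex"
 assumes p: "polynomial_function p" and lap: "!!x. laplacian p x = 0"
  and x: "norm x <= r"
  and bd: "!!y. norm y = r ==> cmod (p y) <= M"
 shows "cmod (p x) <= M"
proof -
 \<comment> \<open>This is 0 if \<open>p x = 0\<close>, so what holds in general is
   \<open>cmod u <= 1\<close>.\<close>
 define u where "u = cnj (sgn (p x))"
 have "Re (u * p x) <= M"
 proof (rule maximum_principle[OF _ _ x])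
  show "polynomial_function (%x. u * p x)"
   by (rule polynomial_function_bounded_linear_compose[where L="%z. _ * z", OF bounded_linear_mult_right p])
  show "laplacian (%x. u * p x) x = 0" for x
   using laplacian_bounded_linear[OF bounded_linear_mult_right p, of u x] lap[of x] by simp
  fix y :: "real^'n" assume y: "norm y = r"
  have "cmod u <= 1" by (simp add: u_def norm_sgn)
  then have "cmod (u * p y) <= 1 * M"
   unfolding norm_mult using bd[OF y] by (intro mult_mono) auto
  then show "Re (u * p y) <= M" using complex_Re_le_cmod[of "u * p y"] by linarith
 qed
 moreover have "u * p x = of_real (cmod (p x))"
 proof (cases "p x = 0")
  case False
  have "u * p x = of_real ((cmod (p x))^2) / of_real (cmod (p x))"
   unfolding complex_norm_square by (simp add: u_def sgn_eq)
  then show ?thesis using False by (simp add: power2_eq_square)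
 qed simp
 ultimately show ?thesis by simp
qed

section \<open>Zonal harmonics\<close>

text \<open>The zonal harmonic with pole \<open>te\<close>, unnormalised. The parameter is half the
  dimension because the generating series is to be the Poisson kernel, whose exponent is
  \<open>d/2\<close>.\<close>

definition zharm :: "nat => real^'n => real^'n => complex" where
 "zharm k te x = of_real (zonal (real CARD('n) / 2) k (x \<bullet> te) (x \<bullet> x))"

text \<open>For \<open>ny\<close> half the dimension, this recursion is what harmonicity of the
  zonal polynomial amounts to.\<close>

lemma zonal_coeff_Suc:
 assumes "2 * Suc j <= n"
 shows "zonal_coeff ny n (Suc j) * (real j + 1) * 4 * (ny + real n - real j - 2)
   = - zonal_coeff ny n j * real (n - 2*j) * real (n - 2*j - 1)"
proof -
 define m where "m = n - 2 * Suc j"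
 have n: "n = m + 2 * j + 2" using assms by (simp add: m_def)
 have e: "n - 2 * Suc j = m" "n - 2*j = Suc (Suc m)" "n - 1 - Suc j = m + j" "n - 1 - j = Suc (m + j)" "n - 2*j - 1 = Suc m"
  by (auto simp: n)
 define A where "A = (-1)^j * 2^m * pochhammer ny (m+j) * (ny + real n - 1)"
 define D1 D2 where "D1 = (fact j :: real)" and "D2 = (fact m :: real)"
 have nz: "D1 ~= 0" "D2 ~= 0" "real j + 1 ~= 0" "real m + 1 ~= 0" "real m + 2 ~= 0" by (auto simp: D1_def D2_def)
 have x1: "zonal_coeff ny n (Suc j) = - A / ((real j + 1) * D1 * D2)"
  unfolding zonal_coeff_def e A_def D1_def D2_def by (simp add: n)
 have x2: "zonal_coeff ny n j = 4 * A * (ny + (real m + real j)) / (D1 * ((real m + 2) * (real m + 1) * D2))"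
  unfolding zonal_coeff_def e A_def D1_def D2_def pochhammer_Suc fact_Suc by (simp add: n mult_ac add_ac)
 show ?thesis
  unfolding e x1 x2 using nz
  by (simp add: divide_simps n) (simp add: algebra_simps)
qed

text \<open>Truncated exponents such as \<open>a-2\<close> and \<open>b-1\<close> are harmless:
  wherever truncation occurs, the factor in front is 0.\<close>

lemma zonal_monomial:
 fixes te :: "real^'n"
 assumes te: "norm te = 1"
 defines "T \<equiv> %a b x. complex_of_real ((x \<bullet> te)^a * (x \<bullet> x)^b)"
 shows "polynomial_function (T a b)"
  and "laplacian (T a b) x = of_real (real a * real (a-1)) * T (a-2) b x
    + of_real (real (4*a*b + 2*b*CARD('n) + 4*b*(b-1))) * T a (b-1) x"
proof -
 let ?R = "%a b x. (x \<bullet> te)^a * (x \<bullet> x)^b"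
 have rp1: "real_polynomial_function (%x. x \<bullet> te)"
  by (rule real_polynomial_function.intros(1)) (rule bounded_linear_inner_left)
 have rp2: "real_polynomial_function (%x::real^'n. x \<bullet> x)"
  unfolding inner_vec_def inner_real_def
  by (intro real_polynomial_function_sum real_polynomial_function.intros(4)
     real_polynomial_function.intros(1) bounded_linear_vec_nth finite)
 have "real_polynomial_function (?R a b)" for a b
  by (intro real_polynomial_function.intros(4) real_polynomial_function_power rp1 rp2)
 then show poly: "polynomial_function (T a b)" for a b
  unfolding T_def real_polynomial_function_eq by (rule polynomial_function_bounded_linear_compose[OF bounded_linear_of_real])
 have R1: "(?R a b has_derivative (%h. real a * (h \<bullet> te) * ?R (a-1) b x + 2 * real b * (x \<bullet> h) * ?R a (b-1) x)) (at x)" for a b x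
  by (rule has_derivative_eq_rhs, rule has_derivative_mult,
    (rule has_derivative_power has_derivative_inner has_derivative_ident has_derivative_inner_left)+)
    (auto simp: fun_eq_iff algebra_simps inner_commute)
 have P1: "partial_deriv i (T a b) = (%x. of_real (real a * te $ i * ?R (a-1) b x + 2 * real b * x $ i * ?R a (b-1) x))" for i a b
  unfolding T_def
  by (rule ext, subst partial_deriv_eqI[OF bounded_linear.has_derivative[OF bounded_linear_of_real R1]])
    (simp add: inner_axis inner_axis')
 have P2: "partial_deriv i (%x. of_real (real a * te $ i * ?R (a-1) b x + 2 * real b * x $ i * ?R a (b-1) x)) x
   = complex_of_real (real a * te $ i * (real (a-1) * te $ i * ?R (a-2) b x + 2 * real b * x $ i * ?R (a-1) (b-1) x)
     + 2 * real b * ?R a (b-1) x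
     + 2 * real b * x $ i * (real a * te $ i * ?R (a-1) (b-1) x + 2 * real (b-1) * x $ i * ?R a (b-2) x))" for i
 proof -
  have "((%x. real a * te $ i * ?R (a-1) b x + 2 * real b * x $ i * ?R a (b-1) x) has_derivative
   (%h. real a * te $ i * (real (a-1) * (h \<bullet> te) * ?R (a-1-1) b x + 2 * real b * (x \<bullet> h) * ?R (a-1) (b-1) x) +
     (2 * real b * x $ i * (real a * (h \<bullet> te) * ?R (a-1) (b-1) x + 2 * real (b-1) * (x \<bullet> h) * ?R a (b-1-1) x)
     + 2 * real b * h $ i * ?R a (b-1) x))) (at x)"
   by (intro has_derivative_add has_derivative_mult_right[OF R1] has_derivative_mult[OF _ R1]
     has_derivative_mult_right bounded_linear_imp_has_derivative bounded_linear_vec_nth)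
  from partial_deriv_eqI[OF bounded_linear.has_derivative[OF bounded_linear_of_real this], of i]
  show ?thesis by (simp add: inner_axis inner_axis' numeral_2_eq_2 algebra_simps)
 qed
 have s1: "(SUM i:UNIV. te $ i * te $ i) = 1"
  using te by (simp add: norm_eq_sqrt_inner inner_vec_def)
 have s2: "(SUM i:UNIV. te $ i * x $ i) = x \<bullet> te" by (simp add: inner_vec_def mult.commute)
 have s3: "(SUM i:UNIV. x $ i * x $ i) = x \<bullet> x" by (simp add: inner_vec_def)
 have "laplacian (T a b) x = of_real (SUM i:UNIV. 
    (real a * real (a-1) * ?R (a-2) b x) * (te $ i * te $ i)
    + (4 * real a * real b * ?R (a-1) (b-1) x) * (te $ i * x $ i)
    + 2 * real b * ?R a (b-1) x
    + (4 * real b * real (b-1) * ?R a (b-2) x) * (x $ i * x $ i))"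
  unfolding laplacian_def P1 P2 of_real_sum by (intro sum.cong refl arg_cong[where f=of_real]) (simp add: algebra_simps)
 also have "... = of_real (real a * real (a-1) * ?R (a-2) b x
    + 4 * real a * real b * ?R (a-1) (b-1) x * (x \<bullet> te)
    + real CARD('n) * (2 * real b * ?R a (b-1) x)
    + 4 * real b * real (b-1) * ?R a (b-2) x * (x \<bullet> x))"
  by (simp add: sum.distrib s1 s2 s3 flip: sum_distrib_left)
 also have "4 * real a * real b * ?R (a-1) (b-1) x * (x \<bullet> te) = 4 * real a * real b * ?R a (b-1) x"
  by (cases a) auto
 also have "4 * real b * real (b-1) * ?R a (b-2) x * (x \<bullet> x) = 4 * real b * real (b-1) * ?R a (b-1) x"
  by (cases "b <= 1") (auto simp: not_le le_Suc_eq numeral_2_eq_2 dest!: less_imp_Suc_add)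
 finally have "laplacian (T a b) x = of_real (real a * real (a-1) * ?R (a-2) b x
    + 4 * real a * real b * ?R a (b-1) x
    + real CARD('n) * (2 * real b * ?R a (b-1) x)
    + 4 * real b * real (b-1) * ?R a (b-1) x)" .
 moreover have "real (4*a*b + 2*b*CARD('n) + 4*b*(b-1))
   = 4 * real a * real b + real CARD('n) * (2 * real b) + 4 * real b * real (b-1)"
  by (simp only: of_nat_add of_nat_mult of_nat_numeral mult_ac)
 ultimately show "laplacian (T a b) x = of_real (real a * real (a-1)) * T (a-2) b x
    + of_real (real (4*a*b + 2*b*CARD('n) + 4*b*(b-1))) * T a (b-1) x"
  by (simp only: T_def of_real_add of_real_mult distrib_right distrib_left mult_ac add_ac)
qed

text \<open>The Laplacian lowers either the power of \<open>x \<bullet> te\<close> by two or the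
  power of \<open>x \<bullet> x\<close> by one. The first effect on the term \<open>j\<close>
  cancels the second effect on the term \<open>j + 1\<close>.\<close>

lemma zonal_harmonic_in:
 fixes te :: "real^'n"
 assumes te: "norm te = 1"
 shows "zharm n te : harmonic_homogeneous n"
proof -
 define ny where "ny = real CARD('n) / 2"
 define T where "T a b = (%x. complex_of_real ((x \<bullet> te)^a * (x \<bullet> x)^b))" for a b
 note Tpoly = zonal_monomial(1)[OF te, folded T_def] 
 have Tlap: "laplacian (T a b) x = of_real (real a * real (a-1)) * T (a-2) b x
    + of_real (real (4*a*b + 2*b*CARD('n) + 4*b*(b-1))) * T a (b-1) x" for a b x
  unfolding T_def by (rule zonal_monomial(2)[OF te])
 let ?be = "%j. complex_of_real (zonal_coeff ny n j)"
 have Z: "zharm n te = (%x. \<Sum>j\<le>n div 2. ?be j * T (n-2*j) j x)"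
  by (auto simp: zharm_def zonal_def T_def ny_def mult_ac)
 have Spoly: "polynomial_function (%x. ?be j * T (n-2*j) j x)" for j
  by (rule polynomial_function_bounded_linear_compose[OF bounded_linear_mult_right Tpoly])
 have hom: "zharm n te (t *\<^sub>R x) = t ^ n *\<^sub>R zharm n te x" for t x
 proof -
  have "T (n-2*j) j (t *\<^sub>R x) = t ^ n *\<^sub>R T (n-2*j) j x" if "j <= n div 2" for j
  proof -
   have "t ^ n = t^(n-2*j) * (t*t)^j" using that
    by (simp add: power2_eq_square[symmetric] power_mult[symmetric] power_add[symmetric])
   then show ?thesis by (simp add: T_def power_mult_distrib scaleR_conv_of_real[where 'a=complex] mult_ac)
  qed
  then show ?thesis unfolding Z scaleR_right.sum by (intro sum.cong) auto
 qed
 have "laplacian (zharm n te) x = 0" for x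
 proof -
  define N where "N = n div 2"
  have "laplacian (zharm n te) x = (\<Sum>j\<le>N. laplacian (%x. ?be j * T (n-2*j) j x) x)"
   unfolding Z N_def by (rule laplacian_sum) (auto intro: Spoly)
  also have "... = (\<Sum>j\<le>N. ?be j * of_real (real (n-2*j) * real (n-2*j-1)) * T (n-2*j-2) j x
    + ?be j * of_real (real (4*(n-2*j)*j + 2*j*CARD('n) + 4*j*(j-1))) * T (n-2*j) (j-1) x)"
   by (intro sum.cong refl) (subst laplacian_bounded_linear[OF bounded_linear_mult_right Tpoly], simp only: Tlap distrib_left mult.assoc)
  also have "... = (\<Sum>j\<le>N. ?be j * of_real (real (n-2*j) * real (n-2*j-1)) * T (n-2*j-2) j x)
    + (\<Sum>j\<le>N. ?be j * of_real (real (4*(n-2*j)*j + 2*j*CARD('n) + 4*j*(j-1))) * T (n-2*j) (j-1) x)"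
   by (rule sum.distrib)
  \<comment> \<open>The last term vanishes, its power of \<open>x \<bullet> te\<close> being 0 or
    1.\<close>
  also have "(\<Sum>j\<le>N. ?be j * of_real (real (n-2*j) * real (n-2*j-1)) * T (n-2*j-2) j x)
    = (\<Sum>j<N. ?be j * of_real (real (n-2*j) * real (n-2*j-1)) * T (n-2*j-2) j x)"
  proof (rule sum.mono_neutral_right)
   show "ALL i:{..N} - {..<N}. ?be i * of_real (real (n-2*i) * real (n-2*i-1)) * T (n-2*i-2) i x = 0"
   proof
    fix i assume "i : {..N} - {..<N}"
    then have "n - 2*i = 0 \<or> n - 2*i = 1" by (auto simp: N_def)
    then show "?be i * of_real (real (n-2*i) * real (n-2*i-1)) * T (n-2*i-2) i x = 0" by auto
   qed
  qed auto
  also have "(\<Sum>j\<le>N. ?be j * of_real (real (4*(n-2*j)*j + 2*j*CARD('n) + 4*j*(j-1))) * T (n-2*j) (j-1) x)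
    = (\<Sum>j<N. ?be (Suc j) * of_real (real (4*(n-2*Suc j)*Suc j + 2*Suc j*CARD('n) + 4*Suc j*j)) * T (n-2*Suc j) j x)"
   by (simp only: sum.atMost_shift) simp
  also have "(\<Sum>j<N. ?be j * of_real (real (n-2*j) * real (n-2*j-1)) * T (n-2*j-2) j x) + ... = (\<Sum>j<N. 0)"
   unfolding sum.distrib[symmetric]
  proof (rule sum.cong[OF refl])
   fix j assume "j : {..<N}"
   then have j: "2 * Suc j <= n" by (auto simp: N_def)
   \<comment> \<open>Here the dimension enters as \<open>2 * ny\<close>, which makes the factor that
     of the recursion for the coefficients.\<close>
   have "real (4*(n-2*Suc j)*Suc j + 2*Suc j*CARD('n) + 4*Suc j*j)
     = (real j + 1) * 4 * (ny + real n - real j - 2)"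
   proof -
    obtain m where m: "n = m + 2 * Suc j" using j by (metis le_add_diff_inverse2)
    have "n - 2 * Suc j = m" using m by simp
    then show ?thesis by (simp add: m ny_def algebra_simps)
   qed
   then have "zonal_coeff ny n (Suc j) * real (4*(n-2*Suc j)*Suc j + 2*Suc j*CARD('n) + 4*Suc j*j)
     = zonal_coeff ny n (Suc j) * (real j + 1) * 4 * (ny + real n - real j - 2)"
    by (simp only: mult.assoc)
   also have "... = - (zonal_coeff ny n j * (real (n-2*j) * real (n-2*j-1)))"
    using zonal_coeff_Suc[OF j, of ny] by (simp only: mult_minus_left mult.assoc)
   finally have "zonal_coeff ny n j * (real (n-2*j) * real (n-2*j-1)) +
     zonal_coeff ny n (Suc j) * real (4*(n-2*Suc j)*Suc j + 2*Suc j*CARD('n) + 4*Suc j*j) = 0"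
    by linarith
   then have "?be j * of_real (real (n-2*j) * real (n-2*j-1)) +
     ?be (Suc j) * of_real (real (4*(n-2*Suc j)*Suc j + 2*Suc j*CARD('n) + 4*Suc j*j)) = 0"
    by (simp only: of_real_add[symmetric] of_real_mult[symmetric] of_real_0)
   moreover have "n - 2*j - 2 = n - 2 * Suc j" by simp
   ultimately show "?be j * of_real (real (n-2*j) * real (n-2*j-1)) * T (n-2*j-2) j x
    + ?be (Suc j) * of_real (real (4*(n-2*Suc j)*Suc j + 2*Suc j*CARD('n) + 4*Suc j*j)) * T (n-2*Suc j) j x = 0"
    by (simp only: flip: distrib_right) simp
  qed
  finally show ?thesis by simp
 qed
 moreover have "polynomial_function (zharm n te)"
  unfolding Z by (rule polynomial_function_sum) (auto intro: Spoly)
 ultimately show ?thesis using hom by (auto simp: harmonic_homogeneous_def)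
qed

section \<open>Measurability and integration on the sphere\<close>

lemma borel_measurable_cnj[measurable (raw)]:
 "f : bmeas M ==> (%x. cnj (f x)) : bmeas M"
 by (rule borel_measurable_continuous_on[of cnj]) (auto intro: continuous_intros)

lemma borel_measurable_sphere_measure:
 "f : borel_measurable borel ==> f : bmeas (dS :: (real^'n) measure)"
 unfolding measurable_cong_sets[OF sets_sphere_measure refl] by (rule measurable_restrict_space1)

lemma measurable_sphere_measure_id[measurable]:
 "(%x. x) : bmeas (dS :: (real^'n) measure)"
 by (rule borel_measurable_sphere_measure) simp

lemma continuous_sphere_measurable:
 fixes f :: "real^'n => complex"
 assumes "continuous_on (sphere 0 1) f"
 shows "f : bmeas dS"
 using borel_measurable_continuous_on_restrict[OF assms]
 unfolding measurable_cong_sets[OF sets_sphere_measure refl] .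

lemma integrable_sphere_bounded:
 fixes f :: "real^'n => complex"
 assumes "f : bmeas dS" "!!x. norm x = 1 ==> norm (f x) <= B"
 shows "integrable dS f"
 by (rule finite_measure.integrable_const_bound[OF finite_sphere_measure, where B=B])
   (use assms in auto)

lemma integrable_sphere_continuous:
 fixes f :: "real^'n => complex"
 assumes f: "continuous_on (sphere 0 1) f"
 shows "integrable dS f"
proof -
 have "bounded (f ` sphere 0 1)" by (rule compact_imp_bounded[OF compact_continuous_image[OF f]]) simp
 then obtain B where "ALL x:sphere 0 1. norm (f x) <= B"
  unfolding bounded_iff by auto
 then show ?thesis
  by (intro integrable_sphere_bounded[where B=B] continuous_sphere_measurable f) auto
qed

lemma sphere_integral_orthogonal:
 fixes f :: "real^'n => complex" and U :: "real^'n => real^'n"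
 assumes U: "orthogonal_transformation U" and f: "f : bmeas dS"
 shows "(LINT te|dS. f (U te)) = (LINT te|dS. f te)"
proof -
 have "U : dS \<rightarrow>\<^sub>M dS"
 proof -
  have "linear U" using U by (rule orthogonal_transformation_linear)
  then have "U : borel_measurable borel"
   by (intro borel_measurable_continuous_onI linear_continuous_on) (simp add: linear_linear)
  then have "U : restrict_space borel (sphere 0 1) \<rightarrow>\<^sub>M restrict_space borel (sphere 0 1)"
   using orthogonal_transformation_norm[OF U]
   by (intro measurable_restrict_space2 measurable_restrict_space1) (auto simp: space_restrict_space)
  then show ?thesis unfolding measurable_cong_sets[OF sets_sphere_measure sets_sphere_measure] .
 qed
 then have "(LINT te|dS. f (U te)) = (LINT te|distr dS dS U. f te)"
  using f by (simp add: integral_distr)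
 then show ?thesis by (simp add: distr_sphere_measure_orthogonal[OF U])
qed

section \<open>Zonal harmonics on the sphere and the Poisson kernel\<close>

lemma zonal_harmonic_sphere:
 fixes te x :: "real^'n"
 assumes "norm x = 1"
 shows "zharm k te x = of_real (zonal (real CARD('n) / 2) k (x \<bullet> te) 1)"
 using assms by (simp add: zharm_def dot_square_norm)

lemma zonal_harmonic_commute:
 "norm x = 1 ==> norm te = 1 ==> zharm k te x = zharm k x te"
 by (simp add: zonal_harmonic_sphere inner_commute)

lemma zonal_harmonic_bound:
 assumes "0 < rh" "rh < 1"
 obtains M where "M > 0"
  "!!k (x::real^'n) te. norm x = 1 ==> norm te = 1 ==> cmod (zharm k te x) <= M / rh^k"
proof -
 obtain M where M: "M > 0" "!!n t. \<bar>t\<bar> <= 1 ==> \<bar>zonal (real CARD('n) / 2) n t 1\<bar> <= M / rh^n"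
  using zonal_bound[OF assms, of "real CARD('n) / 2"] by auto
 show ?thesis
 proof
  fix k and x te :: "real^'n" assume n: "norm x = 1" "norm te = 1"
  have "\<bar>x \<bullet> te\<bar> <= 1" using Cauchy_Schwarz_ineq2[of x te] n by simp
  then show "cmod (zharm k te x) <= M / rh^k" using M(2) by (simp add: zonal_harmonic_sphere n)
 qed fact
qed

text \<open>For unit vectors the base of the power is the squared distance of
  \<open>r *\<^sub>R x\<close> from \<open>te\<close>. There is no division by the mass of the
  sphere, so the integral over the sphere is \<open>omega CARD('n)\<close> and not 1.\<close>

definition poisson_sphere :: "real => real^'n => real^'n => real" where
 "poisson_sphere r te x = (1 - r^2) / (1 - 2 * r * (x \<bullet> te) + r^2) powr (real CARD('n) / 2)"

lemma zonal_harmonic_sums: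
 fixes x te :: "real^'n"
 assumes n: "norm x = 1" "norm te = 1" and w: "cmod w < 1"
 shows "(%k. w^k * zharm k te x) sums
   ((1 - w^2) / (1 - 2 * w * of_real (x \<bullet> te) + w^2) powr of_real (real CARD('n) / 2))"
proof -
 have "\<bar>x \<bullet> te\<bar> <= 1" using Cauchy_Schwarz_ineq2[of x te] n by simp
 from zonal_generating_function[OF this w, of "real CARD('n) / 2"]
 show ?thesis by (simp add: zonal_harmonic_sphere n mult.commute)
qed

lemma poisson_sphere_base:
 fixes x te :: "real^'n"
 assumes n: "norm x = 1" "norm te = 1"
 shows "1 - 2 * r * (x \<bullet> te) + r^2 = (1 - r)^2 + r * (norm (x - te))^2"
 using n unfolding dot_norm_neg[of x te] by (simp add: power2_eq_square field_simps)

lemma poisson_sphere_sums: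
 fixes x te :: "real^'n"
 assumes n: "norm x = 1" "norm te = 1" and r: "0 <= r" "r < 1"
 shows "(%k. of_real r^k * zharm k te x) sums of_real (poisson_sphere r te x)"
proof -
 have "1 - 2 * r * (x \<bullet> te) + r^2 > 0"
  unfolding poisson_sphere_base[OF n] using r by (intro add_pos_nonneg) auto
 then have "complex_of_real (poisson_sphere r te x) =
   (1 - (of_real r)^2) / (1 - 2 * of_real r * of_real (x \<bullet> te) + (of_real r)^2) powr of_real (real CARD('n) / 2)"
  unfolding poisson_sphere_def
  using powr_of_real[of "1 - 2 * r * (x \<bullet> te) + r^2" "real CARD('n) / 2"] by simp
 then show ?thesis using zonal_harmonic_sums[OF n, of "of_real r"] r by simp
qed

lemma poisson_sphere_nonneg:
 "0 <= r ==> r < 1 ==> poisson_sphere r te x >= 0"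
 unfolding poisson_sphere_def by (intro divide_nonneg_nonneg) (auto simp: power_le_one)

lemma zonal_harmonic_measurable[measurable]:
 "(%(x, te). zharm k te x) : bmeas (dS \<Otimes>\<^sub>M dS)"
proof -
 have [measurable]: "fst : bmeas (dS \<Otimes>\<^sub>M dS)"
  "snd : bmeas (dS \<Otimes>\<^sub>M (dS :: (real^'n) measure))"
  by (auto intro: measurable_compose[OF measurable_fst measurable_sphere_measure_id]
    measurable_compose[OF measurable_snd measurable_sphere_measure_id])
 show ?thesis unfolding zharm_def zonal_def case_prod_beta by measurable
qed

lemma zonal_harmonic_continuous: "continuous_on A (%x. zharm k te x)" 
  "continuous_on A (%te. zharm k te x)"
 unfolding zharm_def zonal_def by (intro continuous_intros)+

lemma sum_fun_apply: "finite A ==> (SUM a:A. f a) x = (SUM a:A. f a x)"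
 for f :: "'a => 'b => 'c::comm_monoid_add"
 by (induction A rule: finite_induct) auto

section \<open>Expansions in the orthonormal basis of one degree\<close>

context
 fixes Y :: "nat => nat => real^'n => complex"
 assumes Y: "orthonormal_harmonics Y"
begin


lemma Y_harm: "l : {1..harm_dim TYPE('n) k} ==> Y k l : harmonic_homogeneous k"
 using Y by (auto simp: orthonormal_harmonics_def)

lemma Y_orthonormal_deg:
 "l : {1..harm_dim TYPE('n) k} ==> m : {1..harm_dim TYPE('n) k} ==>
   (LINT te|dS. Y k l te * cnj (Y k m te)) = (if l = m then 1 else 0)"
 using Y by (auto simp: orthonormal_harmonics_def)

lemma Y_span: "cfun.span (Y k ` {1..harm_dim TYPE('n) k}) = harmonic_homogeneous k"
 using Y by (auto simp: orthonormal_harmonics_def)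

lemma Y_poly: "l : {1..harm_dim TYPE('n) k} ==> polynomial_function (Y k l)"
 using Y_harm harmonic_homogeneousD(1) by blast

lemma Y_continuous: "l : {1..harm_dim TYPE('n) k} ==> continuous_on A (Y k l)"
 by (intro continuous_on_polymonial_function Y_poly)

lemma Y_combination_in: "(%x. SUM l:{1..harm_dim TYPE('n) k}. c l * Y k l x) : harmonic_homogeneous k"
proof -
 have "(SUM l:{1..harm_dim TYPE('n) k}. (%x. c l * Y k l x)) : cfun.span (Y k ` {1..harm_dim TYPE('n) k})"
  by (intro cfun.span_sum cfun.span_scale cfun.span_base) auto
 moreover have "(SUM l:{1..harm_dim TYPE('n) k}. (%x. c l * Y k l x)) = (%x. SUM l:{1..harm_dim TYPE('n) k}. c l * Y k l x)"
  by (auto simp: fun_eq_iff sum_fun_apply)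
 ultimately show ?thesis unfolding Y_span by simp
qed

lemma harmonic_expansion_exists:
 assumes "p : harmonic_homogeneous k"
 shows "EX c. p = (%x. SUM l:{1..harm_dim TYPE('n) k}. c l * Y k l x)"
proof -
 have "p : cfun.span (Y k ` {1..harm_dim TYPE('n) k})" using assms unfolding Y_span .
 then show ?thesis
 proof (induction rule: cfun.span_induct_alt)
  case base
  show ?case by (intro exI[of _ "%_. 0"]) (auto simp: fun_eq_iff)
 next
  case (step a v w)
  then obtain c j where c: "w = (%x. SUM l:{1..harm_dim TYPE('n) k}. c l * Y k l x)" and j: "j : {1..harm_dim TYPE('n) k}" "v = Y k j" by auto
  have "(SUM l:{1..harm_dim TYPE('n) k}. (c(j := c j + a)) l * Y k l x) = a * Y k j x + w x" for x
   unfolding c using j by (subst (1 2) sum.remove[OF _ j(1)]) (auto simp: algebra_simps intro!: sum.cong)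
  then show ?case using j by (intro exI[of _ "c(j := c j + a)"]) (auto simp: fun_eq_iff)
 qed
qed

lemma Y_integrable2:
 assumes "l : {1..harm_dim TYPE('n) k}" "continuous_on (sphere 0 1) p"
 shows "integrable dS (%te. p te * cnj (Y k l te))"
 by (intro integrable_sphere_continuous continuous_intros assms Y_continuous)

lemma harmonic_expansion:
 assumes p: "p : harmonic_homogeneous k"
 shows "p x = (SUM l:{1..harm_dim TYPE('n) k}. (LINT te|dS. p te * cnj (Y k l te)) * Y k l x)"
proof -
 obtain c where c: "p = (%x. SUM l:{1..harm_dim TYPE('n) k}. c l * Y k l x)" using harmonic_expansion_exists[OF p] by blast
 have "(LINT te|dS. p te * cnj (Y k m te)) = c m" if m: "m : {1..harm_dim TYPE('n) k}" for m
 proof -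
  have "(LINT te|dS. p te * cnj (Y k m te))
    = (LINT te|dS. (SUM l:{1..harm_dim TYPE('n) k}. c l * (Y k l te * cnj (Y k m te))))"
   by (simp add: c sum_distrib_right mult.assoc)
  also have "... = (SUM l:{1..harm_dim TYPE('n) k}. c l * (LINT te|dS. Y k l te * cnj (Y k m te)))"
   by (subst lint_sum) (auto intro!: Y_integrable2 Y_continuous m)
  also have "... = (SUM l:{1..harm_dim TYPE('n) k}. c l * (if l = m then 1 else 0))"
   using Y_orthonormal_deg[OF _ m] by (intro sum.cong refl arg_cong2[where f="(*)"]) blast
  also have "... = c m" using m by (simp add: sum.delta if_distrib cong: if_cong)
  finally show ?thesis .
 qed
 then show ?thesis by (subst c) simp
qed

text \<open>The expansion of \<open>zharm k te\<close> in the basis separates \<open>x\<close> from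
  \<open>te\<close>. The integral is then a finite combination of basis elements, and nothing has to
  be differentiated under the integral sign.\<close>

lemma zonal_integral_in:
 fixes h :: "real^'n => complex"
 assumes h: "h : bmeas dS" "!!x. norm x = 1 ==> cmod (h x) <= B"
 shows "(%x. LINT te|dS. zharm k te x * h te) : harmonic_homogeneous k"
proof -
 define ga where "ga l te = (LINT x|dS. zharm k te x * cnj (Y k l x))" for l te
 obtain M where M: "M > 0" "!!k (x::real^'n) te. norm x = 1 ==> norm te = 1 ==> cmod (zharm k te x) <= M / (1/2)^k"
  using zonal_harmonic_bound[of "1/2"] by auto
 interpret S: finite_measure "dS :: (real^'n) measure" by (rule finite_sphere_measure)
 have gam: "(%te. ga l te * h te) : bmeas dS" if l: "l : {1..harm_dim TYPE('n) k}" for l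
 proof -
  have [measurable]: "Y k l : bmeas dS"
   by (intro continuous_sphere_measurable Y_continuous l)
  have "(%(te, x). zharm k te x) : bmeas (dS \<Otimes>\<^sub>M (dS :: (real^'n) measure))"
   using measurable_pair_swap[OF zonal_harmonic_measurable] by (simp add: case_prod_beta)
  then have [measurable]: "(%x. zharm k (fst x) (snd x)) : bmeas (dS \<Otimes>\<^sub>M (dS :: (real^'n) measure))"
   by (simp add: case_prod_beta)
  have "ga l : bmeas dS"
   unfolding ga_def
   by (rule S.borel_measurable_lebesgue_integral) (unfold case_prod_beta, measurable)
  then show ?thesis using h by simp
 qed
 have gai: "integrable dS (%te. ga l te * h te)" if l: "l : {1..harm_dim TYPE('n) k}" for l
 proof -
  have "bounded (Y k l ` sphere 0 1)"
   by (rule compact_imp_bounded[OF compact_continuous_image[OF Y_continuous[OF l]]]) simp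
  then obtain C where "ALL x:sphere 0 1. cmod (Y k l x) <= C" unfolding bounded_iff by auto
  then have C: "!!x. norm x = 1 ==> cmod (Y k l x) <= C" by auto
  have "cmod (ga l te) <= M / (1/2)^k * C * omega CARD('n)" if te: "norm te = 1" for te
  proof -
   have "cmod (ga l te) <= (LINT x|(dS :: (real^'n) measure). M / (1/2)^k * C)"
    unfolding ga_def
   proof (rule order_trans[OF integral_norm_bound] integral_mono)+
    show "integrable dS (%x. cmod (zharm k te x * cnj (Y k l x)))"
     by (intro integrable_norm integrable_sphere_continuous continuous_intros zonal_harmonic_continuous Y_continuous l)
    fix x assume "x : space (dS :: (real^'n) measure)"
    then show "cmod (zharm k te x * cnj (Y k l x)) <= M / (1/2)^k * C"
     unfolding norm_mult using M(2)[of x te k] C[of x] te M(1) by (intro mult_mono) auto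
   qed simp
   then show ?thesis by (simp add: measure_sphere_measure mult_ac)
  qed
  then have "cmod (ga l te * h te) <= M / (1/2)^k * C * omega CARD('n) * B" if te: "norm te = 1" for te
   unfolding norm_mult using h(2)[OF te] te
   by (intro mult_mono) (auto intro: order_trans[OF norm_ge_zero])
  then show ?thesis by (intro integrable_sphere_bounded gam l)
 qed
 have "(LINT te|dS. zharm k te x * h te)
   = (SUM l:{1..harm_dim TYPE('n) k}. (LINT te|dS. ga l te * h te) * Y k l x)" for x
 proof -
  have "(LINT te|dS. zharm k te x * h te)
    = (LINT te|dS. (SUM l:{1..harm_dim TYPE('n) k}. (ga l te * h te) * Y k l x))"
  proof (rule lint_cong[OF refl])
   fix te assume "te : space (dS :: (real^'n) measure)"
   then have "norm te = 1" by simp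
   from harmonic_expansion[OF zonal_harmonic_in[OF this], of k x]
   show "zharm k te x * h te = (SUM l:{1..harm_dim TYPE('n) k}. (ga l te * h te) * Y k l x)"
    by (simp add: ga_def sum_distrib_right sum_distrib_left mult_ac)
  qed
  also have "... = (SUM l:{1..harm_dim TYPE('n) k}. (LINT te|dS. ga l te * h te) * Y k l x)"
   by (subst lint_sum) (auto intro!: gai integrable_mult_left)
  finally show ?thesis .
 qed
 then show ?thesis using Y_combination_in by simp
qed

text \<open>For \<open>k > 0\<close> the integral is a harmonic polynomial in \<open>x\<close>, and
  invariance of the measure makes it constant on the sphere. By the maximum principle it has the
  same value at the origin, where homogeneity makes it vanish.\<close>

lemma zonal_integral_const:
 assumes x: "norm x = 1"
 shows "(LINT te|(dS::(real^'n) measure). zharm k te x) = (if k = 0 then of_real (omega CARD('n)) else 0)"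
proof (cases "k = 0")
 case True
 have "zharm 0 te x = 1" for te :: "real^'n" by (simp add: zharm_def zonal_def zonal_coeff_def)
 then show ?thesis using True by (simp add: measure_sphere_measure scaleR_conv_of_real)
next
 case False
 define I where "I = (%x. LINT te|(dS::(real^'n) measure). zharm k te x)"
 have I: "I : harmonic_homogeneous k"
  using zonal_integral_in[of "%_. 1" 1 k] by (simp add: I_def)
 have inv: "I (U y) = I y" if U: "orthogonal_transformation U" for U y
 proof -
  have "I (U y) = (LINT te|(dS::(real^'n) measure). zharm k (U te) (U y))"
   unfolding I_def
   by (rule sphere_integral_orthogonal[OF U, symmetric])
     (intro continuous_sphere_measurable zonal_harmonic_continuous)
  also have "... = I y"
   using U unfolding I_def by (intro lint_cong) (auto simp: zharm_def orthogonal_transformation_def)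
  finally show ?thesis .
 qed
 have const: "I y = I x" if y: "norm y = 1" for y
  using orthogonal_transformation_exists[of x y] inv x y by metis
 have "cmod (I 0 + - I x) <= 0"
 proof (rule maximum_principle_cmod[where r = 1 and p = "%y. I y + - I x" and x = 0])
  show "polynomial_function (%y. I y + - I x)"
   using harmonic_homogeneousD(1)[OF I] by (intro polynomial_function_add) auto
  show "laplacian (%y. I y + - I x) y = 0" for y
   using harmonic_homogeneousD[OF I] by (subst laplacian_add) (auto simp: laplacian_const)
 qed (use const in auto)
 moreover have "I 0 = 0" using harmonic_homogeneousD(2)[OF I, of 0 x] False by simp
 ultimately show ?thesis using False by (simp add: I_def)
qed

end

section \<open>Poisson integrals on the sphere\<close>

lemma sums_geometric_tail:
 fixes a :: "nat => complex"
 assumes s: "a sums s" and b: "!!k. cmod (a k) <= M * q^k" and q: "0 <= q" "q < 1"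
 shows "cmod ((\<Sum>k<N. a k) - s) <= M * q^N / (1 - q)"
proof -
 have t: "(%k. a (k + N)) sums (s - (\<Sum>k<N. a k))" by (rule sums_split_initial_segment[OF s])
 have g: "(%k. M * q^N * q^k) sums (M * q^N * (1 / (1 - q)))"
  by (intro sums_mult geometric_sums) (use q in auto)
 have "cmod (s - (\<Sum>k<N. a k)) <= M * q^N * (1 / (1 - q))"
 proof -
  have "cmod (\<Sum>k. a (k + N)) <= (\<Sum>k. M * q^N * q^k)"
   by (rule norm_suminf_le) (use b[of "_ + N"] g in "auto simp: power_add mult_ac sums_iff")
  then show ?thesis using t g by (simp add: sums_iff)
 qed
 then show ?thesis by (simp add: norm_minus_commute)
qed

lemma poisson_sphere_measurable:
 "(%te. complex_of_real (poisson_sphere r te x)) : bmeas dS"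
 unfolding poisson_sphere_def by measurable

text \<open>A radius \<open>rh\<close> strictly between \<open>r\<close> and 1 turns the growth
  bound into geometric convergence of ratio \<open>r / rh\<close>, uniformly on the sphere.\<close>

lemma poisson_partial_sums:
 assumes r: "0 <= r" "r < 1"
 obtains M q where "M > 0" "0 <= q" "q < 1"
  "!!N (x::real^'n) te. norm x = 1 ==> norm te = 1 ==>
    cmod ((\<Sum>k<N. of_real r^k * zharm k te x) - of_real (poisson_sphere r te x)) <= M * q^N / (1 - q)"
  "!!k (x::real^'n) te. norm x = 1 ==> norm te = 1 ==> cmod (of_real r^k * zharm k te x) <= M * q^k"
proof -
 define rh where "rh = (1 + r) / 2"
 have rh: "0 < rh" "rh < 1" "r < rh" using r by (auto simp: rh_def)
 obtain M where M: "M > 0"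
  "!!k (x::real^'n) te. norm x = 1 ==> norm te = 1 ==> cmod (zharm k te x) <= M / rh^k"
  using zonal_harmonic_bound[OF rh(1,2)] by blast
 define q where "q = r / rh"
 have q: "0 <= q" "q < 1" using r rh by (auto simp: q_def)
 have b: "cmod (of_real r^k * zharm k te x) <= M * q^k" if "norm x = 1" "norm te = 1" for k and x te :: "real^'n"
 proof -
  have "cmod (of_real r^k * zharm k te x) <= r^k * (M / rh^k)"
   using mult_left_mono[OF M(2)[OF that, of k], of "r^k"] r by (simp add: norm_mult norm_power)
  also have "... = M * q^k" by (simp only: q_def power_divide times_divide_eq_right mult.commute)
  finally show ?thesis .
 qed
 have "cmod ((\<Sum>k<N. of_real r^k * zharm k te x) - of_real (poisson_sphere r te x)) <= M * q^N / (1 - q)"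
  if "norm x = 1" "norm te = 1" for N and x te :: "real^'n"
  by (rule sums_geometric_tail[OF poisson_sphere_sums[OF that r] b[OF that] q])
 then show ?thesis using that[OF M(1) q] b by blast
qed

lemma sphere_integral_bound:
 fixes f :: "real^'n => complex"
 assumes "f : bmeas dS" "!!x. norm x = 1 ==> cmod (f x) <= B"
 shows "cmod (LINT te|dS. f te) <= B * omega CARD('n)"
proof -
 interpret S: finite_measure "dS :: (real^'n) measure" by (rule finite_sphere_measure)
 have "cmod (LINT te|dS. f te) <= (LINT te|(dS::(real^'n) measure). B)"
 proof (rule order_trans[OF integral_norm_bound integral_mono])
  show "integrable dS (%x. cmod (f x))"
   by (intro integrable_norm integrable_sphere_bounded[OF assms])
 qed (use assms(2) in auto)
 then show ?thesis by (simp add: measure_sphere_measure mult.commute)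
qed

lemma integrable_sphere_mult:
 fixes p h :: "real^'n => complex"
 assumes p: "continuous_on (sphere 0 1) p"
  and h: "h : bmeas dS" "!!x. norm x = 1 ==> cmod (h x) <= B"
 shows "integrable dS (%x. p x * h x)"
proof -
 have "bounded (p ` sphere 0 1)" by (rule compact_imp_bounded[OF compact_continuous_image[OF p]]) simp
 then obtain C where "ALL x:sphere 0 1. cmod (p x) <= C" unfolding bounded_iff by auto
 then have C: "!!x. norm x = 1 ==> cmod (p x) <= C" by auto
 have "cmod (p x * h x) <= C * B" if x: "norm x = 1" for x
  unfolding norm_mult using order_trans[OF norm_ge_zero C[OF x]]
  by (intro mult_mono C[OF x] h(2)[OF x]) auto
 then show ?thesis
  by (intro integrable_sphere_bounded borel_measurable_times h(1) continuous_sphere_measurable p)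
qed

text \<open>The threshold \<open>N0\<close> does not depend on \<open>x\<close>, because the maximum
  principle will need the estimate on the whole sphere at once.\<close>

lemma poisson_integral_tail:
 fixes h :: "real^'n => complex"
 assumes r: "0 <= r" "r < 1"
  and h: "h : bmeas dS" "!!x::real^'n. norm x = 1 ==> cmod (h x) <= B"
  and e: "e > 0"
 obtains N0 where "!!N x. N >= N0 ==> norm x = 1 ==>
  cmod ((\<Sum>k<N. of_real r^k * (LINT te|dS. zharm k te x * h te))
    - (LINT te|dS. of_real (poisson_sphere r te x) * h te)) <= e"
proof -
 obtain M q where M: "M > 0" "0 <= q" "q < 1"
  "!!N (x::real^'n) te. norm x = 1 ==> norm te = 1 ==>
    cmod ((\<Sum>k<N. of_real r^k * zharm k te x) - of_real (poisson_sphere r te x)) <= M * q^N / (1 - q)"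
  "!!k (x::real^'n) te. norm x = 1 ==> norm te = 1 ==> cmod (of_real r^k * zharm k te x) <= M * q^k"
  by (rule poisson_partial_sums[OF r, where 'n='n]) (rule that; assumption)
 have B: "B >= 0"
  by (rule order_trans[OF norm_ge_zero h(2)[of "axis undefined 1"]]) simp
 have hi: "integrable dS h" by (rule integrable_sphere_bounded[OF h])
 have zi: "integrable dS (%te. zharm k te x * h te)" if x: "norm x = 1" for k x
  by (rule integrable_sphere_mult[OF zonal_harmonic_continuous(2) h])
 have est: "cmod ((\<Sum>k<N. of_real r^k * (LINT te|dS. zharm k te x * h te))
    - (LINT te|dS. of_real (poisson_sphere r te x) * h te)) <= M * q^N / (1 - q) * B * omega CARD('n)"
  if x: "norm x = 1" for N x
 proof -
  let ?D = "%te. (\<Sum>k<N. of_real r^k * zharm k te x) - of_real (poisson_sphere r te x)"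
  have Dm: "?D : bmeas dS"
   by (intro borel_measurable_diff borel_measurable_sum borel_measurable_times poisson_sphere_measurable
     continuous_sphere_measurable zonal_harmonic_continuous continuous_intros)
  have bd: "cmod (?D te * h te) <= M * q^N / (1 - q) * B" if "norm te = 1" for te
   unfolding norm_mult using M(1-3) M(4)[OF x that] h(2)[OF that] by (intro mult_mono) auto
  have Dh: "(%te. ?D te * h te) : bmeas dS" using Dm h(1) by simp
  have si: "integrable dS (%te. \<Sum>k<N. of_real r^k * (zharm k te x * h te))"
   using zi[OF x] by auto
  have pi: "integrable dS (%te. of_real (poisson_sphere r te x) * h te)"
  proof -
   have "(%te. of_real (poisson_sphere r te x) * h te) = (%te. (\<Sum>k<N. of_real r^k * (zharm k te x * h te)) - ?D te * h te)"
    by (auto simp: fun_eq_iff algebra_simps sum_distrib_left sum_distrib_right)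
   then show ?thesis using si integrable_sphere_bounded[OF Dh bd] by simp
  qed
  have A: "(\<Sum>k<N. of_real r^k * (LINT te|dS. zharm k te x * h te))
    = (LINT te|dS. (\<Sum>k<N. of_real r^k * (zharm k te x * h te)))"
   using zi[OF x] by (subst lint_sum) auto
  have "(\<Sum>k<N. of_real r^k * (LINT te|dS. zharm k te x * h te))
    - (LINT te|dS. of_real (poisson_sphere r te x) * h te) = (LINT te|dS. ?D te * h te)"
  proof -
   have "(LINT te|dS. ?D te * h te) = (LINT te|dS.
     (\<Sum>k<N. of_real r^k * (zharm k te x * h te)) - of_real (poisson_sphere r te x) * h te)"
    by (rule lint_cong) (simp_all only: left_diff_distrib sum_distrib_right mult.assoc)
   then show ?thesis using A Bochner_Integration.integral_diff[OF si pi] by simp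
  qed
  then show ?thesis using sphere_integral_bound[OF Dh bd] by simp
 qed
 have "(%N. M * q^N / (1 - q) * B * omega CARD('n)) \<longlonglongrightarrow> M * 0 / (1 - q) * B * omega CARD('n)"
  using M by (intro tendsto_intros LIMSEQ_realpow_zero) auto
 then have "eventually (%N. M * q^N / (1 - q) * B * omega CARD('n) < e) sequentially"
  using e by (intro order_tendstoD(2)) auto
 then obtain N0 where "!!N. N >= N0 ==> M * q^N / (1 - q) * B * omega CARD('n) < e"
  unfolding eventually_sequentially by blast
 then show ?thesis using est that by (meson less_imp_le order_trans)
qed

context
 fixes Y :: "nat => nat => real^'n => complex"
 assumes Y: "orthonormal_harmonics Y"
begin

text \<open>Integrated term by term, the series of the kernel keeps its constant term only.\<close>

lemma poisson_integral_const:
 assumes r: "0 <= r" "r < 1" and x: "norm (x::real^'n) = 1"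
 shows "(LINT te|dS. complex_of_real (poisson_sphere r te x)) = of_real (omega CARD('n))"
proof -
 have "cmod (of_real (omega CARD('n)) - (LINT te|dS. complex_of_real (poisson_sphere r te x))) <= e" if e: "e > 0" for e
 proof -
  obtain N0 where N0: "!!N x. N >= N0 ==> norm x = 1 ==>
   cmod ((\<Sum>k<N. of_real r^k * (LINT te|dS. zharm k te x * 1))
    - (LINT te|(dS :: (real^'n) measure). of_real (poisson_sphere r te x) * 1)) <= e"
   by (rule poisson_integral_tail[OF r, of "%_. 1" 1 e]) (use e in auto)
  have "(\<Sum>k<Suc N0. of_real r^k * (LINT te|(dS::(real^'n) measure). zharm k te x * 1)) = of_real (omega CARD('n))"
   by (subst sum.lessThan_Suc_shift) (simp add: zonal_integral_const[OF Y x])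
  then show ?thesis using N0[of "Suc N0" x] x by simp
 qed
 then have "cmod (of_real (omega CARD('n)) - (LINT te|dS. complex_of_real (poisson_sphere r te x))) <= 0"
  by (rule field_le_epsilon) (simp only: add_0)
 then show ?thesis by simp
qed

text \<open>Where \<open>te\<close> is within \<open>de\<close> of \<open>x\<close>, uniform
  continuity controls \<open>g te - g x\<close>; farther away the kernel itself is at most
  \<open>(1 - r^2) / c\<close>, which tends to 0 uniformly.\<close>

lemma poisson_approximate_identity:
 fixes g :: "real^'n => complex"
 assumes g: "continuous_on (sphere 0 1) g" and e: "e > 0"
 obtains r0 where "0 <= r0" "r0 < 1" "!!r x. r0 < r ==> r < 1 ==> norm x = 1 ==>
   cmod ((LINT te|dS. of_real (poisson_sphere r te x) * g te) - of_real (omega CARD('n)) * g x) <= e"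
proof -
 interpret S: finite_measure "dS :: (real^'n) measure" by (rule finite_sphere_measure)
 define omg where "omg = omega CARD('n)"
 have omg: "omg > 0" unfolding omg_def by (rule omega_pos) simp
 have "bounded (g ` sphere 0 1)" by (rule compact_imp_bounded[OF compact_continuous_image[OF g]]) simp
 then obtain G where "G > 0" "ALL x:sphere 0 1. cmod (g x) <= G" unfolding bounded_pos by auto
 then have G: "G > 0" "!!x. norm x = 1 ==> cmod (g x) <= G" by auto
 have gm: "g : bmeas dS" by (rule continuous_sphere_measurable[OF g])
 have "uniformly_continuous_on (sphere 0 1) g" by (rule compact_uniformly_continuous[OF g]) simp
 then obtain de where de: "de > 0" "!!x y. norm x = 1 ==> norm y = 1 ==> dist y x < de ==> dist (g y) (g x) < e / (2 * omg)"
  unfolding uniformly_continuous_on_def using e omg by (metis dist_0_norm divide_pos_pos mem_sphere mult_pos_pos zero_less_numeral)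
 \<comment> \<open>For \<open>r >= 1/2\<close> and \<open>te\<close> at distance at least
   \<open>de\<close> from \<open>x\<close> the denominator of the kernel is at least this number, as
   its base \<open>(1 - r)^2 + r * (norm (x - te))^2\<close> is then at least
   \<open>de^2 / 2\<close>.\<close>
 define c where "c = (de^2 / 2) powr (real CARD('n) / 2)"
 have c: "c > 0" using de by (simp add: c_def)
 have "((%r. 2 * G * ((1 - r^2) / c) * omg) \<longlongrightarrow> 2 * G * ((1 - 1^2) / c) * omg) (at_left 1)"
  using c by (intro tendsto_intros) auto
 then have "eventually (%r. 2 * G * ((1 - r^2) / c) * omg < e / 2) (at_left 1)"
  using e by (intro order_tendstoD(2)) auto
 then obtain b where b: "b < 1" "!!r. b < r ==> r < 1 ==> 2 * G * ((1 - r^2) / c) * omg < e / 2"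
  unfolding eventually_at_left_field by auto
 show ?thesis
 proof
  show "0 <= max (1/2) b" "max (1/2) b < 1" using b by auto
  fix r and x :: "real^'n" assume r: "max (1/2) b < r" "r < 1" and x: "norm x = 1"
  have r0: "0 <= r" using r by auto
  let ?P = "%te. poisson_sphere r te x"
  have Pc: "(LINT te|dS. complex_of_real (?P te)) = of_real omg"
   unfolding omg_def by (rule poisson_integral_const[OF r0 r(2) x])
  have P0: "?P te >= 0" for te by (rule poisson_sphere_nonneg[OF r0 r(2)])
  have Pi: "integrable dS (%te. complex_of_real (?P te))"
   using Pc omg not_integrable_integral_eq by fastforce
  then have Pi': "integrable dS ?P" by (simp add: complex_of_real_integrable_eq)
  have Pc': "(LINT te|dS. ?P te) = omg"
   using Pc by (simp add: of_real_eq_iff)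
  have Pgi: "integrable dS (%te. of_real (?P te) * h te)"
   if "h : bmeas dS" "!!te. norm te = 1 ==> cmod (h te) <= H" for h H
  proof (rule integrable_bound[OF integrable_mult_right[OF Pi', of H]])
   show "(%te. of_real (?P te) * h te) : bmeas dS"
    by (intro borel_measurable_times poisson_sphere_measurable that(1))
   show "AE te in dS. norm (of_real (?P te) * h te) <= norm (H * ?P te)"
   proof (rule AE_I2)
    fix te assume "te : space (dS :: (real^'n) measure)"
    then have "cmod (h te) * ?P te <= \<bar>H\<bar> * ?P te"
     using that(2)[of te] P0[of te] by (intro mult_right_mono) auto
    then show "norm (of_real (?P te) * h te) <= norm (H * ?P te)"
     using P0[of te] by (simp add: norm_mult abs_mult mult.commute)
   qed
  qed
  have "(LINT te|dS. of_real (?P te) * g te) - of_real omg * g x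
    = (LINT te|dS. of_real (?P te) * (g te - g x))"
  proof -
   have "of_real omg * g x = (LINT te|dS. of_real (?P te) * g x)" by (simp add: Pc')
   then show ?thesis
    using Bochner_Integration.integral_diff[OF Pgi[OF gm G(2)] integrable_mult_left[OF Pi, of "g x"]]
    by (simp add: right_diff_distrib Pc')
  qed
  also have "cmod ... <= (LINT te|dS. ?P te * (e / (2 * omg)) + (1 - r^2) / c * (2 * G))"
  proof (rule order_trans[OF integral_norm_bound integral_mono])
   show "integrable dS (%te. cmod (complex_of_real (?P te) * (g te - g x)))"
   proof (intro integrable_norm Pgi[where H = "2 * G"])
    show "(%te. g te - g x) : bmeas dS" using gm by simp
    show "cmod (g te - g x) <= 2 * G" if "norm te = 1" for te
     using norm_triangle_ineq4[of "g te" "g x"] G(2)[OF that] G(2)[OF x] by linarith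
   qed
   show "integrable dS (%te. ?P te * (e / (2 * omg)) + (1 - r^2) / c * (2 * G))"
    by (intro Bochner_Integration.integrable_add integrable_mult_left Pi') auto
   fix te assume "te : space (dS :: (real^'n) measure)"
   then have te: "norm te = 1" by simp
   have r2: "(1 - r^2) >= 0" using r0 r by (simp add: power_le_one)
   have pos2: "(1 - r^2) / c * (2 * G) >= 0" using r2 c G by simp
   have pos1: "?P te * (e / (2 * omg)) >= 0" using P0 e omg by simp
   show "cmod (complex_of_real (?P te) * (g te - g x)) <= ?P te * (e / (2 * omg)) + (1 - r^2) / c * (2 * G)"
   proof (cases "dist te x < de")
    case True
    have "cmod (g te - g x) <= e / (2 * omg)" using de(2)[OF x te True] by (simp add: dist_norm)
    then have "cmod (complex_of_real (?P te) * (g te - g x)) <= ?P te * (e / (2 * omg))"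
     using P0[of te] by (simp add: norm_mult mult_left_mono del: times_divide_eq_right)
    then show ?thesis using pos2 by linarith
   next
    case False
    have "de^2 / 2 <= r * (norm (x - te))^2"
    proof -
     have "de^2 <= (norm (x - te))^2" using False de(1) by (intro power_mono) (auto simp: dist_norm norm_minus_commute)
     then have "(1/2) * de^2 <= r * (norm (x - te))^2" using r by (intro mult_mono) auto
     then show ?thesis by simp
    qed
    then have "de^2 / 2 <= 1 - 2 * r * (x \<bullet> te) + r^2"
     unfolding poisson_sphere_base[OF x te] using zero_le_power2[of "1 - r"] by linarith
    then have cle: "c <= (1 - 2 * r * (x \<bullet> te) + r^2) powr (real CARD('n) / 2)"
     unfolding c_def by (intro powr_mono2) auto
    moreover from cle have "0 < (1 - 2 * r * (x \<bullet> te) + r^2) powr (real CARD('n) / 2)" using c by linarith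
    ultimately have "?P te <= (1 - r^2) / c"
     unfolding poisson_sphere_def using r2 c mult_pos_pos by (intro divide_left_mono) blast+
    moreover have "cmod (g te - g x) <= 2 * G"
     using norm_triangle_ineq4[of "g te" "g x"] G(2)[OF x] G(2)[OF te] by linarith
    ultimately have "cmod (complex_of_real (?P te) * (g te - g x)) <= (1 - r^2) / c * (2 * G)"
     unfolding norm_mult using P0[of te] r2 c by (intro mult_mono) auto
    then show ?thesis using pos1 by linarith
   qed
  qed
  also have "... = omg * (e / (2 * omg)) + (1 - r^2) / c * (2 * G) * omg"
   by (subst Bochner_Integration.integral_add)
     (auto simp: Pi' Pc' measure_sphere_measure omg_def)
  also have "... <= e"
   using b(2)[of r] r omg by (simp add: field_simps)
  finally show "cmod ((LINT te|dS. of_real (?P te) * g te) - of_real (omega CARD('n)) * g x) <= e"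
   by (simp add: omg_def)
 qed
qed

end

section \<open>Series in bounded orthogonal systems\<close>

text \<open>The Weierstrass test for unordered sums. The bound on \<open>e i x\<close> stands
  inside, as a premise at each \<open>x\<close>, so that one \<open>F0\<close> serves all points at
  which it holds.\<close>

lemma uniform_series_approx:
 fixes a :: "'i => complex" and e :: "'i => 'a => complex"
 assumes sm: "(%i. cmod (a i) * B i) summable_on J" and eps: "ep > 0"
 shows "EX F0. finite F0 & F0 <= J &
  (ALL F x. finite F --> F0 <= F --> F <= J --> (ALL i:J. cmod (e i x) <= B i) -->
    cmod ((\<Sum>\<^sub>\<infinity>i\<in>J. a i * e i x) - (SUM i:F. a i * e i x)) <= ep)"
proof -
 define b where "b i = cmod (a i) * B i" for i
 have bs: "b summable_on J" using sm by (simp add: b_def[abs_def])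
 have "(sum b \<longlongrightarrow> infsum b J) (finite_subsets_at_top J)"
  using has_sum_infsum[OF bs] by (simp add: has_sum_def)
 then have "eventually (%F. infsum b J - ep < sum b F) (finite_subsets_at_top J)"
  using eps by (intro order_tendstoD(1)) auto
 then obtain F0 where F0: "finite F0" "F0 <= J" and "ALL F. finite F & F0 <= F & F <= J --> infsum b J - ep < sum b F"
  unfolding eventually_finite_subsets_at_top by (elim exE conjE) (rule that)
 then have F0': "!!F. finite F ==> F0 <= F ==> F <= J ==> infsum b J - ep < sum b F" by simp
 show ?thesis
 proof (intro exI[of _ F0] conjI allI impI F0)
  fix F x assume F: "finite F" "F0 <= F" "F <= J" and "ALL i:J. cmod (e i x) <= B i"
  then have e: "!!i. i : J ==> cmod (e i x) <= B i" by simp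
  have le: "cmod (a i * e i x) <= b i" if "i : J" for i
   unfolding b_def norm_mult using e[OF that] by (intro mult_left_mono) auto
  have as: "(%i. a i * e i x) summable_on J"
   by (rule abs_summable_summable, rule summable_on_comparison_test[OF bs]) (auto intro: le)
  have "(\<Sum>\<^sub>\<infinity>i\<in>J. a i * e i x) = (\<Sum>\<^sub>\<infinity>i\<in>F. a i * e i x) + (\<Sum>\<^sub>\<infinity>i\<in>J - F. a i * e i x)"
   using F as by (subst infsum_Un_disjoint[symmetric]) (auto intro: summable_on_subset_banach simp: Un_absorb1)
  then have "cmod ((\<Sum>\<^sub>\<infinity>i\<in>J. a i * e i x) - (SUM i:F. a i * e i x)) = cmod (\<Sum>\<^sub>\<infinity>i\<in>J - F. a i * e i x)"
   using F by simp
  also have "... <= infsum b (J - F)"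
   by (rule norm_infsum_le)
     (use le bs as in "auto intro!: has_sum_infsum intro: summable_on_subset_banach[of _ J]")
  also have "infsum b J = infsum b F + infsum b (J - F)"
   using F bs by (subst infsum_Un_disjoint[symmetric]) (auto intro: summable_on_subset_banach simp: Un_absorb1)
  then have "infsum b (J - F) <= ep" using F0'[OF F] F by simp
  finally show "cmod ((\<Sum>\<^sub>\<infinity>i\<in>J. a i * e i x) - (SUM i:F. a i * e i x)) <= ep" .
 qed
qed

lemma bounded_mult_integrable:
 fixes g h :: "'a => complex"
 assumes "g : bmeas M" "!!x. x : space M ==> cmod (g x) <= C" "integrable M h"
 shows "integrable M (%x. g x * h x)"
proof (rule integrable_bound[OF integrable_mult_right[OF integrable_norm[OF assms(3)], of "C"]])
 show "(%x. g x * h x) : bmeas M" using assms by (intro borel_measurable_times) auto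
 show "AE x in M. norm (g x * h x) <= norm (C * norm (h x))"
  by (rule AE_I2)
   (simp add: norm_mult abs_mult, intro mult_right_mono order_trans[OF assms(2) abs_ge_self], auto)
qed

section \<open>Uniformly convergent series on a finite measure space\<close>

context
 fixes M :: "'a measure" and J :: "'i set" and e :: "'i => 'a => complex" and B :: "'i => real"
 assumes M: "finite_measure M"
  and em: "!!i. i : J ==> e i : bmeas M"
  and eB: "!!i x. i : J ==> x : space M ==> cmod (e i x) <= B i"
  and B0: "!!i. i : J ==> 0 <= B i"
begin

text \<open>The sum over \<open>J\<close> is a limit along a net. Uniform approximation up to
  \<open>1 / (n + 1)\<close> by finite sums replaces the net by a sequence, whose limit is
  measurable.\<close>

lemma bounded_series_measurable:
 assumes sm: "(%i. cmod (a i) * B i) summable_on J"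
 shows "(%x. \<Sum>\<^sub>\<infinity>i\<in>J. a i * e i x) : bmeas M"
proof -
 have "EX F. finite F & F <= J & (ALL x:space M. cmod ((\<Sum>\<^sub>\<infinity>i\<in>J. a i * e i x) - (SUM i:F. a i * e i x)) <= inverse (real (Suc n)))" for n
 proof -
  obtain F0 where F0: "finite F0" "F0 <= J" and F0':
   "ALL F x. finite F --> F0 <= F --> F <= J --> (ALL i:J. cmod (e i x) <= B i) -->
    cmod ((\<Sum>\<^sub>\<infinity>i\<in>J. a i * e i x) - (SUM i:F. a i * e i x)) <= inverse (real (Suc n))"
  proof -
   have "inverse (real (Suc n)) > 0" by simp
   from uniform_series_approx[where B = B and J = J and e = e, OF sm this]
   show thesis by (elim exE conjE) (rule that)
  qed
  have "cmod ((\<Sum>\<^sub>\<infinity>i\<in>J. a i * e i x) - (SUM i:F0. a i * e i x)) <= inverse (real (Suc n))" if "x : space M" for x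
   using F0'[rule_format, OF F0(1) order_refl F0(2), of x] eB that by simp
  then show ?thesis using F0 by (intro exI[of _ F0]) simp
 qed
 then have "ALL n. EX F. finite F & F <= J & (ALL x:space M. cmod ((\<Sum>\<^sub>\<infinity>i\<in>J. a i * e i x) - (SUM i:F. a i * e i x)) <= inverse (real (Suc n)))"
  by (rule allI)
 from choice[OF this] obtain F where
  "ALL n. finite (F n) & F n <= J & (ALL x:space M. cmod ((\<Sum>\<^sub>\<infinity>i\<in>J. a i * e i x) - (SUM i:F n. a i * e i x)) <= inverse (real (Suc n)))" ..
 then have F: "!!n. finite (F n)" "!!n. F n <= J"
  "!!n x. x : space M ==> cmod ((\<Sum>\<^sub>\<infinity>i\<in>J. a i * e i x) - (SUM i:F n. a i * e i x)) <= inverse (real (Suc n))"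
  by (simp_all del: of_nat_Suc)
 show ?thesis
 proof (rule borel_measurable_LIMSEQ_metric)
  show "(%x. SUM i:F n. a i * e i x) : bmeas M" for n
   using F(2)[of n] em by (intro borel_measurable_sum borel_measurable_times) auto
  fix x assume x: "x : space M"
  show "(%n. SUM i:F n. a i * e i x) \<longlonglongrightarrow> (\<Sum>\<^sub>\<infinity>i\<in>J. a i * e i x)"
  proof (rule metric_tendsto_imp_tendsto[OF LIMSEQ_inverse_real_of_nat])
   show "eventually (%n. dist (SUM i:F n. a i * e i x) (\<Sum>\<^sub>\<infinity>i\<in>J. a i * e i x) <= dist (inverse (real (Suc n))) 0) sequentially"
    using F(3)[OF x] by (intro always_eventually allI) (simp add: dist_norm norm_minus_commute del: of_nat_Suc)
  qed
 qed
qed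

lemma bounded_series_summable:
 assumes sm: "(%i. cmod (a i) * B i) summable_on J" and x: "x : space M"
 shows "(%i. a i * e i x) summable_on J"
proof (rule abs_summable_summable, rule summable_on_comparison_test[OF sm])
 fix i assume i: "i : J"
 show "cmod (a i * e i x) <= cmod (a i) * B i"
  unfolding norm_mult by (rule mult_left_mono[OF eB[OF i x]]) simp
qed simp

lemma bounded_series_bound:
 assumes sm: "(%i. cmod (a i) * B i) summable_on J" and x: "x : space M"
 shows "cmod (\<Sum>\<^sub>\<infinity>i\<in>J. a i * e i x) <= (\<Sum>\<^sub>\<infinity>i\<in>J. cmod (a i) * B i)"
 by (rule norm_infsum_le[OF has_sum_infsum[OF bounded_series_summable[OF sm x]] has_sum_infsum[OF sm]])
   (unfold norm_mult, rule mult_left_mono[OF eB[OF _ x]], auto)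

lemma bounded_series_integral:
 assumes sm: "(%i. cmod (a i) * B i) summable_on J" and h: "integrable M h"
 shows "((%i. a i * (LINT x|M. e i x * h x)) has_sum (LINT x|M. (\<Sum>\<^sub>\<infinity>i\<in>J. a i * e i x) * h x)) J"
proof -
 let ?G = "%x. \<Sum>\<^sub>\<infinity>i\<in>J. a i * e i x"
 \<comment> \<open>The added 1 keeps the divisor positive when \<open>h\<close> vanishes almost
   everywhere.\<close>
 define H where "H = (LINT x|M. cmod (h x)) + 1"
 have H: "H > 0" by (simp add: H_def add_nonneg_pos)
 have Gi: "integrable M (%x. ?G x * h x)"
  by (rule bounded_mult_integrable[OF bounded_series_measurable[OF sm] bounded_series_bound[OF sm] h])
 have ei: "integrable M (%x. e i x * h x)" if "i : J" for i
  by (rule bounded_mult_integrable[OF em[OF that] eB[OF that] h])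
 have ev: "eventually (%F. dist (SUM i:F. a i * (LINT x|M. e i x * h x)) (LINT x|M. ?G x * h x) < ep) (finite_subsets_at_top J)"
  if eps: "ep > 0" for ep
 proof -
  have e2: "ep / H / 2 > 0" using eps H by simp
  obtain F0 where F0: "finite F0" "F0 <= J" and F0':
   "ALL F x. finite F --> F0 <= F --> F <= J --> (ALL i:J. cmod (e i x) <= B i) -->
    cmod (?G x - (SUM i:F. a i * e i x)) <= ep / H / 2"
   using uniform_series_approx[where B = B and J = J and e = e, OF sm e2] by (elim exE conjE) (rule that)
  have "dist (SUM i:F. a i * (LINT x|M. e i x * h x)) (LINT x|M. ?G x * h x) < ep" if F: "finite F" "F0 <= F" "F <= J" for F
  proof -
   have Fi: "integrable M (%x. a i * (e i x * h x))" if "i : F" for i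
    using ei F that by (intro integrable_mult_right) auto
   have "(SUM i:F. a i * (LINT x|M. e i x * h x)) = (LINT x|M. (SUM i:F. a i * (e i x * h x)))"
    using Fi by (subst lint_sum) auto
   then have "dist (SUM i:F. a i * (LINT x|M. e i x * h x)) (LINT x|M. ?G x * h x)
     = cmod (LINT x|M. ?G x * h x - (SUM i:F. a i * (e i x * h x)))"
    using Bochner_Integration.integral_diff[OF Gi Bochner_Integration.integrable_sum[of F, OF Fi]]
    by (simp add: dist_norm norm_minus_commute)
   also have "... <= (LINT x|M. ep / H / 2 * cmod (h x))"
   proof (rule order_trans[OF integral_norm_bound integral_mono])
    show "integrable M (%x. cmod (?G x * h x - (SUM i:F. a i * (e i x * h x))))"
     by (intro integrable_norm Bochner_Integration.integrable_diff Gi Bochner_Integration.integrable_sum Fi)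
    show "integrable M (%x. ep / H / 2 * cmod (h x))" by (intro integrable_mult_right integrable_norm h)
    fix x assume x: "x : space M"
    have "?G x * h x - (SUM i:F. a i * (e i x * h x)) = (?G x - (SUM i:F. a i * e i x)) * h x"
     by (simp only: left_diff_distrib sum_distrib_right mult.assoc)
    then show "cmod (?G x * h x - (SUM i:F. a i * (e i x * h x))) <= ep / H / 2 * cmod (h x)"
     unfolding norm_mult using F0'[rule_format, OF F, of x] eB[OF _ x] by (simp only: norm_mult) (intro mult_right_mono, auto)
   qed
   also have "... = ep / H / 2 * (H - 1)" by (simp add: H_def)
   also have "... < ep" using eps H mult_pos_pos[OF H eps] by (simp add: field_simps add_pos_pos)
   finally show ?thesis .
  qed
  then show ?thesis unfolding eventually_finite_subsets_at_top using F0(1,2) by blast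
 qed
 then show ?thesis unfolding has_sum_def tendsto_iff by blast
qed

lemma bounded_integrable:
 assumes "g : bmeas M" "!!x. x : space M ==> cmod (g x) <= C"
 shows "integrable M g"
 by (rule finite_measure.integrable_const_bound[OF M, where B = C]) (use assms in auto)

context
 fixes N :: real
 assumes N: "N > 0"
  and ort: "!!i j. i : J ==> j : J ==> (LINT x|M. e i x * cnj (e j x)) = (if i = j then of_real N else 0)"
begin

lemma bounded_series_coefficient:
 assumes sm: "(%i. cmod (a i) * B i) summable_on J" and j: "j : J"
 shows "(LINT x|M. (\<Sum>\<^sub>\<infinity>i\<in>J. a i * e i x) * cnj (e j x)) = of_real N * a j"
proof -
 have "((%i. a i * (LINT x|M. e i x * cnj (e j x))) has_sum (LINT x|M. (\<Sum>\<^sub>\<infinity>i\<in>J. a i * e i x) * cnj (e j x))) J"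
  by (rule bounded_series_integral[OF sm bounded_integrable[of _ "B j"]])
    (use em[OF j] eB[OF j] in "auto intro: borel_measurable_continuous_on[of cnj] continuous_intros")
 moreover have "((%i. a i * (LINT x|M. e i x * cnj (e j x))) has_sum (of_real N * a j)) J"
  by (rule has_sum_finite_neutralI[where B = "{j}"]) (use j ort in "auto")
 ultimately show ?thesis by (rule has_sum_unique)
qed

text \<open>The series is integrated term by term against its own conjugate, and the integrals that
  arise are its conjugated coefficients.\<close>

lemma bounded_series_parseval:
 assumes sm: "(%i. cmod (a i) * B i) summable_on J"
 shows "((%i. N * (cmod (a i))^2) has_sum (LINT x|M. (cmod (\<Sum>\<^sub>\<infinity>i\<in>J. a i * e i x))^2)) J"
proof -
 let ?G = "%x. \<Sum>\<^sub>\<infinity>i\<in>J. a i * e i x"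
 have Gm: "?G : bmeas M" by (rule bounded_series_measurable[OF sm])
 have cGm: "(%x. cnj (?G x)) : bmeas M"
  using Gm by (intro borel_measurable_continuous_on[of cnj]) (auto intro: continuous_intros)
 have X1: "((%i. a i * (LINT x|M. e i x * cnj (?G x))) has_sum (LINT x|M. ?G x * cnj (?G x))) J"
  by (rule bounded_series_integral[OF sm bounded_integrable[OF cGm]])
    (simp, rule bounded_series_bound[OF sm])
 have X2: "a i * (LINT x|M. e i x * cnj (?G x)) = of_real (N * (cmod (a i))^2)" if i: "i : J" for i
 proof -
  have "(LINT x|M. e i x * cnj (?G x)) = cnj (LINT x|M. ?G x * cnj (e i x))"
   by (subst Bochner_Integration.integral_cnj[symmetric]) (simp add: mult.commute)
  also have "... = of_real N * cnj (a i)" by (simp add: bounded_series_coefficient[OF sm i])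
  finally have "a i * (LINT x|M. e i x * cnj (?G x)) = of_real N * (a i * cnj (a i))" by simp
  also have "a i * cnj (a i) = of_real ((cmod (a i))^2)" by (rule complex_norm_square[symmetric])
  finally show ?thesis by simp
 qed
 have X3: "(LINT x|M. ?G x * cnj (?G x)) = of_real (LINT x|M. (cmod (?G x))^2)"
  unfolding complex_norm_square[symmetric] by (rule integral_complex_of_real)
 have "((%i. complex_of_real (N * (cmod (a i))^2)) has_sum of_real (LINT x|M. (cmod (?G x))^2)) J"
  by (rule has_sum_cong[THEN iffD1, OF X2 X1[unfolded X3]])
 then show ?thesis by (rule has_sum_of_real_iff[THEN iffD1])
qed

text \<open>Expand the squared distance from \<open>g\<close> to its orthogonal projection
  \<open>S\<close> on the span of the chosen functions. These have squared norm \<open>N\<close>,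
  and the inner products on the left are not divided by it, hence the factor \<open>N\<close> on the
  right.\<close>

lemma bessel_inequality:
 assumes g: "g : bmeas M" "integrable M (%x. (cmod (g x))^2)" and F: "finite F" "F <= J"
 shows "(SUM i:F. (cmod (LINT x|M. g x * cnj (e i x)))^2) <= N * (LINT x|M. (cmod (g x))^2)"
proof -
 define c where "c i = (LINT x|M. g x * cnj (e i x)) / of_real N" for i
 define S where "S x = (SUM i:F. c i * e i x)" for x
 have cem: "(%x. cnj (e i x)) : bmeas M" if "i : J" for i
  using em[OF that] by (intro borel_measurable_continuous_on[of cnj]) (auto intro: continuous_intros)
 have g1: "integrable M g"
 proof (rule integrable_bound[OF Bochner_Integration.integrable_add[OF finite_measure.integrable_const[OF M, of 1] g(2)]])
  show "g : bmeas M" by fact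
  show "AE x in M. norm (g x) <= norm (1 + (cmod (g x))^2)"
  proof (rule AE_I2)
   fix x show "norm (g x) <= norm (1 + (cmod (g x))^2)"
    using power2_diff[of "cmod (g x)" "1/2"] zero_le_power2[of "cmod (g x) - 1/2"] by (simp add: power2_eq_square)
  qed
 qed
 have gei: "integrable M (%x. g x * cnj (e i x))" if "i : J" for i
  using bounded_mult_integrable[OF cem[OF that] _ g1, of "B i"] eB[OF that] by (simp add: mult.commute)
 have eei: "integrable M (%x. e i x * cnj (e j x))" if "i : J" "j : J" for i j
  by (rule bounded_mult_integrable[OF em[OF that(1)] eB[OF that(1)]]) (auto intro!: bounded_integrable[where C = "B j"] em that eB)
 have gS: "integrable M (%x. g x * cnj (S x))" "(LINT x|M. g x * cnj (S x)) = of_real N * (SUM i:F. c i * cnj (c i))"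
 proof -
  have eq: "g x * cnj (S x) = (SUM i:F. cnj (c i) * (g x * cnj (e i x)))" for x
   by (simp add: S_def sum_distrib_left mult_ac)
  show "integrable M (%x. g x * cnj (S x))"
   unfolding eq using F gei by (intro Bochner_Integration.integrable_sum integrable_mult_right) auto
  have "(LINT x|M. g x * cnj (S x)) = (SUM i:F. cnj (c i) * (LINT x|M. g x * cnj (e i x)))"
   unfolding eq using F gei by (subst lint_sum) (auto intro!: integrable_mult_right)
  also have "... = of_real N * (SUM i:F. c i * cnj (c i))"
   using N by (simp add: c_def sum_distrib_left mult_ac)
  finally show "(LINT x|M. g x * cnj (S x)) = of_real N * (SUM i:F. c i * cnj (c i))" .
 qed
 have SS: "integrable M (%x. S x * cnj (S x))" "(LINT x|M. S x * cnj (S x)) = of_real N * (SUM i:F. c i * cnj (c i))"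
 proof -
  have eq: "S x * cnj (S x) = (SUM i:F. SUM j:F. c i * cnj (c j) * (e i x * cnj (e j x)))" for x
   by (simp add: S_def sum_product mult_ac)
  show "integrable M (%x. S x * cnj (S x))"
   unfolding eq using F eei by (intro Bochner_Integration.integrable_sum integrable_mult_right) auto
  have "(LINT x|M. S x * cnj (S x)) = (SUM i:F. SUM j:F. c i * cnj (c j) * (LINT x|M. e i x * cnj (e j x)))"
   unfolding eq using F eei
   by (subst lint_sum, force intro!: Bochner_Integration.integrable_sum integrable_mult_right)
     (intro sum.cong refl, subst lint_sum, auto intro!: integrable_mult_right)
  also have "... = (SUM i:F. SUM j:F. if i = j then c i * cnj (c j) * of_real N else 0)"
   using F by (intro sum.cong refl) (auto simp: ort subset_iff)
  also have "... = of_real N * (SUM i:F. c i * cnj (c i))"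
   using F by (simp add: sum_distrib_left mult_ac)
  finally show "(LINT x|M. S x * cnj (S x)) = of_real N * (SUM i:F. c i * cnj (c i))" .
 qed
 define s where "s = (SUM i:F. (cmod (c i))^2)"
 have s: "(SUM i:F. c i * cnj (c i)) = of_real s"
  by (simp add: s_def complex_norm_square del: of_real_power)
 have R1: "(LINT x|M. Re (g x * cnj (S x))) = N * s"
  unfolding integral_Re[OF gS(1)] gS(2) s by simp
 have R2: "(LINT x|M. (cmod (S x))^2) = N * s" "integrable M (%x. (cmod (S x))^2)"
 proof -
  have eq: "(cmod (S x))^2 = Re (S x * cnj (S x))" for x by (simp add: complex_norm_square[symmetric])
  show "(LINT x|M. (cmod (S x))^2) = N * s"
   unfolding eq integral_Re[OF SS(1)] SS(2) s by simp
  show "integrable M (%x. (cmod (S x))^2)"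
   unfolding eq by (rule integrable_Re[OF SS(1)])
 qed
 have "0 <= (LINT x|M. (cmod (g x - S x))^2)" by simp
 also have "... = (LINT x|M. (cmod (g x))^2 - 2 * Re (g x * cnj (S x)) + (cmod (S x))^2)"
  by (intro lint_cong refl)
    (simp only: cmod_power2, simp add: power2_eq_square algebra_simps)
 also have "... = (LINT x|M. (cmod (g x))^2) - 2 * (N * s) + N * s"
  unfolding Bochner_Integration.integral_add[OF Bochner_Integration.integrable_diff[OF g(2)
    integrable_mult_right[OF integrable_Re[OF gS(1)]]] R2(2)]
   Bochner_Integration.integral_diff[OF g(2) integrable_mult_right[OF integrable_Re[OF gS(1)]]]
   integral_mult_right_zero R1 R2(1) ..
 finally have "N * s <= (LINT x|M. (cmod (g x))^2)" by simp
 then have "N * (N * s) <= N * (LINT x|M. (cmod (g x))^2)" using N by (intro mult_left_mono) auto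
 moreover have "(SUM i:F. (cmod (LINT x|M. g x * cnj (e i x)))^2) = N * (N * s)"
  using N by (simp add: s_def c_def sum_distrib_left norm_divide power_divide power2_eq_square)
 ultimately show ?thesis by simp
qed

end

end

declare One_nat_def[simp del]

lemma power_series_zero_on_reals:
 fixes c :: "nat => complex"
 assumes z: "!!s. 0 < s ==> s < 1 ==> (%k. of_real s ^ k * c k) sums 0"
 shows "c k = 0"
proof (rule ccontr)
 assume k: "c k ~= 0"
 \<comment> \<open>Shifting the coefficients by one makes the function vanish at 0. A nonzero
   coefficient of positive index then makes this zero isolated.\<close>
 define a where "a n = (if n = 0 then 0 else c (n - 1))" for n
 define f where "f z = (\<Sum>n. a n * z ^ n)" for z
 have real0: "(%n. a n * of_real s ^ n) sums 0" if "0 < s" "s < 1" for s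
 proof -
  have "(%n. a (Suc n) * of_real s ^ Suc n) sums 0"
   using sums_mult[OF z[OF that], of "of_real s"] by (simp add: a_def mult_ac)
  then show ?thesis using sums_Suc_iff[of "%n. a n * of_real s ^ n" 0] by (simp add: a_def)
 qed
 have sm: "(%n. a n * (z - 0) ^ n) sums f z" if "norm (z - 0) < 1/2" for z
  unfolding f_def using powser_inside[OF sums_summable[OF real0[of "1/2"]], of z] that
  by (simp add: summable_sums)
 have f0: "f 0 = 0" by (simp add: f_def a_def)
 have "a (Suc k) ~= 0" using k by (simp add: a_def)
 then obtain s where s: "s > 0" "!!z. z : cball 0 s - {0} ==> f z ~= 0"
  using powser_0_nonzero[of "1/2" 0 a f "Suc k", OF _ sm f0] by auto
 define t where "t = min s (1/4)"
 have t: "0 < t" "t < 1" "t <= s" using s by (auto simp: t_def)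
 have "f (of_real t) = 0" unfolding f_def using real0[OF t(1,2)] by (simp add: sums_iff)
 moreover have "complex_of_real t : cball 0 s - {0}" using t by auto
 ultimately show False using s(2) by blast
qed

lemma harmonic_bounded_on_sphere:
 assumes "continuous_on (sphere 0 1) (p :: real^'n => complex)"
 obtains B where "B > 0" "!!x. norm x = 1 ==> cmod (p x) <= B"
proof -
 have "bounded (p ` sphere 0 1)" by (rule compact_imp_bounded[OF compact_continuous_image[OF assms]]) simp
 then obtain G where "G > 0" "ALL x:sphere 0 1. cmod (p x) <= G" unfolding bounded_pos by auto
 then show ?thesis using that by auto
qed

section \<open>Reproducing property, addition theorem and orthogonality of degrees\<close>

context
 fixes Y :: "nat => nat => real^'n => complex"
 assumes Y: "orthonormal_harmonics Y"
begin

text \<open>For \<open>y\<close> on the sphere and \<open>r\<close> near 1, the sum of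
  \<open>r^k * v k y\<close> is close to \<open>omg * p y\<close>. Both are harmonic in
  \<open>y\<close>, so this persists at \<open>(s / r) *\<^sub>R x\<close>, where homogeneity gives
  the sum of \<open>s^k * v k x\<close> and \<open>(s / r)^m * omg * p x\<close>. As
  \<open>r\<close> tends to 1, the series in \<open>s\<close> is identified with
  \<open>omg * s^m * p x\<close>, and its coefficients can be compared.\<close>

lemma zonal_reproducing:
 assumes p: "p : harmonic_homogeneous m" and x: "norm (x::real^'n) = 1"
 shows "(LINT te|dS. zharm k te x * p te)
   = (if k = m then of_real (omega CARD('n)) * p x else 0)"
proof -
 define omg where "omg = omega CARD('n)"
 define v where "v k y = (LINT te|dS. zharm k te y * p te)" for k y
 have pc: "continuous_on A p" for A
  by (intro continuous_on_polymonial_function harmonic_homogeneousD(1)[OF p])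
 obtain B where B: "B > 0" "!!x. norm x = 1 ==> cmod (p x) <= B"
  using harmonic_bounded_on_sphere[OF pc] by blast
 have pm: "p : bmeas dS" by (rule continuous_sphere_measurable[OF pc])
 have v: "v k : harmonic_homogeneous k" for k
  unfolding v_def[abs_def] by (rule zonal_integral_in[OF Y pm B(2)])
 define poi where "poi r y = (LINT te|dS. of_real (poisson_sphere r te y) * p te)" for r y
 have est: "cmod (poi s x - of_real omg * of_real s ^ m * p x) <= 3 * e" if s: "0 < s" "s < 1" and e: "e > 0" for s e
 proof -
  obtain r0 where r0: "0 <= r0" "r0 < 1" "!!r y. r0 < r ==> r < 1 ==> norm y = 1 ==>
    cmod (poi r y - of_real omg * p y) <= e"
   by (rule poisson_approximate_identity[OF Y pc e, folded poi_def omg_def]) (assumption | (rule that; assumption))+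
  obtain N1 where N1: "!!N y. N >= N1 ==> norm y = 1 ==> cmod ((\<Sum>k<N. of_real s^k * v k y) - poi s y) <= e"
   by (rule poisson_integral_tail[OF less_imp_le[OF s(1)] s(2) pm B(2) e, folded v_def poi_def]) (assumption | (rule that; assumption))+
  have r: "cmod (poi s x - of_real omg * of_real (s / r) ^ m * p x) <= 3 * e" if r: "max r0 s < r" "r < 1" for r
  proof -
   have r': "0 <= r" "0 < r" "r0 < r" using r s by auto
   obtain N0 where N0: "!!N y. N >= N0 ==> norm y = 1 ==> cmod ((\<Sum>k<N. of_real r^k * v k y) - poi r y) <= e"
    by (rule poisson_integral_tail[OF r'(1) r(2) pm B(2) e, folded v_def poi_def]) (assumption | (rule that; assumption))+
   define N where "N = max N0 N1"
   \<comment> \<open>The series is truncated here because the maximum principle is proved for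
     polynomials.\<close>
   define Q where "Q = (%y. (\<Sum>k<N. of_real r^k * v k y) + - of_real omg * p y)"
   have vp: "polynomial_function (%y. of_real r^k * v k y)" for k
    using polynomial_function_bounded_linear_compose[OF bounded_linear_mult_right harmonic_homogeneousD(1)[OF v]] .
   have pp: "polynomial_function (%y. - of_real omg * p y)"
    using polynomial_function_bounded_linear_compose[OF bounded_linear_mult_right harmonic_homogeneousD(1)[OF p]] .
   have sp: "polynomial_function (%y. \<Sum>k<N. of_real r^k * v k y)"
    by (rule polynomial_function_sum) (auto intro: vp)
   have "cmod (Q ((s / r) *\<^sub>R x)) <= 2 * e"
   proof (rule maximum_principle_cmod[where r = 1 and p = Q and x = "(s / r) *\<^sub>R x"])
    show "polynomial_function Q" unfolding Q_def using sp pp by (rule polynomial_function_add)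
    show "laplacian Q y = 0" for y
    proof -
     have "laplacian Q y = laplacian (%y. \<Sum>k<N. of_real r^k * v k y) y + laplacian (%y. - of_real omg * p y) y"
      unfolding Q_def by (rule laplacian_add[OF sp pp])
     also have "laplacian (%y. \<Sum>k<N. of_real r^k * v k y) y = (\<Sum>k<N. laplacian (%y. of_real r^k * v k y) y)"
      by (rule laplacian_sum) (auto intro: vp)
     also have "... = 0"
      using laplacian_bounded_linear[OF bounded_linear_mult_right harmonic_homogeneousD(1)[OF v]] harmonic_homogeneousD(3)[OF v]
      by (intro sum.neutral) simp
     also have "laplacian (%y. - of_real omg * p y) y = 0"
      using laplacian_bounded_linear[OF bounded_linear_mult_right harmonic_homogeneousD(1)[OF p], of "- of_real omg" y] harmonic_homogeneousD(3)[OF p]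
      by simp
     finally show ?thesis by simp
    qed
    show "norm ((s / r) *\<^sub>R x) <= 1" using r r' s x by simp
    fix y :: "real^'n" assume y: "norm y = 1"
    have "Q y = ((\<Sum>k<N. of_real r^k * v k y) - poi r y) + (poi r y - of_real omg * p y)" by (simp add: Q_def)
    also have "cmod ... <= e + e"
     by (rule norm_triangle_le[OF add_mono[OF N0 r0(3)]]) (use y r r' in "auto simp: N_def")
    finally show "cmod (Q y) <= 2 * e" by simp
   qed
   moreover have "Q ((s / r) *\<^sub>R x) = (\<Sum>k<N. of_real s^k * v k x) - of_real omg * of_real (s / r) ^ m * p x"
   proof -
    have "of_real r^k * v k ((s / r) *\<^sub>R x) = of_real s^k * v k x" for k
    proof -
     have "of_real r^k * v k ((s / r) *\<^sub>R x) = of_real (r^k * (s / r)^k) * v k x"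
      by (simp only: harmonic_homogeneousD(2)[OF v]) (simp add: scaleR_conv_of_real)
     also have "r^k * (s / r)^k = s^k" using r' by (simp add: power_mult_distrib[symmetric])
     finally show ?thesis by simp
    qed
    moreover have "p ((s / r) *\<^sub>R x) = of_real (s / r) ^ m * p x"
     by (simp only: harmonic_homogeneousD(2)[OF p]) (simp add: scaleR_conv_of_real)
    ultimately show ?thesis by (simp add: Q_def)
   qed
   moreover have "cmod ((\<Sum>k<N. of_real s^k * v k x) - poi s x) <= e" by (rule N1) (auto simp: N_def x)
   ultimately show ?thesis
    using norm_triangle_ineq4[of "(\<Sum>k<N. of_real s^k * v k x) - of_real omg * of_real (s / r) ^ m * p x" "(\<Sum>k<N. of_real s^k * v k x) - poi s x"]
    by (simp add: algebra_simps)
  qed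
  \<comment> \<open>The truncation depended on \<open>r\<close> but has disappeared from the
    estimate. Only \<open>s / r\<close> still involves \<open>r\<close>, which may now tend to
    1.\<close>
  have "((%r. cmod (poi s x - of_real omg * of_real (s / r) ^ m * p x)) \<longlongrightarrow> cmod (poi s x - of_real omg * of_real (s / 1) ^ m * p x)) (at_left 1)"
   by (intro tendsto_intros) auto
  moreover have "eventually (%r. cmod (poi s x - of_real omg * of_real (s / r) ^ m * p x) <= 3 * e) (at_left 1)"
   unfolding eventually_at_left_field using r r0(2) s(2) by (intro exI[of _ "max r0 s"]) auto
  ultimately show ?thesis by (intro tendsto_upperbound[where F = "at_left (1::real)"]) auto
 qed
 have poi: "poi s x = of_real omg * of_real s ^ m * p x" if s: "0 < s" "s < 1" for s
 proof -
  have "cmod (poi s x - of_real omg * of_real s ^ m * p x) <= 0"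
  proof (rule field_le_epsilon)
   fix e :: real assume "e > 0"
   then show "cmod (poi s x - of_real omg * of_real s ^ m * p x) <= 0 + e" using est[OF s, of "e / 3"] by simp
  qed
  then show ?thesis by simp
 qed
 have sv: "(%k. of_real s^k * v k x) sums (of_real omg * of_real s ^ m * p x)" if s: "0 < s" "s < 1" for s
 proof -
  have "(%N. \<Sum>k<N. of_real s^k * v k x) \<longlonglongrightarrow> poi s x"
  proof (rule LIMSEQ_I)
   fix e :: real assume "e > 0"
   then have e: "e / 2 > 0" by simp
   obtain N1 where N1: "!!N y. N >= N1 ==> norm y = 1 ==> cmod ((\<Sum>k<N. of_real s^k * v k y) - poi s y) <= e / 2"
    by (rule poisson_integral_tail[OF less_imp_le[OF s(1)] s(2) pm B(2) e, folded v_def poi_def]) (assumption | (rule that; assumption))+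
   show "EX no. \<forall>n\<ge>no. cmod ((\<Sum>k<n. of_real s^k * v k x) - poi s x) < e"
   proof (intro exI allI impI)
    fix n assume "n >= N1"
    from N1[OF this x] show "cmod ((\<Sum>k<n. of_real s^k * v k x) - poi s x) < e" using \<open>e > 0\<close> by linarith
   qed
  qed
  then show ?thesis by (simp add: sums_def poi[OF s])
 qed
 have "v k x - (if k = m then of_real omg * p x else 0) = 0"
 proof (rule power_series_zero_on_reals[where c = "%k. v k x - (if k = m then of_real omg * p x else 0)" and k = k])
  fix s :: real assume s: "0 < s" "s < 1"
  have "(%k. of_real s ^ k * (if k = m then of_real omg * p x else 0)) sums (of_real s ^ m * (of_real omg * p x))"
   using sums_single[of m "%k. of_real s ^ k * (of_real omg * p x)"] by (simp add: if_distrib cong: if_cong)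
  from sums_diff[OF sv[OF s] this]
  show "(%k. of_real s ^ k * (v k x - (if k = m then of_real omg * p x else 0))) sums 0"
   by (simp add: algebra_simps)
 qed
 then show ?thesis by (simp add: v_def omg_def)
qed

text \<open>The addition theorem. The zonal harmonic is symmetric in its two points, so the
  reproducing property, applied to the conjugated basis elements, gives its coefficients.\<close>

lemma zonal_harmonic_kernel:
 assumes x: "norm (x::real^'n) = 1" and te: "norm te = 1"
 shows "zharm k te x = of_real (omega CARD('n)) * (SUM l:{1..harm_dim TYPE('n) k}. Y k l x * cnj (Y k l te))"
proof -
 have c: "(LINT y|dS. zharm k te y * cnj (Y k l y)) = of_real (omega CARD('n)) * cnj (Y k l te)"
  if l: "l : {1..harm_dim TYPE('n) k}" for l
 proof -
  have "(LINT y|dS. zharm k te y * cnj (Y k l y)) = (LINT y|dS. zharm k y te * cnj (Y k l y))"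
   by (rule lint_cong) (use te zonal_harmonic_commute in auto)
  also have "... = of_real (omega CARD('n)) * cnj (Y k l te)"
   using zonal_reproducing[OF harmonic_homogeneous_cnj[OF Y_harm[OF Y l]] te, of k] by simp
  finally show ?thesis .
 qed
 have "zharm k te x = (SUM l:{1..harm_dim TYPE('n) k}. (of_real (omega CARD('n)) * cnj (Y k l te)) * Y k l x)"
  using c by (subst harmonic_expansion[OF Y zonal_harmonic_in[OF te]]) (intro sum.cong refl, simp only:)
 then show ?thesis by (simp only: sum_distrib_left mult_ac)
qed

text \<open>The zonal kernel of degree \<open>k\<close> integrates to 0 against
  \<open>Y m j\<close>. Replacing it by its basis expansion gives a linear relation between the
  \<open>Y k i\<close> on the sphere, and pairing with \<open>Y k l\<close> isolates
  \<open>a l\<close>, the conjugate of the wanted integral.\<close>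

lemma Y_orthogonal:
 assumes l: "l : {1..harm_dim TYPE('n) k}" and j: "j : {1..harm_dim TYPE('n) m}" and ne: "k ~= m"
 shows "(LINT te|dS. Y k l te * cnj (Y m j te)) = 0"
proof -
 let ?I = "{1..harm_dim TYPE('n) k}"
 define a where "a i = (LINT te|dS. cnj (Y k i te) * Y m j te)" for i
 have om: "omega CARD('n) ~= 0" using omega_pos[of "CARD('n)"] by simp
 have int: "integrable dS (%te. cnj (Y k i te) * Y m j te)" if "i : ?I" for i
  by (intro integrable_sphere_continuous continuous_intros Y_continuous[OF Y] that j)
 have z: "(SUM i:?I. a i * Y k i x) = 0" if x: "norm x = 1" for x
 proof -
  have "0 = (LINT te|dS. zharm k te x * Y m j te)"
   using zonal_reproducing[OF Y_harm[OF Y j] x, of k] ne by simp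
  also have "... = (LINT te|dS. (SUM i:?I. of_real (omega CARD('n)) * Y k i x * (cnj (Y k i te) * Y m j te)))"
   by (rule lint_cong[OF refl])
     (simp add: zonal_harmonic_kernel[OF x] sum_distrib_left sum_distrib_right mult_ac)
  also have "... = (SUM i:?I. of_real (omega CARD('n)) * Y k i x * a i)"
   unfolding a_def by (subst lint_sum) (auto intro!: int integrable_mult_right)
  also have "... = of_real (omega CARD('n)) * (SUM i:?I. a i * Y k i x)"
   by (simp only: sum_distrib_left mult_ac)
  finally show ?thesis using om by simp
 qed
 have ii: "integrable dS (%x. Y k i x * cnj (Y k l x))" if "i : ?I" for i
  by (intro integrable_sphere_continuous continuous_intros Y_continuous[OF Y] that l)
 have "0 = (LINT x|dS. (SUM i:?I. a i * Y k i x) * cnj (Y k l x))"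
  by (rule sym, subst lint_cong[OF refl, where g = "%_. 0"]) (auto simp: z)
 also have "... = (LINT x|dS. (SUM i:?I. a i * (Y k i x * cnj (Y k l x))))"
  by (simp only: sum_distrib_right mult.assoc)
 also have "... = (SUM i:?I. a i * (LINT x|dS. Y k i x * cnj (Y k l x)))"
  by (subst lint_sum) (auto intro!: ii integrable_mult_right)
 also have "... = (SUM i:?I. if i = l then a i else 0)"
  using Y_orthonormal_deg[OF Y _ l] by (intro sum.cong refl) simp
 also have "... = a l" using l by simp
 finally have "cnj (a l) = 0" by simp
 then show ?thesis unfolding a_def by (simp flip: Bochner_Integration.integral_cnj)
qed

lemma Y_orthonormal:
 assumes "l : {1..harm_dim TYPE('n) k}" "j : {1..harm_dim TYPE('n) m}"
 shows "(LINT te|dS. Y k l te * cnj (Y m j te)) = (if k = m & l = j then 1 else 0)"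
 using Y_orthogonal[OF assms] Y_orthonormal_deg[OF Y assms(1), of j] assms(2) by (cases "k = m") auto

text \<open>On the diagonal the addition theorem turns the sum of squares into a value of the zonal
  harmonic, whose growth is known.\<close>

lemma Y_growth:
 assumes rh: "0 < rh" "rh < 1"
 obtains M where "M > 0" "!!k x. norm x = 1 ==> (SUM l:{1..harm_dim TYPE('n) k}. (cmod (Y k l x))^2) <= M / rh^k"
proof -
 obtain M where M: "M > 0"
  "!!k (x::real^'n) te. norm x = 1 ==> norm te = 1 ==> cmod (zharm k te x) <= M / rh^k"
  using zonal_harmonic_bound[OF rh, where 'n='n] by blast
 have om: "omega CARD('n) > 0" using omega_pos[of "CARD('n)"] by simp
 show ?thesis
 proof
  show "M / omega CARD('n) > 0" using M om by simp
  fix k and x :: "real^'n" assume x: "norm x = 1"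
  have "zharm k x x = of_real (omega CARD('n) * (SUM l:{1..harm_dim TYPE('n) k}. (cmod (Y k l x))^2))"
   by (simp add: zonal_harmonic_kernel[OF x x] complex_norm_square del: of_real_power)
  then have "cmod (zharm k x x) = omega CARD('n) * (SUM l:{1..harm_dim TYPE('n) k}. (cmod (Y k l x))^2)"
   using om by (simp only: norm_of_real) (simp add: sum_nonneg)
  then have "omega CARD('n) * (SUM l:{1..harm_dim TYPE('n) k}. (cmod (Y k l x))^2) <= M / rh^k"
   using M(2)[OF x x, of k] by simp
  then show "(SUM l:{1..harm_dim TYPE('n) k}. (cmod (Y k l x))^2) <= M / omega CARD('n) / rh^k"
   using om rh(1) by (simp add: field_simps)
 qed
qed

text \<open>A Poisson integral of \<open>g\<close> with radius near 1 is uniformly close to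
  \<open>omg * g\<close>, and its truncated series is a combination of harmonics.\<close>

lemma harmonics_dense:
 assumes g: "continuous_on (sphere 0 1) (g :: real^'n => complex)" and e: "e > 0"
 obtains N c where "!!x. norm x = 1 ==>
   cmod (g x - (\<Sum>k<N. SUM l:{1..harm_dim TYPE('n) k}. c k l * Y k l x)) <= e"
proof -
 define omg where "omg = omega CARD('n)"
 have om: "omg > 0" unfolding omg_def by (rule omega_pos) simp
 have e2: "e * omg / 2 > 0" using e om by simp
 obtain B where B: "B > 0" "!!x. norm x = 1 ==> cmod (g x) <= B"
  using harmonic_bounded_on_sphere[OF g] by blast
 have gm: "g : bmeas dS" by (rule continuous_sphere_measurable[OF g])
 obtain r0 where r0: "0 <= r0" "r0 < 1" "!!r x. r0 < r ==> r < 1 ==> norm x = 1 ==>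
   cmod ((LINT te|dS. of_real (poisson_sphere r te x) * g te) - of_real omg * g x) <= e * omg / 2"
  by (rule poisson_approximate_identity[OF Y g e2, folded omg_def]) (assumption | (rule that; assumption))+
 define r where "r = (1 + r0) / 2"
 have r: "0 <= r" "r < 1" "r0 < r" using r0 by (auto simp: r_def)
 obtain N where N: "!!n x. n >= N ==> norm x = 1 ==>
  cmod ((\<Sum>k<n. of_real r^k * (LINT te|dS. zharm k te x * g te))
    - (LINT te|dS. of_real (poisson_sphere r te x) * g te)) <= e * omg / 2"
  by (rule poisson_integral_tail[OF r(1,2) gm B(2) e2]) (assumption | (rule that; assumption))+
 have "ALL k. EX c. (%x. LINT te|dS. zharm k te x * g te) = (%x. SUM l:{1..harm_dim TYPE('n) k}. c l * Y k l x)"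
  using harmonic_expansion_exists[OF Y zonal_integral_in[OF Y gm B(2)]] by blast
 from choice[OF this] obtain c where
  "ALL k. (%x. LINT te|dS. zharm k te x * g te) = (%x. SUM l:{1..harm_dim TYPE('n) k}. c k l * Y k l x)" ..
 then have c: "!!k. (%x. LINT te|dS. zharm k te x * g te) = (%x. SUM l:{1..harm_dim TYPE('n) k}. c k l * Y k l x)" by (rule spec)
 show ?thesis
 proof (rule that[where N = N and c = "%k l. of_real r^k * c k l / of_real omg"])
  fix x :: "real^'n" assume x: "norm x = 1"
  let ?S = "\<Sum>k<N. of_real r^k * (LINT te|dS. zharm k te x * g te)"
  let ?P = "LINT te|dS. of_real (poisson_sphere r te x) * g te"
  have S: "(\<Sum>k<N. SUM l:{1..harm_dim TYPE('n) k}. of_real r^k * c k l / of_real omg * Y k l x) = ?S / of_real omg"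
   unfolding fun_cong[OF c]
   by (simp only: sum_divide_distrib sum_distrib_left times_divide_eq_left times_divide_eq_right mult.assoc)
  have "cmod (?S - of_real omg * g x) <= cmod (?S - ?P) + cmod (?P - of_real omg * g x)"
   using norm_triangle_ineq[of "?S - ?P" "?P - of_real omg * g x"] by simp
  also have "... <= e * omg" using N[OF order_refl x] r0(3)[OF r(3,2) x] by simp
  finally have *: "cmod (?S - of_real omg * g x) <= e * omg" .
  have "g x - ?S / of_real omg = (of_real omg * g x - ?S) / of_real omg" using om by (simp add: field_simps)
  then have "cmod (g x - ?S / of_real omg) = cmod (?S - of_real omg * g x) / omg"
   using om by (simp add: norm_divide norm_minus_commute)
  also have "... <= e" using * om by (simp add: field_simps)
  finally show "cmod (g x - (\<Sum>k<N. SUM l:{1..harm_dim TYPE('n) k}. of_real r^k * c k l / of_real omg * Y k l x)) <= e"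
   by (simp only: S)
 qed
qed

end

declare One_nat_def[simp]

section \<open>The product of the circle and the sphere\<close>

lemma space_angle_measure[simp]: "space dA = {0..2*pi}"
 by (simp add: angle_measure_def space_restrict_space)

lemma sets_angle_measure: "sets dA = sets (restrict_space borel {0..2*pi})"
 by (simp add: angle_measure_def sets_restrict_space)

lemma emeasure_angle_measure: "emeasure dA {0..2*pi} = ennreal (2 * pi)"
 by (simp add: angle_measure_def emeasure_restrict_space)

lemma finite_angle_measure: "finite_measure dA"
 by (rule finite_measureI) (simp add: emeasure_angle_measure)

lemma measure_angle_measure: "measure dA {0..2*pi} = 2 * pi"
 by (simp add: measure_def emeasure_angle_measure)

lemma borel_measurable_angle_measure:
 "f : borel_measurable borel ==> f : bmeas dA"
 unfolding measurable_cong_sets[OF sets_angle_measure refl] by (rule measurable_restrict_space1)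

lemma measurable_angle_measure_id[measurable]: "(%x. x) : bmeas dA"
 by (rule borel_measurable_angle_measure) simp

lemma cis_measurable_angle: "(%ph. cis (c * ph)) : bmeas dA"
 by (intro borel_measurable_angle_measure borel_measurable_continuous_onI continuous_intros)

lemma integral_angle_measure:
 fixes f :: "real => 'b::{banach, second_countable_topology}"
 shows "(LINT ph|dA. f ph) = (LINT ph:{0..2*pi}|lborel. f ph)"
 unfolding angle_measure_def set_lebesgue_integral_def by (subst integral_restrict_space) auto

lemma integral_cis_angle:
 "(LINT ph|dA. cis (of_int n * ph)) = (if n = 0 then 2 * of_real pi else 0)"
proof (cases "n = 0")
 case True
 then show ?thesis by (simp add: measure_angle_measure scaleR_conv_of_real)
next
 case False
 define F where "F ph = cis (of_int n * ph) / (\<i> * of_int n)" for ph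
 have "has_bochner_integral lborel (%x. indicator {0..2*pi} x *\<^sub>R cis (of_int n * x)) (F (2*pi) - F 0)"
 proof (rule has_bochner_integral_FTC_Icc)
  fix x show "(F has_vector_derivative cis (of_int n * x)) (at x within {0..2*pi})"
  proof -
   have "((%z. exp (\<i> * of_int n * z) / (\<i> * of_int n)) has_field_derivative exp (\<i> * of_int n * of_real x)) (at (of_real x))"
    using False by (auto intro!: derivative_eq_intros)
   from has_vector_derivative_real_field[OF this] show ?thesis
    by (simp add: F_def[abs_def] cis_conv_exp mult_ac)
  qed
 qed (auto intro!: continuous_intros)
 moreover have "F (2*pi) = F 0"
 proof -
  have "cis (of_int n * (2*pi)) = 1" using cis_multiple_2pi[of "of_int n"] by (simp add: mult_ac)
  then show ?thesis by (simp add: F_def)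
 qed
 ultimately show ?thesis
  using False by (simp add: integral_angle_measure set_lebesgue_integral_def has_bochner_integral_integral_eq)
qed

lemma circle_orthonormal:
 "(LINT ph|dA. cis (of_int m * ph) * cnj (cis (of_int n * ph))) = (if m = n then of_real (2 * pi) else 0)"
proof -
 have "cis (of_int m * ph) * cnj (cis (of_int n * ph)) = cis (of_int (m - n) * ph)" for ph
  by (simp add: cis_cnj cis_mult algebra_simps)
 then show ?thesis by (simp only: integral_cis_angle) simp
qed

text \<open>The injection \<open>n\<close> selects the frequencies, so that power series with gaps
  are covered.\<close>

lemma circle_parseval:
 fixes n :: "'i => int"
 assumes a: "(%i. cmod (a i)) summable_on J" and n: "inj_on n J"
 shows "((%i. 2 * pi * (cmod (a i))^2) has_sum (LINT ph|dA. (cmod (\<Sum>\<^sub>\<infinity>i\<in>J. a i * cis (of_int (n i) * ph)))^2)) J"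
 by (rule bounded_series_parseval[OF finite_angle_measure, where B = "%_. 1"])
   (use a n in "auto simp: cis_measurable_angle circle_orthonormal inj_on_eq_iff")

lemma finite_circle_sphere: "finite_measure (dM :: (real * (real^'n)) measure)"
proof -
 interpret A: finite_measure dA by (rule finite_angle_measure)
 interpret S: finite_measure "dS :: (real^'n) measure" by (rule finite_sphere_measure)
 have "emeasure (dM :: (real * (real^'n)) measure) ({0..2*pi} \<times> sphere 0 1)
   = ennreal (2 * pi) * ennreal (omega CARD('n))"
  unfolding circle_sphere_measure_def
  by (subst S.emeasure_pair_measure_Times)
    (auto simp: emeasure_angle_measure sphere_measure_total_mass sets_angle_measure sets_sphere_measure sets_restrict_space_iff)
 then show ?thesis
  by (intro finite_measureI) (simp add: circle_sphere_measure_def space_pair_measure ennreal_mult_eq_top_iff)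
qed

lemma space_circle_sphere: "space (dM :: (real * (real^'n)) measure) = {0..2*pi} \<times> sphere 0 1"
 by (simp add: circle_sphere_measure_def space_pair_measure)

lemma pair_sigma_finite_circle_sphere: "pair_sigma_finite dA (dS :: (real^'n) measure)"
proof -
 interpret A: finite_measure dA by (rule finite_angle_measure)
 interpret S: finite_measure "dS :: (real^'n) measure" by (rule finite_sphere_measure)
 show ?thesis ..
qed

lemma circle_sphere_integral_fst:
 fixes h :: "real * (real^'n) => 'b::{banach, second_countable_topology}"
 assumes "integrable dM h"
 shows "(LINT ph|dA. LINT te|dS. h (ph, te)) = (LINT x|dM. h x)"
 using pair_sigma_finite.integral_fst'[OF pair_sigma_finite_circle_sphere] assms
 unfolding circle_sphere_measure_def by blast

lemma circle_sphere_integral_snd: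
 fixes h :: "real * (real^'n) => 'b::{banach, second_countable_topology}"
 assumes "integrable dM h"
 shows "(LINT te|dS. LINT ph|dA. h (ph, te)) = (LINT x|dM. h x)"
 using pair_sigma_finite.integral_snd[OF pair_sigma_finite_circle_sphere, of "%ph te. h (ph, te)"] assms
 unfolding circle_sphere_measure_def by (simp add: case_prod_beta')

lemma measurable_fst_circle_sphere:
 "f : bmeas dA ==> (%x. f (fst x)) : bmeas (dM :: (real * (real^'n)) measure)"
 unfolding circle_sphere_measure_def by (rule measurable_compose[OF measurable_fst])

lemma measurable_snd_circle_sphere:
 "f : bmeas dS ==> (%x. f (snd x)) : bmeas (dM :: (real * (real^'n)) measure)"
 unfolding circle_sphere_measure_def by (rule measurable_compose[OF measurable_snd])

text \<open>All integer frequencies occur in this system, since it has to be complete; the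
  frequencies \<open>k\<close>, \<open>k + 2\<close>, ... of Hardy functions form a
  subfamily.\<close>

definition circ_harm ::
  "(nat => nat => real^'n => complex) => int * nat * nat => real * (real^'n) => complex" where
 "circ_harm Y = (%(n, k, l) x. cis (of_int n * fst x) * Y k l (snd x))"

definition circle_harm_index :: "'n::finite itself => (int * nat * nat) set" where
 "circle_harm_index _ = {(n, k, l). l : {1..harm_dim TYPE('n) k}}"

lemma l2_integrable:
 fixes M :: "'a measure" and g :: "'a => complex"
 assumes M: "finite_measure M" and g: "g : bmeas M" "integrable M (%x. (cmod (g x))^2)"
 shows "integrable M g"
proof (rule integrable_bound[OF Bochner_Integration.integrable_add[OF finite_measure.integrable_const[OF M, of 1] g(2)]])
 show "AE x in M. norm (g x) <= norm (1 + (cmod (g x))^2)"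
 proof (rule AE_I2)
  fix x show "norm (g x) <= norm (1 + (cmod (g x))^2)"
   using zero_le_power2[of "cmod (g x) - 1/2"] by (simp add: power2_eq_square algebra_simps)
 qed
qed fact

abbreviation polar :: "(complex => real^'n => complex) => real * (real^'n) => complex" where
 "polar g \<equiv> %x. g (cis (fst x)) (snd x)"

lemma l2_circle_sphere_iff:
 "g : l2_circle_sphere \<longleftrightarrow> polar g : bmeas dM &
   integrable dM (%x. (cmod (polar g x))^2)"
 by (simp add: l2_circle_sphere_def case_prod_beta')

lemma l2_polar_integrable:
 "g : l2_circle_sphere ==> integrable dM (polar g)"
 by (auto simp: l2_circle_sphere_iff intro: l2_integrable[OF finite_circle_sphere])

lemma l2_norm_polar: "(l2_norm g)^2 = 1 / (2*pi) * (LINT x|dM. (cmod (polar g x))^2)"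
 unfolding l2_norm_def by (simp add: case_prod_beta')

context
 fixes Y :: "nat => nat => real^'n => complex"
 assumes Y: "orthonormal_harmonics Y"
begin

lemma Y_measurable: "l : {1..harm_dim TYPE('n) k} ==> Y k l : bmeas dS"
 by (intro continuous_sphere_measurable Y_continuous[OF Y])

lemma circle_harmonic_measurable:
 "i : circle_harm_index TYPE('n) ==> circ_harm Y i : bmeas dM"
 by (auto simp: circ_harm_def circle_harm_index_def
   intro!: borel_measurable_times measurable_fst_circle_sphere[OF cis_measurable_angle] measurable_snd_circle_sphere[OF Y_measurable])

text \<open>A single harmonic is at most the root of the sum of squares, so the growth bound is
  applied with \<open>rh^2\<close>.\<close>

lemma circle_harmonic_growth:
 assumes rh: "0 < rh" "rh < 1"
 obtains M where "M > 0"
  "!!k l te. l : {1..harm_dim TYPE('n) k} ==> norm te = 1 ==> cmod (Y k l te) <= M / rh^k"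
proof -
 obtain M where M: "M > 0" "!!k x. norm x = 1 ==> (SUM l:{1..harm_dim TYPE('n) k}. (cmod (Y k l x))^2) <= M / (rh^2)^k"
  by (rule Y_growth[OF Y, of "rh^2"]) (use rh in "auto simp: power_less_one_iff")
 show ?thesis
 proof (rule that[of "sqrt M"])
  show "sqrt M > 0" using M by simp
  fix k l and te :: "real^'n" assume l: "l : {1..harm_dim TYPE('n) k}" and te: "norm te = 1"
  have "(cmod (Y k l te))^2 <= (SUM l:{1..harm_dim TYPE('n) k}. (cmod (Y k l te))^2)"
   by (rule member_le_sum[OF l]) auto
  also have "... <= (sqrt M / rh^k)^2"
   using M te by (simp add: power_divide power_mult[symmetric] mult.commute)
  finally show "cmod (Y k l te) <= sqrt M / rh^k" by (rule power2_le_imp_le) (use M rh in auto)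
 qed
qed

lemma circle_harmonic_orthonormal:
 assumes i: "i : circle_harm_index TYPE('n)" and j: "j : circle_harm_index TYPE('n)"
 shows "(LINT x|dM. circ_harm Y i x * cnj (circ_harm Y j x)) = (if i = j then of_real (2 * pi) else 0)"
proof -
 obtain n k l where i': "i = (n, k, l)" "l : {1..harm_dim TYPE('n) k}" using i by (auto simp: circle_harm_index_def)
 obtain m k' l' where j': "j = (m, k', l')" "l' : {1..harm_dim TYPE('n) k'}" using j by (auto simp: circle_harm_index_def)
 obtain B where B: "!!te. norm te = 1 ==> cmod (Y k l te * cnj (Y k' l' te)) <= B"
  by (rule harmonic_bounded_on_sphere[OF continuous_on_mult[OF Y_continuous[OF Y i'(2)]
     continuous_on_cnj[OF Y_continuous[OF Y j'(2)]]]]) (rule that; assumption)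
 let ?h = "%x. circ_harm Y i x * cnj (circ_harm Y j x)"
 have eq: "?h (ph, te) = (cis (of_int n * ph) * cnj (cis (of_int m * ph))) * (Y k l te * cnj (Y k' l' te))" for ph te
  by (simp add: circ_harm_def i' j')
 have "integrable dM ?h"
 proof (rule finite_measure.integrable_const_bound[OF finite_circle_sphere, where B = B])
  show "?h : bmeas dM"
   using circle_harmonic_measurable[OF i] circle_harmonic_measurable[OF j] by (intro borel_measurable_times borel_measurable_cnj)
  show "AE x in dM. cmod (?h x) <= B"
  proof (rule AE_I2)
   fix x assume "x : space (dM :: (real * (real^'n)) measure)"
   then have "norm (snd x) = 1" by (auto simp: space_circle_sphere)
   then show "cmod (?h x) <= B" using B[of "snd x"] eq[of "fst x" "snd x"] by (simp add: norm_mult)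
  qed
 qed
 from circle_sphere_integral_fst[OF this]
 have "(LINT x|dM. ?h x) = (LINT ph|dA. LINT te|dS. (cis (of_int n * ph) * cnj (cis (of_int m * ph))) * (Y k l te * cnj (Y k' l' te)))"
  by (simp only: eq)
 also have "... = (LINT ph|dA. (cis (of_int n * ph) * cnj (cis (of_int m * ph))) * (if k = k' & l = l' then 1 else 0))"
  by (simp only: integral_mult_right_zero Y_orthonormal[OF Y i'(2) j'(2)])
 also have "... = (if n = m then of_real (2 * pi) else 0) * (if k = k' & l = l' then 1 else 0)"
  by (simp only: integral_mult_left_zero circle_orthonormal)
 also have "... = (if i = j then of_real (2 * pi) else 0)" by (simp add: i' j')
 finally show ?thesis .
qed

text \<open>Fubini's theorem turns the iterated integrals of the definition into one inner product
  on the product space, where Bessel's inequality and completeness apply.\<close>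

lemma laplace_fourier_coeff_polar:
 assumes g: "g : l2_circle_sphere" and l: "l : {1..harm_dim TYPE('n) k}"
 shows "laplace_fourier_coeff Y g k l n = 1 / (2*pi) * (LINT x|dM. polar g x * cnj (circ_harm Y (n, k, l) x))"
  and "integrable dM (%x. polar g x * cnj (circ_harm Y (n, k, l) x))"
proof -
 have i: "(n, k, l) : circle_harm_index TYPE('n)" using l by (simp add: circle_harm_index_def)
 obtain B where B: "!!te. norm te = 1 ==> cmod (Y k l te) <= B"
  using harmonic_bounded_on_sphere[OF Y_continuous[OF Y l]] by blast
 have "integrable dM (%x. cnj (circ_harm Y (n, k, l) x) * polar g x)"
  by (rule bounded_mult_integrable[OF borel_measurable_cnj[OF circle_harmonic_measurable[OF i]] _ l2_polar_integrable[OF g], where C = B])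
    (use B in "auto simp: space_circle_sphere circ_harm_def norm_mult")
 then show int: "integrable dM (%x. polar g x * cnj (circ_harm Y (n, k, l) x))"
  by (simp only: mult.commute)
 have "(LINT x|dM. polar g x * cnj (circ_harm Y (n, k, l) x))
   = (LINT ph|dA. LINT te|dS. g (cis ph) te * cnj (Y k l te) * cis (- (of_int n * ph)))"
  unfolding circle_sphere_integral_fst[OF int, symmetric]
  by (simp add: circ_harm_def cis_cnj mult_ac)
 also have "... = (LINT ph|dA. laplace_comp Y g k l (cis ph) * cis (- (of_int n * ph)))"
  by (simp only: integral_mult_left_zero laplace_comp_def)
 finally show "laplace_fourier_coeff Y g k l n = 1 / (2*pi) * (LINT x|dM. polar g x * cnj (circ_harm Y (n, k, l) x))"
  by (simp add: laplace_fourier_coeff_def)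
qed

end

section \<open>The Poisson kernel of the circle\<close>

text \<open>Normalised to have mean value 1, that is integral \<open>2 * pi\<close>, over the
  circle.\<close>

definition cpoisson :: "real => real => real" where
 "cpoisson r x = (1 - r^2) / (1 - 2 * r * cos x + r^2)"

lemma circle_poisson_denominator:
 "1 - 2 * r * cos x + r^2 = (cmod (1 - of_real r * cis x))^2"
proof -
 have "(cmod (1 - of_real r * cis x))^2 = (1 - r * cos x)^2 + (r * sin x)^2" by (simp add: cmod_power2)
 also have "... = 1 - 2 * r * cos x + r^2 * ((cos x)^2 + (sin x)^2)"
  by algebra
 finally show ?thesis by simp
qed

lemma circle_poisson_denominator_pos:
 fixes x :: real
 assumes "0 <= r" "r < 1"
 shows "(1 - r)^2 <= 1 - 2 * r * cos x + r^2" "0 < 1 - 2 * r * cos x + r^2"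
proof -
 have "2 * r * cos x <= 2 * r" using assms cos_le_one[of x] by (simp add: mult_left_le)
 then show 1: "(1 - r)^2 <= 1 - 2 * r * cos x + r^2" by (simp add: power2_eq_square algebra_simps)
 have "0 < (1 - r)^2" using assms by simp
 with 1 show "0 < 1 - 2 * r * cos x + r^2" by linarith
qed

lemma circle_poisson_nonneg:
 assumes "0 <= r" "r < 1"
 shows "0 <= cpoisson r x"
 unfolding cpoisson_def
 using circle_poisson_denominator_pos(2)[OF assms, of x] assms by (intro divide_nonneg_pos) (auto simp: power_le_one)

lemma circle_poisson_bound:
 assumes r: "0 <= r" "r <= R" "R < 1"
 shows "cpoisson r x <= 1 / (1 - R)^2"
proof -
 have "(1 - R)^2 <= (1 - r)^2" using r by (intro power_mono) auto
 then have "(1 - R)^2 <= 1 - 2 * r * cos x + r^2"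
  using circle_poisson_denominator_pos(1)[of r x] r by linarith
 moreover have "0 < (1 - R)^2" using r by simp
 ultimately show ?thesis
  unfolding cpoisson_def by (intro frac_le) auto
qed

lemma circle_poisson_minus: "cpoisson r (- x) = cpoisson r x"
 by (simp add: cpoisson_def)

text \<open>Since the Poisson kernels form a semigroup, the kernel of \<open>S S\<^sup>*\<close> for a
 linearised maximal operator \<open>S\<close> is the left-hand side below; the inequality
 bounds it by the kernels of \<open>S\<close> and \<open>S\<^sup>*\<close> themselves.\<close>

lemma circle_poisson_mult_le1:
 assumes r: "0 <= r" "r <= s" "s < 1"
 shows "cpoisson (r * s) x <= 8 * cpoisson r x"
proof -
 have r1: "r < 1" using r by simp
 have rs: "0 <= r * s" "r * s < 1" "r * s <= r" using r mult_less_cancel_left1[of r s]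
  by (auto simp: mult_left_le)
 let ?D = "%rh. cmod (1 - of_real rh * cis x)"
 have D: "(?D rh)^2 = 1 - 2 * rh * cos x + rh^2" for rh by (rule circle_poisson_denominator[symmetric])
 have "1 - r * s <= ?D (r * s)"
  using norm_triangle_ineq2[of 1 "of_real (r * s) * cis x"] rs(1) by (simp add: norm_mult abs_mult)
 moreover have "?D r <= ?D (r * s) + (r - r * s)"
 proof -
  have "?D r <= ?D (r * s) + cmod ((of_real (r * s) - of_real r) * cis x)"
   using norm_triangle_ineq[of "1 - of_real (r * s) * cis x" "(of_real (r * s) - of_real r) * cis x"]
   by (simp add: algebra_simps)
  moreover have "cmod ((of_real (r * s) - of_real r) * cis x) = r - r * s"
   using rs(3) by (simp add: norm_mult flip: of_real_diff of_real_mult)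
  ultimately show ?thesis by simp
 qed
 moreover have "r - r * s <= 1 - r * s" using r by simp
 \<comment> \<open>Squared, this costs a factor 4. The numerators cost another 2, because
   \<open>r <= s\<close> gives \<open>1 - (r * s)^2 <= 1 - r^4 <= 2 * (1 - r^2)\<close>. Together
   they make the 8.\<close>
 ultimately have "?D r <= 2 * ?D (r * s)" by linarith
 then have "(?D r)^2 <= (2 * ?D (r * s))^2" by (intro power_mono) auto
 then have d: "1 - 2 * r * cos x + r^2 <= 4 * (1 - 2 * (r * s) * cos x + (r * s)^2)"
  by (simp only: power_mult_distrib D) simp
 have n: "1 - (r * s)^2 <= 2 * (1 - r^2)"
 proof -
  have "r^2 <= s^2" using r by (intro power_mono) auto
  then have "r^2 * r^2 <= r^2 * s^2" by (intro mult_left_mono) auto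
  moreover have "0 <= (1 - r^2) * (1 - r^2)" by simp
  ultimately show ?thesis by (simp add: power_mult_distrib algebra_simps)
 qed
 have p1: "0 < 1 - 2 * r * cos x + r^2" by (rule circle_poisson_denominator_pos(2)[OF r(1) r1])
 have p2: "0 < 1 - 2 * (r * s) * cos x + (r * s)^2" by (rule circle_poisson_denominator_pos(2)[OF rs(1,2)])
 have p3: "0 <= 1 - (r * s)^2" using rs by (simp add: power_le_one)
 have "cpoisson (r * s) x <= 2 * (1 - r^2) / ((1 - 2 * r * cos x + r^2) / 4)"
  unfolding cpoisson_def using n d p1 p2 p3 by (intro frac_le) auto
 then show ?thesis by (simp add: cpoisson_def)
qed

lemma circle_poisson_mult_le:
 assumes "0 <= r" "r < 1" "0 <= s" "s < 1"
 shows "cpoisson (r * s) x <= 8 * (cpoisson r x + cpoisson s x)"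
proof (cases "r <= s")
 case True
 then show ?thesis using circle_poisson_mult_le1[of r s x] circle_poisson_nonneg[of s x] assms by simp
next
 case False
 then show ?thesis using circle_poisson_mult_le1[of s r x] circle_poisson_nonneg[of r x] assms by (simp add: mult.commute)
qed

lemma has_sum_int_split:
 fixes f :: "int => complex"
 assumes 1: "((%n. f (int n)) has_sum a) UNIV" and 2: "((%n. f (- int (Suc n))) has_sum b) UNIV"
 shows "(f has_sum (a + b)) UNIV"
proof -
 have "(f has_sum a) (range int)" using 1 by (subst has_sum_reindex) (auto simp: o_def)
 moreover have "(f has_sum b) (range (%n. - int (Suc n)))"
  using 2 by (subst has_sum_reindex) (auto simp: o_def inj_on_def)
 moreover have "range int Int range (%n. - int (Suc n)) = {}" by auto
 ultimately have "(f has_sum (a + b)) (range int Un range (%n. - int (Suc n)))" by (rule has_sum_Un_disjoint)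
 moreover have "range int Un range (%n. - int (Suc n)) = UNIV"
 proof (intro equalityI subsetI UNIV_I)
  fix z :: int show "z : range int Un range (%n. - int (Suc n))"
   by (cases z) auto
 qed
 ultimately show ?thesis by simp
qed

lemma geometric_has_sum:
 fixes z :: complex
 assumes "cmod z < 1"
 shows "((%n. z ^ n) has_sum (1 / (1 - z))) UNIV"
 by (rule norm_summable_imp_has_sum[OF _ geometric_sums[OF assms]])
   (use assms in "simp add: norm_power summable_geometric")

text \<open>The frequencies \<open>m >= 0\<close> and \<open>m < 0\<close> form geometric series in
  \<open>r * cis x\<close> and in its conjugate.\<close>

lemma circle_poisson_has_sum:
 assumes r: "0 <= r" "r < 1"
 shows "((%m. of_real (r ^ nat \<bar>m\<bar>) * cis (of_int m * x)) has_sum complex_of_real (cpoisson r x)) UNIV"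
proof -
 define z where "z = of_real r * cis x"
 have z: "cmod z < 1" "cmod (cnj z) < 1" using r by (simp_all add: z_def norm_mult)
 have zz: "z * cnj z = of_real (r^2)" by (simp add: z_def cis_cnj cis_mult power2_eq_square mult_ac)
 have nz: "1 - z ~= 0" "1 - cnj z ~= 0" using z by auto
 have "(%m. of_real (r ^ nat \<bar>int m\<bar>) * cis (of_int (int m) * x)) = (%n. z ^ n)"
  by (auto simp: z_def power_mult_distrib Complex.DeMoivre)
 then have 1: "((%m. of_real (r ^ nat \<bar>int m\<bar>) * cis (of_int (int m) * x)) has_sum (1 / (1 - z))) UNIV"
  using geometric_has_sum[OF z(1)] by simp
 have "of_real (r ^ nat \<bar>- int (Suc m)\<bar>) * cis (of_int (- int (Suc m)) * x) = cnj z * cnj z ^ m" for m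
 proof -
  have "cnj z * cnj z ^ m = cnj (z ^ Suc m)" by simp
  also have "... = of_real (r ^ Suc m) * cis (- (real (Suc m) * x))"
   unfolding z_def power_mult_distrib Complex.DeMoivre by (simp add: cis_cnj)
  also have "... = of_real (r ^ nat \<bar>- int (Suc m)\<bar>) * cis (of_int (- int (Suc m)) * x)"
   by (intro arg_cong2[where f="(*)"] arg_cong[where f = cis] arg_cong[where f = of_real] arg_cong2[where f=power]) (auto simp: algebra_simps)
  finally show ?thesis by simp
 qed
 then have "(%m. of_real (r ^ nat \<bar>- int (Suc m)\<bar>) * cis (of_int (- int (Suc m)) * x)) = (%m. cnj z * cnj z ^ m)" by simp
 then have 2: "((%m. of_real (r ^ nat \<bar>- int (Suc m)\<bar>) * cis (of_int (- int (Suc m)) * x)) has_sum (cnj z * (1 / (1 - cnj z)))) UNIV"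
  using has_sum_cmult_right[OF geometric_has_sum[OF z(2)], of "cnj z"] by simp
 have "((%m. of_real (r ^ nat \<bar>m\<bar>) * cis (of_int m * x)) has_sum (1 / (1 - z) + cnj z * (1 / (1 - cnj z)))) UNIV"
  by (rule has_sum_int_split[OF 1 2])
 also have "1 / (1 - z) + cnj z * (1 / (1 - cnj z)) = (1 - z * cnj z) / ((1 - z) * cnj (1 - z))"
  using nz by (simp add: divide_simps) (simp add: algebra_simps)
 also have "... = complex_of_real (cpoisson r x)"
  unfolding zz unfolding complex_norm_square[symmetric] cpoisson_def circle_poisson_denominator z_def
  by simp
 finally show ?thesis .
qed

lemma power_abs_summable_int:
 assumes r: "0 <= r" "r < (1::real)"
 shows "(%m::int. r ^ nat \<bar>m\<bar>) summable_on UNIV"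
proof -
 have "((%m::int. complex_of_real (r ^ nat \<bar>m\<bar>)) has_sum complex_of_real (cpoisson r 0)) UNIV"
  using circle_poisson_has_sum[OF r, of 0] by simp
 then have "((%m::int. r ^ nat \<bar>m\<bar>) has_sum cpoisson r 0) UNIV"
  by (rule has_sum_of_real_iff[THEN iffD1])
 then show ?thesis by (rule has_sum_imp_summable)
qed

lemma circle_poisson_measurable:
 assumes "f : bmeas M" "g : bmeas M"
 shows "(%x. cpoisson (f x) (g x)) : bmeas M"
 using assms unfolding cpoisson_def by measurable

lemma circle_poisson_cis:
 assumes r: "0 <= r" "r < 1"
 shows "(LINT ps|dA. of_real (cpoisson r (y - ps)) * cis (of_int m * ps))
   = 2 * pi * of_real (r ^ nat \<bar>m\<bar>) * cis (of_int m * y)"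
proof -
 let ?e = "%(k::int) ps. cis (of_int (- k) * ps)"
 let ?a = "%k::int. of_real (r ^ nat \<bar>k\<bar>) * cis (of_int k * y)"
 have sm: "(%k::int. cmod (?a k) * 1) summable_on UNIV"
  using power_abs_summable_int[OF r] r by (simp add: norm_mult norm_power)
 have ser: "(\<Sum>\<^sub>\<infinity>k. ?a k * ?e k ps) = of_real (cpoisson r (y - ps))" for ps
 proof -
  have "?a k * ?e k ps = of_real (r ^ nat \<bar>k\<bar>) * cis (of_int k * (y - ps))" for k
   by (simp add: cis_mult mult.assoc right_diff_distrib)
  then show ?thesis by (simp only: infsumI[OF circle_poisson_has_sum[OF r]])
 qed
 have "((%k. ?a k * (LINT ps|dA. ?e k ps * cis (of_int m * ps))) has_sum
   (LINT ps|dA. (\<Sum>\<^sub>\<infinity>k. ?a k * ?e k ps) * cis (of_int m * ps))) UNIV"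
  by (rule bounded_series_integral[OF finite_angle_measure _ _ _ sm])
    (auto intro!: finite_measure.integrable_const_bound[OF finite_angle_measure, of _ 1] cis_measurable_angle
     simp del: of_int_minus)
 moreover have "((%k. ?a k * (LINT ps|dA. ?e k ps * cis (of_int m * ps))) has_sum
   (2 * pi * of_real (r ^ nat \<bar>m\<bar>) * cis (of_int m * y))) UNIV"
 proof (rule has_sum_finite_neutralI[where B = "{m}"])
  have i: "(LINT ps|dA. ?e k ps * cis (of_int m * ps)) = (if k = m then 2 * of_real pi else 0)" for k
  proof -
   have "?e k ps * cis (of_int m * ps) = cis (of_int (m - k) * ps)" for ps
    by (simp add: cis_mult algebra_simps)
   then have "(LINT ps|dA. ?e k ps * cis (of_int m * ps)) = (if m - k = 0 then 2 * of_real pi else 0)"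
    by (simp only: integral_cis_angle)
   then show ?thesis by auto
  qed
  show "?a k * (LINT ps|dA. ?e k ps * cis (of_int m * ps)) = 0" if "k : UNIV - {m}" for k
   using that by (simp only: i) auto
  show "2 * pi * of_real (r ^ nat \<bar>m\<bar>) * cis (of_int m * y) = (SUM k:{m}. ?a k * (LINT ps|dA. ?e k ps * cis (of_int m * ps)))"
   by (simp only: i) simp
 qed auto
 ultimately show ?thesis by (simp only: ser) (rule has_sum_unique)
qed

text \<open>The first kernel is expanded in exponentials, and integration against the second
  multiplies the frequency \<open>k\<close> by \<open>s ^ nat \<bar>k\<bar>\<close>.\<close>

lemma circle_poisson_semigroup:
 assumes r: "0 <= r" "r < 1" and s: "0 <= s" "s < 1"
 shows "(LINT ps|dA. cpoisson r (x - ps) * cpoisson s (y - ps)) = 2 * pi * cpoisson (r * s) (x - y)"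
proof -
 let ?e = "%(k::int) ps. cis (of_int k * ps)"
 let ?a = "%k::int. of_real (r ^ nat \<bar>k\<bar>) * cis (of_int k * (- x))"
 have sm: "(%k::int. cmod (?a k) * 1) summable_on UNIV"
  using power_abs_summable_int[OF r] r by (simp add: norm_mult norm_power)
 have ser: "(\<Sum>\<^sub>\<infinity>k. ?a k * ?e k ps) = of_real (cpoisson r (x - ps))" for ps
 proof -
  have "?a k * ?e k ps = of_real (r ^ nat \<bar>k\<bar>) * cis (of_int k * (- (x - ps)))" for k
   by (simp add: cis_mult mult.assoc algebra_simps)
  then show ?thesis using infsumI[OF circle_poisson_has_sum[OF r], of "- (x - ps)"]
   by (simp only: circle_poisson_minus)
 qed
 have rs: "0 <= r * s" "r * s < 1" using r s mult_strict_mono[of r 1 s 1] by auto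
 have "((%k. ?a k * (LINT ps|dA. ?e k ps * of_real (cpoisson s (y - ps)))) has_sum
   (LINT ps|dA. (\<Sum>\<^sub>\<infinity>k. ?a k * ?e k ps) * of_real (cpoisson s (y - ps)))) UNIV"
 proof (rule bounded_series_integral[OF finite_angle_measure _ _ _ sm])
  have [measurable]: "(%ps. cpoisson s (y - ps)) : bmeas dA"
   by (intro circle_poisson_measurable borel_measurable_diff borel_measurable_const measurable_angle_measure_id)
  show "integrable dA (%ps. complex_of_real (cpoisson s (y - ps)))"
   by (rule finite_measure.integrable_const_bound[OF finite_angle_measure, of _ "1 / (1 - s)^2"])
     (use circle_poisson_bound[OF s(1) order_refl s(2)] circle_poisson_nonneg[OF s] in
      \<open>auto\<close>)
 qed (auto intro: cis_measurable_angle)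
 moreover have "?a k * (LINT ps|dA. ?e k ps * of_real (cpoisson s (y - ps)))
   = (2 * of_real pi) * (of_real ((r * s) ^ nat \<bar>k\<bar>) * cis (of_int k * (- (x - y))))" for k
 proof -
  have "(LINT ps|dA. ?e k ps * of_real (cpoisson s (y - ps))) = 2 * pi * of_real (s ^ nat \<bar>k\<bar>) * cis (of_int k * y)"
   using circle_poisson_cis[OF s, of y k] by (simp only: mult.commute[of "cis _"])
  then have "?a k * (LINT ps|dA. ?e k ps * of_real (cpoisson s (y - ps)))
   = (2 * of_real pi) * (of_real (r ^ nat \<bar>k\<bar> * s ^ nat \<bar>k\<bar>) * (cis (of_int k * (- x)) * cis (of_int k * y)))"
   by simp
  also have "cis (of_int k * (- x)) * cis (of_int k * y) = cis (of_int k * (- (x - y)))"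
   by (simp add: cis_mult algebra_simps)
  finally show ?thesis by (simp only: power_mult_distrib)
 qed
 ultimately have "((%k. (2 * of_real pi) * (of_real ((r * s) ^ nat \<bar>k\<bar>) * cis (of_int k * (- (x - y))))) has_sum
   (LINT ps|dA. of_real (cpoisson r (x - ps)) * of_real (cpoisson s (y - ps)))) UNIV"
  by (simp only: ser)
 moreover have "((%k. (2 * of_real pi) * (of_real ((r * s) ^ nat \<bar>k\<bar>) * cis (of_int k * (- (x - y))))) has_sum
   ((2 * of_real pi) * of_real (cpoisson (r * s) (- (x - y))))) UNIV"
  by (rule has_sum_cmult_right[OF circle_poisson_has_sum[OF rs]])
 ultimately have "(LINT ps|dA. complex_of_real (cpoisson r (x - ps) * cpoisson s (y - ps)))
   = complex_of_real (2 * pi * cpoisson (r * s) (x - y))"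
  unfolding of_real_mult by (simp only: has_sum_unique circle_poisson_minus of_real_numeral)
 then show ?thesis by (simp only: integral_complex_of_real of_real_eq_iff)
qed

section \<open>Radial limits on the disc\<close>

lemma measurable_angle_borel: "f : M \<rightarrow>\<^sub>M dA ==> f : bmeas M"
 using measurable_compose[OF _ measurable_angle_measure_id] by blast

text \<open>\<open>S\<close> is the adjoint of the operator that averages a function at
  \<open>ph\<close> with the Poisson kernel of radius \<open>rh ph\<close>. When
  \<open>(S ps)^2\<close> is written as a double integral, the integration over \<open>ps\<close> is
  done first: the semigroup law and \<open>circle_poisson_mult_le\<close> bound it by the kernels of
  radii \<open>rh ph\<close> and \<open>rh ph'\<close>. So the integral of \<open>(S ps)^2\<close>
  is at most \<open>32 * pi\<close> times that of \<open>h ps * S ps\<close>. The constant is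
  uniform in \<open>R\<close>, which the passage to all radii below 1 requires.\<close>

lemma poisson_maximal_adjoint_bound:
 fixes rh h :: "real => real"
 assumes rh: "rh : bmeas dA" "!!ph. 0 <= rh ph" "!!ph. rh ph <= R" "R < 1"
  and h: "h : bmeas dA" "!!ph. 0 <= h ph" "!!ph. h ph <= H"
 defines "S \<equiv> %ps. (LINT ph|dA. cpoisson (rh ph) (ph - ps) * h ph)"
 shows "(LINT ps|dA. (S ps)^2) <= (32 * pi)^2 * (LINT ph|dA. (h ph)^2)"
  and "S : bmeas dA" "!!ps. 0 <= S ps" "!!ps. S ps <= 2 * pi * H / (1 - R)^2"
proof -
 interpret A: finite_measure dA by (rule finite_angle_measure)
 interpret P: pair_sigma_finite dA dA ..
 have rh1: "rh ph < 1" for ph using rh(3)[of ph] rh(4) by linarith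
 define k where "k ph ps = cpoisson (rh ph) (ph - ps) * h ph" for ph ps
 have k0: "0 <= k ph ps" for ph ps
  unfolding k_def using circle_poisson_nonneg[OF rh(2) rh1] h(2) by simp
 have kB: "k ph ps <= H / (1 - R)^2" for ph ps
 proof -
  have "k ph ps <= 1 / (1 - R)^2 * H"
   unfolding k_def by (intro mult_mono circle_poisson_bound rh h) auto
  then show ?thesis by simp
 qed
 have km: "(%z. k (f z) (g z)) : bmeas M"
  if "f : M \<rightarrow>\<^sub>M dA" "g : M \<rightarrow>\<^sub>M dA" for f g and M :: "'z measure"
  unfolding k_def
  by (intro borel_measurable_times circle_poisson_measurable borel_measurable_diff measurable_angle_borel
    measurable_compose[OF that(1) rh(1)] measurable_compose[OF that(1) h(1)] that)
 have ki: "integrable dA (%ph. k ph ps)" if "ps : space dA" for ps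
  by (rule A.integrable_const_bound[where B = "H / (1 - R)^2"])
    (use k0 kB that in "auto intro!: AE_I2 km")
 have Sk: "S ps = (LINT ph|dA. k ph ps)" for ps by (simp add: S_def k_def)
 show S0: "0 <= S ps" for ps unfolding Sk using k0 by simp
 show Sm: "S : bmeas dA"
  unfolding Sk[abs_def]
  by (rule A.borel_measurable_lebesgue_integral) (unfold case_prod_beta', rule km[OF measurable_snd measurable_fst])
 have SB: "S ps <= 2 * pi * H / (1 - R)^2" for ps
 proof (cases "integrable dA (%ph. k ph ps)")
  case True
  have "S ps <= (LINT ph|dA. H / (1 - R)^2)" unfolding Sk by (rule integral_mono[OF True]) (use kB in auto)
  then show ?thesis by (simp add: measure_angle_measure)
 next
  case False
  have "0 <= H" using h(2,3)[of 0] by linarith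
  then show ?thesis unfolding Sk using False by (simp add: not_integrable_integral_eq)
 qed
 then show "S ps <= 2 * pi * H / (1 - R)^2" for ps .
 define a where "a ph ps = ennreal (k ph ps)" for ph ps
 have am: "(%z. a (f z) (g z)) : bmeas M"
  if "f : M \<rightarrow>\<^sub>M dA" "g : M \<rightarrow>\<^sub>M dA" for f g and M :: "'z measure"
  unfolding a_def using km[OF that] by simp
 have am': "(%x. a (fst x) (snd x)) : bmeas (dA \<Otimes>\<^sub>M dA)"
  by (intro am measurable_fst measurable_snd)
 have Sa: "ennreal (S ps) = (\<integral>\<^sup>+ph. a ph ps \<partial>dA)" if "ps : space dA" for ps
  unfolding a_def Sk by (rule nn_integral_eq_integral[OF ki[OF that], symmetric]) (simp add: k0)
 have "(\<integral>\<^sup>+ps. ennreal ((S ps)^2) \<partial>dA) = (\<integral>\<^sup>+ps. (\<integral>\<^sup>+ph. (\<integral>\<^sup>+ph'. a ph ps * a ph' ps \<partial>dA) \<partial>dA) \<partial>dA)"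
 proof (rule nn_integral_cong)
  fix ps assume ps: "ps : space dA"
  have m: "(%ph. a ph ps) : bmeas dA" using ps by (intro am) auto
  have "ennreal ((S ps)^2) = ennreal (S ps) * ennreal (S ps)" using S0 by (simp add: power2_eq_square ennreal_mult)
  also have "... = (\<integral>\<^sup>+ph. a ph ps * ennreal (S ps) \<partial>dA)" using Sa[OF ps] m by (simp add: nn_integral_multc)
  also have "... = (\<integral>\<^sup>+ph. (\<integral>\<^sup>+ph'. a ph ps * a ph' ps \<partial>dA) \<partial>dA)"
   using Sa[OF ps] m by (simp add: nn_integral_cmult)
  finally show "ennreal ((S ps)^2) = (\<integral>\<^sup>+ph. (\<integral>\<^sup>+ph'. a ph ps * a ph' ps \<partial>dA) \<partial>dA)" .
 qed
 also have "... = (\<integral>\<^sup>+ph. (\<integral>\<^sup>+ps. (\<integral>\<^sup>+ph'. a ph ps * a ph' ps \<partial>dA) \<partial>dA) \<partial>dA)"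
 proof (rule P.Fubini')
  have "(%z. \<integral>\<^sup>+ph'. a (fst z) (snd z) * a ph' (snd z) \<partial>dA) : bmeas (dA \<Otimes>\<^sub>M dA)"
   by (rule A.borel_measurable_nn_integral)
     (unfold case_prod_beta', intro borel_measurable_times_ennreal am measurable_snd
      measurable_compose[OF measurable_fst measurable_fst] measurable_compose[OF measurable_fst measurable_snd])
  then show "case_prod (%ph ps. \<integral>\<^sup>+ph'. a ph ps * a ph' ps \<partial>dA) : bmeas (dA \<Otimes>\<^sub>M dA)"
   by (simp add: case_prod_beta')
 qed
 also have "... = (\<integral>\<^sup>+ph. (\<integral>\<^sup>+ph'. (\<integral>\<^sup>+ps. a ph ps * a ph' ps \<partial>dA) \<partial>dA) \<partial>dA)"
 proof (rule nn_integral_cong)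
  fix ph assume ph: "ph : space dA"
  show "(\<integral>\<^sup>+ps. (\<integral>\<^sup>+ph'. a ph ps * a ph' ps \<partial>dA) \<partial>dA) = (\<integral>\<^sup>+ph'. (\<integral>\<^sup>+ps. a ph ps * a ph' ps \<partial>dA) \<partial>dA)"
   by (rule P.Fubini') (use ph in "auto simp: case_prod_beta' intro!: borel_measurable_times_ennreal am")
 qed
 \<comment> \<open>The factor \<open>16 * pi\<close> is \<open>2 * pi\<close> from the semigroup law
   times 8. The two summands have equal integrals, which doubles it to
   \<open>32 * pi\<close>.\<close>
 also have "... <= (\<integral>\<^sup>+ph. (\<integral>\<^sup>+ph'. ennreal (16 * pi) * (ennreal (h ph') * a ph ph' + ennreal (h ph) * a ph' ph) \<partial>dA) \<partial>dA)"
 proof (intro nn_integral_mono)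
  fix ph ph' assume ph: "ph : space dA" "ph' : space dA"
  let ?c = "%ps. cpoisson (rh ph) (ph - ps) * cpoisson (rh ph') (ph' - ps)"
  have kk: "k ph ps * k ph' ps = (h ph * h ph') * ?c ps" for ps by (simp add: k_def)
  have kki: "integrable dA (%ps. k ph ps * k ph' ps)"
  proof (rule A.integrable_const_bound[where B = "H / (1 - R)^2 * (H / (1 - R)^2)"])
   show "AE ps in dA. norm (k ph ps * k ph' ps) <= H / (1 - R)^2 * (H / (1 - R)^2)"
   proof (rule AE_I2)
    fix ps
    have "k ph ps * k ph' ps <= H / (1 - R)^2 * (H / (1 - R)^2)"
     by (intro mult_mono kB k0 order_trans[OF k0 kB])
    then show "norm (k ph ps * k ph' ps) <= H / (1 - R)^2 * (H / (1 - R)^2)"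
     using k0 by (simp add: abs_mult)
   qed
  qed (use ph in "auto intro!: borel_measurable_times km")
  have "(\<integral>\<^sup>+ps. a ph ps * a ph' ps \<partial>dA) = (\<integral>\<^sup>+ps. ennreal (k ph ps * k ph' ps) \<partial>dA)"
   by (intro nn_integral_cong) (simp add: a_def ennreal_mult k0)
  also have "... = ennreal (LINT ps|dA. k ph ps * k ph' ps)"
   by (rule nn_integral_eq_integral[OF kki]) (simp add: k0)
  also have "(LINT ps|dA. k ph ps * k ph' ps) = (h ph * h ph') * (2 * pi * cpoisson (rh ph * rh ph') (ph - ph'))"
   unfolding kk integral_mult_right_zero circle_poisson_semigroup[OF rh(2) rh1 rh(2) rh1] ..
  also have "... <= (h ph * h ph') * (2 * pi * (8 * (cpoisson (rh ph) (ph - ph') + cpoisson (rh ph') (ph - ph'))))"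
   using h(2) by (intro mult_left_mono circle_poisson_mult_le rh(2) rh1) auto
  also have "cpoisson (rh ph') (ph - ph') = cpoisson (rh ph') (ph' - ph)"
   using circle_poisson_minus[of "rh ph'" "ph - ph'"] by simp
  also have "(h ph * h ph') * (2 * pi * (8 * (cpoisson (rh ph) (ph - ph') + cpoisson (rh ph') (ph' - ph))))
    = 16 * pi * (h ph' * k ph ph' + h ph * k ph' ph)"
   by (simp add: k_def algebra_simps)
  also have "ennreal ... = ennreal (16 * pi) * (ennreal (h ph') * a ph ph' + ennreal (h ph) * a ph' ph)"
   using k0 h(2) by (simp add: a_def ennreal_mult[symmetric] ennreal_plus[symmetric] del: ennreal_plus)
  finally show "(\<integral>\<^sup>+ps. a ph ps * a ph' ps \<partial>dA) <= ennreal (16 * pi) * (ennreal (h ph') * a ph ph' + ennreal (h ph) * a ph' ph)"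
   by (simp add: ennreal_leI)
 qed
 also have "... = ennreal (32 * pi) * (\<integral>\<^sup>+ps. ennreal (h ps * S ps) \<partial>dA)"
 proof -
  have hm: "(%z. ennreal (h (f z))) : bmeas M" if "f : M \<rightarrow>\<^sub>M dA" for f and M :: "'z measure"
   using measurable_compose[OF that h(1)] by simp
  have m1: "(%x. ennreal (h (snd x)) * a (fst x) (snd x)) : bmeas (dA \<Otimes>\<^sub>M dA)"
   by (intro borel_measurable_times_ennreal am hm measurable_fst measurable_snd)
  have m2: "(%x. ennreal (h (fst x)) * a (snd x) (fst x)) : bmeas (dA \<Otimes>\<^sub>M dA)"
   by (intro borel_measurable_times_ennreal am hm measurable_fst measurable_snd)
  have e: "(\<integral>\<^sup>+ph. ennreal (h ps) * a ph ps \<partial>dA) = ennreal (h ps * S ps)" if "ps : space dA" for ps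
  proof -
   have "(\<integral>\<^sup>+ph. ennreal (h ps) * a ph ps \<partial>dA) = ennreal (h ps) * ennreal (S ps)"
    unfolding Sa[OF that] using that by (intro nn_integral_cmult am) auto
   then show ?thesis using h(2) S0 by (simp add: ennreal_mult)
  qed
  have "(\<integral>\<^sup>+ph. (\<integral>\<^sup>+ph'. ennreal (16 * pi) * (ennreal (h ph') * a ph ph' + ennreal (h ph) * a ph' ph) \<partial>dA) \<partial>dA)
   = (\<integral>\<^sup>+ph. ennreal (16 * pi) * ((\<integral>\<^sup>+ph'. ennreal (h ph') * a ph ph' \<partial>dA) + (\<integral>\<^sup>+ph'. ennreal (h ph) * a ph' ph \<partial>dA)) \<partial>dA)"
  proof (rule nn_integral_cong)
   fix ph assume ph: "ph : space dA"
   have 1: "(%ph'. ennreal (h ph') * a ph ph') : bmeas dA"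
    using ph by (intro borel_measurable_times_ennreal am hm) auto
   have 2: "(%ph'. ennreal (h ph) * a ph' ph) : bmeas dA"
    using ph by (intro borel_measurable_times_ennreal am hm) auto
   show "(\<integral>\<^sup>+ph'. ennreal (16 * pi) * (ennreal (h ph') * a ph ph' + ennreal (h ph) * a ph' ph) \<partial>dA)
     = ennreal (16 * pi) * ((\<integral>\<^sup>+ph'. ennreal (h ph') * a ph ph' \<partial>dA) + (\<integral>\<^sup>+ph'. ennreal (h ph) * a ph' ph \<partial>dA))"
    using nn_integral_cmult[OF borel_measurable_add[OF 1 2], of "ennreal (16 * pi)"] nn_integral_add[OF 1 2] by simp
  qed
  also have "... = ennreal (16 * pi) * ((\<integral>\<^sup>+ph. (\<integral>\<^sup>+ph'. ennreal (h ph') * a ph ph' \<partial>dA) \<partial>dA)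
     + (\<integral>\<^sup>+ph. (\<integral>\<^sup>+ph'. ennreal (h ph) * a ph' ph \<partial>dA) \<partial>dA))"
  proof -
   have 1: "(%ph. \<integral>\<^sup>+ph'. ennreal (h ph') * a ph ph' \<partial>dA) : bmeas dA"
    by (rule A.borel_measurable_nn_integral) (use m1 in "simp add: case_prod_beta'")
   have 2: "(%ph. \<integral>\<^sup>+ph'. ennreal (h ph) * a ph' ph \<partial>dA) : bmeas dA"
    by (rule A.borel_measurable_nn_integral) (use m2 in "simp add: case_prod_beta'")
   show ?thesis
    using nn_integral_cmult[OF borel_measurable_add[OF 1 2], of "ennreal (16 * pi)"] nn_integral_add[OF 1 2] by simp
  qed
  also have "(\<integral>\<^sup>+ph. (\<integral>\<^sup>+ph'. ennreal (h ph') * a ph ph' \<partial>dA) \<partial>dA)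
    = (\<integral>\<^sup>+ph'. (\<integral>\<^sup>+ph. ennreal (h ph') * a ph ph' \<partial>dA) \<partial>dA)"
   by (rule P.Fubini'[symmetric]) (use m1 in "simp add: case_prod_beta'")
  also have "... = (\<integral>\<^sup>+ps. ennreal (h ps * S ps) \<partial>dA)"
   by (rule nn_integral_cong) (rule e)
  also have "ennreal (16 * pi) * ((\<integral>\<^sup>+ps. ennreal (h ps * S ps) \<partial>dA) + (\<integral>\<^sup>+ps. ennreal (h ps * S ps) \<partial>dA))
   = ennreal (16 * pi) * 2 * (\<integral>\<^sup>+ps. ennreal (h ps * S ps) \<partial>dA)"
   by (simp only: mult_2[symmetric] mult.assoc)
  also have "ennreal (16 * pi) * 2 = ennreal (32 * pi)"
   using ennreal_mult[of "16 * pi" 2] by (simp add: mult.commute)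
  finally show ?thesis .
 qed
 finally have N: "(\<integral>\<^sup>+ps. ennreal ((S ps)^2) \<partial>dA) <= ennreal (32 * pi) * (\<integral>\<^sup>+ps. ennreal (h ps * S ps) \<partial>dA)" .
 have H0: "0 <= H" using h(2,3)[of 0] by linarith
 define C where "C = 2 * pi * H / (1 - R)^2"
 have C0: "0 <= C" using H0 by (simp add: C_def)
 have iS: "integrable dA (%ps. (S ps)^2)"
  by (rule A.integrable_const_bound[where B = "C^2"]) (use S0 SB Sm in "auto simp: C_def[symmetric] intro!: power_mono")
 have ih: "integrable dA (%ps. (h ps)^2)"
  by (rule A.integrable_const_bound[where B = "H^2"]) (use h in "auto intro!: power_mono")
 have ihS: "integrable dA (%ps. h ps * S ps)"
  by (rule A.integrable_const_bound[where B = "H * C"]) (use S0 SB Sm h H0 in "auto simp: C_def[symmetric] abs_mult intro!: mult_mono")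
 have "ennreal (LINT ps|dA. (S ps)^2) <= ennreal (32 * pi * (LINT ps|dA. h ps * S ps))"
 proof -
  have e1: "(\<integral>\<^sup>+ps. ennreal ((S ps)^2) \<partial>dA) = ennreal (LINT ps|dA. (S ps)^2)"
   by (rule nn_integral_eq_integral[OF iS]) simp
  have e2: "(\<integral>\<^sup>+ps. ennreal (h ps * S ps) \<partial>dA) = ennreal (LINT ps|dA. h ps * S ps)"
   by (rule nn_integral_eq_integral[OF ihS]) (simp add: h(2) S0)
  have p: "0 <= (LINT ps|dA. h ps * S ps)" using h(2) S0 by simp
  show ?thesis using N unfolding e1 e2 by (subst ennreal_mult) (use p in simp_all)
 qed
 then have "(LINT ps|dA. (S ps)^2) <= 32 * pi * (LINT ps|dA. h ps * S ps)"
  using h(2) S0 by (subst (asm) ennreal_le_iff) (auto intro!: mult_nonneg_nonneg)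
 also have "... = (LINT ps|dA. 32 * pi * (h ps * S ps))" by simp
 \<comment> \<open>The weights are chosen so that half of the integral of \<open>(S ps)^2\<close>
   can be absorbed in the left-hand side, which is finite.\<close>
 also have "... <= (LINT ps|dA. 1/2 * (S ps)^2 + (32 * pi)^2 / 2 * (h ps)^2)"
 proof (rule integral_mono)
  show "32 * pi * (h ps * S ps) <= 1/2 * (S ps)^2 + (32 * pi)^2 / 2 * (h ps)^2" for ps
   using zero_le_power2[of "S ps - 32 * pi * h ps"] by (simp add: power2_eq_square algebra_simps)
 qed (use iS ih ihS in auto)
 also have "... = 1/2 * (LINT ps|dA. (S ps)^2) + (32 * pi)^2 / 2 * (LINT ps|dA. (h ps)^2)"
  using iS ih by simp
 finally show "(LINT ps|dA. (S ps)^2) <= (32 * pi)^2 * (LINT ph|dA. (h ph)^2)" by simp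
qed

text \<open>Radius and angle are separate arguments, because the radius will be chosen as a function
  of the angle.\<close>

definition cseries :: "(nat => complex) => real => real => complex" where
 "cseries b s ph = (\<Sum>\<^sub>\<infinity>m. b m * (of_real s ^ m * cis (of_int (int m) * ph)))"

lemma circle_series_summable:
 assumes b: "!!m. cmod (b m) <= C" and s: "0 <= s" "s < 1"
 shows "(%m. cmod (b m) * s ^ m) summable_on UNIV"
proof -
 have "(%m. C * s ^ m) summable_on UNIV"
  using s by (intro summable_on_cmult_right norm_summable_imp_summable_on) (simp add: summable_geometric norm_power)
 then show ?thesis
  by (rule summable_on_comparison_test) (use b s in "auto intro!: mult_right_mono")
qed

lemma circle_series_has_sum:
 assumes b: "!!m. cmod (b m) <= C" and s: "0 <= s" "s < 1"
 shows "((%m. b m * (of_real s ^ m * cis (of_int (int m) * ph))) has_sum cseries b s ph) UNIV"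
 unfolding cseries_def
 by (rule has_sum_infsum, rule abs_summable_summable,
   rule summable_on_comparison_test[OF circle_series_summable[OF assms]])
   (use s in "auto simp: norm_mult norm_power")

lemma circle_series_sums:
 assumes b: "!!m. cmod (b m) <= C" and s: "0 <= s" "s < 1"
 shows "(%m. b m * (of_real s * cis ph) ^ m) sums cseries b s ph"
 using has_sum_imp_sums[OF circle_series_has_sum[OF assms, where ph=ph]]
 by (simp add: power_mult_distrib Complex.DeMoivre)

lemma circle_series_eq_suminf:
 assumes b: "!!m. cmod (b m) <= C" and s: "0 <= s" "s < 1"
 shows "cseries b s ph = (\<Sum>m. b m * (of_real s * cis ph) ^ m)"
 using circle_series_sums[OF assms] by (simp add: sums_iff)

lemma circle_series_continuous:
 assumes b: "!!m. cmod (b m) <= C" and s: "0 <= s" "s < 1"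
 shows "continuous (at s within {0..<1}) (%s. cseries b s ph)"
proof -
 define K where "K = (1 + s) / 2"
 have K: "0 <= K" "K < 1" "s < K" using s by (auto simp: K_def)
 have "summable (%m. b m * (of_real K * cis ph) ^ m)"
  using circle_series_sums[OF b K(1,2), where ph=ph] by (simp add: sums_iff)
 then have "isCont (%z. \<Sum>m. b m * z ^ m) (of_real s * cis ph)"
  by (rule isCont_powser) (use s K in "simp add: norm_mult")
 then have "((%s. \<Sum>m. b m * (of_real s * cis ph) ^ m) \<longlongrightarrow> (\<Sum>m. b m * (of_real s * cis ph) ^ m)) (at s within {0..<1})"
  by (rule isCont_tendsto_compose) (intro tendsto_intros)
 then have "continuous (at s within {0..<1}) (%s. \<Sum>m. b m * (of_real s * cis ph) ^ m)"
  by (simp only: continuous_within)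
 then show ?thesis
  by (rule continuous_transform_within[OF _ zero_less_one])
    (use s circle_series_eq_suminf[OF b] in auto)
qed

text \<open>The maximal inequality is linearised: the supremum over radii becomes a
 measurable choice \<open>rh\<close> of the radius.\<close>

lemma circle_series_linearised_maximal:
 fixes rh :: "real => real"
 assumes rh: "rh : bmeas dA" "!!ph. 0 <= rh ph" "!!ph. rh ph <= R" "R < 1"
  and b: "summable (%m. (cmod (b m))^2)"
 shows "(%ph. cseries b (rh ph) ph) : bmeas dA"
  and "(LINT ph|dA. (cmod (cseries b (rh ph) ph))^2) <= 512 * pi * (\<Sum>m. (cmod (b m))^2)"
  and "integrable dA (%ph. (cmod (cseries b (rh ph) ph))^2)"
proof -
 interpret A: finite_measure dA by (rule finite_angle_measure)
 interpret P: pair_sigma_finite dA dA ..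
 define Cb where "Cb = sqrt (\<Sum>m. (cmod (b m))^2)"
 have bC: "cmod (b m) <= Cb" for m
  unfolding Cb_def
  by (rule real_le_rsqrt) (use sum_le_suminf[OF b, of "{m}"] in auto)
 have R0: "0 <= R" using rh(2,3)[of 0] by linarith
 define Q where "Q = sqrt R"
 \<comment> \<open>Each radius \<open>rh ph\<close> is to be the product of a fixed
   \<open>R'\<close> and a variable \<open>sg ph\<close>, both bounded away from 1. The series at
   radius \<open>rh ph\<close> is then the Poisson integral of radius \<open>sg ph\<close> of the
   bounded function \<open>g\<close>. The root of \<open>R\<close> serves as \<open>R'\<close>,
   except for \<open>R = 0\<close>, where it cannot be divided by.\<close>
 define R' where "R' = (if R = 0 then 1/2 else Q)"
 have R': "0 < R'" "R' < 1" "R <= R' * R'"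
  using R0 rh(4) by (auto simp: R'_def Q_def)
 define T where "T ph = cseries b (rh ph) ph" for ph
 define g where "g ps = cseries b R' ps" for ps
 define sg where "sg ph = rh ph / R'" for ph
 have sg: "sg : bmeas dA" "0 <= sg ph" "sg ph <= R'" for ph
 proof -
  show "sg : bmeas dA" unfolding sg_def[abs_def] using rh(1) by simp
  show "0 <= sg ph" using rh(2) R' by (simp add: sg_def)
  have "rh ph <= R' * R'" using rh(3)[of ph] R'(3) by linarith
  then show "sg ph <= R'" using R' by (simp add: sg_def divide_le_eq)
 qed
 have sg1: "sg ph < 1" for ph using sg(3)[of ph] R'(2) by linarith
 have rh1: "rh ph < 1" for ph using rh(3)[of ph] rh(4) by linarith
 have smR: "(%m. cmod (b m) * R ^ m) summable_on UNIV" by (rule circle_series_summable[OF bC R0 rh(4)])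
 have smR': "(%m. cmod (b m) * R' ^ m) summable_on UNIV" by (rule circle_series_summable[OF bC less_imp_le[OF R'(1)] R'(2)])
 have em: "(%ph. of_real (f ph) ^ m * cis (of_int (int m) * ph)) : bmeas dA"
  if "f : bmeas dA" for f and m :: nat
  using that cis_measurable_angle[of "of_int (int m)"] by measurable
 have eB: "cmod (of_real (rh ph) ^ m * cis (of_int (int m) * ph)) <= R ^ m" for m ph
  using rh(2,3)[of ph] by (simp add: norm_mult norm_power power_mono)
 have eB': "cmod (of_real R' ^ m * cis (of_int (int m) * ph)) <= R' ^ m" for m ph
  using R' by (simp add: norm_mult norm_power)
 show Tm: "(%ph. cseries b (rh ph) ph) : bmeas dA"
  unfolding cseries_def
  by (rule bounded_series_measurable[OF finite_angle_measure _ _ _ smR]) (use em[OF rh(1)] eB R0 in auto)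
 define CT where "CT = (\<Sum>\<^sub>\<infinity>m. cmod (b m) * R ^ m)"
 have TB: "cmod (T ph) <= CT" if "ph : space dA" for ph
  unfolding T_def cseries_def CT_def
  by (rule bounded_series_bound[OF finite_angle_measure _ _ _ smR that]) (use em[OF rh(1)] eB R0 in auto)
 have gm: "g : bmeas dA"
  unfolding g_def[abs_def] cseries_def
  by (rule bounded_series_measurable[OF finite_angle_measure _ _ _ smR']) (use em[of "%_. R'"] eB' R' in auto)
 define Cg where "Cg = (\<Sum>\<^sub>\<infinity>m. cmod (b m) * R' ^ m)"
 have gB: "cmod (g ph) <= Cg" if "ph : space dA" for ph
  unfolding g_def cseries_def Cg_def
  by (rule bounded_series_bound[OF finite_angle_measure _ _ _ smR' that]) (use em[of "%_. R'"] eB' R' in auto)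
 have ig: "integrable dA (%ps. (cmod (g ps))^2)"
  by (rule A.integrable_const_bound[where B = "Cg^2"]) (use gm gB in "auto intro!: AE_I2 power_mono")
 have iT: "integrable dA (%ps. (cmod (T ps))^2)"
  by (rule A.integrable_const_bound[where B = "CT^2"]) (use Tm TB in "auto simp: T_def intro!: AE_I2 power_mono")
 then show "integrable dA (%ph. (cmod (cseries b (rh ph) ph))^2)" by (simp add: T_def)
 have g2: "(LINT ps|dA. (cmod (g ps))^2) <= 2 * pi * (\<Sum>m. (cmod (b m))^2)"
 proof -
  have sm: "(%m. cmod (b m * of_real R' ^ m)) summable_on UNIV" using smR' R' by (simp add: norm_mult norm_power)
  have "((%m. 2 * pi * (cmod (b m * of_real R' ^ m))^2) has_sum (LINT ps|dA. (cmod (\<Sum>\<^sub>\<infinity>m. b m * of_real R' ^ m * cis (of_int (int m) * ps)))^2)) UNIV"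
   by (rule circle_parseval[OF sm]) auto
  from has_sum_imp_sums[OF this]
  have 1: "(%m. 2 * pi * (cmod (b m * of_real R' ^ m))^2) sums (LINT ps|dA. (cmod (g ps))^2)"
   by (simp add: g_def cseries_def mult.assoc)
  have 2: "(%m. 2 * pi * (cmod (b m))^2) sums (2 * pi * (\<Sum>m. (cmod (b m))^2))"
   by (intro sums_mult summable_sums b)
  show ?thesis
  proof (rule sums_le[OF _ 1 2])
   fix m
   have "cmod (b m * of_real R' ^ m) <= cmod (b m) * 1"
    unfolding norm_mult using R' by (intro mult_left_mono) (auto simp: norm_power power_le_one)
   then show "2 * pi * (cmod (b m * of_real R' ^ m))^2 <= 2 * pi * (cmod (b m))^2"
    by (intro mult_left_mono power_mono) auto
  qed
 qed
 have rep: "T ph = 1 / (2 * pi) * (LINT ps|dA. g ps * of_real (cpoisson (sg ph) (ph - ps)))" for ph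
 proof -
  have "((%m. b m * (LINT ps|dA. (of_real R' ^ m * cis (of_int (int m) * ps)) * of_real (cpoisson (sg ph) (ph - ps)))) has_sum
    (LINT ps|dA. (\<Sum>\<^sub>\<infinity>m. b m * (of_real R' ^ m * cis (of_int (int m) * ps))) * of_real (cpoisson (sg ph) (ph - ps)))) UNIV"
  proof (rule bounded_series_integral[OF finite_angle_measure _ _ _ smR'])
   have [measurable]: "(%ps. cpoisson (sg ph) (ph - ps)) : bmeas dA"
    by (intro circle_poisson_measurable borel_measurable_diff borel_measurable_const measurable_angle_measure_id)
   show "integrable dA (%ps. complex_of_real (cpoisson (sg ph) (ph - ps)))"
    by (rule A.integrable_const_bound[where B = "1 / (1 - R')^2"])
      (use circle_poisson_bound[OF sg(2,3) R'(2)] circle_poisson_nonneg[OF sg(2) sg1] in auto)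
  qed (use em[of "%_. R'"] eB' R' in auto)
  moreover have "b m * (LINT ps|dA. (of_real R' ^ m * cis (of_int (int m) * ps)) * of_real (cpoisson (sg ph) (ph - ps)))
    = 2 * pi * (b m * (of_real (rh ph) ^ m * cis (of_int (int m) * ph)))" for m
  proof -
   have "(LINT ps|dA. (of_real R' ^ m * cis (of_int (int m) * ps)) * of_real (cpoisson (sg ph) (ph - ps)))
    = of_real R' ^ m * (LINT ps|dA. of_real (cpoisson (sg ph) (ph - ps)) * cis (of_int (int m) * ps))"
    by (simp only: integral_mult_right_zero[symmetric] mult_ac)
   also have "... = of_real R' ^ m * (2 * pi * of_real (sg ph ^ m) * cis (of_int (int m) * ph))"
    by (subst circle_poisson_cis[OF sg(2) sg1]) simp
   also have "... = 2 * pi * (of_real (R' ^ m * sg ph ^ m) * cis (of_int (int m) * ph))" by simp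
   also have "R' ^ m * sg ph ^ m = rh ph ^ m" using R' by (simp add: sg_def power_mult_distrib[symmetric])
   finally show ?thesis by simp
  qed
  ultimately have "((%m. 2 * pi * (b m * (of_real (rh ph) ^ m * cis (of_int (int m) * ph)))) has_sum
    (LINT ps|dA. g ps * of_real (cpoisson (sg ph) (ph - ps)))) UNIV"
   by (simp only: g_def cseries_def)
  moreover have "((%m. 2 * pi * (b m * (of_real (rh ph) ^ m * cis (of_int (int m) * ph)))) has_sum (2 * pi * T ph)) UNIV"
   unfolding T_def by (intro has_sum_cmult_right circle_series_has_sum[OF bC rh(2) rh1])
  ultimately have "(LINT ps|dA. g ps * of_real (cpoisson (sg ph) (ph - ps))) = 2 * pi * T ph"
   by (rule has_sum_unique)
  then show ?thesis by simp
 qed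
 \<comment> \<open>Set to 0 off the interval, since the adjoint bound requires its estimates at
   every real number.\<close>
 define h where "h ph = (if ph : space dA then cmod (T ph) else 0)" for ph
 have CT0: "0 <= CT" using TB[of 0] norm_ge_zero[of "T 0"] by (auto intro: order_trans simp del: norm_ge_zero)
 have hm: "h : bmeas dA"
  unfolding h_def[abs_def] using Tm by (subst measurable_cong[where g = "%ph. cmod (T ph)"]) (auto simp: T_def)
 have h0: "0 <= h ph" and hB: "h ph <= CT" for ph using TB[of ph] CT0 by (auto simp: h_def)
 define S where "S ps = (LINT ph|dA. cpoisson (sg ph) (ph - ps) * h ph)" for ps
 note adj = poisson_maximal_adjoint_bound[OF sg(1,2,3) R'(2) hm h0 hB, folded S_def]
 have adjm: "S : bmeas dA" using adj(2) by (simp add: S_def[abs_def])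
 define X where "X = (LINT ph|dA. (cmod (T ph))^2)"
 define G2 where "G2 = (LINT ps|dA. (cmod (g ps))^2)"
 have hX: "(LINT ph|dA. (h ph)^2) = X"
  unfolding X_def by (rule lint_cong) (auto simp: h_def)
 \<comment> \<open>The integrand of the pairing of \<open>h\<close> with the Poisson integrals of
   \<open>cmod (g ps)\<close>. Exchanging the order of integration brings in
   \<open>S\<close>.\<close>
 define W where "W ph ps = h ph * (cpoisson (sg ph) (ph - ps) * cmod (g ps))" for ph ps
 have Wi: "integrable (dA \<Otimes>\<^sub>M dA) (%z. W (fst z) (snd z))"
 proof (rule finite_measure.integrable_const_bound[where B = "CT * (1 / (1 - R')^2 * Cg)"])
  show "finite_measure (dA \<Otimes>\<^sub>M dA)"
   by (rule finite_measureI)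
     (simp add: space_pair_measure A.emeasure_pair_measure_Times emeasure_angle_measure sets.top[of dA, simplified] ennreal_mult_eq_top_iff)
  show "AE z in dA \<Otimes>\<^sub>M dA. norm (W (fst z) (snd z)) <= CT * (1 / (1 - R')^2 * Cg)"
  proof (rule AE_I2)
   fix z assume "z : space (dA \<Otimes>\<^sub>M dA)"
   then have z: "snd z : space dA" by (auto simp: space_pair_measure)
   have "W (fst z) (snd z) <= CT * (1 / (1 - R')^2 * Cg)"
    unfolding W_def
    by (intro mult_mono hB gB[OF z] circle_poisson_bound sg R' mult_nonneg_nonneg circle_poisson_nonneg sg1 CT0) (auto intro: order_trans[OF norm_ge_zero gB[OF z]])
   moreover have "0 <= W (fst z) (snd z)"
    unfolding W_def by (intro mult_nonneg_nonneg h0 circle_poisson_nonneg sg sg1 norm_ge_zero)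
   ultimately show "norm (W (fst z) (snd z)) <= CT * (1 / (1 - R')^2 * Cg)" by simp
  qed
  show "(%z. W (fst z) (snd z)) : bmeas (dA \<Otimes>\<^sub>M dA)"
  proof -
   let ?M = "dA \<Otimes>\<^sub>M dA"
   have m1: "(%z. sg (fst z)) : bmeas ?M" by (rule measurable_compose[OF measurable_fst sg(1)])
   have m2: "(%z. h (fst z)) : bmeas ?M" by (rule measurable_compose[OF measurable_fst hm])
   have m3: "(%z. cmod (g (snd z))) : bmeas ?M"
    by (rule measurable_compose[OF measurable_compose[OF measurable_snd gm] borel_measurable_norm])
   have m4: "fst : bmeas ?M" "snd : bmeas ?M"
    by (rule measurable_angle_borel[OF measurable_fst], rule measurable_angle_borel[OF measurable_snd])
   note m = m1 m2 m3 m4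
   show ?thesis
    unfolding W_def by (intro borel_measurable_times circle_poisson_measurable borel_measurable_diff m)
  qed
 qed
 have ihh: "integrable dA (%ph. LINT ps|dA. W ph ps)"
  using P.integrable_fst'[OF Wi] by simp
 have iS: "integrable dA (%ps. (S ps)^2)"
  by (rule A.integrable_const_bound[where B = "(2 * pi * CT / (1 - R')^2)^2"])
    (use adjm adj(3,4) in "auto simp: S_def[symmetric] intro!: AE_I2 power_mono")
 have "X <= (LINT ph|dA. 1 / (2 * pi) * (LINT ps|dA. W ph ps))"
  unfolding hX[symmetric]
 proof (rule integral_mono)
  show "integrable dA (%ph. (h ph)^2)"
   by (rule A.integrable_const_bound[where B = "CT^2"]) (use hm h0 hB in "auto intro!: AE_I2 power_mono")
  show "integrable dA (%ph. 1 / (2 * pi) * (LINT ps|dA. W ph ps))"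
   using ihh by (rule integrable_mult_right)
  fix ph assume ph: "ph : space dA"
  have "cmod (T ph) <= 1 / (2 * pi) * (LINT ps|dA. cpoisson (sg ph) (ph - ps) * cmod (g ps))"
  proof -
   have "cmod (LINT ps|dA. g ps * of_real (cpoisson (sg ph) (ph - ps)))
    <= (LINT ps|dA. cmod (g ps * of_real (cpoisson (sg ph) (ph - ps))))" by (rule integral_norm_bound)
   also have "... = (LINT ps|dA. cpoisson (sg ph) (ph - ps) * cmod (g ps))"
    using circle_poisson_nonneg[OF sg(2) sg1] by (simp add: norm_mult mult.commute)
   finally show ?thesis by (simp add: rep[of ph] norm_mult norm_divide divide_right_mono)
  qed
  then have "h ph * h ph <= h ph * (1 / (2 * pi) * (LINT ps|dA. cpoisson (sg ph) (ph - ps) * cmod (g ps)))"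
   using ph h0[of ph] by (intro mult_left_mono) (simp_all add: h_def)
  then show "(h ph)^2 <= 1 / (2 * pi) * (LINT ps|dA. W ph ps)"
   by (simp add: W_def power2_eq_square)
 qed
 also have "... = 1 / (2 * pi) * (LINT ph|dA. LINT ps|dA. W ph ps)" by simp
 also have "(LINT ph|dA. LINT ps|dA. W ph ps) = (LINT ps|dA. LINT ph|dA. W ph ps)"
  using P.Fubini_integral[of W] Wi by (simp add: case_prod_beta')
 also have "... = (LINT ps|dA. cmod (g ps) * S ps)"
 proof (rule lint_cong[OF refl])
  fix ps
  have "(LINT ph|dA. W ph ps) = (LINT ph|dA. cmod (g ps) * (cpoisson (sg ph) (ph - ps) * h ph))"
   by (simp only: W_def mult_ac)
  then show "(LINT ph|dA. W ph ps) = cmod (g ps) * S ps"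
   by (simp only: S_def integral_mult_right_zero)
 qed
 also have "1 / (2 * pi) * ... = (LINT ps|dA. 1 / (2 * pi) * (cmod (g ps) * S ps))" by simp
 \<comment> \<open>The adjoint bound turns the first summand into \<open>X / 2\<close>, which is
   absorbed. What remains is \<open>X <= 256 * G2\<close>, and the \<open>2 * pi\<close> from
   Parseval's identity makes it \<open>512 * pi\<close>.\<close>
 also have "... <= (LINT ps|dA. 1 / (2 * (32 * pi)^2) * (S ps)^2 + 128 * (cmod (g ps))^2)"
 proof (rule integral_mono)
  show "integrable dA (%ps. 1 / (2 * pi) * (cmod (g ps) * S ps))"
  proof (intro integrable_mult_right A.integrable_const_bound[where B = "Cg * (2 * pi * CT / (1 - R')^2)"])
   show "AE ps in dA. norm (cmod (g ps) * S ps) <= Cg * (2 * pi * CT / (1 - R')^2)"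
   proof (rule AE_I2)
    fix ps assume ps: "ps : space dA"
    have "cmod (g ps) * S ps <= Cg * (2 * pi * CT / (1 - R')^2)"
     using gB[OF ps] adj(3,4)[of ps] by (intro mult_mono) (auto simp: S_def[symmetric] intro: order_trans[OF norm_ge_zero])
    then show "norm (cmod (g ps) * S ps) <= Cg * (2 * pi * CT / (1 - R')^2)"
     using adj(3)[of ps] by (simp add: S_def[symmetric] abs_mult)
   qed
  qed (use gm adjm in auto)
  show "integrable dA (%ps. 1 / (2 * (32 * pi)^2) * (S ps)^2 + 128 * (cmod (g ps))^2)"
   using iS ig by auto
  show "1 / (2 * pi) * (cmod (g ps) * S ps) <= 1 / (2 * (32 * pi)^2) * (S ps)^2 + 128 * (cmod (g ps))^2" for ps
  proof -
   define p where "p = S ps / (32 * pi)"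
   have Sp: "S ps = 32 * pi * p" by (simp add: p_def)
   have "1 / (2 * pi) * (cmod (g ps) * S ps) = 16 * (cmod (g ps) * p)" by (simp add: Sp)
   also have "... <= p^2 / 2 + 128 * (cmod (g ps))^2"
    using zero_le_power2[of "p - 16 * cmod (g ps)"] by (simp add: power2_eq_square algebra_simps)
   also have "p^2 / 2 = 1 / (2 * (32 * pi)^2) * (S ps)^2" by (simp add: Sp power_mult_distrib)
   finally show ?thesis .
  qed
 qed
 also have "... = 1 / (2 * (32 * pi)^2) * (LINT ps|dA. (S ps)^2) + 128 * G2"
  using iS ig by (simp add: G2_def)
 also have "... <= 1 / (2 * (32 * pi)^2) * ((32 * pi)^2 * X) + 128 * G2"
  using adj(1) unfolding hX by (intro add_right_mono mult_left_mono) (auto simp: S_def)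
 also have "... = X / 2 + 128 * G2" by simp
 finally have "X <= 256 * G2" by simp
 also have "... <= 256 * (2 * pi * (\<Sum>m. (cmod (b m))^2))" using g2 by (simp add: G2_def)
 finally show "(LINT ph|dA. (cmod (cseries b (rh ph) ph))^2) <= 512 * pi * (\<Sum>m. (cmod (b m))^2)"
  by (simp add: X_def T_def)
qed

section \<open>Almost everywhere convergence from the maximal inequality\<close>

lemma convergent_at_left_if_Cauchy:
 fixes f :: "real => complex"
 assumes c: "!!e. e > 0 ==> \<exists>d<1. ALL s t. d < s --> s < 1 --> d < t --> t < 1 --> cmod (f s - f t) <= e"
 shows "EX L. (f \<longlongrightarrow> L) (at_left 1)"
proof -
 define x where "x n = 1 - inverse (real (Suc n))" for n
 have x1: "x n < 1" for n by (simp add: x_def)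
 have xl: "x \<longlonglongrightarrow> 1" unfolding x_def[abs_def] using tendsto_diff[OF tendsto_const LIMSEQ_inverse_real_of_nat, of 1] by simp
 have ev: "eventually (%n. d < x n) sequentially" if "d < 1" for d
  by (rule order_tendstoD(1)[OF xl that])
 have "Cauchy (%n. f (x n))"
 proof (rule metric_CauchyI)
  fix e :: real assume e: "e > 0"
  then obtain d where d: "d < 1" "ALL s t. d < s --> s < 1 --> d < t --> t < 1 --> cmod (f s - f t) <= e / 2"
   using c[of "e / 2"] by auto
  obtain N where N: "!!n. n >= N ==> d < x n" using ev[OF d(1)] unfolding eventually_sequentially by auto
  show "EX M. \<forall>m\<ge>M. \<forall>n\<ge>M. dist (f (x m)) (f (x n)) < e"
  proof (intro exI allI impI)
   fix m n assume "N <= m" "N <= n"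
   then have "cmod (f (x m) - f (x n)) <= e / 2" using d(2) N x1 by blast
   then show "dist (f (x m)) (f (x n)) < e" using e by (simp add: dist_norm)
  qed
 qed
 then obtain L where L: "(%n. f (x n)) \<longlonglongrightarrow> L" using Cauchy_convergent_iff convergent_def by blast
 have "(f \<longlongrightarrow> L) (at_left 1)"
 proof (rule tendstoI)
  fix e :: real assume e: "e > 0"
  then obtain d where d: "d < 1" "ALL s t. d < s --> s < 1 --> d < t --> t < 1 --> cmod (f s - f t) <= e / 2"
   using c[of "e / 2"] by auto
  have "dist (f s) L < e" if s: "d < s" "s < 1" for s
  proof -
   have "(%n. cmod (f s - f (x n))) \<longlonglongrightarrow> cmod (f s - L)" by (intro tendsto_intros L)
   moreover have "eventually (%n. cmod (f s - f (x n)) <= e / 2) sequentially"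
    using ev[OF d(1)] by eventually_elim (use d(2) s x1 in blast)
   ultimately have "cmod (f s - L) <= e / 2" by (rule tendsto_upperbound) simp
   then show ?thesis using e by (simp add: dist_norm)
  qed
  then show "eventually (%s. dist (f s) L < e) (at_left 1)"
   unfolding eventually_at_left_field using d(1) by blast
 qed
 then show ?thesis ..
qed

text \<open>A countable dense set of radii keeps suprema over radii measurable. Continuity in the
  radius extends the conclusions to all radii.\<close>

lemma rational_radii:
 obtains r :: "nat => real" where "range r = {q : \<rat>. 0 <= q & q < 1}"
proof -
 let ?Q = "{q : \<rat>. 0 <= q & q < (1::real)}"
 have "countable ?Q" by (rule countable_subset[OF _ countable_rat]) auto
 moreover have "?Q ~= {}" by (auto intro!: exI[of _ 0])
 ultimately show ?thesis using range_from_nat_into[of ?Q] that by blast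
qed

text \<open>At each angle \<open>rh K\<close> picks, among the radii of index at most
  \<open>K\<close>, one at which the series is largest. The linearised bound applies for each
  \<open>K\<close>, and monotone convergence carries it to the supremum.\<close>

lemma circle_series_maximal:
 fixes r :: "nat => real"
 assumes r: "!!i. 0 <= r i" "!!i. r i < 1" and b: "summable (%m. (cmod (b m))^2)"
 obtains F where "F : bmeas dA"
  "!!i ph. ennreal ((cmod (cseries b (r i) ph))^2) <= F ph"
  "(\<integral>\<^sup>+ph. F ph \<partial>dA) <= ennreal (512 * pi * (\<Sum>m. (cmod (b m))^2))"
proof -
 define rh where "rh = rec_nat (%ph. r 0) (%K p ph. if cmod (cseries b (r (Suc K)) ph) > cmod (cseries b (p ph) ph) then r (Suc K) else p ph)"
 have rh0: "rh 0 ph = r 0" for ph by (simp add: rh_def)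
 have rhS: "rh (Suc K) ph = (if cmod (cseries b (r (Suc K)) ph) > cmod (cseries b (rh K ph) ph) then r (Suc K) else rh K ph)" for K ph
  by (simp add: rh_def)
 define R where "R K = Max (r ` {..K})" for K
 have R1: "R K < 1" for K unfolding R_def using r(2) by (subst Max_less_iff) auto
 have rR: "r i <= R K" if "i <= K" for i K unfolding R_def using that by (intro Max_ge) auto
 have RS: "R K <= R (Suc K)" for K unfolding R_def by (intro Max_mono) auto
 have rhb: "0 <= rh K ph" "rh K ph <= R K" for K ph
 proof -
  show "0 <= rh K ph" by (induction K) (auto simp: rh0 rhS r(1))
  show "rh K ph <= R K"
  proof (induction K)
   case 0 then show ?case using rR[of 0 0] by (simp add: rh0)
  next
   case (Suc K) then show ?case using rR[of "Suc K" "Suc K"] RS[of K] by (simp add: rhS)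
  qed
 qed
 have const: "(%ph. cseries b s ph) : bmeas dA" if "0 <= s" "s < 1" for s
  by (rule circle_series_linearised_maximal(1)[where R = s]) (use that b in auto)
 have rhm: "rh K : bmeas dA" for K
 proof (induction K)
  case 0 then show ?case unfolding rh0[abs_def] by simp
 next
  case (Suc K)
  have [measurable]: "(%ph. cseries b (rh K ph) ph) : bmeas dA"
   by (rule circle_series_linearised_maximal(1)[OF Suc rhb R1 b])
  have [measurable]: "(%ph. cseries b (r (Suc K)) ph) : bmeas dA" by (rule const[OF r])
  note Suc[measurable]
  show ?case unfolding rhS[abs_def] by measurable
 qed
 define G where "G K ph = ennreal ((cmod (cseries b (rh K ph) ph))^2)" for K ph
 have Gm: "G K : bmeas dA" for K
  unfolding G_def[abs_def] using circle_series_linearised_maximal(1)[OF rhm rhb R1 b, of K] by simp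
 have inc: "cmod (cseries b (rh K ph) ph) <= cmod (cseries b (rh (Suc K) ph) ph)" for K ph
  by (simp add: rhS)
 have Ginc: "G K ph <= G (Suc K) ph" for K ph
  unfolding G_def by (intro ennreal_leI power_mono inc) auto
 have rle: "cmod (cseries b (r i) ph) <= cmod (cseries b (rh i ph) ph)" for i ph
  by (cases i) (simp_all add: rh0 rhS)
 show ?thesis
 proof (rule that[of "%ph. SUP K. G K ph"])
  show "(%ph. SUP K. G K ph) : bmeas dA" using Gm by (intro borel_measurable_SUP) auto
  show "ennreal ((cmod (cseries b (r i) ph))^2) <= (SUP K. G K ph)" for i ph
   by (rule SUP_upper2[of i]) (auto simp: G_def intro!: ennreal_leI power_mono rle)
  have "(\<integral>\<^sup>+ph. (SUP K. G K ph) \<partial>dA) = (SUP K. \<integral>\<^sup>+ph. G K ph \<partial>dA)"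
   by (rule nn_integral_monotone_convergence_SUP) (auto intro!: incseq_SucI le_funI Ginc Gm)
  also have "... <= ennreal (512 * pi * (\<Sum>m. (cmod (b m))^2))"
  proof (rule SUP_least)
   fix K
   have "(\<integral>\<^sup>+ph. G K ph \<partial>dA) = ennreal (LINT ph|dA. (cmod (cseries b (rh K ph) ph))^2)"
    unfolding G_def by (rule nn_integral_eq_integral[OF circle_series_linearised_maximal(3)[OF rhm rhb R1 b]]) simp
   also have "... <= ennreal (512 * pi * (\<Sum>m. (cmod (b m))^2))"
    by (rule ennreal_leI[OF circle_series_linearised_maximal(2)[OF rhm rhb R1 b]])
   finally show "(\<integral>\<^sup>+ph. G K ph \<partial>dA) <= ennreal (512 * pi * (\<Sum>m. (cmod (b m))^2))" .
  qed
  finally show "(\<integral>\<^sup>+ph. (SUP K. G K ph) \<partial>dA) <= ennreal (512 * pi * (\<Sum>m. (cmod (b m))^2))" .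
 qed
qed

lemma square_summable_bounded:
 assumes b: "summable (%m. (cmod (b m))^2)"
 shows "cmod (b m) <= sqrt (\<Sum>m. (cmod (b m))^2)"
 by (rule real_le_rsqrt) (use sum_le_suminf[OF b, of "{m}"] in auto)

text \<open>The maximal inequality is applied to the tails of the series. The bounds for them tend
  to 0, so at almost every angle some tail is small for all radii at once, while the remaining
  polynomial is continuous up to radius 1.\<close>

theorem circle_series_radial_limit:
 assumes b: "summable (%m. (cmod (b m))^2)"
 shows "AE ph in dA. EX L. ((%s. cseries b s ph) \<longlongrightarrow> L) (at_left 1)"
proof -
 obtain r :: "nat => real" where rr: "range r = {q : \<rat>. 0 <= q & q < 1}" by (rule rational_radii)
 have r: "0 <= r i" "r i < 1" for i using rr by auto
 define t where "t N m = (if N <= m then b m else 0)" for N m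
 have tsum: "(%m. (cmod (t N m))^2) sums (\<Sum>m. (cmod (b (m + N)))^2)" for N
 proof -
  have "(%m. (cmod (t N (m + N)))^2) sums (\<Sum>m. (cmod (b (m + N)))^2)"
   unfolding t_def using summable_ignore_initial_segment[OF b, of N] by (simp add: summable_sums)
  then show ?thesis by (subst (asm) sums_iff_shift) (simp add: t_def)
 qed
 have ts: "summable (%m. (cmod (t N m))^2)" for N using tsum by (rule sums_summable)
 have "ALL N. EX F. F : bmeas dA &
  (ALL i ph. ennreal ((cmod (cseries (t N) (r i) ph))^2) <= F ph) &
  (\<integral>\<^sup>+ph. F ph \<partial>dA) <= ennreal (512 * pi * (\<Sum>m. (cmod (b (m + N)))^2))"
 proof
  fix N
  obtain F where "F : bmeas dA"
   "!!i ph. ennreal ((cmod (cseries (t N) (r i) ph))^2) <= F ph"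
   "(\<integral>\<^sup>+ph. F ph \<partial>dA) <= ennreal (512 * pi * (\<Sum>m. (cmod (t N m))^2))"
   by (rule circle_series_maximal[OF r ts]) (rule that; assumption)
  moreover have "(\<Sum>m. (cmod (t N m))^2) = (\<Sum>m. (cmod (b (m + N)))^2)" using tsum[of N] by (simp add: sums_iff)
  ultimately show "EX F. F : bmeas dA &
   (ALL i ph. ennreal ((cmod (cseries (t N) (r i) ph))^2) <= F ph) &
   (\<integral>\<^sup>+ph. F ph \<partial>dA) <= ennreal (512 * pi * (\<Sum>m. (cmod (b (m + N)))^2))" by (intro exI[of _ F]) simp
 qed
 from choice[OF this] obtain F where "ALL N. F N : bmeas dA &
   (ALL i ph. ennreal ((cmod (cseries (t N) (r i) ph))^2) <= F N ph) &
   (\<integral>\<^sup>+ph. F N ph \<partial>dA) <= ennreal (512 * pi * (\<Sum>m. (cmod (b (m + N)))^2))" ..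
 then have F: "F N : bmeas dA"
   "ennreal ((cmod (cseries (t N) (r i) ph))^2) <= F N ph"
   "(\<integral>\<^sup>+ph. F N ph \<partial>dA) <= ennreal (512 * pi * (\<Sum>m. (cmod (b (m + N)))^2))" for N i ph
  by simp_all
 have Im: "(%ph. INF N. F N ph) : bmeas dA" using F(1) by (intro borel_measurable_INF) auto
 have le: "(\<integral>\<^sup>+ph. (INF N. F N ph) \<partial>dA) <= ennreal e" if e: "e > 0" for e
 proof -
  obtain N where N: "norm (\<Sum>i. (cmod (b (i + N)))^2) < e / (512 * pi)"
   using suminf_exist_split[OF _ b, of "e / (512 * pi)"] e by force
  have "(\<integral>\<^sup>+ph. (INF N. F N ph) \<partial>dA) <= (\<integral>\<^sup>+ph. F N ph \<partial>dA)"
   by (intro nn_integral_mono INF_lower) simp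
  also have "... <= ennreal (512 * pi * (\<Sum>m. (cmod (b (m + N)))^2))" by (rule F(3))
  also have "... <= ennreal e"
  proof (rule ennreal_leI)
   have "(\<Sum>m. (cmod (b (m + N)))^2) <= e / (512 * pi)" using N by simp
   then show "512 * pi * (\<Sum>m. (cmod (b (m + N)))^2) <= e" by (simp add: field_simps)
  qed
  finally show ?thesis .
 qed
 have "(\<integral>\<^sup>+ph. (INF N. F N ph) \<partial>dA) <= 0"
 proof (rule ennreal_le_epsilon)
  fix e :: real assume "0 < e"
  from le[OF this] show "(\<integral>\<^sup>+ph. (INF N. F N ph) \<partial>dA) <= 0 + ennreal e" by simp
 qed
 then have "AE ph in dA. (INF N. F N ph) = 0"
  using nn_integral_0_iff_AE[OF Im] by simp
 then show ?thesis
 proof eventually_elim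
  fix ph assume inf: "(INF N. F N ph) = 0"
  have tb: "cmod (t N m) <= sqrt (\<Sum>m. (cmod (t N m))^2)" for N m by (rule square_summable_bounded[OF ts])
  have bb: "cmod (b m) <= sqrt (\<Sum>m. (cmod (b m))^2)" for m by (rule square_summable_bounded[OF b])
  show "EX L. ((%s. cseries b s ph) \<longlongrightarrow> L) (at_left 1)"
  proof (rule convergent_at_left_if_Cauchy)
   fix e :: real assume e: "e > 0"
   have "(INF N. F N ph) < ennreal ((e / 3)^2)" using inf e by simp
   then obtain N where N: "F N ph < ennreal ((e / 3)^2)" unfolding INF_less_iff by blast
   have rat: "cmod (cseries (t N) (r i) ph) <= e / 3" for i
   proof -
    have "ennreal ((cmod (cseries (t N) (r i) ph))^2) <= ennreal ((e / 3)^2)" by (rule order_trans[OF F(2) less_imp_le[OF N]])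
    then have "(cmod (cseries (t N) (r i) ph))^2 <= (e / 3)^2" by (subst (asm) ennreal_le_iff) auto
    then show ?thesis by (rule power2_le_imp_le) (use e in simp)
   qed
   \<comment> \<open>The maximal function sees rational radii only; by continuity a large value at
     \<open>s\<close> would persist at a rational radius nearby.\<close>
   have tail: "cmod (cseries (t N) s ph) <= e / 3" if s: "0 <= s" "s < 1" for s
   proof (rule ccontr)
    assume n: "\<not> ?thesis"
    have "continuous (at s within {0..<1}) (%s. cmod (cseries (t N) s ph))"
     by (intro continuous_norm circle_series_continuous[OF tb s])
    then have "((%s. cmod (cseries (t N) s ph)) \<longlongrightarrow> cmod (cseries (t N) s ph)) (at s within {0..<1})"
     by (simp only: continuous_within)
    from order_tendstoD(1)[OF this, of "e / 3"] n
    obtain d where d: "d > 0" "!!y. y : {0..<1} ==> y ~= s ==> dist y s < d ==> e / 3 < cmod (cseries (t N) y ph)"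
     unfolding eventually_at by auto
    obtain q where q: "q : \<rat>" "s < q" "q < min 1 (s + d)"
     using Rats_dense_in_real[of s "min 1 (s + d)"] s d by auto
    then have "q : range r" using rr s by auto
    then obtain i where "q = r i" by auto
    with rat[of i] d(2)[of q] q s show False by (auto simp: dist_real_def)
   qed
   define p where "p s = (\<Sum>m<N. b m * (of_real s * cis ph) ^ m)" for s
   have split: "cseries b s ph = p s + cseries (t N) s ph" if s: "0 <= s" "s < 1" for s
   proof -
    have 1: "(%m. t N m * (of_real s * cis ph) ^ m) sums cseries (t N) s ph" by (rule circle_series_sums[OF tb s])
    have 2: "(%m. if m : {..<N} then b m * (of_real s * cis ph) ^ m else 0) sums p s"
     unfolding p_def by (rule sums_If_finite_set) simp
    have "(%m. (if m : {..<N} then b m * (of_real s * cis ph) ^ m else 0) + t N m * (of_real s * cis ph) ^ m) = (%m. b m * (of_real s * cis ph) ^ m)"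
     by (auto simp: t_def)
    then have "(%m. b m * (of_real s * cis ph) ^ m) sums (p s + cseries (t N) s ph)"
     using sums_add[OF 2 1] by simp
    with circle_series_sums[OF bb s, where ph=ph] show ?thesis by (rule sums_unique2)
   qed
   have "(p \<longlongrightarrow> p 1) (at_left 1)" unfolding p_def by (intro tendsto_intros)
   then have "eventually (%s. dist (p s) (p 1) < e / 6) (at_left 1)" by (rule tendstoD) (use e in simp)
   then obtain d where d: "d < 1" "!!s. d < s ==> s < 1 ==> dist (p s) (p 1) < e / 6"
    unfolding eventually_at_left_field by auto
   show "\<exists>d<1. ALL s t. d < s --> s < 1 --> d < t --> t < 1 --> cmod (cseries b s ph - cseries b t ph) <= e"
   proof (intro exI[of _ "max 0 d"] conjI allI impI)
    show "max 0 d < 1" using d by auto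
    fix s u assume "max 0 d < s" "s < 1" "max 0 d < u" "u < 1"
    then have s: "0 <= s" "s < 1" "d < s" and u: "0 <= u" "u < 1" "d < u" by auto
    have "cseries b s ph - cseries b u ph
     = (p s - p 1) + (p 1 - p u) + (cseries (t N) s ph - cseries (t N) u ph)"
     by (simp add: split[OF s(1,2)] split[OF u(1,2)])
    also have "cmod ... <= cmod (p s - p 1) + cmod (p 1 - p u) + (cmod (cseries (t N) s ph) + cmod (cseries (t N) u ph))"
     by (rule order_trans[OF norm_triangle_ineq add_mono[OF norm_triangle_ineq norm_triangle_ineq4]])
    also have "... <= e / 6 + e / 6 + (e / 3 + e / 3)"
     using d(2)[OF s(3,2)] d(2)[OF u(3,2)] tail[OF s(1,2)] tail[OF u(1,2)]
     by (simp add: dist_norm norm_minus_commute)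
    finally show "cmod (cseries b s ph - cseries b u ph) <= e" by simp
   qed
  qed
 qed
qed

section \<open>Completeness of the circle harmonics\<close>

lemma AE_nonpos_if_integrals_zero:
 fixes g :: "'a => real"
 assumes g: "integrable M g" and z: "!!A. A : sets M ==> (LINT x:A|M. g x) = 0"
 shows "AE x in M. g x <= 0"
proof -
 define A where "A = {x : space M. g x > 0}"
 have A: "A : sets M" unfolding A_def using g by measurable
 have i: "integrable M (%x. indicator A x *\<^sub>R g x)" using integrable_mult_indicator[OF A g] .
 have nn: "AE x in M. 0 <= indicator A x *\<^sub>R g x" by (rule AE_I2) (auto simp: A_def indicator_def)
 have "(LINT x|M. indicator A x *\<^sub>R g x) = 0" using z[OF A] by (simp add: set_lebesgue_integral_def)
 then have "AE x in M. indicator A x *\<^sub>R g x = 0" using integral_nonneg_eq_0_iff_AE[OF i nn] by blast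
 then show ?thesis
  using AE_space by eventually_elim (auto simp: A_def indicator_def split: if_splits)
qed

lemma AE_zero_if_integrals_zero:
 fixes G :: "'a => complex"
 assumes G: "integrable M G" and z: "!!A. A : sets M ==> (LINT x:A|M. G x) = 0"
 shows "AE x in M. G x = 0"
proof -
 have si: "set_integrable M A G" if "A : sets M" for A
  unfolding set_integrable_def using integrable_mult_indicator[OF that G] .
 have Re: "(LINT x:A|M. Re (G x)) = 0" and Im: "(LINT x:A|M. Im (G x)) = 0" if A: "A : sets M" for A
 proof -
  have "(LINT x:A|M. Re (G x)) = Re (LINT x:A|M. G x)"
   unfolding set_lebesgue_integral_def
   by (subst integral_Re[symmetric]) (use si[OF A] in "auto simp: set_integrable_def")
  then show "(LINT x:A|M. Re (G x)) = 0" by (simp add: z[OF A])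
  have "(LINT x:A|M. Im (G x)) = Im (LINT x:A|M. G x)"
   unfolding set_lebesgue_integral_def
   by (subst integral_Im[symmetric]) (use si[OF A] in "auto simp: set_integrable_def")
  then show "(LINT x:A|M. Im (G x)) = 0" by (simp add: z[OF A])
 qed
 have neg: "(LINT x:A|M. - g x) = 0" if "(LINT x:A|M. g x) = 0" for A and g :: "'a => real"
  using that by (simp add: set_lebesgue_integral_def)
 have "AE x in M. Re (G x) <= 0" "AE x in M. - Re (G x) <= 0" "AE x in M. Im (G x) <= 0" "AE x in M. - Im (G x) <= 0"
  by (intro AE_nonpos_if_integrals_zero integrable_Re integrable_Im Bochner_Integration.integrable_minus G Re Im neg; assumption)+
 then show ?thesis by eventually_elim (simp add: complex_eq_iff)
qed

text \<open>A Dynkin class argument. The whole space belongs to the generator, so complements are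
  handled by subtraction.\<close>

lemma integrals_zero_if_zero_on_generator:
 fixes G :: "'a => complex"
 assumes G: "integrable M G" and E: "Int_stable E" "E <= Pow (space M)" "sets M = sigma_sets (space M) E" "space M : E"
  and z: "!!A. A : E ==> (LINT x:A|M. G x) = 0" and A: "A : sets M"
 shows "(LINT x:A|M. G x) = 0"
proof -
 have si: "set_integrable M A G" if "A : sets M" for A
  unfolding set_integrable_def using integrable_mult_indicator[OF that G] .
 from A have "A : sigma_sets (space M) E" by (simp add: E(3))
 with E(1,2) show ?thesis
 proof (induction rule: sigma_sets_induct_disjoint)
  case (basic A) then show ?case by (rule z)
 next
  case empty then show ?case by (simp add: set_lebesgue_integral_def)
 next
  case (compl A)
  then have A: "A : sets M" by (simp add: E(3))
  have "(LINT x:A Un (space M - A)|M. G x) = (LINT x:A|M. G x) + (LINT x:space M - A|M. G x)"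
   by (rule set_integral_Un) (use A si in auto)
  moreover have "A Un (space M - A) = space M" using sets.sets_into_space[OF A] by auto
  ultimately show ?case using compl z[OF E(4)] by simp
 next
  case (union A)
  then have "A i : sets M" for i by (auto simp: E(3))
  moreover from this have "set_integrable M (\<Union>i. A i) G" by (intro si) auto
  ultimately have "(LINT x:(\<Union>i. A i)|M. G x) = (\<Sum>i. (LINT x:(A i)|M. G x))"
   by (intro lebesgue_integral_countable_add) (use union in "auto simp: disjoint_family_on_def")
  then show ?case using union by simp
 qed
qed

lemma sets_restrict_borel_closed:
 fixes S :: "'a::topological_space set"
 assumes "S : sets borel"
 shows "sets (restrict_space borel S) = sigma_sets S ((\<inter>) S ` Collect closed)"
proof -
 have b: "sets (borel :: 'a measure) = sigma_sets UNIV (Collect closed)"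
  by (subst borel_eq_closed) (rule sets_measure_of, simp)
 show ?thesis
  unfolding sets_restrict_space b by (rule sigma_sets_Int) (use assms b in auto)
qed

text \<open>A trigonometric polynomial, written as one polynomial in \<open>cis ph\<close> with the
  negative frequencies factored out, so that closure under products is immediate.\<close>

definition trig_form :: "(real => complex) => bool" where
 "trig_form f \<longleftrightarrow> (EX N p. ALL ph. f ph = cis (- real N * ph) * poly p (cis ph))"

lemma trig_form_const: "trig_form (%_. c)"
 unfolding trig_form_def by (intro exI[of _ 0] exI[of _ "[:c:]"]) simp

lemma trig_form_mult:
 assumes "trig_form f" "trig_form g"
 shows "trig_form (%ph. f ph * g ph)"
proof -
 obtain N p M q where "ALL ph. f ph = cis (- real N * ph) * poly p (cis ph)" "ALL ph. g ph = cis (- real M * ph) * poly q (cis ph)"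
  using assms unfolding trig_form_def by auto
 moreover have "cis (- real (N + M) * ph) = cis (- real N * ph) * cis (- real M * ph)" for ph
  by (simp add: cis_mult algebra_simps)
 ultimately show ?thesis
  unfolding trig_form_def by (intro exI[of _ "N + M"] exI[of _ "p * q"]) simp
qed

lemma trig_form_add:
 assumes "trig_form f" "trig_form g"
 shows "trig_form (%ph. f ph + g ph)"
proof -
 obtain N p M q where f: "ALL ph. f ph = cis (- real N * ph) * poly p (cis ph)" and g: "ALL ph. g ph = cis (- real M * ph) * poly q (cis ph)"
  using assms unfolding trig_form_def by auto
 have "f ph + g ph = cis (- real (N + M) * ph) * poly (monom 1 M * p + monom 1 N * q) (cis ph)" for ph
 proof -
  have 1: "cis (- real (N + M) * ph) * cis ph ^ M = cis (- real N * ph)"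
   by (simp add: Complex.DeMoivre cis_mult algebra_simps)
  have 2: "cis (- real (N + M) * ph) * cis ph ^ N = cis (- real M * ph)"
   by (simp add: Complex.DeMoivre cis_mult algebra_simps)
  have "cis (- real (N + M) * ph) * poly (monom 1 M * p + monom 1 N * q) (cis ph)
    = (cis (- real (N + M) * ph) * cis ph ^ M) * poly p (cis ph) + (cis (- real (N + M) * ph) * cis ph ^ N) * poly q (cis ph)"
   by (simp only: poly_add poly_mult poly_monom mult_1 distrib_left mult.assoc)
  then show ?thesis unfolding 1 2 using f g by simp
 qed
 then show ?thesis unfolding trig_form_def by blast
qed

lemma trig_form_polynomial:
 fixes u :: "complex => real"
 assumes "real_polynomial_function u"
 shows "trig_form (%ph. of_real (u (cis ph)))"
 using assms
proof (induction rule: real_polynomial_function.induct)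
 case (linear f)
 have c: "trig_form (%ph. of_real (cos ph))"
  unfolding trig_form_def
 proof (intro exI[of _ "1::nat"] exI[of _ "[:1/2, 0, 1/2::complex:]"] allI)
  fix ph
  have "cis (- real 1 * ph) * poly [:1/2, 0, 1/2:] (cis ph) = cis (- ph) / 2 + (cis (- ph) * cis ph) * cis ph / 2" by (simp add: algebra_simps)
  also have "... = of_real (cos ph)" by (simp add: cis_mult complex_eq_iff)
  finally show "of_real (cos ph) = cis (- real 1 * ph) * poly [:1/2, 0, 1/2:] (cis ph)" by simp
 qed
 have s: "trig_form (%ph. of_real (sin ph))"
  unfolding trig_form_def
 proof (intro exI[of _ "1::nat"] exI[of _ "[:\<i>/2, 0, -\<i>/2:]"] allI)
  fix ph
  have "cis (- real 1 * ph) * poly [:\<i>/2, 0, -\<i>/2:] (cis ph) = \<i> * cis (- ph) / 2 - \<i> * (cis (- ph) * cis ph) * cis ph / 2" by (simp add: algebra_simps)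
  also have "... = of_real (sin ph)" by (simp add: cis_mult complex_eq_iff)
  finally show "of_real (sin ph) = cis (- real 1 * ph) * poly [:\<i>/2, 0, -\<i>/2:] (cis ph)" by simp
 qed
 have "f (cis ph) = cos ph * f 1 + sin ph * f \<i>" for ph
 proof -
  have "cis ph = cos ph *\<^sub>R 1 + sin ph *\<^sub>R \<i>" by (simp add: complex_eq_iff)
  then show ?thesis using linear by (simp only: linear_add linear_cmul bounded_linear.linear real_scaleR_def)
 qed
 then show ?case
  using trig_form_add[OF trig_form_mult[OF c trig_form_const[of "of_real (f 1)"]] trig_form_mult[OF s trig_form_const[of "of_real (f \<i>)"]]]
  by simp
next
 case (const c) then show ?case by (rule trig_form_const)
next
 case (add f g) then show ?case using trig_form_add by simp
next
 case (mult f g) then show ?case using trig_form_mult by simp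
qed

text \<open>A function with equal values at both ends descends to the circle. The descended function
  is continuous because the preimage of a closed set is the image under \<open>cis\<close> of a
  compact set, and Stone-Weierstrass supplies a polynomial in the two coordinates.\<close>

lemma trig_form_dense:
 fixes a :: "real => real"
 assumes a: "continuous_on {0..2*pi} a" "a 0 = a (2*pi)" and e: "e > 0"
 obtains f where "trig_form f" "!!ph. ph : {0..2*pi} ==> cmod (of_real (a ph) - f ph) <= e"
proof -
 define al where "al z = a (Arg2pi z)" for z
 have al: "al (cis ph) = a ph" if "ph : {0..2*pi}" for ph
 proof (cases "ph = 2*pi")
  case True then show ?thesis using a(2) by (simp add: al_def Arg2pi_of_real[of 1, simplified])
 next
  case False
  then have "Arg2pi (cis ph) = ph" using that by (intro Arg2pi_unique[of 1]) (auto simp: cis_conv_exp)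
  then show ?thesis by (simp add: al_def)
 qed
 have "continuous_on (sphere 0 1) al"
  unfolding continuous_on_closed_vimage[OF closed_sphere]
 proof (intro allI impI)
  fix C :: "real set" assume C: "closed C"
  have "al -` C Int sphere 0 1 = cis ` ({0..2*pi} Int a -` C)"
  proof (intro equalityI subsetI)
   fix z assume z: "z : al -` C Int sphere 0 1"
   have "z = cis (Arg2pi z)" using z Arg2pi_eq[of z] by (simp add: cis_conv_exp)
   moreover have "Arg2pi z : {0..2*pi} Int a -` C" using z Arg2pi_ge_0[of z] Arg2pi_lt_2pi[of z] by (auto simp: al_def)
   ultimately show "z : cis ` ({0..2*pi} Int a -` C)" by blast
  next
   fix z assume "z : cis ` ({0..2*pi} Int a -` C)"
   then show "z : al -` C Int sphere 0 1" using al by auto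
  qed
  moreover have "compact ({0..2*pi} Int a -` C)"
   using continuous_on_closed_vimage[OF closed_atLeastAtMost, of 0 "2*pi" a] a(1) C
   by (intro closed_Int_compact[of "a -` C Int {0..2*pi}" "{0..2*pi}", simplified inf_assoc inf_idem, unfolded Int_commute[of "a -` C"]])
     (auto simp: Int_commute)
  ultimately show "closed (al -` C Int sphere 0 1)"
   by (auto intro!: compact_imp_closed compact_continuous_image continuous_intros)
 qed
 then obtain u where u: "real_polynomial_function u" "!!z. z : sphere 0 1 ==> \<bar>al z - u z\<bar> < e"
  using Stone_Weierstrass_real_polynomial_function[OF compact_sphere _ e] by blast
 show ?thesis
 proof (rule that[OF trig_form_polynomial[OF u(1)]])
  fix ph :: real assume ph: "ph : {0..2*pi}"
  have "\<bar>a ph - u (cis ph)\<bar> < e" using u(2)[of "cis ph"] al[OF ph] by simp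
  then show "cmod (of_real (a ph) - of_real (u (cis ph))) <= e"
   unfolding of_real_diff[symmetric] norm_of_real by simp
 qed
qed

context
 fixes Y :: "nat => nat => real^'n => complex" and G :: "real * (real^'n) => complex"
 assumes Y: "orthonormal_harmonics Y" and G: "integrable dM G"
  and z: "!!i. i : circle_harm_index TYPE('n) ==> (LINT x|dM. G x * cnj (circ_harm Y i x)) = 0"
begin

text \<open>Integration against the integrable \<open>G\<close> is continuous for uniform
  convergence, so it vanishes on uniform limits of functions on which it vanishes.\<close>

lemma integral_zero_limit:
 assumes fm: "f : bmeas dM" "!!x. x : space dM ==> cmod (f x) <= C"
  and ap: "!!e. e > 0 ==> EX f'. f' : bmeas dM &
    (ALL x:space dM. cmod (f x - f' x) <= e) & (LINT x|dM. f' x * G x) = 0"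
 shows "(LINT x|dM. f x * G x) = 0"
proof -
 let ?M = "dM :: (real * (real^'n)) measure"
 define K where "K = (LINT x|?M. cmod (G x)) + 1"
 have K: "K > 0" by (simp add: K_def add_nonneg_pos)
 have "cmod (LINT x|?M. f x * G x) <= e" if e: "e > 0" for e
 proof -
  have e1: "e / K > 0" using e K by simp
  obtain f' where f': "f' : bmeas ?M" "!!x. x : space ?M ==> cmod (f x - f' x) <= e / K" "(LINT x|?M. f' x * G x) = 0"
   using ap[OF e1] by blast
  have fG: "integrable ?M (%x. f x * G x)" by (rule bounded_mult_integrable[OF fm G])
  have dG: "integrable ?M (%x. (f x - f' x) * G x)"
   by (rule bounded_mult_integrable[OF _ f'(2) G]) (use fm f' in auto)
  have "integrable ?M (%x. f x * G x - (f x - f' x) * G x)" by (rule Bochner_Integration.integrable_diff[OF fG dG])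
  then have f'G: "integrable ?M (%x. f' x * G x)" by (simp add: algebra_simps)
  have "(LINT x|?M. f x * G x) = (LINT x|?M. (f x - f' x) * G x)"
   using Bochner_Integration.integral_diff[OF fG f'G] f'(3) by (simp add: left_diff_distrib)
  also have "cmod ... <= (LINT x|?M. e / K * cmod (G x))"
  proof (rule order_trans[OF integral_norm_bound integral_mono])
   show "integrable ?M (%x. cmod ((f x - f' x) * G x))" by (rule integrable_norm[OF dG])
   show "integrable ?M (%x. e / K * cmod (G x))" by (intro integrable_mult_right integrable_norm G)
   show "cmod ((f x - f' x) * G x) <= e / K * cmod (G x)" if "x : space ?M" for x
    unfolding norm_mult by (rule mult_right_mono[OF f'(2)[OF that]]) simp
  qed
  also have "... = e / K * (K - 1)" by (simp add: K_def)
  also have "... <= e" using e K by (simp add: field_simps)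
  finally show ?thesis .
 qed
 then have "cmod (LINT x|?M. f x * G x) <= 0" by (intro field_le_epsilon[of _ 0]) simp
 then show ?thesis by simp
qed

lemma coefficient_integrable:
 assumes l: "l : {1..harm_dim TYPE('n) k}"
 shows "integrable dM (%x. cis (of_int n * fst x) * cnj (Y k l (snd x)) * G x)"
proof -
 obtain B where B: "B > 0" "!!x. norm x = 1 ==> cmod (Y k l x) <= B"
  by (rule harmonic_bounded_on_sphere[OF Y_continuous[OF Y l]]) (rule that; assumption)
 show ?thesis
  by (rule bounded_mult_integrable[OF borel_measurable_times[OF measurable_fst_circle_sphere[OF cis_measurable_angle]
     borel_measurable_cnj[OF measurable_snd_circle_sphere[OF Y_measurable[OF Y l]]]] _ G, where C = B])
    (use B(2) in "auto simp: space_circle_sphere norm_mult")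
qed

lemma coefficient_zero:
 assumes l: "l : {1..harm_dim TYPE('n) k}"
 shows "(LINT x|dM. cis (of_int n * fst x) * cnj (Y k l (snd x)) * G x) = 0"
proof -
 have "(LINT x|dM. G x * cnj (circ_harm Y (- n, k, l) x)) = 0"
  by (rule z) (use l in "simp add: circle_harm_index_def")
 moreover have "G x * cnj (circ_harm Y (- n, k, l) x) = cis (of_int n * fst x) * cnj (Y k l (snd x)) * G x" for x
  by (simp add: circ_harm_def cis_cnj mult_ac)
 ultimately show ?thesis by simp
qed

lemma trig_form_zero:
 assumes f: "trig_form f" and l: "l : {1..harm_dim TYPE('n) k}"
 shows "(LINT x|dM. f (fst x) * cnj (Y k l (snd x)) * G x) = 0" (is ?A)
  and "integrable dM (%x. f (fst x) * cnj (Y k l (snd x)) * G x)" (is ?B)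
  and "f : bmeas dA" (is ?C)
proof -
 obtain N p where p: "!!ph. f ph = cis (- real N * ph) * poly p (cis ph)" using f unfolding trig_form_def by auto
 have e: "f ph = (\<Sum>i\<le>degree p. coeff p i * cis (of_int (int i - int N) * ph))" for ph
  unfolding p poly_altdef sum_distrib_left
  by (intro sum.cong refl) (simp add: Complex.DeMoivre cis_mult algebra_simps)
 have e2: "f (fst x) * cnj (Y k l (snd x)) * G x
   = (\<Sum>i\<le>degree p. coeff p i * (cis (of_int (int i - int N) * fst x) * cnj (Y k l (snd x)) * G x))" for x
  unfolding e sum_distrib_right by (simp only: mult.assoc)
 show ?B unfolding e2 by (intro Bochner_Integration.integrable_sum integrable_mult_right coefficient_integrable l)
 show ?A unfolding e2
  by (subst lint_sum)
    (intro integrable_mult_right coefficient_integrable l, simp only: integral_mult_right_zero coefficient_zero[OF l] mult_zero_right sum.neutral_const)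
 show ?C unfolding e[abs_def] by (intro borel_measurable_sum borel_measurable_times borel_measurable_const cis_measurable_angle)
qed

text \<open>The two factors are approximated one after the other: \<open>a\<close> by trigonometric
  polynomials against a fixed harmonic, and then \<open>b\<close> by harmonics with \<open>a\<close>
  left as it is.\<close>

lemma product_zero:
 fixes a :: "real => real" and b :: "real^'n => real"
 assumes a: "continuous_on {0..2*pi} a" "a 0 = a (2*pi)" and b: "continuous_on (sphere 0 1) b"
 shows "(LINT x|dM. of_real (a (fst x) * b (snd x)) * G x) = 0"
proof -
 let ?M = "dM :: (real * (real^'n)) measure"
 have "compact (a ` {0..2*pi})" by (rule compact_continuous_image[OF a(1)]) simp
 then have "bounded (a ` {0..2*pi})" by (rule compact_imp_bounded)
 then obtain Ca where "Ca > 0" "ALL x:{0..2*pi}. \<bar>a x\<bar> <= Ca" unfolding bounded_pos by auto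
 then have Ca: "Ca > 0" "!!x. x : {0..2*pi} ==> \<bar>a x\<bar> <= Ca" by auto
 have cb: "continuous_on (sphere 0 1) (%x. complex_of_real (b x))" by (intro continuous_intros b)
 obtain Cb where Cb: "Cb > 0" "!!x. norm x = 1 ==> cmod (of_real (b x)) <= Cb"
  by (rule harmonic_bounded_on_sphere[OF cb]) (rule that; assumption)
 have am: "(%ph. complex_of_real (a ph)) : bmeas dA"
  unfolding measurable_cong_sets[OF sets_angle_measure refl]
  by (intro borel_measurable_continuous_on_restrict continuous_intros a(1))
 have bm: "(%x. complex_of_real (b x)) : bmeas dS" by (rule continuous_sphere_measurable[OF cb])
 note afm = measurable_fst_circle_sphere[OF am] and bfm = measurable_snd_circle_sphere[OF bm]
 have Yz: "(LINT x|?M. of_real (a (fst x)) * cnj (Y k l (snd x)) * G x) = 0 &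
   integrable ?M (%x. of_real (a (fst x)) * cnj (Y k l (snd x)) * G x)"
  if l: "l : {1..harm_dim TYPE('n) k}" for k l
 proof -
  obtain By where By: "By > 0" "!!x. norm x = 1 ==> cmod (Y k l x) <= By"
   by (rule harmonic_bounded_on_sphere[OF Y_continuous[OF Y l]]) (rule that; assumption)
  note Ym = borel_measurable_cnj[OF measurable_snd_circle_sphere[OF Y_measurable[OF Y l]]]
  have m: "(%x. of_real (a (fst x)) * cnj (Y k l (snd x))) : bmeas ?M" by (rule borel_measurable_times[OF afm Ym])
  have bd: "cmod (of_real (a (fst x)) * cnj (Y k l (snd x))) <= Ca * By" if "x : space ?M" for x
  proof -
   from that have "\<bar>a (fst x)\<bar> <= Ca" "cmod (Y k l (snd x)) <= By" by (intro Ca By; auto simp: space_circle_sphere)+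
   then show ?thesis unfolding norm_mult using Ca(1) by (intro mult_mono) auto
  qed
  have "(LINT x|?M. of_real (a (fst x)) * cnj (Y k l (snd x)) * G x) = 0"
  proof (rule integral_zero_limit[OF m bd])
   fix e :: real assume e: "e > 0"
   then have e': "e / By > 0" using By by simp
   obtain f where f: "trig_form f" "!!ph. ph : {0..2*pi} ==> cmod (of_real (a ph) - f ph) <= e / By"
    by (rule trig_form_dense[OF a e']) (rule that; assumption)
   show "EX f'. f' : bmeas ?M & (ALL x:space ?M. cmod (of_real (a (fst x)) * cnj (Y k l (snd x)) - f' x) <= e) & (LINT x|?M. f' x * G x) = 0"
   proof (intro exI[of _ "%x. f (fst x) * cnj (Y k l (snd x))"] conjI ballI)
    show "(%x. f (fst x) * cnj (Y k l (snd x))) : bmeas ?M"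
     by (rule borel_measurable_times[OF measurable_fst_circle_sphere[OF trig_form_zero(3)[OF f(1) l]] Ym])
    show "(LINT x|?M. f (fst x) * cnj (Y k l (snd x)) * G x) = 0" by (rule trig_form_zero(1)[OF f(1) l])
    fix x assume x: "x : space ?M"
    have "cmod ((of_real (a (fst x)) - f (fst x)) * cnj (Y k l (snd x))) <= e / By * By"
     unfolding norm_mult complex_mod_cnj
     by (intro mult_mono f(2) By(2)) (use x e' By(1) in "auto simp: space_circle_sphere")
    then show "cmod (of_real (a (fst x)) * cnj (Y k l (snd x)) - f (fst x) * cnj (Y k l (snd x))) <= e"
     using By(1) by (simp add: left_diff_distrib)
   qed
  qed
  moreover have "integrable ?M (%x. of_real (a (fst x)) * cnj (Y k l (snd x)) * G x)"
   by (rule bounded_mult_integrable[OF m bd G])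
  ultimately show ?thesis by simp
 qed
 have m: "(%x. complex_of_real (a (fst x) * b (snd x))) : bmeas ?M"
  unfolding of_real_mult by (rule borel_measurable_times[OF afm bfm])
 have bd: "cmod (of_real (a (fst x) * b (snd x))) <= Ca * Cb" if "x : space ?M" for x
 proof -
  from that have "\<bar>a (fst x)\<bar> <= Ca" "cmod (of_real (b (snd x))) <= Cb" by (intro Ca Cb; auto simp: space_circle_sphere)+
  then show ?thesis unfolding of_real_mult norm_mult using Ca(1) by (intro mult_mono) auto
 qed
 show ?thesis
 proof (rule integral_zero_limit[OF m bd])
  fix e :: real assume e: "e > 0"
  then have e': "e / Ca > 0" using Ca by simp
  obtain N c where c: "!!x. norm x = 1 ==> cmod (of_real (b x) - (\<Sum>k<N. SUM l:{1..harm_dim TYPE('n) k}. c k l * Y k l x)) <= e / Ca"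
   by (rule harmonics_dense[OF Y cb e']) (rule that; assumption)
  \<comment> \<open>Orthogonality of \<open>G\<close> to the harmonics involves their conjugates. As
    \<open>b\<close> is real, conjugating its approximation gives one of the required form.\<close>
  define s where "s x = (\<Sum>k<N. SUM l:{1..harm_dim TYPE('n) k}. cnj (c k l) * cnj (Y k l x))" for x
  have s: "cmod (of_real (b x) - s x) <= e / Ca" if "norm x = 1" for x
  proof -
   have "of_real (b x) - s x = cnj (of_real (b x) - (\<Sum>k<N. SUM l:{1..harm_dim TYPE('n) k}. c k l * Y k l x))"
    by (simp add: s_def)
   then show ?thesis using c[OF that] by (simp only: complex_mod_cnj)
  qed
  have sm: "s : bmeas dS"
   unfolding s_def[abs_def] by (intro borel_measurable_sum borel_measurable_times borel_measurable_const borel_measurable_cnj Y_measurable[OF Y])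
  show "EX f'. f' : bmeas ?M & (ALL x:space ?M. cmod (of_real (a (fst x) * b (snd x)) - f' x) <= e) & (LINT x|?M. f' x * G x) = 0"
  proof (intro exI[of _ "%x. of_real (a (fst x)) * s (snd x)"] conjI ballI)
   show "(%x. of_real (a (fst x)) * s (snd x)) : bmeas ?M"
    by (rule borel_measurable_times[OF afm measurable_snd_circle_sphere[OF sm]])
   have eq: "of_real (a (fst x)) * s (snd x) * G x = (\<Sum>k<N. SUM l:{1..harm_dim TYPE('n) k}. cnj (c k l) * (of_real (a (fst x)) * cnj (Y k l (snd x)) * G x))" for x
    by (simp add: s_def sum_distrib_left sum_distrib_right mult_ac)
   have "(LINT x|?M. of_real (a (fst x)) * s (snd x) * G x) = (\<Sum>k<N. LINT x|?M. (SUM l:{1..harm_dim TYPE('n) k}. cnj (c k l) * (of_real (a (fst x)) * cnj (Y k l (snd x)) * G x)))"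
    unfolding eq using Yz by (intro lint_sum Bochner_Integration.integrable_sum integrable_mult_right) blast
   also have "... = (\<Sum>k<N. SUM l:{1..harm_dim TYPE('n) k}. LINT x|?M. cnj (c k l) * (of_real (a (fst x)) * cnj (Y k l (snd x)) * G x))"
    using Yz by (intro sum.cong refl lint_sum integrable_mult_right) blast
   also have "... = 0" using Yz by (intro sum.neutral ballI) (simp only: integral_mult_right_zero mult_zero_right)
   finally show "(LINT x|?M. of_real (a (fst x)) * s (snd x) * G x) = 0" .
   fix x assume x: "x : space ?M"
   have "cmod (of_real (a (fst x)) * (of_real (b (snd x)) - s (snd x))) <= Ca * (e / Ca)"
    unfolding norm_mult norm_of_real by (intro mult_mono Ca(2) s) (use x e' Ca(1) in "auto simp: space_circle_sphere")
   then show "cmod (of_real (a (fst x) * b (snd x)) - of_real (a (fst x)) * s (snd x)) <= e"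
    using Ca(1) by (simp add: right_diff_distrib)
  qed
 qed
qed

lemma indicator_approx:
 fixes C :: "'a::metric_space set"
 assumes "closed C" "C ~= {}"
 shows "(%n. max 0 (1 - real n * infdist x C)) \<longlonglongrightarrow> indicator C x"
proof (cases "x : C")
 case True
 then show ?thesis by simp
next
 case False
 then have d: "infdist x C > 0" using infdist_pos_not_in_closed assms by blast
 obtain N where N: "1 < real N * infdist x C" using reals_Archimedean3[OF d, rule_format, of 1] by auto
 have "eventually (%n. max 0 (1 - real n * infdist x C) = 0) sequentially"
  unfolding eventually_sequentially
 proof (intro exI allI impI)
  fix n assume "N <= n"
  then have "real N * infdist x C <= real n * infdist x C" using d by (intro mult_right_mono) auto
  then show "max 0 (1 - real n * infdist x C) = 0" using N by simp
 qed
 then show ?thesis using False by (simp add: tendsto_eventually)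
qed

lemma rectangle_zero:
 assumes C: "closed C" "C ~= {}" and D: "closed D" "D ~= {}"
 shows "(LINT x:(({0..2*pi} Int C) \<times> (sphere 0 1 Int D))|dM. G x) = 0"
proof -
 let ?M = "dM :: (real * (real^'n)) measure"
 \<comment> \<open>The first factor approximates the indicator of \<open>C\<close>. The other two
   make the function vanish at both ends of the interval, hence periodic, and they tend to 1 in the
   interior, so that only a null set is missed.\<close>
 define a where "a n ph = max 0 (1 - real n * infdist ph C) * (min 1 (real n * ph) * min 1 (real n * (2*pi - ph)))" for n ph
 define b where "b n te = max 0 (1 - real n * infdist te D)" for n te
 have a: "continuous_on {0..2*pi} (a n)" "a n 0 = a n (2*pi)" for n
  unfolding a_def by (intro continuous_intros) simp
 have b: "continuous_on (sphere 0 1) (b n)" for n unfolding b_def by (intro continuous_intros)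
 have a01: "\<bar>a n ph\<bar> <= 1" if "ph : {0..2*pi}" for n ph
 proof -
  have "0 <= min 1 (real n * ph)" "0 <= min 1 (real n * (2*pi - ph))" using that by auto
  moreover have "0 <= max 0 (1 - real n * infdist ph C)" "max 0 (1 - real n * infdist ph C) <= 1" by (auto simp: infdist_nonneg)
  ultimately show ?thesis unfolding a_def abs_mult by (intro mult_le_one) auto
 qed
 have b01: "\<bar>b n te\<bar> <= 1" for n te by (auto simp: b_def infdist_nonneg)
 have lim1: "(%n. min 1 (real n * y)) \<longlonglongrightarrow> 1" if y: "y > 0" for y :: real
 proof -
  obtain N where N: "1 < real N * y" using reals_Archimedean3[OF y, rule_format, of 1] by auto
  have "eventually (%n. min 1 (real n * y) = 1) sequentially"
   unfolding eventually_sequentially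
  proof (intro exI allI impI)
   fix n assume "N <= n"
   then have "real N * y <= real n * y" using y by (intro mult_right_mono) auto
   then show "min 1 (real n * y) = 1" using N by simp
  qed
  then show ?thesis by (simp add: tendsto_eventually)
 qed
 have alim: "(%n. a n ph) \<longlonglongrightarrow> indicator C ph" if "0 < ph" "ph < 2*pi" for ph
  using tendsto_mult[OF indicator_approx[OF C, of ph] tendsto_mult[OF lim1[of ph] lim1[of "2*pi - ph"]]] that
  by (simp add: a_def)
 have AEint: "AE x in ?M. 0 < fst x & fst x < 2 * pi"
 proof -
  have "AE ph in lborel. ph ~= 0 & ph ~= 2 * pi" by (intro AE_conjI AE_lborel_singleton)
  then have "AE ph in dA. 0 < ph & ph < 2 * pi"
   unfolding angle_measure_def by (subst AE_restrict_space_iff) auto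
  then have ae: "AE ph in dA. AE te in (dS :: (real^'n) measure). 0 < fst (ph, te) & fst (ph, te) < 2 * pi"
   by eventually_elim simp
  have fm: "fst : bmeas ?M" by (rule measurable_fst_circle_sphere[OF measurable_angle_measure_id])
  have "{x : space ?M. 0 < fst x & fst x < 2 * pi} : sets ?M"
   using fm by measurable
  then show ?thesis
   using pair_sigma_finite.AE_pair_measure[OF pair_sigma_finite_circle_sphere _ ae] unfolding circle_sphere_measure_def by blast
 qed
 have "(%n. LINT x|?M. of_real (a n (fst x) * b n (snd x)) * G x) \<longlonglongrightarrow> (LINT x|?M. indicator (({0..2*pi} Int C) \<times> (sphere 0 1 Int D)) x *\<^sub>R G x)"
 proof (rule integral_dominated_convergence[where w = "%x. cmod (G x)"])
  show "integrable ?M (%x. cmod (G x))" by (rule integrable_norm[OF G])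
  have set: "({0..2*pi} Int C) \<times> (sphere 0 1 Int D) : sets ?M"
   unfolding circle_sphere_measure_def using C D
   by (intro pair_measureI) (auto simp: sets_angle_measure sets_sphere_measure sets_restrict_space)
  show "(%x. indicator (({0..2*pi} Int C) \<times> (sphere 0 1 Int D)) x *\<^sub>R G x) : bmeas ?M"
   using borel_measurable_integrable[OF integrable_mult_indicator[OF set G]] .
  fix n
  have am: "(%ph. complex_of_real (a n ph)) : bmeas dA"
   unfolding measurable_cong_sets[OF sets_angle_measure refl]
   by (intro borel_measurable_continuous_on_restrict continuous_intros a(1))
  have bm: "(%x. complex_of_real (b n x)) : bmeas dS"
   by (intro continuous_sphere_measurable continuous_intros b)
  show "(%x. of_real (a n (fst x) * b n (snd x)) * G x) : bmeas ?M"
   unfolding of_real_mult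
   by (rule borel_measurable_times[OF borel_measurable_times[OF measurable_fst_circle_sphere[OF am] measurable_snd_circle_sphere[OF bm]] borel_measurable_integrable[OF G]])
  show "AE x in ?M. norm (of_real (a n (fst x) * b n (snd x)) * G x) <= cmod (G x)"
  proof (rule AE_I2)
   fix x assume "x : space ?M"
   then have "\<bar>a n (fst x)\<bar> * \<bar>b n (snd x)\<bar> <= 1" by (intro mult_le_one a01 b01) (auto simp: space_circle_sphere)
   then have "\<bar>a n (fst x)\<bar> * \<bar>b n (snd x)\<bar> * cmod (G x) <= 1 * cmod (G x)" by (intro mult_right_mono) auto
   then show "norm (of_real (a n (fst x) * b n (snd x)) * G x) <= cmod (G x)" by (simp add: norm_mult abs_mult)
  qed
 next
  show "AE x in ?M. (%n. of_real (a n (fst x) * b n (snd x)) * G x) \<longlonglongrightarrow> indicator (({0..2*pi} Int C) \<times> (sphere 0 1 Int D)) x *\<^sub>R G x"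
   using AEint AE_space
  proof eventually_elim
   fix x assume x: "0 < fst x & fst x < 2 * pi" "x : space ?M"
   have 1: "(%n. of_real (a n (fst x) * b n (snd x)) * G x) \<longlonglongrightarrow> of_real (indicator C (fst x) * indicator D (snd x)) * G x"
    unfolding b_def using x by (intro tendsto_intros alim indicator_approx D) auto
   have 2: "indicator (({0..2*pi} Int C) \<times> (sphere 0 1 Int D)) x *\<^sub>R G x = of_real (indicator C (fst x) * indicator D (snd x)) * G x"
    using x(2) by (auto simp: space_circle_sphere indicator_def)
   show "(%n. of_real (a n (fst x) * b n (snd x)) * G x) \<longlonglongrightarrow> indicator (({0..2*pi} Int C) \<times> (sphere 0 1 Int D)) x *\<^sub>R G x"
    using 1 unfolding 2 .
  qed
 qed
 moreover have "(LINT x|?M. of_real (a n (fst x) * b n (snd x)) * G x) = 0" for n by (rule product_zero[OF a b])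
 ultimately have "(%n. 0) \<longlonglongrightarrow> (LINT x|?M. indicator (({0..2*pi} Int C) \<times> (sphere 0 1 Int D)) x *\<^sub>R G x)" by simp
 then show ?thesis unfolding set_lebesgue_integral_def using LIMSEQ_unique tendsto_const by blast
qed

text \<open>Products of relatively closed sets generate the measurable sets, are stable under
  intersection and include the whole space. The integral of \<open>G\<close> over each of them is 0
  by \<open>rectangle_zero\<close>, hence over every measurable set.\<close>

theorem circle_harmonics_complete: "AE x in dM. G x = 0"
proof -
 let ?M = "dM :: (real * (real^'n)) measure"
 let ?EA = "(\<inter>) {0..2*pi} ` Collect closed" and ?EB = "(\<inter>) (sphere (0::real^'n) 1) ` Collect closed"
 let ?E = "{a \<times> b |a b. a : ?EA & b : ?EB}"
 have EA: "{0..2*pi} : ?EA" by (rule image_eqI[of _ _ UNIV]) auto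
 have EB: "sphere 0 1 : ?EB" by (rule image_eqI[of _ _ UNIV]) auto
 have "sets ?M = sets (sigma ({0..2*pi} \<times> sphere 0 1) ?E)"
  unfolding circle_sphere_measure_def
  using sets_pair_eq[of ?EA dA "{{0..2*pi}}" ?EB dS "{sphere 0 1}"] EA EB
  by (simp add: sets_angle_measure sets_sphere_measure sets_restrict_borel_closed image_subset_iff)
 also have "... = sigma_sets ({0..2*pi} \<times> sphere 0 1) ?E" by (rule sets_measure_of) auto
 finally have sets: "sets ?M = sigma_sets (space ?M) ?E" by (simp add: space_circle_sphere)
 show ?thesis
 proof (rule AE_zero_if_integrals_zero[OF G])
  fix A assume A: "A : sets ?M"
  show "(LINT x:A|?M. G x) = 0"
  proof (rule integrals_zero_if_zero_on_generator[OF G _ _ sets _ _ A])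
   show "Int_stable ?E"
   proof (rule Int_stableI)
    fix a b assume "a : ?E" "b : ?E"
    then obtain C1 D1 C2 D2 where *: "a = ({0..2*pi} Int C1) \<times> (sphere 0 1 Int D1)" "b = ({0..2*pi} Int C2) \<times> (sphere 0 1 Int D2)"
     "closed C1" "closed D1" "closed C2" "closed D2" by auto
    have e: "a Int b = ({0..2*pi} Int (C1 Int C2)) \<times> (sphere 0 1 Int (D1 Int D2))" unfolding * by auto
    have "{0..2*pi} Int (C1 Int C2) : ?EA" using *(3,5) by (intro imageI CollectI closed_Int)
    moreover have "sphere 0 1 Int (D1 Int D2) : ?EB" using *(4,6) by (intro imageI CollectI closed_Int)
    ultimately show "a Int b : ?E" unfolding e by blast
   qed
   show "?E <= Pow (space ?M)" by (auto simp: space_circle_sphere)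
   show "space ?M : ?E" using EA EB by (auto simp: space_circle_sphere)
   fix R assume "R : ?E"
   then obtain C D where R: "R = ({0..2*pi} Int C) \<times> (sphere 0 1 Int D)" "closed C" "closed D" by auto
   show "(LINT x:R|?M. G x) = 0"
   proof (cases "C = {} \<or> D = {}")
    case True
    then have "R = {}" using R by auto
    then show ?thesis by (simp add: set_lebesgue_integral_def)
   next
    case False
    then show ?thesis using rectangle_zero[of C D] R by simp
   qed
  qed
 qed
qed

end

section \<open>Series in the harmonics and their radial limits\<close>

definition hdeg :: "nat * nat * nat => nat" where
 "hdeg = (%(k, l, j). k + 2 * j)"

text \<open>Embeds the indices of Hardy expansions in those of the full product system; the image
  consists of the frequencies that the Riesz conditions admit.\<close>

definition to_circ :: "nat * nat * nat => int * nat * nat" where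
 "to_circ = (%(k, l, j). (int (k + 2 * j), k, l))"

lemma harm_to_circle_in: "i : harm_index TYPE('n::finite) ==> to_circ i : circle_harm_index TYPE('n)"
 by (auto simp: to_circ_def harm_index_def circle_harm_index_def)

lemma inj_harm_to_circle: "inj to_circ"
 by (auto simp: inj_def to_circ_def)

lemma harm_index_Sigma: "harm_index TYPE('n::finite) = (SIGMA k:UNIV. {1..harm_dim TYPE('n) k} \<times> UNIV)"
 by (auto simp: harm_index_def)

text \<open>The sup norm of the harmonic on the sphere, which is also that of
  \<open>circ_harm Y (n, k, l)\<close>, as \<open>cis\<close> has modulus 1.\<close>

definition hsup :: "(nat => nat => real^'n => complex) => int * nat * nat => real" where
 "hsup Y = (%(n, k, l). SUP te\<in>sphere 0 1. cmod (Y k l te))"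

context
 fixes Y :: "nat => nat => real^'n => complex"
 assumes Y: "orthonormal_harmonics Y"
begin

lemma hsup:
 assumes l: "l : {1..harm_dim TYPE('n) k}"
 shows "norm te = 1 ==> cmod (Y k l te) <= hsup Y (n, k, l)"
  and "(!!te. norm te = 1 ==> cmod (Y k l te) <= C) ==> hsup Y (n, k, l) <= C"
  and "0 <= hsup Y (n, k, l)"
proof -
 obtain B where B: "B > 0" "!!x. norm x = 1 ==> cmod (Y k l x) <= B"
  by (rule harmonic_bounded_on_sphere[OF Y_continuous[OF Y l]]) (rule that; assumption)
 have bdd: "bdd_above ((%te. cmod (Y k l te)) ` sphere 0 1)" using B(2) by (intro bdd_aboveI[of _ B]) auto
 show 1: "cmod (Y k l te) <= hsup Y (n, k, l)" if "norm te = 1" for te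
  unfolding hsup_def by (simp, rule cSUP_upper[OF _ bdd]) (use that in simp)
 have "axis undefined 1 : sphere (0::real^'n) 1" by simp
 then show "hsup Y (n, k, l) <= C" if "!!te. norm te = 1 ==> cmod (Y k l te) <= C"
  unfolding hsup_def by (simp, intro cSUP_least) (use that in auto)
 show "0 <= hsup Y (n, k, l)"
  by (rule order_trans[OF norm_ge_zero 1[of "axis undefined 1"]]) simp
qed

lemma circle_harmonic_bound:
 assumes "i : circle_harm_index TYPE('n)" "x : space dM"
 shows "cmod (circ_harm Y i x) <= hsup Y i"
 using assms hsup(1) by (auto simp: circle_harm_index_def circ_harm_def norm_mult space_circle_sphere)

lemma harmonic_sup_nonneg: "i : circle_harm_index TYPE('n) ==> 0 <= hsup Y i"
 using hsup(3) by (auto simp: circle_harm_index_def)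

text \<open>The dimension is the integral of the sum of squares of an orthonormal basis, and this
  sum is bounded pointwise by \<open>Y_growth\<close>.\<close>

lemma harm_dim_growth:
 assumes rh: "0 < rh" "rh < 1"
 obtains M where "M > 0" "!!k. real (harm_dim TYPE('n) k) <= M / rh^k"
proof -
 obtain M where M: "M > 0" "!!k (x::real^'n). norm x = 1 ==> (SUM l:{1..harm_dim TYPE('n) k}. (cmod (Y k l x))^2) <= M / rh^k"
  by (rule Y_growth[OF Y rh]) (rule that; assumption)
 have om: "omega CARD('n) > 0" by (rule omega_pos) simp
 show ?thesis
 proof (rule that[of "M * omega CARD('n)"])
  show "M * omega CARD('n) > 0" using M om by simp
  fix k
  let ?I = "{1..harm_dim TYPE('n) k}"
  have int: "integrable dS (%x. Y k l x * cnj (Y k l x))" if "l : ?I" for l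
   by (intro integrable_sphere_continuous continuous_intros Y_continuous[OF Y that])
  have "complex_of_real (real (harm_dim TYPE('n) k)) = (SUM l:?I. LINT x|dS. Y k l x * cnj (Y k l x))"
   using Y_orthonormal_deg[OF Y] by simp
  also have "... = (LINT x|dS. (SUM l:?I. Y k l x * cnj (Y k l x)))"
   by (rule lint_sum[symmetric]) (rule int)
  finally have "real (harm_dim TYPE('n) k) = cmod (LINT x|dS. (SUM l:?I. Y k l x * cnj (Y k l x)))"
   by (metis norm_of_nat of_real_of_nat_eq)
  also have "... <= M / rh^k * omega CARD('n)"
  proof (rule sphere_integral_bound)
   show "(%x. SUM l:?I. Y k l x * cnj (Y k l x)) : bmeas dS"
    by (intro borel_measurable_sum borel_measurable_times borel_measurable_cnj Y_measurable[OF Y])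
   fix x :: "real^'n" assume x: "norm x = 1"
   have "(SUM l:?I. Y k l x * cnj (Y k l x)) = of_real (SUM l:?I. (cmod (Y k l x))^2)"
    by (simp only: complex_norm_square of_real_sum)
   then have "cmod (SUM l:?I. Y k l x * cnj (Y k l x)) = (SUM l:?I. (cmod (Y k l x))^2)"
    by (simp only: norm_of_real) (simp add: sum_nonneg)
   then show "cmod (SUM l:?I. Y k l x * cnj (Y k l x)) <= M / rh^k" using M(2)[OF x, of k] by simp
  qed
  finally show "real (harm_dim TYPE('n) k) <= M * omega CARD('n) / rh^k" by simp
 qed
qed

text \<open>The dimension and the squared sup norms each contribute at most a constant times
  \<open>1 / rh^(2*k)\<close>, so \<open>r < rh^2\<close> leaves a geometric series in
  \<open>k\<close> of ratio \<open>(r / rh^2)^2\<close>. The sum over \<open>j\<close> is geometric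
  of ratio \<open>r^4\<close>.\<close>

lemma square_sup_summable:
 assumes r: "0 <= r" "r < 1"
 shows "(%i. (r ^ hdeg i * hsup Y (to_circ i))^2) summable_on harm_index TYPE('n)"
proof -
 define rh where "rh = sqrt ((1 + r) / 2)"
 have rh: "0 < rh" "rh < 1" "r < rh^2" using r by (auto simp: rh_def)
 obtain M where M: "M > 0" "!!k l te. l : {1..harm_dim TYPE('n) k} ==> norm te = 1 ==> cmod (Y k l te) <= M / rh^k"
  by (rule circle_harmonic_growth[OF Y rh(1,2)]) (rule that; assumption)
 obtain D where D: "D > 0" "!!k. real (harm_dim TYPE('n) k) <= D / (rh^2)^k"
  by (rule harm_dim_growth[of "rh^2"]) (use rh in "auto simp: power_less_one_iff intro: that")
 define q where "q = (r / rh^2)^2"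
 have q: "0 <= q" "q < 1" using r rh by (auto simp: q_def power_less_one_iff divide_less_eq)
 define s where "s = r ^ 4"
 have s: "0 <= s" "s < 1" using r by (auto simp: s_def power_less_one_iff)
 define u where "u k = (r / rh)^(2*k) * M^2" for k
 have gs: "((%j. s ^ j) has_sum (1 / (1 - s))) UNIV"
  using s by (intro norm_summable_imp_has_sum geometric_sums) (auto simp: norm_power summable_geometric)
 have "(%(k, l, j). u k * s ^ j) summable_on (SIGMA k:UNIV. {1..harm_dim TYPE('n) k} \<times> UNIV)"
 proof (rule summable_on_SigmaI)
  fix k
  have "((%(l, j). u k * s ^ j) has_sum (SUM l:{1..harm_dim TYPE('n) k}. u k * (1 / (1 - s)))) ({1..harm_dim TYPE('n) k} \<times> UNIV)"
  proof (rule has_sum_SigmaI)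
   show "((%j. case (l, j) of (l, j) => u k * s ^ j) has_sum (u k * (1 / (1 - s)))) UNIV" for l
    using has_sum_cmult_right[OF gs, of "u k"] by simp
   show "((%l. u k * (1 / (1 - s))) has_sum (SUM l:{1..harm_dim TYPE('n) k}. u k * (1 / (1 - s)))) {1..harm_dim TYPE('n) k}"
    by (rule has_sum_finite) simp
   show "(%(l, j). u k * s ^ j) summable_on {1..harm_dim TYPE('n) k} \<times> UNIV"
    by (rule summable_on_SigmaI[where g = "%_. u k * (1 / (1 - s))"])
      (use has_sum_cmult_right[OF gs, of "u k"] s in "auto simp: u_def intro: summable_on_finite")
  qed
  then show "((%y. case (k, y) of (k, l, j) => u k * s ^ j) has_sum (real (harm_dim TYPE('n) k) * (u k / (1 - s)))) ({1..harm_dim TYPE('n) k} \<times> UNIV)"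
   by simp
 next
  have "(%k. D * M^2 / (1 - s) * q ^ k) summable_on UNIV"
   using q by (intro summable_on_cmult_right norm_summable_imp_summable_on) (simp add: summable_geometric norm_power)
  then show "(%k. real (harm_dim TYPE('n) k) * (u k / (1 - s))) summable_on UNIV"
  proof (rule summable_on_comparison_test)
   fix k
   have u0: "0 <= u k / (1 - s)" using s by (simp add: u_def)
   show "0 <= real (harm_dim TYPE('n) k) * (u k / (1 - s))" by (rule mult_nonneg_nonneg[OF of_nat_0_le_iff u0])
   have "real (harm_dim TYPE('n) k) * (u k / (1 - s)) <= D / (rh^2)^k * (u k / (1 - s))"
    by (rule mult_right_mono[OF D(2) u0])
   also have "... = D * M^2 / (1 - s) * q ^ k"
    using rh(1) by (simp add: u_def q_def power_divide power_mult[symmetric] field_simps power_add[symmetric])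
   finally show "real (harm_dim TYPE('n) k) * (u k / (1 - s)) <= D * M^2 / (1 - s) * q ^ k" .
  qed
 next
  show "0 <= (case (k, y) of (k, l, j) => u k * s ^ j)" for k and y :: "nat * nat"
   using s by (cases y) (simp add: u_def)
 qed
 then have "(%(k, l, j). u k * s ^ j) summable_on harm_index TYPE('n)" by (simp only: harm_index_Sigma)
 then show ?thesis
 proof (rule summable_on_comparison_test)
  fix i assume i: "i : harm_index TYPE('n)"
  obtain k l j where i': "i = (k, l, j)" "l : {1..harm_dim TYPE('n) k}" using i by (auto simp: harm_index_def)
  have "hsup Y (to_circ i) <= M / rh^k"
   unfolding i' to_circ_def using hsup(2)[OF i'(2)] M(2)[OF i'(2)] by simp
  moreover have "0 <= hsup Y (to_circ i)" by (rule harmonic_sup_nonneg[OF harm_to_circle_in[OF i]])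
  ultimately have "(r ^ hdeg i * hsup Y (to_circ i))^2 <= (r ^ (k + 2*j) * (M / rh^k))^2"
   using r by (intro power_mono mult_mono) (auto simp: i' hdeg_def)
  also have "... = u k * s ^ j"
   using rh(1) by (simp add: u_def s_def power_mult_distrib power_divide power_add power_mult[symmetric] mult_ac)
  finally show "(r ^ hdeg i * hsup Y (to_circ i))^2 <= (case i of (k, l, j) => u k * s ^ j)"
   by (simp add: i')
 qed simp
qed

text \<open>By \<open>a * b <= a^2 + b^2\<close> the square summability of \<open>c\<close>
  suffices, the damping by \<open>r ^ hdeg i\<close> making the sup norms square summable.\<close>

lemma weighted_sup_summable:
 fixes c :: "nat * nat * nat => complex"
 assumes c: "(%i. (cmod (c i))^2) summable_on harm_index TYPE('n)" and r: "0 <= r" "r < 1"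
 shows "(%i. cmod (c i * of_real r ^ hdeg i) * hsup Y (to_circ i)) summable_on harm_index TYPE('n)"
proof (rule summable_on_comparison_test[OF summable_on_add[OF c square_sup_summable[OF r]]])
 fix i assume i: "i : harm_index TYPE('n)"
 have p: "0 <= hsup Y (to_circ i)" by (rule harmonic_sup_nonneg[OF harm_to_circle_in[OF i]])
 then show "0 <= cmod (c i * of_real r ^ hdeg i) * hsup Y (to_circ i)" by simp
 define a b where "a = cmod (c i)" and "b = r ^ hdeg i * hsup Y (to_circ i)"
 have "a * b <= a^2 + b^2"
 proof -
  have "2 * (a * b) <= a^2 + b^2" using zero_le_power2[of "a - b"] by (simp add: power2_eq_square algebra_simps)
  then show ?thesis using zero_le_power2[of a] zero_le_power2[of b] by linarith
 qed
 moreover have "cmod (c i * of_real r ^ hdeg i) * hsup Y (to_circ i) = a * b"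
  using r by (simp only: a_def b_def norm_mult norm_power norm_of_real abs_of_nonneg mult.assoc)
 ultimately show "cmod (c i * of_real r ^ hdeg i) * hsup Y (to_circ i)
   <= (cmod (c i))^2 + (r ^ hdeg i * hsup Y (to_circ i))^2"
  by (simp only: a_def b_def)
qed

definition hseries :: "(nat * nat * nat => complex) => real * (real^'n) => complex" where
 "hseries a x = (\<Sum>\<^sub>\<infinity>i\<in>harm_index TYPE('n). a i * circ_harm Y (to_circ i) x)"

abbreviation sup_summable :: "(nat * nat * nat => complex) => bool" where
 "sup_summable a \<equiv> (%i. cmod (a i) * hsup Y (to_circ i)) summable_on harm_index TYPE('n)"

text \<open>The general facts on bounded orthogonal systems for the circle harmonics. The fifth
  concerns the indices outside the image of \<open>to_circ\<close>, from which the Riesz conditions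
  will come.\<close>

lemma harmonic_series_facts:
 fixes a :: "nat * nat * nat => complex"
 assumes a: "sup_summable a"
 shows "hseries a : bmeas dM"
  and "x : space dM ==> cmod (hseries a x) <= (\<Sum>\<^sub>\<infinity>i\<in>harm_index TYPE('n). cmod (a i) * hsup Y (to_circ i))"
  and "((%i. 2 * pi * (cmod (a i))^2) has_sum (LINT x|dM. (cmod (hseries a x))^2)) (harm_index TYPE('n))"
  and "i : harm_index TYPE('n) ==> (LINT x|dM. hseries a x * cnj (circ_harm Y (to_circ i) x)) = of_real (2 * pi) * a i"
  and "m : circle_harm_index TYPE('n) ==> m ~: to_circ ` harm_index TYPE('n) ==> (LINT x|dM. hseries a x * cnj (circ_harm Y m x)) = 0"
  and "x : space dM ==> ((%i. a i * circ_harm Y (to_circ i) x) has_sum hseries a x) (harm_index TYPE('n))"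
  and "integrable dM h ==> ((%i. a i * (LINT x|dM. circ_harm Y (to_circ i) x * h x)) has_sum (LINT x|dM. hseries a x * h x)) (harm_index TYPE('n))"
proof -
 let ?M = "dM :: (real * (real^'n)) measure"
 note M = finite_circle_sphere[where 'n = 'n]
 have em: "circ_harm Y (to_circ i) : bmeas ?M" if "i : harm_index TYPE('n)" for i
  by (rule circle_harmonic_measurable[OF Y harm_to_circle_in[OF that]])
 have eB: "cmod (circ_harm Y (to_circ i) x) <= hsup Y (to_circ i)" if "i : harm_index TYPE('n)" "x : space ?M" for i x
  by (rule circle_harmonic_bound[OF harm_to_circle_in[OF that(1)] that(2)])
 have B0: "0 <= hsup Y (to_circ i)" if "i : harm_index TYPE('n)" for i
  by (rule harmonic_sup_nonneg[OF harm_to_circle_in[OF that]])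
 have ort: "(LINT x|?M. circ_harm Y (to_circ i) x * cnj (circ_harm Y (to_circ j) x)) = (if i = j then of_real (2 * pi) else 0)"
  if "i : harm_index TYPE('n)" "j : harm_index TYPE('n)" for i j
  using circle_harmonic_orthonormal[OF Y harm_to_circle_in[OF that(1)] harm_to_circle_in[OF that(2)]] inj_eq[OF inj_harm_to_circle] by simp
 show "hseries a : bmeas ?M"
  unfolding hseries_def[abs_def] by (rule bounded_series_measurable[OF M em eB B0 a])
 show "cmod (hseries a x) <= (\<Sum>\<^sub>\<infinity>i\<in>harm_index TYPE('n). cmod (a i) * hsup Y (to_circ i))" if "x : space ?M"
  unfolding hseries_def by (rule bounded_series_bound[OF M em eB B0 a that])
 show "((%i. a i * circ_harm Y (to_circ i) x) has_sum hseries a x) (harm_index TYPE('n))" if "x : space ?M"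
  unfolding hseries_def by (rule has_sum_infsum[OF bounded_series_summable[OF M em eB B0 a that]])
 show hs: "((%i. a i * (LINT x|?M. circ_harm Y (to_circ i) x * h x)) has_sum (LINT x|?M. hseries a x * h x)) (harm_index TYPE('n))"
  if "integrable ?M h" for h
  unfolding hseries_def by (rule bounded_series_integral[OF M em eB B0 a that])
 show "((%i. 2 * pi * (cmod (a i))^2) has_sum (LINT x|?M. (cmod (hseries a x))^2)) (harm_index TYPE('n))"
  unfolding hseries_def by (rule bounded_series_parseval[OF M em eB B0 mult_pos_pos[OF zero_less_numeral pi_gt_zero] ort a])
 show "(LINT x|?M. hseries a x * cnj (circ_harm Y (to_circ i) x)) = of_real (2 * pi) * a i" if "i : harm_index TYPE('n)"
  unfolding hseries_def using bounded_series_coefficient[OF M em eB B0 mult_pos_pos[OF zero_less_numeral pi_gt_zero] ort a that] by simp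
 show "(LINT x|?M. hseries a x * cnj (circ_harm Y m x)) = 0"
  if m: "m : circle_harm_index TYPE('n)" "m ~: to_circ ` harm_index TYPE('n)"
 proof -
  have "integrable ?M (%x. cnj (circ_harm Y m x))"
   by (rule bounded_integrable[OF M _ _ _ borel_measurable_cnj[OF circle_harmonic_measurable[OF Y m(1)]], where J = "{}" and e = undefined and B = undefined and C = "hsup Y m"])
     (use circle_harmonic_bound[OF m(1)] in auto)
  from hs[OF this] have "((%i. a i * (LINT x|?M. circ_harm Y (to_circ i) x * cnj (circ_harm Y m x))) has_sum (LINT x|?M. hseries a x * cnj (circ_harm Y m x))) (harm_index TYPE('n))" .
  moreover have "a i * (LINT x|?M. circ_harm Y (to_circ i) x * cnj (circ_harm Y m x)) = 0" if "i : harm_index TYPE('n)" for i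
   using circle_harmonic_orthonormal[OF Y harm_to_circle_in[OF that] m(1)] m(2) that by auto
  then have "((%i. a i * (LINT x|?M. circ_harm Y (to_circ i) x * cnj (circ_harm Y m x))) has_sum 0) (harm_index TYPE('n))"
   by (rule has_sum_0)
  ultimately show ?thesis by (rule has_sum_unique)
 qed
qed

lemma harmonic_series_square_integrable:
 assumes a: "sup_summable a"
 shows "integrable dM (%x. (cmod (hseries a x))^2)"
proof (rule finite_measure.integrable_const_bound[OF finite_circle_sphere, OF AE_I2])
 fix x :: "real * (real^'n)" assume "x : space dM"
 from power_mono[OF harmonic_series_facts(2)[OF a this] norm_ge_zero, of 2]
 show "norm ((cmod (hseries a x))^2) <= (\<Sum>\<^sub>\<infinity>i\<in>harm_index TYPE('n). cmod (a i) * hsup Y (to_circ i))^2" by simp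
qed (use harmonic_series_facts(1)[OF a] in simp)

lemma sup_summable_power:
 assumes c: "(%i. (cmod (c i))^2) summable_on harm_index TYPE('n)" and r: "0 <= r" "r < 1"
 shows "sup_summable (%i. c i * of_real r ^ hdeg i)"
 by (rule weighted_sup_summable[OF c r])

lemma sup_summable_finite:
 assumes "finite A"
 shows "sup_summable (%i. if i : A then c i else 0)"
proof -
 have "(%i. cmod (if i : A then c i else 0) * hsup Y (to_circ i)) summable_on (harm_index TYPE('n) Int A)"
  using assms by (intro summable_on_finite) auto
 then show ?thesis by (rule summable_on_cong_neutral[THEN iffD1, rotated -1]) auto
qed

lemma sup_summable_diff:
 assumes "sup_summable a" "sup_summable b"
 shows "sup_summable (%i. a i - b i)"
proof (rule summable_on_comparison_test[OF summable_on_add[OF assms]])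
 fix i assume i: "i : harm_index TYPE('n)"
 have p: "0 <= hsup Y (to_circ i)" by (rule harmonic_sup_nonneg[OF harm_to_circle_in[OF i]])
 then show "0 <= cmod (a i - b i) * hsup Y (to_circ i)" by simp
 have "cmod (a i - b i) * hsup Y (to_circ i) <= (cmod (a i) + cmod (b i)) * hsup Y (to_circ i)"
  by (rule mult_right_mono[OF norm_triangle_ineq4 p])
 then show "cmod (a i - b i) * hsup Y (to_circ i) <= cmod (a i) * hsup Y (to_circ i) + cmod (b i) * hsup Y (to_circ i)"
  by (simp add: distrib_right)
qed

lemma harmonic_series_diff:
 assumes "sup_summable a" "sup_summable b" "x : space dM"
 shows "hseries a x - hseries b x = hseries (%i. a i - b i) x"
proof -
 have "((%i. a i * circ_harm Y (to_circ i) x - b i * circ_harm Y (to_circ i) x) has_sum (hseries a x - hseries b x)) (harm_index TYPE('n))"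
 proof -
  have "((%i. - (b i * circ_harm Y (to_circ i) x)) has_sum - hseries b x) (harm_index TYPE('n))"
   using harmonic_series_facts(6)[OF assms(2,3)] by (simp only: has_sum_uminus minus_minus)
  from has_sum_add[OF harmonic_series_facts(6)[OF assms(1,3)] this] show ?thesis by simp
 qed
 then have "((%i. (a i - b i) * circ_harm Y (to_circ i) x) has_sum (hseries a x - hseries b x)) (harm_index TYPE('n))"
  by (simp only: left_diff_distrib)
 then show ?thesis unfolding hseries_def[of "%i. a i - b i"] by (rule infsumI[symmetric])
qed

lemma harmonic_series_finite:
 assumes "finite A" "A <= harm_index TYPE('n)"
 shows "hseries (%i. if i : A then c i else 0) x = (SUM i:A. c i * circ_harm Y (to_circ i) x)"
proof -
 have "hseries (%i. if i : A then c i else 0) x = (\<Sum>\<^sub>\<infinity>i\<in>A. c i * circ_harm Y (to_circ i) x)"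
  unfolding hseries_def by (rule infsum_cong_neutral) (use assms in auto)
 then show ?thesis using assms by simp
qed

end

section \<open>Measurability of radial limits and slices of fixed degree\<close>

lemma rational_near:
 fixes h :: "real => real"
 assumes c: "continuous (at s within {0..<1}) h" and s: "0 <= d" "d < s" "s < 1" and h: "h s > e"
 shows "EX q:\<rat>. d < q & q < 1 & h q > e"
proof -
 have "(h \<longlongrightarrow> h s) (at s within {0..<1})" using c by (simp only: continuous_within)
 from order_tendstoD(1)[OF this h]
 obtain de where de: "de > 0" "!!y. y : {0..<1} ==> y ~= s ==> dist y s < de ==> e < h y"
  unfolding eventually_at by auto
 obtain q where q: "q : \<rat>" "s < q" "q < min 1 (s + de)"
  using Rats_dense_in_real[of s "min 1 (s + de)"] s de by auto
 then have "h q > e" using de(2)[of q] s by (auto simp: dist_real_def)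
 then show ?thesis using q s by (intro bexI[of _ q]) auto
qed

text \<open>Continuity in the radius reduces the Cauchy criterion to countably many conditions on
  rational radii. On the set of convergence the limit is that of a sequence; elsewhere
  \<open>Lim\<close> takes one fixed default value, so it is measurable there too.\<close>

lemma radial_limit_measurable:
 fixes F :: "real => 'a => complex"
 assumes Fm: "!!r. 0 <= r ==> r < 1 ==> F r : bmeas M"
  and Fc: "!!x s. x : space M ==> 0 <= s ==> s < 1 ==> continuous (at s within {0..<1}) (%r. F r x)"
 shows "{x : space M. EX L. ((%r. F r x) \<longlongrightarrow> L) (at_left 1)} : sets M"
  and "(%x. Lim (at_left 1) (%r. F r x)) : bmeas M"
proof -
 obtain r :: "nat => real" where rr: "range r = {q : \<rat>. 0 <= q & q < 1}" by (rule rational_radii)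
 have r: "0 <= r i" "r i < 1" for i using rr by auto
 have [measurable]: "F (r i) : bmeas M" for i by (rule Fm[OF r])
 define d where "d m = 1 - inverse (real (Suc m))" for m
 have d: "0 <= d m" "d m < 1" for m by (auto simp: d_def field_simps)
 define E where "E = {x : space M. EX L. ((%r. F r x) \<longlongrightarrow> L) (at_left 1)}"
 have Eeq: "E = {x : space M. ALL n. EX m. ALL i j. d m < r i --> d m < r j --> cmod (F (r i) x - F (r j) x) <= inverse (real (Suc n))}"
 proof (intro equalityI subsetI)
  fix x assume "x : E"
  then obtain L where x: "x : space M" and L: "((%r. F r x) \<longlongrightarrow> L) (at_left 1)" by (auto simp: E_def)
  have "EX m. ALL i j. d m < r i --> d m < r j --> cmod (F (r i) x - F (r j) x) <= inverse (real (Suc n))" for n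
  proof -
   have "eventually (%r. dist (F r x) L < inverse (real (Suc n)) / 2) (at_left 1)" by (rule tendstoD[OF L]) simp
   then obtain b where b: "b < 1" "!!s. b < s ==> s < 1 ==> dist (F s x) L < inverse (real (Suc n)) / 2"
    unfolding eventually_at_left_field by auto
   obtain m where m: "inverse (real (Suc m)) < 1 - b" using reals_Archimedean[of "1 - b"] b(1) by auto
   show ?thesis
   proof (intro exI[of _ m] allI impI)
    fix i j assume "d m < r i" "d m < r j"
    then have "b < r i" "b < r j" using m by (auto simp: d_def)
    then have "dist (F (r i) x) L < inverse (real (Suc n)) / 2" "dist (F (r j) x) L < inverse (real (Suc n)) / 2" using b(2) r(2) by blast+
    then have "dist (F (r i) x) (F (r j) x) < inverse (real (Suc n))" by (rule dist_triangle_half_l)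
    then show "cmod (F (r i) x - F (r j) x) <= inverse (real (Suc n))" by (simp add: dist_norm del: of_nat_Suc)
   qed
  qed
  then show "x : {x : space M. ALL n. EX m. ALL i j. d m < r i --> d m < r j --> cmod (F (r i) x - F (r j) x) <= inverse (real (Suc n))}"
   using x by blast
 next
  fix x assume "x : {x : space M. ALL n. EX m. ALL i j. d m < r i --> d m < r j --> cmod (F (r i) x - F (r j) x) <= inverse (real (Suc n))}"
  then have x: "x : space M" and a: "!!n. EX m. ALL i j. d m < r i --> d m < r j --> cmod (F (r i) x - F (r j) x) <= inverse (real (Suc n))" by auto
  have "EX L. ((%r. F r x) \<longlongrightarrow> L) (at_left 1)"
  proof (rule convergent_at_left_if_Cauchy)
   fix e :: real assume "e > 0"
   then obtain n where n: "inverse (real (Suc n)) < e" using reals_Archimedean by blast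
   obtain m where m: "ALL i j. d m < r i --> d m < r j --> cmod (F (r i) x - F (r j) x) <= inverse (real (Suc n))" using a[of n] by blast
   have q: "cmod (F q x - F q' x) <= e" if "q : \<rat>" "d m < q" "q < 1" "q' : \<rat>" "d m < q'" "q' < 1" for q q'
   proof -
    have "q : range r" "q' : range r" unfolding rr using that d(1)[of m] by auto
    then obtain i j where "q = r i" "q' = r j" by auto
    then have "cmod (F q x - F q' x) <= inverse (real (Suc n))" using m that by blast
    then show ?thesis using n by linarith
   qed
   have "cmod (F s x - F t x) <= e" if s: "d m < s" "s < 1" and t: "d m < t" "t < 1" for s t
   proof (rule ccontr)
    assume "\<not> ?thesis"
    then have h: "cmod (F s x - F t x) > e" by simp
    have s0: "0 <= s" and t0: "0 <= t" using s t d(1)[of m] by linarith+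
    have "continuous (at s within {0..<1}) (%s. cmod (F s x - F t x))"
     by (intro continuous_intros Fc x s0 s(2))
    from rational_near[OF this d(1)[of m] s h] obtain q' where q': "q' : \<rat>" "d m < q'" "q' < 1" "cmod (F q' x - F t x) > e" by blast
    have "continuous (at t within {0..<1}) (%t. cmod (F q' x - F t x))"
     by (intro continuous_intros Fc x t0 t(2))
    from rational_near[OF this d(1)[of m] t q'(4)] obtain q'' where "q'' : \<rat>" "d m < q''" "q'' < 1" "cmod (F q' x - F q'' x) > e" by blast
    with q[OF q'(1-3) this(1-3)] show False by linarith
   qed
   then show "\<exists>d<1. ALL s t. d < s --> s < 1 --> d < t --> t < 1 --> cmod (F s x - F t x) <= e" using d(2)[of m] by blast
  qed
  then show "x : E" using x by (simp add: E_def)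
 qed
 show Em: "{x : space M. EX L. ((%r. F r x) \<longlongrightarrow> L) (at_left 1)} : sets M"
  unfolding E_def[symmetric] Eeq by measurable
 have xl: "filterlim d (at_left 1) sequentially"
 proof -
  have "d \<longlonglongrightarrow> 1" unfolding d_def[abs_def] using tendsto_diff[OF tendsto_const LIMSEQ_inverse_real_of_nat, of 1] by simp
  then show ?thesis unfolding filterlim_at using d(2) by (auto intro!: always_eventually simp: less_imp_neq)
 qed
 have dm: "F (d n) : bmeas M" for n by (rule Fm[OF d])
 have "(%x. if x : E then lim (%n. F (d n) x) else (THE l. False)) : bmeas M"
  using Em dm unfolding E_def[symmetric] by measurable
 moreover have "Lim (at_left 1) (%r. F r x) = (if x : E then lim (%n. F (d n) x) else (THE l. False))" if "x : space M" for x
 proof (cases "x : E")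
  case True
  then obtain L where L: "((%r. F r x) \<longlongrightarrow> L) (at_left 1)" by (auto simp: E_def)
  have "Lim (at_left 1) (%r. F r x) = L" by (rule tendsto_Lim[OF _ L]) simp
  moreover have "lim (%n. F (d n) x) = L" by (rule limI[OF filterlim_compose[OF L xl]])
  ultimately show ?thesis using True by simp
 next
  case False
  then have n: "((%r. F r x) \<longlongrightarrow> l) (at_left 1) = False" for l using that by (auto simp: E_def)
  have "Lim (at_left 1) (%r. F r x) = (THE l. False)" by (simp only: Topological_Spaces.Lim_def n)
  then show ?thesis using False by simp
 qed
 ultimately show "(%x. Lim (at_left 1) (%r. F r x)) : bmeas M"
  by (subst measurable_cong) auto
qed

lemma finite_degree_fibre: "finite {i : harm_index TYPE('n::finite). hdeg i = m}"
proof (rule finite_subset)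
 show "{i : harm_index TYPE('n). hdeg i = m} <= (SIGMA k:{..m}. {1..harm_dim TYPE('n) k} \<times> {..m})"
  by (auto simp: harm_index_def hdeg_def)
qed auto

text \<open>Only finitely many indices share a total degree. The regrouping yields a power series in
  \<open>z\<close> at each fixed point of the sphere.\<close>

lemma has_sum_by_degree:
 fixes f :: "nat * nat * nat => 'a::{topological_comm_monoid_add, t3_space}"
 assumes "(f has_sum S) (harm_index TYPE('n::finite))"
 shows "((%m. SUM i:{i : harm_index TYPE('n). hdeg i = m}. f i) has_sum S) UNIV"
proof -
 let ?B = "%m. {i : harm_index TYPE('n). hdeg i = m}"
 have "inj_on snd (Sigma UNIV ?B)" by (auto simp: inj_on_def)
 moreover have "snd ` Sigma UNIV ?B = harm_index TYPE('n)" by force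
 ultimately have "((f \<circ> snd) has_sum S) (Sigma UNIV ?B)" using has_sum_reindex[of snd "Sigma UNIV ?B" f S] assms by simp
 then show ?thesis
  by (rule has_sum_SigmaD) (auto intro!: has_sum_finite finite_degree_fibre)
qed

context
 fixes Y :: "nat => nat => real^'n => complex"
 assumes Y: "orthonormal_harmonics Y"
begin

lemma power_expansion_radial:
 assumes pe: "power_expansion Y f c" and r: "0 <= r" "r < 1" and x: "x : space dM"
 shows "f (kd_point (of_real r * cis (fst x)) (snd x)) = hseries Y (%i. (%(k, l, j). c k l j) i * of_real r ^ hdeg i) x"
proof -
 have "((%(k, l, j). c k l j * (of_real r * cis (fst x)) ^ (k + 2*j) * Y k l (snd x)) has_sum f (kd_point (of_real r * cis (fst x)) (snd x))) (harm_index TYPE('n))"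
  using pe x r unfolding power_expansion_def by (auto simp: space_circle_sphere norm_mult)
 moreover have "(%(k, l, j). c k l j * (of_real r * cis (fst x)) ^ (k + 2*j) * Y k l (snd x))
   = (%i. (%(k, l, j). c k l j) i * of_real r ^ hdeg i * circ_harm Y (to_circ i) x)"
  by (auto simp: fun_eq_iff hdeg_def to_circ_def circ_harm_def power_mult_distrib Complex.DeMoivre)
 ultimately show ?thesis unfolding hseries_def[OF Y] by (simp only: infsumI)
qed

context
 fixes c :: "nat * nat * nat => complex"
 assumes sq: "(%i. (cmod (c i))^2) summable_on harm_index TYPE('n)"
begin

text \<open>The Taylor coefficient of order \<open>m\<close> in \<open>z\<close>, at a fixed point
  of the sphere, of the series with coefficients \<open>c\<close>.\<close>

definition hslice :: "nat => real^'n => complex" where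
 "hslice m te = (SUM i:{i : harm_index TYPE('n). hdeg i = m}. c i * (case i of (k, l, j) => Y k l te))"

abbreviation "rseries r \<equiv> hseries Y (%i. c i * of_real r ^ hdeg i)"

lemma radial_series_slices_has_sum:
 assumes r: "0 <= r" "r < 1" and ph: "ph : {0..2*pi}" and te: "norm te = 1"
 shows "((%m. hslice m te * (of_real r ^ m * cis (of_int (int m) * ph))) has_sum rseries r (ph, te)) UNIV"
proof -
 have "((%i. c i * of_real r ^ hdeg i * circ_harm Y (to_circ i) (ph, te)) has_sum rseries r (ph, te)) (harm_index TYPE('n))"
  by (rule harmonic_series_facts(6)[OF Y sup_summable_power[OF Y sq r]]) (use ph te in "simp add: space_circle_sphere")
 from has_sum_by_degree[OF this]
 have "((%m. SUM i:{i : harm_index TYPE('n). hdeg i = m}. c i * of_real r ^ hdeg i * circ_harm Y (to_circ i) (ph, te)) has_sum rseries r (ph, te)) UNIV" .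
 moreover have "(SUM i:{i : harm_index TYPE('n). hdeg i = m}. c i * of_real r ^ hdeg i * circ_harm Y (to_circ i) (ph, te))
   = hslice m te * (of_real r ^ m * cis (of_int (int m) * ph))" for m
  unfolding hslice_def sum_distrib_right
  by (rule sum.cong) (auto simp: hdeg_def to_circ_def circ_harm_def)
 ultimately show ?thesis by simp
qed

lemma radial_series_slices:
 assumes r: "0 <= r" "r < 1" and ph: "ph : {0..2*pi}" and te: "norm te = 1"
 shows "rseries r (ph, te) = cseries (%m. hslice m te) r ph"
 unfolding cseries_def by (rule infsumI[OF radial_series_slices_has_sum[OF assms], symmetric])

text \<open>Indices of equal degree with equal \<open>k\<close> and \<open>l\<close> coincide, so
  the harmonics in one slice are orthonormal and its squared norm is the sum of its
  \<open>(cmod (c i))^2\<close>. Summed over \<open>m\<close> this gives a function of finite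
  integral, hence finite almost everywhere.\<close>

lemma slices_square_summable: "AE te in dS. summable (%m. (cmod (hslice m te))^2)"
proof -
 let ?B = "%m. {i : harm_index TYPE('n). hdeg i = m}"
 let ?e = "%i. case i of (k, l, j) => Y k l"
 have em: "?e i : bmeas dS" if "i : harm_index TYPE('n)" for i
  using that Y_measurable[OF Y] by (auto simp: harm_index_def)
 have sm: "hslice m : bmeas dS" for m
 proof -
  have "(%te. SUM i:?B m. c i * ?e i te) : bmeas dS"
   by (intro borel_measurable_sum borel_measurable_times borel_measurable_const em) auto
  moreover have "hslice m = (%te. SUM i:?B m. c i * ?e i te)"
   by (auto simp: hslice_def fun_eq_iff intro!: sum.cong)
  ultimately show ?thesis by simp
 qed
 have norm: "(\<integral>\<^sup>+te. ennreal ((cmod (hslice m te))^2) \<partial>dS) = ennreal (SUM i:?B m. (cmod (c i))^2)" for m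
 proof -
  have "((%i. 1 * (cmod (c i))^2) has_sum (LINT te|dS. (cmod (\<Sum>\<^sub>\<infinity>i\<in>?B m. c i * ?e i te))^2)) (?B m)"
  proof (rule bounded_series_parseval[OF finite_sphere_measure, where B = "%i. hsup Y (to_circ i)"])
   show "cmod (?e i te) <= hsup Y (to_circ i)" if "i : ?B m" "te : space dS" for i te
    using that hsup(1)[OF Y] by (auto simp: harm_index_def to_circ_def)
   show "0 <= hsup Y (to_circ i)" if "i : ?B m" for i
    using harmonic_sup_nonneg[OF Y harm_to_circle_in] that by blast
   show "(LINT te|dS. ?e i te * cnj (?e j te)) = (if i = j then complex_of_real 1 else 0)" if "i : ?B m" "j : ?B m" for i j
   proof -
    obtain k l a k' l' a' where ij: "i = (k, l, a)" "j = (k', l', a')" by (cases i, cases j)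
    have e: "l : {1..harm_dim TYPE('n) k}" "l' : {1..harm_dim TYPE('n) k'}" "k + 2 * a = k' + 2 * a'"
     using that unfolding ij by (auto simp: harm_index_def hdeg_def)
    show ?thesis unfolding ij using Y_orthonormal[OF Y e(1,2)] e(3) by auto
   qed
   show "(%i. cmod (c i) * hsup Y (to_circ i)) summable_on ?B m"
    by (rule summable_on_finite[OF finite_degree_fibre])
  qed (use em in auto)
  moreover have "(\<Sum>\<^sub>\<infinity>i\<in>?B m. c i * ?e i te) = hslice m te" for te
   using finite_degree_fibre[where 'n = 'n, of m] by (simp add: hslice_def) (auto intro!: sum.cong)
  ultimately have hs: "((%i. (cmod (c i))^2) has_sum (LINT te|dS. (cmod (hslice m te))^2)) (?B m)" by simp
  have eq: "(LINT te|dS. (cmod (hslice m te))^2) = (SUM i:?B m. (cmod (c i))^2)"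
   using infsumI[OF hs] infsum_finite[OF finite_degree_fibre[where 'n = 'n, of m], of "%i. (cmod (c i))^2"] by simp
  have "integrable dS (%te. (cmod (hslice m te))^2)"
  proof (rule finite_measure.integrable_const_bound[OF finite_sphere_measure, where B = "(SUM i:?B m. cmod (c i) * hsup Y (to_circ i))^2"])
   show "AE te in dS. norm ((cmod (hslice m te))^2) <= (SUM i:?B m. cmod (c i) * hsup Y (to_circ i))^2"
   proof (rule AE_I2)
    fix te assume "te : space (dS :: (real^'n) measure)"
    then have te: "norm te = 1" by simp
    have "cmod (hslice m te) <= (SUM i:?B m. cmod (c i) * hsup Y (to_circ i))"
     unfolding hslice_def
     by (rule sum_norm_le)
       (use te hsup(1)[OF Y] in "auto simp: norm_mult harm_index_def to_circ_def intro!: mult_left_mono")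
    then show "norm ((cmod (hslice m te))^2) <= (SUM i:?B m. cmod (c i) * hsup Y (to_circ i))^2"
     by (simp add: power_mono)
   qed
  qed (use sm in simp)
  from nn_integral_eq_integral[OF this] show ?thesis by (simp add: eq)
 qed
 have hs: "((%m. SUM i:?B m. (cmod (c i))^2) has_sum (\<Sum>\<^sub>\<infinity>i\<in>harm_index TYPE('n). (cmod (c i))^2)) UNIV"
  by (rule has_sum_by_degree[OF has_sum_infsum[OF sq]])
 then have "summable (%m. SUM i:?B m. (cmod (c i))^2)" using has_sum_imp_sums sums_summable by blast
 then have fin: "(\<Sum>m. ennreal (SUM i:?B m. (cmod (c i))^2)) ~= top" by (intro ennreal_suminf_neq_top) (auto intro: sum_nonneg)
 have "(\<integral>\<^sup>+te. (\<Sum>m. ennreal ((cmod (hslice m te))^2)) \<partial>dS) = (\<Sum>m. ennreal (SUM i:?B m. (cmod (c i))^2))"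
  by (subst nn_integral_suminf) (use sm norm in auto)
 then have "AE te in dS. (\<Sum>m. ennreal ((cmod (hslice m te))^2)) ~= \<infinity>"
  using fin sm by (intro nn_integral_noteq_infinite) auto
 then show ?thesis
  by eventually_elim (rule summable_suminf_not_top, auto)
qed

end

end

section \<open>The radial limit of a square summable series\<close>

context
 fixes Y :: "nat => nat => real^'n => complex" and c :: "nat * nat * nat => complex"
 assumes Y: "orthonormal_harmonics Y"
  and sq: "(%i. (cmod (c i))^2) summable_on harm_index TYPE('n)"
begin

lemma radial_series_continuous:
 assumes x: "x : space dM" and s: "0 <= s" "s < 1"
 shows "continuous (at s within {0..<1}) (%r. rseries Y c r x)"
proof -
 obtain ph te where x': "x = (ph, te)" "ph : {0..2*pi}" "norm te = 1" using x by (cases x) (auto simp: space_circle_sphere)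
 define b where "b = (%m. hslice Y c m te)"
 have bs: "(%m. b m * (of_real r * cis ph) ^ m) sums rseries Y c r x" if "0 <= r" "r < 1" for r
 proof -
  have "((%m. b m * (of_real r ^ m * cis (of_int (int m) * ph))) has_sum rseries Y c r x) UNIV"
   unfolding x' b_def by (rule radial_series_slices_has_sum[OF Y sq that x'(2,3)])
  from has_sum_imp_sums[OF this] show ?thesis by (simp add: power_mult_distrib Complex.DeMoivre)
 qed
 define K where "K = (1 + s) / 2"
 have K: "0 <= K" "K < 1" "s < K" using s by (auto simp: K_def)
 have "summable (%m. b m * (of_real K * cis ph) ^ m)" using bs[OF K(1,2)] by (simp add: sums_iff)
 then have "isCont (%z. \<Sum>m. b m * z ^ m) (of_real s * cis ph)"
  by (rule isCont_powser) (use s K in "simp add: norm_mult")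
 then have "((%s. \<Sum>m. b m * (of_real s * cis ph) ^ m) \<longlongrightarrow> (\<Sum>m. b m * (of_real s * cis ph) ^ m)) (at s within {0..<1})"
  by (rule isCont_tendsto_compose) (intro tendsto_intros)
 then have "continuous (at s within {0..<1}) (%s. \<Sum>m. b m * (of_real s * cis ph) ^ m)"
  by (simp only: continuous_within)
 then show ?thesis
  by (rule continuous_transform_within[OF _ zero_less_one]) (use bs s in "auto simp: sums_iff")
qed

lemma radial_series_measurable: "0 <= r ==> r < 1 ==> rseries Y c r : bmeas dM"
 by (rule harmonic_series_facts(1)[OF Y sup_summable_power[OF Y sq]])

definition radial_limit :: "real * (real^'n) => complex" where
 "radial_limit x = Lim (at_left 1) (%r. rseries Y c r x)"

lemma radial_limit_measurable': "radial_limit : bmeas dM"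
 unfolding radial_limit_def[abs_def]
 by (rule radial_limit_measurable(2)) (use radial_series_measurable radial_series_continuous in auto)

text \<open>The theorem on the disc gives almost every angle for almost every point of the sphere.
  Measurability of the set of convergence allows the two quantifiers to be exchanged and then merged
  in the product measure.\<close>

lemma AE_radial_limit: "AE x in dM. ((%r. rseries Y c r x) \<longlongrightarrow> radial_limit x) (at_left 1)"
proof -
 let ?P = "%ph te. EX L. ((%r. rseries Y c r (ph, te)) \<longlongrightarrow> L) (at_left 1)"
 interpret P: pair_sigma_finite dA "dS :: (real^'n) measure" by (rule pair_sigma_finite_circle_sphere)
 have m: "{x : space dM. ?P (fst x) (snd x)} : sets dM"
  using radial_limit_measurable(1)[of "rseries Y c" dM, OF radial_series_measurable radial_series_continuous]
  by simp
 have "AE te in dS. AE ph in dA. ?P ph te"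
 proof (rule AE_mp[OF slices_square_summable[OF Y sq]], rule AE_I2, rule impI)
  fix te :: "real^'n" assume "te : space dS" and s: "summable (%m. (cmod (hslice Y c m te))^2)"
  then have te: "norm te = 1" by simp
  show "AE ph in dA. ?P ph te"
  proof (rule AE_mp[OF circle_series_radial_limit[OF s]], rule AE_I2, rule impI)
   fix ph assume "ph : space dA" and "EX L. ((%r. cseries (%m. hslice Y c m te) r ph) \<longlongrightarrow> L) (at_left 1)"
   then obtain L where L: "((%r. cseries (%m. hslice Y c m te) r ph) \<longlongrightarrow> L) (at_left 1)" and ph: "ph : {0..2*pi}" by auto
   have "\<forall>\<^sub>F r in at_left 1. cseries (%m. hslice Y c m te) r ph = rseries Y c r (ph, te)"
    unfolding eventually_at_left_field
    by (intro exI[of _ 0]) (use radial_series_slices[OF Y sq _ _ ph te] in auto)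
   from tendsto_cong[OF this] L show "?P ph te" by blast
  qed
 qed
 then have "AE ph in dA. AE te in dS. ?P ph te"
  using P.AE_commute[of ?P] m unfolding circle_sphere_measure_def by blast
 then have "AE x in dM. ?P (fst x) (snd x)"
  unfolding circle_sphere_measure_def
  by (intro P.AE_pair_measure) (use m in "simp_all add: circle_sphere_measure_def")
 then show ?thesis
 proof eventually_elim
  case (elim x)
  then obtain L where L: "((%r. rseries Y c r x) \<longlongrightarrow> L) (at_left 1)" by auto
  have "radial_limit x = L" unfolding radial_limit_def by (rule tendsto_Lim[OF _ L]) simp
  then show ?case using L by simp
 qed
qed

text \<open>The squared distance between \<open>c\<close> and its damped version
  \<open>c i * s ^ hdeg i\<close> in the space of square summable families.\<close>

definition abel_defect :: "real => real" where
 "abel_defect s = (\<Sum>\<^sub>\<infinity>i\<in>harm_index TYPE('n). (cmod (c i))^2 * (1 - s ^ hdeg i)^2)"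

lemma weighted_square_summable:
 assumes t: "!!i. 0 <= t i" "!!i. t i <= (1::real)"
 shows "(%i. (cmod (c i))^2 * (1 - t i)^2) summable_on harm_index TYPE('n)"
proof (rule summable_on_comparison_test[OF sq])
 fix i
 have "(1 - t i)^2 <= 1^2" by (rule power_mono) (use t[of i] in auto)
 then show "(cmod (c i))^2 * (1 - t i)^2 <= (cmod (c i))^2" by (simp add: mult_left_le)
qed simp

text \<open>The terms outside a finite set are small uniformly in \<open>s\<close>, and each
  remaining term tends to 0.\<close>

lemma abel_defect_tendsto: "(abel_defect \<longlongrightarrow> 0) (at_left 1)"
proof (rule tendstoI)
 fix ep :: real assume e: "ep > 0"
 let ?I = "harm_index TYPE('n)"
 have sm: "(%i. cmod (of_real ((cmod (c i))^2)) * 1) summable_on ?I" using sq by (simp only: norm_of_real abs_power2 mult_1_right)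
 obtain A where A: "finite A" "A <= ?I" and ap:
  "!!s::real. (ALL i:?I. cmod (of_real ((1 - s ^ hdeg i)^2)) <= 1) ==>
    cmod ((\<Sum>\<^sub>\<infinity>i\<in>?I. of_real ((cmod (c i))^2) * of_real ((1 - s ^ hdeg i)^2)) - (SUM i:A. of_real ((cmod (c i))^2) * of_real ((1 - s ^ hdeg i)^2))) <= ep / 2"
 proof -
  from uniform_series_approx[OF sm half_gt_zero[OF e], of "%i (s::real). of_real ((1 - s ^ hdeg i)^2)"]
  obtain F0 where F0: "finite F0" "F0 <= ?I" and
   all: "ALL F s. finite F --> F0 <= F --> F <= ?I --> (ALL i:?I. cmod (of_real ((1 - s ^ hdeg i)^2)) <= 1) -->
    cmod ((\<Sum>\<^sub>\<infinity>i\<in>?I. of_real ((cmod (c i))^2) * of_real ((1 - s ^ hdeg i)^2)) - (SUM i:F. of_real ((cmod (c i))^2) * of_real ((1 - s ^ hdeg i)^2))) <= ep / 2"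
   by (elim exE conjE)
  show ?thesis by (rule that[OF F0]) (rule all[rule_format, OF F0(1) order_refl F0(2)], blast)
 qed
 have "((%s. SUM i:A. (cmod (c i))^2 * (1 - s ^ hdeg i)^2) \<longlongrightarrow> (SUM i:A. (cmod (c i))^2 * (1 - 1 ^ hdeg i)^2)) (at_left (1::real))"
  by (intro tendsto_intros)
 then have "((%s. SUM i:A. (cmod (c i))^2 * (1 - s ^ hdeg i)^2) \<longlongrightarrow> 0) (at_left (1::real))" by simp
 from tendstoD[OF this, of "ep / 2"] e
 have "\<forall>\<^sub>F s in at_left (1::real). \<bar>SUM i:A. (cmod (c i))^2 * (1 - s ^ hdeg i)^2\<bar> < ep / 2" by simp
 moreover have "\<forall>\<^sub>F s in at_left (1::real). 0 < s & s < 1"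
  unfolding eventually_at_left_field by (intro exI[of _ 0]) auto
 ultimately show "\<forall>\<^sub>F s in at_left 1. dist (abel_defect s) 0 < ep"
 proof eventually_elim
  case (elim s)
  have "(1 - s ^ m)^2 <= 1" for m
   using elim power_le_one[of s m] zero_le_power[of s m] power_mono[of "1 - s ^ m" 1 2] by simp
  then have "cmod ((\<Sum>\<^sub>\<infinity>i\<in>?I. of_real ((cmod (c i))^2) * of_real ((1 - s ^ hdeg i)^2)) - (SUM i:A. of_real ((cmod (c i))^2) * of_real ((1 - s ^ hdeg i)^2))) <= ep / 2"
   by (intro ap) (simp only: norm_of_real, simp)
  moreover have "(\<Sum>\<^sub>\<infinity>i\<in>?I. of_real ((cmod (c i))^2) * of_real ((1 - s ^ hdeg i)^2)) = complex_of_real (abel_defect s)"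
   unfolding abel_defect_def of_real_mult[symmetric] by (rule infsumI[OF has_sum_bounded_linear[OF bounded_linear_of_real has_sum_infsum[OF weighted_square_summable]]])
     (use elim power_le_one[of s] in auto)
  ultimately have "cmod (of_real (abel_defect s - (SUM i:A. (cmod (c i))^2 * (1 - s ^ hdeg i)^2))) <= ep / 2"
   by (simp only: of_real_diff of_real_sum of_real_mult)
  then show ?case using elim by (simp only: norm_of_real dist_real_def)
 qed
qed

text \<open>The damping \<open>t\<close> is left general: \<open>0\<close>,
  \<open>r ^ hdeg i\<close> and the indicator of a finite set will give the norm bound, the mean
  square convergence and the partial sums. Fatou's lemma along the radii \<open>d n\<close> passes
  from Parseval's identity for differences of dilations to the limit.\<close>

lemma radial_limit_approx:
 assumes t: "!!i. 0 <= t i" "!!i. t i <= (1::real)" and ts: "sup_summable Y (%i. c i * of_real (t i))"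
 shows "(\<integral>\<^sup>+x. ennreal ((cmod (radial_limit x - hseries Y (%i. c i * of_real (t i)) x))^2) \<partial>dM)
   <= ennreal (2 * pi * (\<Sum>\<^sub>\<infinity>i\<in>harm_index TYPE('n). (cmod (c i))^2 * (1 - t i)^2))"
proof -
 let ?M = "dM :: (real * (real^'n)) measure" and ?I = "harm_index TYPE('n)"
 let ?h = "hseries Y (%i. c i * of_real (t i))"
 define T where "T = (\<Sum>\<^sub>\<infinity>i\<in>?I. (cmod (c i))^2 * (1 - t i)^2)"
 define d where "d n = 1 - inverse (real (Suc n))" for n
 have d: "0 <= d n" "d n < 1" for n by (auto simp: d_def field_simps)
 have dl: "filterlim d (at_left 1) sequentially"
 proof -
  have "d \<longlonglongrightarrow> 1" unfolding d_def[abs_def] using tendsto_diff[OF tendsto_const LIMSEQ_inverse_real_of_nat, of 1] by simp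
  then show ?thesis unfolding filterlim_at using d(2) by (auto intro!: always_eventually simp: less_imp_neq)
 qed
 define u where "u n x = ennreal ((cmod (rseries Y c (d n) x - ?h x))^2)" for n x
 have hm: "?h : bmeas ?M" by (rule harmonic_series_facts(1)[OF Y ts])
 have um: "u n : bmeas ?M" for n
  unfolding u_def[abs_def] using hm radial_series_measurable[OF d] by measurable
 have bound: "(\<integral>\<^sup>+x. u n x \<partial>?M) <= ennreal (2 * pi * (T + abel_defect (d n)))" for n
 proof -
  let ?a = "%i. c i * of_real (d n) ^ hdeg i - c i * of_real (t i)"
  have as: "sup_summable Y ?a" by (rule sup_summable_diff[OF Y sup_summable_power[OF Y sq d] ts])
  have eq: "rseries Y c (d n) x - ?h x = hseries Y ?a x" if "x : space ?M" for x
   by (rule harmonic_series_diff[OF Y sup_summable_power[OF Y sq d] ts that])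
  have "((%i. 2 * pi * (cmod (?a i))^2) has_sum (LINT x|?M. (cmod (hseries Y ?a x))^2)) ?I"
   by (rule harmonic_series_facts(3)[OF Y as])
  moreover have "((%i. 2 * pi * ((cmod (c i))^2 * (1 - t i)^2 + (cmod (c i))^2 * (1 - d n ^ hdeg i)^2)) has_sum (2 * pi * (T + abel_defect (d n)))) ?I"
   unfolding T_def abel_defect_def
   by (intro has_sum_cmult_right has_sum_add has_sum_infsum weighted_square_summable t)
     (use d[of n] power_le_one[of "d n"] in auto)
  ultimately have le: "(LINT x|?M. (cmod (hseries Y ?a x))^2) <= 2 * pi * (T + abel_defect (d n))"
  proof (rule has_sum_mono)
   fix i
   define p where "p = d n ^ hdeg i"
   have p: "0 <= p" "p <= 1" using d[of n] by (auto simp: p_def power_le_one)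
   \<comment> \<open>Both numbers lie in the unit interval, so their distance is at most the larger
     of their distances from 1.\<close>
   have "(p - t i)^2 <= (1 - t i)^2 + (1 - p)^2"
   proof (cases "p <= t i")
    case True
    then have "(p - t i)^2 <= (1 - p)^2" using p t[of i] by (intro power2_le_iff_abs_le[THEN iffD2]) auto
    then show ?thesis using zero_le_power2[of "1 - t i"] by linarith
   next
    case False
    then have "(p - t i)^2 <= (1 - t i)^2" using p t[of i] by (intro power_mono) auto
    then show ?thesis using zero_le_power2[of "1 - p"] by linarith
   qed
   moreover have "?a i = c i * of_real (p - t i)" by (simp add: p_def algebra_simps)
   then have "(cmod (?a i))^2 = (cmod (c i))^2 * (p - t i)^2" by (simp only: norm_mult norm_of_real power_mult_distrib power2_abs)
   ultimately have "(cmod (?a i))^2 <= (cmod (c i))^2 * ((1 - t i)^2 + (1 - p)^2)" by (simp only: mult_left_mono zero_le_power2)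
   then have "(cmod (?a i))^2 <= (cmod (c i))^2 * (1 - t i)^2 + (cmod (c i))^2 * (1 - d n ^ hdeg i)^2"
    by (simp only: p_def distrib_left)
   then show "2 * pi * (cmod (?a i))^2 <= 2 * pi * ((cmod (c i))^2 * (1 - t i)^2 + (cmod (c i))^2 * (1 - d n ^ hdeg i)^2)"
    by (rule mult_left_mono) simp
  qed
  have "integrable ?M (%x. (cmod (hseries Y ?a x))^2)"
   by (rule harmonic_series_square_integrable[OF Y as])
  from nn_integral_eq_integral[OF this]
  have "(\<integral>\<^sup>+x. u n x \<partial>?M) = ennreal (LINT x|?M. (cmod (hseries Y ?a x))^2)"
   unfolding u_def using eq by (simp cong: nn_integral_cong)
  then show ?thesis using le by (simp add: ennreal_leI)
 qed
 have "AE x in ?M. ennreal ((cmod (radial_limit x - ?h x))^2) = liminf (%n. u n x)"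
  using AE_radial_limit
 proof eventually_elim
  case (elim x)
  have "(%n. u n x) \<longlonglongrightarrow> ennreal ((cmod (radial_limit x - ?h x))^2)"
   unfolding u_def by (intro tendsto_intros tendsto_ennrealI filterlim_compose[OF elim dl])
  then show ?case by (rule lim_imp_Liminf[OF sequentially_bot, symmetric])
 qed
 then have "(\<integral>\<^sup>+x. ennreal ((cmod (radial_limit x - ?h x))^2) \<partial>?M) = (\<integral>\<^sup>+x. liminf (%n. u n x) \<partial>?M)"
  by (rule nn_integral_cong_AE)
 also have "... <= liminf (%n. \<integral>\<^sup>+x. u n x \<partial>?M)" by (rule nn_integral_liminf[OF um])
 also have "... <= liminf (%n. ennreal (2 * pi * (T + abel_defect (d n))))"
  by (rule Liminf_mono) (use bound in simp)
 also have "... = ennreal (2 * pi * (T + 0))"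
  by (rule lim_imp_Liminf[OF sequentially_bot]) (intro tendsto_intros tendsto_ennrealI filterlim_compose[OF abel_defect_tendsto dl])
 finally show ?thesis by (simp add: T_def)
qed

lemma radial_limit_L2:
 assumes t: "!!i. 0 <= t i" "!!i. t i <= (1::real)" and ts: "sup_summable Y (%i. c i * of_real (t i))"
 shows "integrable dM (%x. (cmod (radial_limit x - hseries Y (%i. c i * of_real (t i)) x))^2)"
  and "(LINT x|dM. (cmod (radial_limit x - hseries Y (%i. c i * of_real (t i)) x))^2)
   <= 2 * pi * (\<Sum>\<^sub>\<infinity>i\<in>harm_index TYPE('n). (cmod (c i))^2 * (1 - t i)^2)"
proof -
 let ?M = "dM :: (real * (real^'n)) measure"
 let ?h = "hseries Y (%i. c i * of_real (t i))"
 have m: "(%x. (cmod (radial_limit x - ?h x))^2) : bmeas ?M"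
  using radial_limit_measurable' harmonic_series_facts(1)[OF Y ts] by measurable
 have n: "(\<integral>\<^sup>+x. ennreal ((cmod (radial_limit x - ?h x))^2) \<partial>?M) ~= \<infinity>"
  using radial_limit_approx[OF t ts] by (auto simp: top_unique)
 show i: "integrable ?M (%x. (cmod (radial_limit x - ?h x))^2)"
  by (rule integrableI_nonneg[OF m]) (use n in "auto simp: less_top")
 have "ennreal (LINT x|?M. (cmod (radial_limit x - ?h x))^2) <= ennreal (2 * pi * (\<Sum>\<^sub>\<infinity>i\<in>harm_index TYPE('n). (cmod (c i))^2 * (1 - t i)^2))"
  using radial_limit_approx[OF t ts] nn_integral_eq_integral[OF i] by simp
 then show "(LINT x|?M. (cmod (radial_limit x - ?h x))^2) <= 2 * pi * (\<Sum>\<^sub>\<infinity>i\<in>harm_index TYPE('n). (cmod (c i))^2 * (1 - t i)^2)"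
  by (subst (asm) ennreal_le_iff) (auto intro!: mult_nonneg_nonneg infsum_nonneg)
qed

lemma radial_limit_square:
 shows "integrable dM (%x. (cmod (radial_limit x))^2)"
  and "(LINT x|dM. (cmod (radial_limit x))^2) <= 2 * pi * (\<Sum>\<^sub>\<infinity>i\<in>harm_index TYPE('n). (cmod (c i))^2)"
proof -
 have z: "hseries Y (%i. c i * of_real 0) = (%x. 0)" by (simp add: hseries_def[OF Y] fun_eq_iff)
 show "integrable dM (%x. (cmod (radial_limit x))^2)"
  using radial_limit_L2(1)[of "%_. 0"] unfolding z by simp
 show "(LINT x|dM. (cmod (radial_limit x))^2) <= 2 * pi * (\<Sum>\<^sub>\<infinity>i\<in>harm_index TYPE('n). (cmod (c i))^2)"
  using radial_limit_L2(2)[of "%_. 0"] unfolding z by simp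
qed

lemma radial_limit_mean_square:
 assumes r: "0 <= r" "r < 1"
 shows "integrable dM (%x. (cmod (radial_limit x - rseries Y c r x))^2)"
  and "(LINT x|dM. (cmod (radial_limit x - rseries Y c r x))^2) <= 2 * pi * abel_defect r"
 using radial_limit_L2[of "%i. r ^ hdeg i"] sup_summable_power[OF Y sq r] r
 by (auto simp: power_le_one abel_defect_def)

lemma radial_limit_partial_sum:
 assumes A: "finite A" "A <= harm_index TYPE('n)"
 shows "(LINT x|dM. (cmod (radial_limit x - (SUM i:A. c i * circ_harm Y (to_circ i) x)))^2)
   <= 2 * pi * ((\<Sum>\<^sub>\<infinity>i\<in>harm_index TYPE('n). (cmod (c i))^2) - (SUM i:A. (cmod (c i))^2))"
proof -
 let ?t = "%i. if i : A then 1 else 0 :: real"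
 have ct: "c i * of_real (?t i) = (if i : A then c i else 0)" for i by simp
 have "((%i. (cmod (c i))^2 - (if i : A then (cmod (c i))^2 else 0)) has_sum
   ((\<Sum>\<^sub>\<infinity>i\<in>harm_index TYPE('n). (cmod (c i))^2) - (SUM i:A. (cmod (c i))^2))) (harm_index TYPE('n))"
 proof -
  have "((%i. - (if i : A then (cmod (c i))^2 else 0)) has_sum (SUM i:A. - ((cmod (c i))^2))) (harm_index TYPE('n))"
   by (rule has_sum_cong_neutral[THEN iffD1, OF _ _ _ has_sum_finite[OF A(1)]]) (use A in auto)
  from has_sum_add[OF has_sum_infsum[OF sq] this] show ?thesis by (simp add: sum_negf)
 qed
 moreover have "(%i. (cmod (c i))^2 - (if i : A then (cmod (c i))^2 else 0)) = (%i. (cmod (c i))^2 * (1 - ?t i)^2)" by auto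
 ultimately have "(\<Sum>\<^sub>\<infinity>i\<in>harm_index TYPE('n). (cmod (c i))^2 * (1 - ?t i)^2) = (\<Sum>\<^sub>\<infinity>i\<in>harm_index TYPE('n). (cmod (c i))^2) - (SUM i:A. (cmod (c i))^2)"
  by (simp only: infsumI)
 moreover have "sup_summable Y (%i. c i * of_real (?t i))"
  using sup_summable_finite[OF Y A(1), of c] by (simp only: ct)
 from radial_limit_L2(2)[OF _ _ this]
 have "(LINT x|dM. (cmod (radial_limit x - hseries Y (%i. c i * of_real (?t i)) x))^2)
   <= 2 * pi * (\<Sum>\<^sub>\<infinity>i\<in>harm_index TYPE('n). (cmod (c i))^2 * (1 - ?t i)^2)" by simp
 ultimately show ?thesis by (simp only: ct harmonic_series_finite[OF Y A])
qed

text \<open>The coefficients of the dilations are explicit and converge as \<open>r\<close> tends to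
  1. Bessel's inequality for a single function, a form of the Cauchy-Schwarz inequality, shows that
  they converge to the coefficients of the radial limit.\<close>

lemma radial_limit_coefficient:
 assumes m: "m : circle_harm_index TYPE('n)"
 shows "(LINT x|dM. radial_limit x * cnj (circ_harm Y m x))
   = (if m : to_circ ` harm_index TYPE('n) then of_real (2 * pi) * c (inv_into (harm_index TYPE('n)) to_circ m) else 0)" (is "?L = ?R")
proof -
 let ?M = "dM :: (real * (real^'n)) measure" and ?I = "harm_index TYPE('n)"
 let ?e = "circ_harm Y m"
 note fin = finite_circle_sphere[where 'n = 'n]
 define v where "v r = (LINT x|?M. rseries Y c r x * cnj (?e x))" for r
 have em: "?e : bmeas ?M" by (rule circle_harmonic_measurable[OF Y m])
 have int: "integrable ?M (%x. g x * cnj (?e x))" if "g : bmeas ?M" "integrable ?M (%x. (cmod (g x))^2)" for g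
  using bounded_mult_integrable[OF borel_measurable_cnj[OF em] _ l2_integrable[OF fin that], of "hsup Y m"] circle_harmonic_bound[OF Y m]
  by (simp add: mult.commute)
 have rs: "integrable ?M (%x. (cmod (rseries Y c r x))^2)" if "0 <= r" "r < 1" for r
  by (rule harmonic_series_square_integrable[OF Y sup_summable_power[OF Y sq that]])
 have close: "(cmod (?L - v r))^2 <= 2 * pi * (2 * pi * abel_defect r)" if r: "0 <= r" "r < 1" for r
 proof -
  have "?L - v r = (LINT x|?M. radial_limit x * cnj (?e x) - rseries Y c r x * cnj (?e x))"
   unfolding v_def by (rule Bochner_Integration.integral_diff[symmetric])
    (rule int radial_limit_measurable' radial_limit_square radial_series_measurable r rs)+
  also have "... = (LINT x|?M. (radial_limit x - rseries Y c r x) * cnj (?e x))" by (simp only: left_diff_distrib)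
  finally have e: "?L - v r = ..." .
  have "(SUM i:{m}. (cmod (LINT x|?M. (radial_limit x - rseries Y c r x) * cnj (circ_harm Y i x)))^2)
    <= 2 * pi * (LINT x|?M. (cmod (radial_limit x - rseries Y c r x))^2)"
   by (rule bessel_inequality[OF fin, where J = "{m}" and B = "hsup Y"])
     (use em m circle_harmonic_bound[OF Y m] harmonic_sup_nonneg[OF Y m] circle_harmonic_orthonormal[OF Y m m]
      radial_limit_mean_square(1)[OF r] radial_limit_measurable' radial_series_measurable[OF r] in auto)
  also have "... <= 2 * pi * (2 * pi * abel_defect r)" by (rule mult_left_mono[OF radial_limit_mean_square(2)[OF r]]) simp
  finally show ?thesis by (simp add: e)
 qed
 have ev: "\<forall>\<^sub>F r in at_left (1::real). 0 < r & r < 1"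
  unfolding eventually_at_left_field by (intro exI[of _ 0]) auto
 have l1: "(v \<longlongrightarrow> ?L) (at_left 1)"
 proof -
  have "((%r. sqrt (2 * pi * (2 * pi * abel_defect r))) \<longlongrightarrow> sqrt (2 * pi * (2 * pi * 0))) (at_left 1)"
   by (intro tendsto_intros abel_defect_tendsto)
  then have "((%r. sqrt (2 * pi * (2 * pi * abel_defect r))) \<longlongrightarrow> 0) (at_left 1)" by simp
  then have "((%r. v r - ?L) \<longlongrightarrow> 0) (at_left 1)"
  proof (rule tendsto_0_le[where K = 1])
   show "\<forall>\<^sub>F r in at_left 1. cmod (v r - ?L) <= norm (sqrt (2 * pi * (2 * pi * abel_defect r))) * 1"
    using ev
   proof eventually_elim
    case (elim r)
    then have "cmod (?L - v r) <= sqrt (2 * pi * (2 * pi * abel_defect r))" by (intro real_le_rsqrt close) auto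
    then show ?case by (simp only: norm_minus_commute[of "v r"] real_norm_def mult_1_right)
   qed
  qed
  then show ?thesis by (simp only: LIM_zero_iff)
 qed
 show ?thesis
 proof (cases "m : to_circ ` ?I")
  case False
  have "v r = 0" if "0 <= r" "r < 1" for r
   unfolding v_def by (rule harmonic_series_facts(5)[OF Y sup_summable_power[OF Y sq that] m False])
  with ev have "\<forall>\<^sub>F r in at_left 1. v r = 0" by (auto elim!: eventually_mono)
  from tendsto_eventually[OF this] have "(v \<longlongrightarrow> 0) (at_left 1)" .
  from tendsto_unique[OF _ l1 this] show ?thesis using False by simp
 next
  case True
  then obtain i where i: "i : ?I" "m = to_circ i" by blast
  have inv: "inv_into ?I to_circ m = i" unfolding i(2) by (rule inv_into_f_f[OF inj_on_subset[OF inj_harm_to_circle] i(1)]) simp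
  have "v r = of_real (2 * pi) * (c i * of_real r ^ hdeg i)" if "0 <= r" "r < 1" for r
   unfolding v_def i(2) by (rule harmonic_series_facts(4)[OF Y sup_summable_power[OF Y sq that] i(1)])
  with ev have "\<forall>\<^sub>F r in at_left 1. of_real (2 * pi) * (c i * of_real r ^ hdeg i) = v r" by (auto elim!: eventually_mono)
  moreover have "((%r. of_real (2 * pi) * (c i * of_real r ^ hdeg i)) \<longlongrightarrow> of_real (2 * pi) * (c i * of_real 1 ^ hdeg i)) (at_left (1::real))"
   by (intro tendsto_intros)
  ultimately have "(v \<longlongrightarrow> of_real (2 * pi) * (c i * of_real 1 ^ hdeg i)) (at_left 1)" by (simp only: tendsto_cong)
  from tendsto_unique[OF _ l1 this] show ?thesis using True inv by simp
 qed
qed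

text \<open>Fatou's lemma gave one inequality; Bessel's inequality with the coefficients just found
  gives the other.\<close>

lemma radial_limit_norm:
 "(LINT x|dM. (cmod (radial_limit x))^2) = 2 * pi * (\<Sum>\<^sub>\<infinity>i\<in>harm_index TYPE('n). (cmod (c i))^2)"
proof (rule antisym[OF radial_limit_square(2)])
 let ?M = "dM :: (real * (real^'n)) measure" and ?I = "harm_index TYPE('n)"
 have "(\<Sum>\<^sub>\<infinity>i\<in>?I. (cmod (c i))^2) <= (LINT x|?M. (cmod (radial_limit x))^2) / (2 * pi)"
 proof (rule infsum_le_finite_sums[OF sq])
  fix A assume A: "finite A" "A <= ?I"
  have "0 <= (LINT x|?M. (cmod (radial_limit x - (SUM i:A. c i * circ_harm Y (to_circ i) x)))^2)" by simp
  have "(SUM i:A. (cmod (LINT x|?M. radial_limit x * cnj (circ_harm Y (to_circ i) x)))^2) <= 2 * pi * (LINT x|?M. (cmod (radial_limit x))^2)"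
  proof (rule bessel_inequality[OF finite_circle_sphere, where J = ?I and B = "%i. hsup Y (to_circ i)"])
   show "(LINT x|?M. circ_harm Y (to_circ i) x * cnj (circ_harm Y (to_circ j) x)) = (if i = j then of_real (2 * pi) else 0)"
    if "i : ?I" "j : ?I" for i j
    using circle_harmonic_orthonormal[OF Y harm_to_circle_in[OF that(1)] harm_to_circle_in[OF that(2)]] inj_eq[OF inj_harm_to_circle] by simp
  qed (use A circle_harmonic_measurable[OF Y harm_to_circle_in] circle_harmonic_bound[OF Y harm_to_circle_in] harmonic_sup_nonneg[OF Y harm_to_circle_in]
      radial_limit_measurable' radial_limit_square(1) in auto)
  moreover have "(LINT x|?M. radial_limit x * cnj (circ_harm Y (to_circ i) x)) = of_real (2 * pi) * c i" if "i : A" for i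
  proof -
   have i: "i : ?I" using that A by blast
   have "inv_into ?I to_circ (to_circ i) = i" by (rule inv_into_f_f[OF inj_on_subset[OF inj_harm_to_circle] i]) simp
   then show ?thesis using radial_limit_coefficient[OF harm_to_circle_in[OF i]] i by simp
  qed
  ultimately have "(SUM i:A. (cmod (of_real (2 * pi) * c i))^2) <= 2 * pi * (LINT x|?M. (cmod (radial_limit x))^2)" by simp
  then have "(2 * pi) * ((2 * pi) * (SUM i:A. (cmod (c i))^2)) <= (2 * pi) * (LINT x|?M. (cmod (radial_limit x))^2)"
   by (simp add: norm_mult power_mult_distrib sum_distrib_left power2_eq_square mult_ac)
  then have "(2 * pi) * (SUM i:A. (cmod (c i))^2) <= (LINT x|?M. (cmod (radial_limit x))^2)"
   by (rule mult_left_le_imp_le) simp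
  then show "(SUM i:A. (cmod (c i))^2) <= (LINT x|?M. (cmod (radial_limit x))^2) / (2 * pi)"
   by (simp add: pos_le_divide_eq mult.commute)
 qed
 then show "2 * pi * (\<Sum>\<^sub>\<infinity>i\<in>?I. (cmod (c i))^2) <= (LINT x|?M. (cmod (radial_limit x))^2)"
  by (simp add: pos_le_divide_eq mult.commute)
qed

end

section \<open>Hardy spaces and power expansions\<close>

text \<open>Connects the unordered sum with the order of summation in the definition of the Hardy
  space: over \<open>j\<close> inside a component, then over the finitely many \<open>l\<close>,
  then over \<open>k\<close>.\<close>

lemma harm_index_has_sum:
 fixes f :: "nat * nat * nat => 'a::{topological_comm_monoid_add, t3_space}"
 assumes f: "(f has_sum S) (harm_index TYPE('n::finite))"
  and g: "!!k l. l : {1..harm_dim TYPE('n) k} ==> ((%j. f (k, l, j)) has_sum g k l) UNIV"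
  and fs: "!!k. (%(l, j). f (k, l, j)) summable_on ({1..harm_dim TYPE('n) k} \<times> UNIV)"
 shows "((%k. \<Sum>l=1..harm_dim TYPE('n) k. g k l) has_sum S) UNIV"
proof (rule has_sum_SigmaD[OF f[unfolded harm_index_Sigma]])
 fix k
 have "((%(l, j). f (k, l, j)) has_sum (\<Sum>l=1..harm_dim TYPE('n) k. g k l)) ({1..harm_dim TYPE('n) k} \<times> UNIV)"
 proof (rule has_sum_SigmaI[OF _ _ fs])
  show "(g k has_sum (\<Sum>l=1..harm_dim TYPE('n) k. g k l)) {1..harm_dim TYPE('n) k}" by (rule has_sum_finite) simp
 qed (use g in simp)
 then show "((%y. f (k, y)) has_sum (\<Sum>l=1..harm_dim TYPE('n) k. g k l)) ({1..harm_dim TYPE('n) k} \<times> UNIV)"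
  by (simp add: case_prod_unfold)
qed

lemma harm_index_row_summable:
 fixes f :: "nat * nat * nat => 'a::{complete_uniform_space, uniform_topological_group_add, ab_group_add, topological_comm_monoid_add}"
 assumes "f summable_on (harm_index TYPE('n::finite))"
 shows "(%(l, j). f (k, l, j)) summable_on ({1..harm_dim TYPE('n) k} \<times> UNIV)"
 using summable_on_SigmaD1[of "%k y. f (k, y)" UNIV "%k. {1..harm_dim TYPE('n) k} \<times> UNIV" k] assms
 by (simp add: harm_index_Sigma case_prod_unfold)

lemma harm_index_nonneg_summable:
 fixes f :: "nat * nat * nat => real"
 assumes g: "!!k l. l : {1..harm_dim TYPE('n) k} ==> ((%j. f (k, l, j)) has_sum g k l) UNIV"
  and f0: "!!i. 0 <= f i" and s: "summable (%k. \<Sum>l=1..harm_dim TYPE('n::finite) k. g k l)"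
 shows "f summable_on (harm_index TYPE('n))"
 unfolding harm_index_Sigma
proof (rule summable_on_SigmaI)
 have g0: "0 <= g k l" if "l : {1..harm_dim TYPE('n) k}" for k l by (rule has_sum_nonneg[OF g[OF that]]) (rule f0)
 show "(%k. \<Sum>l=1..harm_dim TYPE('n) k. g k l) summable_on UNIV"
  by (rule summable_on_UNIV_nonneg_real_iff[THEN iffD2, OF _ s]) (intro sum_nonneg g0)
 fix k
 have "(%(l, j). f (k, l, j)) summable_on ({1..harm_dim TYPE('n) k} \<times> UNIV)"
  by (rule summable_on_SigmaI[where g = "g k"]) (use g f0 in auto)
 then have "((%(l, j). f (k, l, j)) has_sum (\<Sum>l=1..harm_dim TYPE('n) k. g k l)) ({1..harm_dim TYPE('n) k} \<times> UNIV)"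
  by (rule has_sum_SigmaI[OF _ has_sum_finite[OF finite_atLeastAtMost], rotated]) (use g in auto)
 then show "((%y. f (k, y)) has_sum (\<Sum>l=1..harm_dim TYPE('n) k. g k l)) ({1..harm_dim TYPE('n) k} \<times> UNIV)"
  by (simp add: case_prod_unfold)
qed (rule f0)

context
 fixes g :: "complex => complex" and a :: "nat => complex" and n :: "nat => nat"
 assumes n: "inj n" and g: "!!z. cmod z < 1 ==> ((%j. a j * z ^ n j) has_sum g z) UNIV"
begin

text \<open>Parseval's identity on the circle of radius \<open>r\<close>. The exponents
  \<open>n j\<close> are arbitrary but distinct, so that series in \<open>z ^ (k + 2 * j)\<close>
  are included.\<close>

lemma hardy_mean_has_sum:
 assumes r: "0 <= r" "r < 1"
 shows "((%j. (cmod (a j))^2 * (r ^ n j)^2) has_sum (hardy_mean g r)^2) UNIV"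
proof -
 have "(%j. a j * of_real r ^ n j) summable_on UNIV" using g[of "of_real r"] r by (auto simp: summable_on_def)
 then have s: "(%j. cmod (a j * of_real r ^ n j)) summable_on UNIV" by (simp only: summable_on_iff_abs_summable_on_complex)
 have i: "inj_on (%j. int (n j)) UNIV" using n by (auto simp: inj_def)
 have e: "(\<Sum>\<^sub>\<infinity>j. a j * of_real r ^ n j * cis (of_int (int (n j)) * ph)) = g (of_real r * cis ph)" for ph
  using infsumI[OF g[of "of_real r * cis ph"]] r by (simp add: norm_mult power_mult_distrib Complex.DeMoivre mult.assoc)
 have "((%j. 2 * pi * (cmod (a j * of_real r ^ n j))^2) has_sum (LINT ph|dA. (cmod (g (of_real r * cis ph)))^2)) UNIV"
  using circle_parseval[OF s i] unfolding e .
 from has_sum_cmult_right[OF this, of "1 / (2 * pi)"]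
 have "((%j. (cmod (a j * of_real r ^ n j))^2) has_sum (1 / (2 * pi) * (LINT ph|dA. (cmod (g (of_real r * cis ph)))^2))) UNIV" by simp
 moreover have "(hardy_mean g r)^2 = 1 / (2 * pi) * (LINT ph|dA. (cmod (g (of_real r * cis ph)))^2)"
  unfolding hardy_mean_def by (rule real_sqrt_pow2) simp
 moreover have "(cmod (a j * of_real r ^ n j))^2 = (cmod (a j))^2 * (r ^ n j)^2" for j
  using r by (simp add: norm_mult norm_power power_mult_distrib)
 ultimately show ?thesis by simp
qed

lemma hardy_mean_nonneg: "0 <= hardy_mean g r"
 unfolding hardy_mean_def by simp

lemma hardy_mean_le:
 assumes s: "(%j. (cmod (a j))^2) summable_on UNIV" and r: "0 <= r" "r < 1"
 shows "hardy_mean g r <= sqrt (\<Sum>\<^sub>\<infinity>j. (cmod (a j))^2)"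
proof (rule real_le_rsqrt, rule has_sum_mono[OF hardy_mean_has_sum[OF r] has_sum_infsum[OF s]])
 fix j
 have "(r ^ n j)^2 <= 1^2" by (rule power_mono) (use r in "auto simp: power_le_one")
 then show "(cmod (a j))^2 * (r ^ n j)^2 <= (cmod (a j))^2" by (simp add: mult_left_le)
qed

text \<open>Each finite sum is continuous in \<open>r\<close> up to \<open>r = 1\<close>, where its
  weights become 1.\<close>

lemma hardy_mean_bound_coefficients:
 assumes B: "!!r. 0 <= r ==> r < 1 ==> hardy_mean g r <= B" and A: "finite A"
 shows "(SUM j:A. (cmod (a j))^2) <= B^2"
proof -
 have le: "(SUM j:A. (cmod (a j))^2 * (r ^ n j)^2) <= B^2" if r: "0 <= r" "r < 1" for r
  by (rule order_trans[OF finite_sum_le_has_sum[OF hardy_mean_has_sum[OF r] A] power_mono[OF B[OF r] hardy_mean_nonneg]]) auto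
 have "((%r. SUM j:A. (cmod (a j))^2 * (r ^ n j)^2) \<longlongrightarrow> (SUM j:A. (cmod (a j))^2 * (1 ^ n j)^2)) (at_left (1::real))"
  by (intro tendsto_intros)
 moreover have "\<forall>\<^sub>F r in at_left (1::real). (SUM j:A. (cmod (a j))^2 * (r ^ n j)^2) <= B^2"
  unfolding eventually_at_left_field by (intro exI[of _ 0]) (use le in auto)
 ultimately have "(SUM j:A. (cmod (a j))^2 * (1 ^ n j)^2) <= B^2"
  by (rule tendsto_upperbound) simp
 then show ?thesis by simp
qed

lemma hardy_mean_bdd_iff: "bdd_above (hardy_mean g ` {0..<1}) \<longleftrightarrow> (%j. (cmod (a j))^2) summable_on UNIV"
proof
 assume "bdd_above (hardy_mean g ` {0..<1})"
 then obtain B where "ALL r:{0..<1}. hardy_mean g r <= B" by (auto simp: bdd_above_def)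
 then have B: "hardy_mean g r <= B" if "0 <= r" "r < 1" for r using that by simp
 show "(%j. (cmod (a j))^2) summable_on UNIV"
  by (rule nonneg_bdd_above_summable_on) (use hardy_mean_bound_coefficients[OF B] in \<open>auto intro!: bdd_aboveI[of _ "B^2"]\<close>)
next
 assume "(%j. (cmod (a j))^2) summable_on UNIV"
 from hardy_mean_le[OF this] show "bdd_above (hardy_mean g ` {0..<1})" by (auto intro!: bdd_aboveI)
qed

text \<open>The root of the full sum bounds all means and so their supremum; conversely any bound
  for the means bounds every finite sum of squares.\<close>

lemma hardy_disc_norm_series:
 assumes s: "(%j. (cmod (a j))^2) summable_on UNIV"
 shows "((%j. (cmod (a j))^2) has_sum (hardy_disc_norm g)^2) UNIV"
proof -
 have bdd: "bdd_above (hardy_mean g ` {0..<1})" using s hardy_mean_bdd_iff by simp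
 have up: "hardy_mean g r <= hardy_disc_norm g" if "0 <= r" "r < 1" for r
  unfolding hardy_disc_norm_def by (rule cSUP_upper[OF _ bdd]) (use that in simp)
 have "(\<Sum>\<^sub>\<infinity>j. (cmod (a j))^2) <= (hardy_disc_norm g)^2"
  by (rule infsum_le_finite_sums[OF s hardy_mean_bound_coefficients[OF up]])
 moreover have "hardy_disc_norm g <= sqrt (\<Sum>\<^sub>\<infinity>j. (cmod (a j))^2)"
  unfolding hardy_disc_norm_def by (rule cSUP_least) (use hardy_mean_le[OF s] in auto)
 moreover have "0 <= hardy_disc_norm g" using up[of 0] hardy_mean_nonneg[of 0] by simp
 ultimately have "(hardy_disc_norm g)^2 = (\<Sum>\<^sub>\<infinity>j. (cmod (a j))^2)"
  by (intro antisym) (auto intro!: sqrt_le_D[THEN order_trans[rotated]] simp: real_le_rsqrt sqrt_ge_absD real_sqrt_ge_0_iff infsum_nonneg power2_le_iff_abs_le real_sqrt_le_iff dest: power_mono[where n = 2])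
 then show ?thesis using has_sum_infsum[OF s] by simp
qed

end

lemma square_summable_power_series:
 fixes a :: "nat => complex" and n :: "nat => nat"
 assumes s: "(%j. (cmod (a j))^2) summable_on UNIV" and n: "inj n" and z: "cmod z < 1"
 shows "((%j. a j * z ^ n j) has_sum (\<Sum>\<^sub>\<infinity>j. a j * z ^ n j)) UNIV"
proof (rule has_sum_infsum, rule abs_summable_summable, rule summable_on_comparison_test)
 have "(%m. (cmod z ^ 2) ^ m) summable_on UNIV"
  using z by (intro norm_summable_imp_summable_on) (simp add: norm_power summable_geometric power_less_one_iff)
 then have "(%m. (cmod z ^ 2) ^ m) summable_on range n" by (rule summable_on_subset_banach) simp
 then have "(%j. (cmod z ^ 2) ^ n j) summable_on UNIV" using summable_on_reindex[OF n, of "%m. (cmod z ^ 2) ^ m"] by (simp add: o_def)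
 from summable_on_add[OF s this] show "(%j. (cmod (a j))^2 + (cmod z ^ 2) ^ n j) summable_on UNIV" .
 fix j
 define u v where "u = cmod (a j)" and "v = cmod z ^ n j"
 have "2 * (u * v) <= u^2 + v^2" using zero_le_power2[of "u - v"] by (simp add: power2_diff mult.assoc)
 then have "u * v <= u^2 + v^2" using zero_le_power2[of u] zero_le_power2[of v] by linarith
 then show "cmod (a j * z ^ n j) <= (cmod (a j))^2 + (cmod z ^ 2) ^ n j"
  by (simp only: u_def v_def norm_mult norm_power power_mult[symmetric] mult.commute)
qed simp

lemma power_degree: "(z::complex) ^ (k + 2 * j) = (z^2) ^ j * z ^ k"
 by (subst power_add, subst power_mult, rule mult.commute)

text \<open>Substituting \<open>z^2\<close> in the Taylor series of \<open>g1\<close> and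
  multiplying by \<open>z ^ k\<close> produces the exponents \<open>k + 2 * j\<close>, and the
  bounded means of \<open>g1\<close> give square summability.\<close>

lemma hardy_disc_degE:
 assumes "g : hardy_disc_deg k"
 obtains a where "(%j. (cmod (a j))^2) summable_on UNIV" "!!z. cmod z < 1 ==> ((%j. a j * z ^ (k + 2 * j)) has_sum g z) UNIV"
proof -
 obtain g1 where g1: "g1 holomorphic_on ball 0 1" "bdd_above (hardy_mean g1 ` {0..<1})" and g: "!!z. cmod z < 1 ==> g z = g1 (z^2) * z ^ k"
  using assms by (auto simp: hardy_disc_deg_def hardy_disc_def)
 define a where "a j = (deriv ^^ j) g1 0 / fact j" for j
 have sums: "(%j. a j * z ^ j) sums g1 z" if "cmod z < 1" for z
  using holomorphic_power_series[OF g1(1), of z] that by (simp add: a_def)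
 have hs: "((%j. a j * z ^ j) has_sum g1 z) UNIV" if z: "cmod z < 1" for z
 proof (rule norm_summable_imp_has_sum[OF _ sums[OF z]])
  obtain t where t: "cmod z < t" "t < 1" using dense z by blast
  then have t0: "0 < t" using norm_ge_zero[of z] by linarith
  show "summable (%j. cmod (a j * z ^ j))"
   by (rule powser_insidea[OF sums_summable[OF sums[of "of_real t"]]]) (use t t0 in auto)
 qed
 show ?thesis
 proof (rule that[of a])
  show "(%j. (cmod (a j))^2) summable_on UNIV"
   using hardy_mean_bdd_iff[of "%j. j" a g1] hs g1(2) by simp
  fix z :: complex assume z: "cmod z < 1"
  then have "cmod (z^2) < 1" by (simp add: norm_power power_less_one_iff)
  from has_sum_cmult_left[OF hs[OF this], of "z ^ k"]
  show "((%j. a j * z ^ (k + 2 * j)) has_sum g z) UNIV"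
   by (simp only: g[OF z] power_degree mult.assoc)
 qed
qed

lemma hardy_disc_degI:
 assumes s: "(%j. (cmod (a j))^2) summable_on UNIV"
 shows "(%z. \<Sum>\<^sub>\<infinity>j. a j * z ^ (k + 2 * j)) : hardy_disc_deg k"
proof -
 define g1 where "g1 z = (\<Sum>\<^sub>\<infinity>j. a j * z ^ j)" for z
 have hs: "((%j. a j * z ^ j) has_sum g1 z) UNIV" if "cmod z < 1" for z
  unfolding g1_def using square_summable_power_series[OF s _ that, of "%j. j"] by simp
 have "g1 holomorphic_on ball 0 1"
  by (rule power_series_holomorphic[where a = a]) (use has_sum_imp_sums[OF hs] in auto)
 moreover have "bdd_above (hardy_mean g1 ` {0..<1})"
  using hardy_mean_bdd_iff[of "%j. j" a g1] hs s by simp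
 moreover have "(\<Sum>\<^sub>\<infinity>j. a j * z ^ (k + 2 * j)) = g1 (z^2) * z ^ k" if z: "cmod z < 1" for z
 proof (rule infsumI)
  have "cmod (z^2) < 1" using z by (simp add: norm_power power_less_one_iff)
  from has_sum_cmult_left[OF hs[OF this], of "z ^ k"]
  show "((%j. a j * z ^ (k + 2 * j)) has_sum g1 (z^2) * z ^ k) UNIV" by (simp only: power_degree mult.assoc)
 qed
 ultimately show ?thesis by (auto simp: hardy_disc_deg_def hardy_disc_def intro!: bexI[of _ g1])
qed

lemma inj_degree: "inj (%j. k + 2 * j :: nat)"
 by (auto simp: inj_def)

context
 fixes Y :: "nat => nat => real^'n => complex"
 assumes Y: "orthonormal_harmonics Y"
begin

lemma harmonic_power_has_sum:
 fixes c :: "nat * nat * nat => complex"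
 assumes sq: "(%i. (cmod (c i))^2) summable_on harm_index TYPE('n)" and z: "cmod z < 1" and te: "norm te = 1"
 shows "(%(k, l, j). c (k, l, j) * z ^ (k + 2 * j) * Y k l te) summable_on harm_index TYPE('n)"
proof -
 define r ph where "r = cmod z" and "ph = Arg2pi z"
 have zr: "z = of_real r * cis ph" unfolding r_def ph_def cis_conv_exp by (rule Arg2pi_eq)
 have x: "(ph, te) : space dM"
  using te Arg2pi_ge_0[of z] Arg2pi_lt_2pi[of z] by (simp add: space_circle_sphere ph_def)
 have "((%i. c i * of_real r ^ hdeg i * circ_harm Y (to_circ i) (ph, te)) has_sum hseries Y (%i. c i * of_real r ^ hdeg i) (ph, te)) (harm_index TYPE('n))"
  by (rule harmonic_series_facts(6)[OF Y sup_summable_power[OF Y sq] x]) (use z in "auto simp: r_def")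
 moreover have "(%i. c i * of_real r ^ hdeg i * circ_harm Y (to_circ i) (ph, te)) = (%(k, l, j). c (k, l, j) * z ^ (k + 2 * j) * Y k l te)"
  by (auto simp: fun_eq_iff zr hdeg_def to_circ_def circ_harm_def power_mult_distrib Complex.DeMoivre)
 ultimately show ?thesis by (auto simp: summable_on_def)
qed

lemma harmonic_power_by_order:
 fixes c :: "nat * nat * nat => complex"
 assumes sq: "(%i. (cmod (c i))^2) summable_on harm_index TYPE('n)" and z: "cmod z < 1" and te: "norm te = 1"
  and F: "!!k l. l : {1..harm_dim TYPE('n) k} ==> ((%j. c (k, l, j) * z ^ (k + 2 * j)) has_sum F k l) UNIV"
 shows "((%k. \<Sum>l=1..harm_dim TYPE('n) k. F k l * Y k l te) has_sum
   (\<Sum>\<^sub>\<infinity>(k, l, j)\<in>harm_index TYPE('n). c (k, l, j) * z ^ (k + 2 * j) * Y k l te)) UNIV"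
 by (rule harm_index_has_sum[OF has_sum_infsum[OF harmonic_power_has_sum[OF sq z te]] _ harm_index_row_summable[OF harmonic_power_has_sum[OF sq z te]]])
   (use has_sum_cmult_left[OF F] in simp)

text \<open>Each component supplies its Taylor coefficients by choice. The whole family is square
  summable, so its unordered series converges, and it agrees with the iterated one that represents
  \<open>f\<close>.\<close>

lemma hardy_expansion_coefficients:
 assumes "hardy_expansion Y f F"
 obtains c where "power_expansion Y f (%k l j. c (k, l, j))" "(%i. (cmod (c i))^2) summable_on harm_index TYPE('n)"
  "(\<Sum>k. \<Sum>l=1..harm_dim TYPE('n) k. (hardy_disc_norm (F k l))^2) = (\<Sum>\<^sub>\<infinity>i\<in>harm_index TYPE('n). (cmod (c i))^2)"
proof -
 have h1: "F k l : hardy_disc_deg k" if "l : {1..harm_dim TYPE('n) k}" for k l using assms that by (auto simp: hardy_expansion_def)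
 have h2: "(%k. \<Sum>l=1..harm_dim TYPE('n) k. F k l z * Y k l te) sums f (kd_point z te)" if "cmod z < 1" "norm te = 1" for z te
  using assms that by (auto simp: hardy_expansion_def)
 have h3: "summable (%k. \<Sum>l=1..harm_dim TYPE('n) k. (hardy_disc_norm (F k l))^2)" using assms by (auto simp: hardy_expansion_def)
 define Q where "Q k l b \<longleftrightarrow> (%j. (cmod (b j))^2) summable_on UNIV & (ALL z. cmod z < 1 --> ((%j. b j * z ^ (k + 2 * j)) has_sum F k l z) UNIV)"
  for k l and b :: "nat => complex"
 have Q: "EX b. Q k l b" if "l : {1..harm_dim TYPE('n) k}" for k l
  by (rule hardy_disc_degE[OF h1[OF that]]) (auto simp: Q_def)
 define a where "a k l = (SOME b. Q k l b)" for k l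
 have "Q k l (a k l)" if "l : {1..harm_dim TYPE('n) k}" for k l unfolding a_def by (rule someI_ex[OF Q[OF that]])
 then have a: "!!k l. l : {1..harm_dim TYPE('n) k} ==> (%j. (cmod (a k l j))^2) summable_on UNIV"
  "!!k l z. l : {1..harm_dim TYPE('n) k} ==> cmod z < 1 ==> ((%j. a k l j * z ^ (k + 2 * j)) has_sum F k l z) UNIV"
  by (simp_all only: Q_def)
 define c where "c = (%(k, l, j). a k l j)"
 have n: "((%j. (cmod (c (k, l, j)))^2) has_sum (hardy_disc_norm (F k l))^2) UNIV" if l: "l : {1..harm_dim TYPE('n) k}" for k l
  using hardy_disc_norm_series[OF inj_degree[of k] a(2)[OF l] a(1)[OF l]] by (simp add: c_def)
 have sq: "(%i. (cmod (c i))^2) summable_on harm_index TYPE('n)"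
  by (rule harm_index_nonneg_summable[OF n _ h3]) auto
 show ?thesis
 proof (rule that[OF _ sq])
  show "power_expansion Y f (%k l j. c (k, l, j))"
   unfolding power_expansion_def
  proof (intro ballI)
   fix z :: complex and te :: "real^'n" assume "z : ball 0 1" "te : sphere 0 1"
   then have z: "cmod z < 1" "norm te = 1" by auto
   have "((%k. \<Sum>l=1..harm_dim TYPE('n) k. F k l z * Y k l te) has_sum
    (\<Sum>\<^sub>\<infinity>(k, l, j)\<in>harm_index TYPE('n). c (k, l, j) * z ^ (k + 2 * j) * Y k l te)) UNIV"
    by (rule harmonic_power_by_order[OF sq z]) (use a(2) z in "simp add: c_def")
   from sums_unique2[OF has_sum_imp_sums[OF this] h2[OF z]]
   show "((%(k, l, j). c (k, l, j) * z ^ (k + 2 * j) * Y k l te) has_sum f (kd_point z te)) (harm_index TYPE('n))"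
    using has_sum_infsum[OF harmonic_power_has_sum[OF sq z]] by simp
  qed
  have "((%k. \<Sum>l=1..harm_dim TYPE('n) k. (hardy_disc_norm (F k l))^2) has_sum (\<Sum>\<^sub>\<infinity>i\<in>harm_index TYPE('n). (cmod (c i))^2)) UNIV"
   by (rule harm_index_has_sum[OF has_sum_infsum[OF sq] n harm_index_row_summable[OF sq]])
  from sums_unique[OF has_sum_imp_sums[OF this]]
  show "(\<Sum>k. \<Sum>l=1..harm_dim TYPE('n) k. (hardy_disc_norm (F k l))^2) = (\<Sum>\<^sub>\<infinity>i\<in>harm_index TYPE('n). (cmod (c i))^2)" ..
 qed
qed

lemma power_expansion_hardy:
 assumes pe: "power_expansion Y f (%k l j. c (k, l, j))" and sq: "(%i. (cmod (c i))^2) summable_on harm_index TYPE('n)"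
 shows "hardy_expansion Y f (%k l z. \<Sum>\<^sub>\<infinity>j. c (k, l, j) * z ^ (k + 2 * j))"
proof -
 have s: "(%j. (cmod (c (k, l, j)))^2) summable_on UNIV" if "l : {1..harm_dim TYPE('n) k}" for k l
  using summable_on_SigmaD1[of "%l j. (cmod (c (k, l, j)))^2", OF harm_index_row_summable[OF sq] that] .
 have F: "((%j. c (k, l, j) * z ^ (k + 2 * j)) has_sum (\<Sum>\<^sub>\<infinity>j. c (k, l, j) * z ^ (k + 2 * j))) UNIV"
  if "l : {1..harm_dim TYPE('n) k}" "cmod z < 1" for k l z
  by (rule square_summable_power_series[OF s[OF that(1)] inj_degree that(2)])
 have "((%k. \<Sum>l=1..harm_dim TYPE('n) k. (hardy_disc_norm (%z. \<Sum>\<^sub>\<infinity>j. c (k, l, j) * z ^ (k + 2 * j)))^2) has_sum (\<Sum>\<^sub>\<infinity>i\<in>harm_index TYPE('n). (cmod (c i))^2)) UNIV"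
  by (rule harm_index_has_sum[OF has_sum_infsum[OF sq] hardy_disc_norm_series[OF inj_degree F s] harm_index_row_summable[OF sq]])
 from sums_summable[OF has_sum_imp_sums[OF this]]
 have "summable (%k. \<Sum>l=1..harm_dim TYPE('n) k. (hardy_disc_norm (%z. \<Sum>\<^sub>\<infinity>j. c (k, l, j) * z ^ (k + 2 * j)))^2)" .
 moreover have "(%k. \<Sum>l=1..harm_dim TYPE('n) k. (\<Sum>\<^sub>\<infinity>j. c (k, l, j) * z ^ (k + 2 * j)) * Y k l te) sums f (kd_point z te)"
  if z: "cmod z < 1" "norm te = 1" for z te
 proof -
  have "((%(k, l, j). c (k, l, j) * z ^ (k + 2 * j) * Y k l te) has_sum f (kd_point z te)) (harm_index TYPE('n))"
   using pe z by (simp add: power_expansion_def)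
  from has_sum_imp_sums[OF harmonic_power_by_order[OF sq z F]] infsumI[OF this] z(1) show ?thesis by simp
 qed
 ultimately show ?thesis using hardy_disc_degI[OF s] by (simp add: hardy_expansion_def)
qed

text \<open>Along real \<open>z\<close> the difference of the two expansions is a power series that
  vanishes identically, so its slice of each degree is 0 on the sphere. Within one degree
  \<open>k\<close> and \<open>l\<close> determine \<open>j\<close>, and orthonormality isolates the
  coefficient.\<close>

lemma power_expansion_unique:
 assumes c: "power_expansion Y f c" and c': "power_expansion Y f c'" and l: "l : {1..harm_dim TYPE('n) k}"
 shows "c k l j = c' k l j"
proof -
 define d where "d = (%(k, l, j). c k l j - c' k l j)"
 let ?B = "%m. {i : harm_index TYPE('n). hdeg i = m}"
 let ?e = "%i. case i of (k, l, j) => Y k l"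
 have zero: "(SUM i:?B m. d i * ?e i te) = 0" if te: "norm te = 1" for m te
 proof (rule power_series_zero_on_reals)
  fix s :: real assume s: "0 < s" "s < 1"
  have c1: "((%(k, l, j). c k l j * of_real s ^ (k + 2*j) * Y k l te) has_sum f (kd_point (of_real s) te)) (harm_index TYPE('n))"
   using c s te by (simp add: power_expansion_def)
  have "((%(k, l, j). c' k l j * of_real s ^ (k + 2*j) * Y k l te) has_sum f (kd_point (of_real s) te)) (harm_index TYPE('n))"
   using c' s te by (simp add: power_expansion_def)
  then have "((%i. - (case i of (k, l, j) => c' k l j * of_real s ^ (k + 2*j) * Y k l te)) has_sum - f (kd_point (of_real s) te)) (harm_index TYPE('n))"
   by (simp only: has_sum_uminus minus_minus)
  from has_sum_add[OF c1 this]
  have "((%i. of_real s ^ hdeg i * (d i * ?e i te)) has_sum 0) (harm_index TYPE('n))"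
   by (simp add: d_def hdeg_def case_prod_unfold algebra_simps)
  note has_sum_imp_sums[OF has_sum_by_degree[OF this]]
  moreover have "(SUM i:?B m. of_real s ^ hdeg i * (d i * ?e i te)) = of_real s ^ m * (SUM i:?B m. d i * ?e i te)" for m
   unfolding sum_distrib_left by (rule sum.cong) auto
  ultimately show "(%m. of_real s ^ m * (SUM i:?B m. d i * ?e i te)) sums 0" by simp
 qed
 define i where "i = (k, l, j)"
 have i: "i : ?B (k + 2 * j)" using l by (simp add: i_def harm_index_def hdeg_def)
 have int: "integrable dS (%te. d i' * ?e i' te * cnj (Y k l te))" if "i' : harm_index TYPE('n)" for i'
 proof -
  obtain k' l' j' where i': "i' = (k', l', j')" "l' : {1..harm_dim TYPE('n) k'}" using \<open>i' : _\<close> by (auto simp: harm_index_def)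
  show ?thesis unfolding i' by (auto intro!: integrable_sphere_continuous continuous_intros Y_continuous[OF Y i'(2)] Y_continuous[OF Y l])
 qed
 have ort: "(LINT te|dS. d i' * ?e i' te * cnj (Y k l te)) = (if i' = i then d i else 0)" if i'B: "i' : ?B (k + 2 * j)" for i'
 proof -
  obtain k' l' j' where i': "i' = (k', l', j')" "l' : {1..harm_dim TYPE('n) k'}" "k' + 2 * j' = k + 2 * j"
   using i'B by (auto simp: harm_index_def hdeg_def)
  show ?thesis unfolding i' i_def using Y_orthonormal[OF Y i'(2) l] i'(3) by (auto simp: mult.assoc)
 qed
 have "0 = (LINT te|dS. (SUM i':?B (k + 2 * j). d i' * ?e i' te) * cnj (Y k l te))"
  by (subst lint_cong[OF refl, where g = "%_. 0"]) (use zero in auto)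
 also have "... = (SUM i':?B (k + 2 * j). LINT te|dS. d i' * ?e i' te * cnj (Y k l te))"
  unfolding sum_distrib_right by (rule lint_sum) (use int in blast)
 also have "... = (SUM i':?B (k + 2 * j). if i' = i then d i else 0)" by (rule sum.cong[OF refl ort])
 also have "... = d i" using i finite_degree_fibre[where 'n = 'n, of "k + 2 * j"] by simp
 finally show ?thesis by (simp add: d_def i_def)
qed

text \<open>By uniqueness of the coefficients every expansion of \<open>f\<close> yields the same
  sum, as the definite description in the norm requires.\<close>

lemma hardy_ball_norm_series:
 assumes pe: "power_expansion Y f (%k l j. c (k, l, j))" and sq: "(%i. (cmod (c i))^2) summable_on harm_index TYPE('n)"
 shows "hardy_ball_norm Y f = sqrt (\<Sum>\<^sub>\<infinity>i\<in>harm_index TYPE('n). (cmod (c i))^2)"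
proof -
 have *: "(\<Sum>k. \<Sum>l=1..harm_dim TYPE('n) k. (hardy_disc_norm (F k l))^2) = (\<Sum>\<^sub>\<infinity>i\<in>harm_index TYPE('n). (cmod (c i))^2)"
  if "hardy_expansion Y f F" for F
 proof -
  obtain c' where c': "power_expansion Y f (%k l j. c' (k, l, j))"
   "(\<Sum>k. \<Sum>l=1..harm_dim TYPE('n) k. (hardy_disc_norm (F k l))^2) = (\<Sum>\<^sub>\<infinity>i\<in>harm_index TYPE('n). (cmod (c' i))^2)"
   by (rule hardy_expansion_coefficients[OF \<open>hardy_expansion Y f F\<close>]) (rule that; assumption)
  have "c' i = c i" if "i : harm_index TYPE('n)" for i
   using power_expansion_unique[OF c'(1) pe] that by (cases i) (auto simp: harm_index_def)
  then show ?thesis unfolding c'(2) by (intro infsum_cong) simp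
 qed
 show ?thesis unfolding hardy_ball_norm_def
 proof (rule the_equality)
  show "EX F. hardy_expansion Y f F & sqrt (\<Sum>\<^sub>\<infinity>i\<in>harm_index TYPE('n). (cmod (c i))^2) = sqrt (\<Sum>k. \<Sum>l=1..harm_dim TYPE('n) k. (hardy_disc_norm (F k l))^2)"
   using power_expansion_hardy[OF pe sq] *[OF power_expansion_hardy[OF pe sq]] by (intro exI conjI) auto
 qed (use * in auto)
qed

lemma hardy_ballE:
 assumes "f : hardy_ball Y"
 obtains c where "power_expansion Y f (%k l j. c (k, l, j))" "(%i. (cmod (c i))^2) summable_on harm_index TYPE('n)"
proof -
 obtain F where "hardy_expansion Y f F" using assms by (auto simp: hardy_ball_def)
 then show ?thesis by (rule hardy_expansion_coefficients) (rule that; assumption)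
qed

lemma hardy_ballI:
 assumes "power_expansion Y f (%k l j. c (k, l, j))" "(%i. (cmod (c i))^2) summable_on harm_index TYPE('n)"
 shows "f : hardy_ball Y"
 using power_expansion_hardy[OF assms] by (auto simp: hardy_ball_def)

end

section \<open>Boundary values of Hardy functions\<close>

lemma eventually_at_left_1: "(!!r. 0 <= r ==> r < 1 ==> P r) ==> \<forall>\<^sub>F r in at_left (1::real). P r"
 unfolding eventually_at_left_field by (intro exI[of _ 0]) auto

lemma norm_diff_square_le:
 fixes a b c :: "'a::real_normed_vector"
 shows "(norm (a - c))^2 <= 2 * (norm (a - b))^2 + 2 * (norm (b - c))^2"
proof -
 have "norm (a - c) <= norm (a - b) + norm (b - c)" using norm_triangle_ineq[of "a - b" "b - c"] by simp
 then have "(norm (a - c))^2 <= (norm (a - b) + norm (b - c))^2" by (rule power_mono) simp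
 moreover have "(norm (a - b) + norm (b - c))^2 <= 2 * (norm (a - b))^2 + 2 * (norm (b - c))^2"
  using zero_le_power2[of "norm (a - b) - norm (b - c)"] by (simp add: power2_sum power2_diff)
 ultimately show ?thesis by linarith
qed

lemma integrable_diff_square:
 fixes f g :: "'a => complex"
 assumes "f : bmeas M" "g : bmeas M" "integrable M (%x. (cmod (f x))^2)" "integrable M (%x. (cmod (g x))^2)"
 shows "integrable M (%x. (cmod (f x - g x))^2)"
proof (rule integrable_bound)
 show "integrable M (%x. 2 * (cmod (f x))^2 + 2 * (cmod (g x))^2)" using assms(3,4) by simp
 show "AE x in M. norm ((cmod (f x - g x))^2) <= norm (2 * (cmod (f x))^2 + 2 * (cmod (g x))^2)"
  using norm_diff_square_le[of "f _" "g _" 0] by (intro AE_I2) simp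
qed (use assms(1,2) in measurable)

text \<open>Away from the origin some coordinate of \<open>te'\<close> is nonzero, and the ratio of
  the corresponding coordinates is a real factor relating the two vectors; both having norm 1, it is
  1 or -1.\<close>

lemma kd_point_cases:
 fixes te te' :: "real^'n"
 assumes e: "kd_point z te = kd_point z' te'" and n: "norm te = 1" "norm te' = 1"
 obtains "z' = z" "te' = te" | "z' = - z" "te' = - te" | "z = 0" "z' = 0"
proof -
 have c: "z * of_real (te $ i) = z' * of_real (te' $ i)" for i using e by (simp add: kd_point_def vec_eq_iff)
 show ?thesis
 proof (cases "z = 0 \<or> z' = 0")
  case True
  have "te ~= 0" "te' ~= 0" using n by auto
  then obtain i j where "te $ i ~= 0" "te' $ j ~= 0" by (auto simp: vec_eq_iff)
  with c[of i] c[of j] True have "z = 0 & z' = 0" by auto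
  then show ?thesis using that(3) by blast
 next
  case False
  have "te' ~= 0" using n by auto
  then obtain i where i: "te' $ i ~= 0" by (auto simp: vec_eq_iff)
  define t where "t = te $ i / te' $ i"
  have z': "z' = z * of_real t" using c[of i] i by (simp add: t_def field_simps)
  have "complex_of_real (te $ j) = of_real (t * te' $ j)" for j using c[of j] False by (simp add: z')
  then have "te $ j = t * te' $ j" for j by (simp only: of_real_eq_iff)
  then have th: "te = t *\<^sub>R te'" by (simp add: vec_eq_iff)
  have "\<bar>t\<bar> = 1" using n by (simp add: th)
  then have "t = 1 \<or> t = - 1" by linarith
  then show ?thesis using that(1,2) z' th by auto
 qed
qed

lemma kd_point_uminus: "kd_point (- z) (- te) = kd_point z te"
 by (simp add: kd_point_def vec_eq_iff)

lemma harm_to_circle_image: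
 assumes "l : {1..harm_dim TYPE('n::finite) k}"
 shows "(n, k, l) : to_circ ` harm_index TYPE('n) \<longleftrightarrow> n : riesz_indices k"
 using assms by (force simp: to_circ_def harm_index_def riesz_indices_def)

lemma boundary_value_uminus: "boundary_value f (- z) (- te) = boundary_value f z te"
 by (simp add: boundary_value_def kd_point_uminus)

text \<open>Lebesgue measure is invariant under translations and the sphere measure under the
  antipodal map. Adding \<open>pi\<close> may leave the interval, so shifts by \<open>pi\<close> and
  by \<open>- pi\<close> are both used: one of them stays inside.\<close>

lemma circle_sphere_AE_antipodal:
 fixes P :: "complex => real^'n => bool"
 assumes P: "AE x in dM. P (cis (fst x)) (snd x)"
  and m: "{x : space dM. P (- cis (fst x)) (- snd x)} : sets dM"
 shows "AE x in dM. P (- cis (fst x)) (- snd x)"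
proof -
 interpret P: pair_sigma_finite dA "dS :: (real^'n) measure" by (rule pair_sigma_finite_circle_sphere)
 let ?Q = "%ph. AE te in dS. P (cis ph) te"
 have "AE ph in dA. ?Q ph"
  using P.AE_pair[OF P[unfolded circle_sphere_measure_def]] by simp
 then have Q: "AE ph in lborel. ph : {0..2*pi} --> ?Q ph"
  unfolding angle_measure_def by (subst (asm) AE_restrict_space_iff) auto
 have shift: "AE ph in lborel. t + ph : {0..2*pi} --> ?Q (t + ph)" for t
 proof (rule AE_distrD[of "(+) t" lborel borel])
  show "AE ph in distr lborel borel ((+) t). ph : {0..2*pi} --> ?Q ph" unfolding lborel_distr_plus by (rule Q)
 qed simp
 have "AE ph in lborel. ph : {0..2*pi} --> (AE te in dS. P (- cis ph) te)"
  using shift[of pi] shift[of "- pi"]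
 proof eventually_elim
  case (elim ph)
  have "cis (pi + ph) = - cis ph" "cis (- pi + ph) = - cis ph" by (simp_all add: complex_eq_iff)
  with elim show ?case by (cases "ph <= pi") auto
 qed
 then have "AE ph in dA. AE te in dS. P (- cis ph) te"
  unfolding angle_measure_def by (subst AE_restrict_space_iff) auto
 note 1 = this
 have neg: "AE te in dS. R (- te)" if "AE te in dS. R te" for R :: "real^'n => bool"
 proof (rule AE_distrD[of uminus dS dS])
  have "orthogonal_transformation (uminus :: real^'n => _)" by (simp add: orthogonal_transformation_def linear_uminus)
  from distr_sphere_measure_orthogonal[OF this] have D: "distr dS dS (uminus :: real^'n => _) = dS" .
  show "AE x in distr dS dS uminus. R x" unfolding D by (rule that)
  show "uminus : dS \<rightarrow>\<^sub>M (dS :: (real^'n) measure)"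
   unfolding measurable_cong_sets[OF sets_sphere_measure sets_sphere_measure]
   by (intro measurable_restrict_space3) auto
 qed
 from 1 have "AE ph in dA. AE te in dS. P (- cis ph) (- te)"
  by (rule eventually_mono) (rule neg)
 then have "AE x in dA \<Otimes>\<^sub>M dS. P (- cis (fst x)) (- snd x)"
  by (intro P.AE_pair_measure) (use m in "simp_all add: circle_sphere_measure_def")
 then show ?thesis by (simp only: circle_sphere_measure_def)
qed

lemma antipodal_measurable:
 fixes g :: "complex => real^'n => complex"
 assumes g: "polar g : bmeas dM"
 shows "(%x. g (- cis (fst x)) (- snd x)) : bmeas dM"
proof -
 \<comment> \<open>The half turn, realised as a piecewise shift of the interval into itself.\<close>
 define T where "T ph = (if ph <= pi then ph + pi else ph - pi)" for ph
 have "T : borel \<rightarrow>\<^sub>M borel" unfolding T_def[abs_def] by measurable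
 then have "T : restrict_space borel {0..2*pi} \<rightarrow>\<^sub>M restrict_space borel {0..2*pi}"
  by (intro measurable_restrict_space3) (auto simp: T_def)
 then have T: "T : dA \<rightarrow>\<^sub>M dA" by (simp only: measurable_cong_sets[OF sets_angle_measure sets_angle_measure])
 have U: "uminus : dS \<rightarrow>\<^sub>M (dS :: (real^'n) measure)"
  unfolding measurable_cong_sets[OF sets_sphere_measure sets_sphere_measure]
  by (intro measurable_restrict_space3) auto
 have "(%x. (T (fst x), - snd x)) : (dM :: (real * (real^'n)) measure) \<rightarrow>\<^sub>M dM"
  unfolding circle_sphere_measure_def
  by (intro measurable_Pair measurable_compose[OF measurable_fst T] measurable_compose[OF measurable_snd U])
 from measurable_compose[OF this g]
 have "(%x. g (cis (T (fst x))) (- snd x)) : bmeas dM" by simp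
 moreover have "cis (T ph) = - cis ph" for ph by (simp add: T_def complex_eq_iff)
 ultimately show ?thesis by simp
qed

context
 fixes Y :: "nat => nat => real^'n => complex"
 assumes Y: "orthonormal_harmonics Y"
begin

context
 fixes f :: "complex^'n => complex" and c :: "nat * nat * nat => complex"
 assumes pe: "power_expansion Y f (%k l j. c (k, l, j))"
  and sq: "(%i. (cmod (c i))^2) summable_on harm_index TYPE('n)"
begin

lemma radial_series_value:
 assumes "0 <= r" "r < 1" "x : space dM"
 shows "f (kd_point (of_real r * cis (fst x)) (snd x)) = rseries Y c r x"
 using power_expansion_radial[OF Y pe assms] by simp

lemma boundary_value_radial_limit:
 assumes x: "x : space dM"
 shows "polar (boundary_value f) x = radial_limit Y c x"
 unfolding boundary_value_def radial_limit_def[OF Y sq]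
 by (rule Lim_cong[OF eventually_at_left_1 refl]) (rule radial_series_value[OF _ _ x])

lemma AE_boundary_value:
 "AE x in dM. ((%r. f (kd_point (of_real r * cis (fst x)) (snd x))) \<longlongrightarrow> polar (boundary_value f) x) (at_left 1)"
proof (rule AE_mp[OF AE_radial_limit[OF Y sq]], rule AE_I2, rule impI)
 fix x :: "real * (real^'n)" assume x: "x : space dM" and l: "((%r. rseries Y c r x) \<longlongrightarrow> radial_limit Y c x) (at_left 1)"
 show "((%r. f (kd_point (of_real r * cis (fst x)) (snd x))) \<longlongrightarrow> polar (boundary_value f) x) (at_left 1)"
  unfolding boundary_value_radial_limit[OF x]
  by (rule tendsto_cong[THEN iffD2, OF eventually_at_left_1 l]) (rule radial_series_value[OF _ _ x])
qed

lemma boundary_value_measurable: "polar (boundary_value f) : bmeas dM"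
 using radial_limit_measurable'[OF Y sq] boundary_value_radial_limit by (simp cong: measurable_cong)

lemma boundary_value_l2: "boundary_value f : l2_circle_sphere"
 unfolding l2_circle_sphere_iff
proof
 show "polar (boundary_value f) : bmeas dM" by (rule boundary_value_measurable)
 show "integrable dM (%x. (cmod (polar (boundary_value f) x))^2)"
  by (rule Bochner_Integration.integrable_cong[THEN iffD2, OF refl _ radial_limit_square(1)[OF Y sq]])
    (simp add: boundary_value_radial_limit)
qed

lemma boundary_value_norm: "(LINT x|dM. (cmod (polar (boundary_value f) x))^2) = 2 * pi * (\<Sum>\<^sub>\<infinity>i\<in>harm_index TYPE('n). (cmod (c i))^2)"
 unfolding radial_limit_norm[OF Y sq, symmetric]
 by (rule lint_cong[OF refl]) (simp add: boundary_value_radial_limit)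

lemma dilation_measurable:
 assumes r: "0 <= r" "r < 1"
 shows "(%x. f (kd_point (of_real r * cis (fst x)) (snd x))) : bmeas dM"
 by (rule measurable_cong[THEN iffD2, OF radial_series_value[OF r] radial_series_measurable[OF Y sq r]])

lemma dilation_square_integrable:
 assumes r: "0 <= r" "r < 1"
 shows "integrable dM (%x. (cmod (f (kd_point (of_real r * cis (fst x)) (snd x))))^2)"
 by (rule Bochner_Integration.integrable_cong[THEN iffD2, OF refl _ harmonic_series_square_integrable[OF Y sup_summable_power[OF Y sq r]]])
   (simp add: radial_series_value[OF r])

lemma boundary_value_mean_square:
 "((%r. LINT x|dM. (cmod (f (kd_point (of_real r * cis (fst x)) (snd x)) - polar (boundary_value f) x))^2) \<longlongrightarrow> 0) (at_left 1)"
proof (rule tendsto_sandwich[OF eventually_at_left_1 eventually_at_left_1 tendsto_const])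
 have "((%r. 2 * pi * abel_defect TYPE('n) c r) \<longlongrightarrow> 2 * pi * 0) (at_left 1)"
  by (intro tendsto_intros abel_defect_tendsto[OF Y sq])
 then show "((%r. 2 * pi * abel_defect TYPE('n) c r) \<longlongrightarrow> 0) (at_left 1)" by simp
 fix r :: real assume r: "0 <= r" "r < 1"
 have "(LINT x|dM. (cmod (f (kd_point (of_real r * cis (fst x)) (snd x)) - polar (boundary_value f) x))^2)
  = (LINT x|dM. (cmod (radial_limit Y c x - rseries Y c r x))^2)"
  by (rule lint_cong[OF refl]) (simp add: boundary_value_radial_limit radial_series_value[OF r] norm_minus_commute)
 then show "(LINT x|dM. (cmod (f (kd_point (of_real r * cis (fst x)) (snd x)) - polar (boundary_value f) x))^2) <= 2 * pi * abel_defect TYPE('n) c r"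
  using radial_limit_mean_square(2)[OF Y sq r] by simp
qed simp

lemma boundary_value_coefficient:
 assumes l: "l : {1..harm_dim TYPE('n) k}"
 shows "laplace_fourier_coeff Y (boundary_value f) k l (int (k + 2 * j)) = c (k, l, j)"
  and "n ~: riesz_indices k ==> laplace_fourier_coeff Y (boundary_value f) k l n = 0"
proof -
 have m: "(n, k, l) : circle_harm_index TYPE('n)" for n using l by (simp add: circle_harm_index_def)
 have "laplace_fourier_coeff Y (boundary_value f) k l n = 1 / (2*pi) * (LINT x|dM. radial_limit Y c x * cnj (circ_harm Y (n, k, l) x))" for n
  unfolding laplace_fourier_coeff_polar(1)[OF Y boundary_value_l2 l]
  by (rule arg_cong[where f = "%t. complex_of_real (1 / (2*pi)) * t"], rule lint_cong[OF refl]) (simp add: boundary_value_radial_limit)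
 then have co: "laplace_fourier_coeff Y (boundary_value f) k l n
   = (if n : riesz_indices k then c (inv_into (harm_index TYPE('n)) to_circ (n, k, l)) else 0)" for n
  using radial_limit_coefficient[OF Y sq m[of n]] harm_to_circle_image[OF l, of n] by simp
 show "n ~: riesz_indices k ==> laplace_fourier_coeff Y (boundary_value f) k l n = 0" by (simp add: co)
 have i: "(k, l, j) : harm_index TYPE('n)" using l by (simp add: harm_index_def)
 have "(int (k + 2 * j), k, l) = to_circ (k, l, j)" by (simp add: to_circ_def)
 then have "inv_into (harm_index TYPE('n)) to_circ (int (k + 2 * j), k, l) = (k, l, j)"
  using inv_into_f_f[OF inj_on_subset[OF inj_harm_to_circle subset_UNIV] i] by simp
 moreover have "int (k + 2 * j) : riesz_indices k" by (auto simp: riesz_indices_def)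
 ultimately show "laplace_fourier_coeff Y (boundary_value f) k l (int (k + 2 * j)) = c (k, l, j)" by (simp only: co if_True)
qed

lemma boundary_value_riesz: "riesz_conditions Y (boundary_value f)"
 unfolding riesz_conditions_def using boundary_value_coefficient(2) by blast

text \<open>The squared error of a partial sum is at most the sum of the squared coefficients that
  it leaves out.\<close>

lemma boundary_value_laplace_fourier:
 assumes c': "power_expansion Y f c'"
 shows "laplace_fourier_sums Y c' (boundary_value f)"
 unfolding laplace_fourier_sums_def
proof (rule tendsto_sandwich[where f = "%_. 0"])
 let ?I = "harm_index TYPE('n)"
 let ?S = "\<Sum>\<^sub>\<infinity>i\<in>?I. (cmod (c i))^2"
 show "\<forall>\<^sub>F A in finite_subsets_at_top ?I. l2_norm (%z te. boundary_value f z te - (\<Sum>(k, l, j)\<in>A. c' k l j * z ^ (k + 2*j) * Y k l te)) <= sqrt (?S - (SUM i:A. (cmod (c i))^2))"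
 proof (rule eventually_finite_subsets_at_top_weakI)
  fix A assume A: "finite A" "A <= ?I"
  let ?g = "%z te. boundary_value f z te - (\<Sum>(k, l, j)\<in>A. c' k l j * z ^ (k + 2*j) * Y k l te)"
  have "(\<Sum>(k, l, j)\<in>A. c' k l j * cis (fst x) ^ (k + 2*j) * Y k l (snd x)) = (SUM i:A. c i * circ_harm Y (to_circ i) x)" for x
  proof (rule sum.cong[OF refl])
   fix i assume "i : A"
   then obtain k l j where i: "i = (k, l, j)" "l : {1..harm_dim TYPE('n) k}" using A by (auto simp: harm_index_def)
   show "(case i of (k, l, j) => c' k l j * cis (fst x) ^ (k + 2*j) * Y k l (snd x)) = c i * circ_harm Y (to_circ i) x"
    using power_expansion_unique[OF Y c' pe i(2), of j] by (simp add: i(1) to_circ_def circ_harm_def Complex.DeMoivre)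
  qed
  then have "(LINT x|dM. (cmod (polar ?g x))^2)
    = (LINT x|dM. (cmod (radial_limit Y c x - (SUM i:A. c i * circ_harm Y (to_circ i) x)))^2)"
   by (intro lint_cong[OF refl]) (simp add: boundary_value_radial_limit)
  with radial_limit_partial_sum[OF Y sq A] have "(LINT x|dM. (cmod (polar ?g x))^2) <= 2 * pi * (?S - (SUM i:A. (cmod (c i))^2))" by simp
  then have "1 / (2*pi) * (LINT x|dM. (cmod (polar ?g x))^2) <= ?S - (SUM i:A. (cmod (c i))^2)"
   by (simp add: divide_le_eq mult.commute)
  then show "l2_norm ?g <= sqrt (?S - (SUM i:A. (cmod (c i))^2))" by (intro real_le_rsqrt) (simp only: l2_norm_polar)
 qed
 have "((%A. SUM i:A. (cmod (c i))^2) \<longlongrightarrow> ?S) (finite_subsets_at_top ?I)" by (rule infsum_tendsto[OF sq])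
 then have "((%A. sqrt (?S - (SUM i:A. (cmod (c i))^2))) \<longlongrightarrow> sqrt (?S - ?S)) (finite_subsets_at_top ?I)" by (intro tendsto_intros)
 then show "((%A. sqrt (?S - (SUM i:A. (cmod (c i))^2))) \<longlongrightarrow> 0) (finite_subsets_at_top ?I)" by simp
qed (auto simp: l2_norm_def intro!: always_eventually real_sqrt_ge_zero divide_nonneg_pos Bochner_Integration.integral_nonneg)

lemma hardy_ball_norm_boundary: "(hardy_ball_norm Y f)^2 = 1 / (2*pi) * (LINT x|dM. (cmod (polar (boundary_value f) x))^2)"
 unfolding hardy_ball_norm_series[OF Y pe sq] boundary_value_norm by (simp add: infsum_nonneg)

end

text \<open>Boundary values that agree almost everywhere have the same Laplace-Fourier coefficients,
  and these are the Taylor coefficients of the two functions.\<close>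

lemma hardy_ball_eqI:
 assumes h: "h1 : hardy_ball Y" "h2 : hardy_ball Y" and ae: "ae_equal (boundary_value h1) (boundary_value h2)" and x: "x : klein_dirac_ball"
 shows "h1 x = h2 x"
proof -
 obtain c1 where c1: "power_expansion Y h1 (%k l j. c1 (k, l, j))" "(%i. (cmod (c1 i))^2) summable_on harm_index TYPE('n)" by (rule hardy_ballE[OF Y h(1)])
 obtain c2 where c2: "power_expansion Y h2 (%k l j. c2 (k, l, j))" "(%i. (cmod (c2 i))^2) summable_on harm_index TYPE('n)" by (rule hardy_ballE[OF Y h(2)])
 have eq: "c1 (k, l, j) = c2 (k, l, j)" if l: "l : {1..harm_dim TYPE('n) k}" for k l j
 proof -
  let ?E = "%g x. polar g x * cnj (circ_harm Y (int (k + 2 * j), k, l) x)"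
  have "(LINT x|dM. ?E (boundary_value h1) x) = (LINT x|dM. ?E (boundary_value h2) x)"
  proof (rule lint_cong_AE)
   show "AE x in dM. ?E (boundary_value h1) x = ?E (boundary_value h2) x"
    using ae unfolding ae_equal_def by (simp add: case_prod_unfold) (auto elim: eventually_mono)
  qed (use laplace_fourier_coeff_polar(2)[OF Y boundary_value_l2[OF c1] l] laplace_fourier_coeff_polar(2)[OF Y boundary_value_l2[OF c2] l] in auto)
  then have "laplace_fourier_coeff Y (boundary_value h1) k l (int (k + 2 * j)) = laplace_fourier_coeff Y (boundary_value h2) k l (int (k + 2 * j))"
   by (simp only: laplace_fourier_coeff_polar(1)[OF Y boundary_value_l2[OF c1] l] laplace_fourier_coeff_polar(1)[OF Y boundary_value_l2[OF c2] l])
  then show ?thesis by (simp only: boundary_value_coefficient(1)[OF c1 l] boundary_value_coefficient(1)[OF c2 l])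
 qed
 obtain z te where z: "z : ball 0 1" "te : sphere 0 1" "x = kd_point z te" using x by (auto simp: klein_dirac_ball_def)
 let ?t = "%c (k, l, j). c (k, l, j) * z ^ (k + 2 * j) * Y k l te"
 have t: "(?t c1 has_sum h1 x) (harm_index TYPE('n))" "(?t c2 has_sum h2 x) (harm_index TYPE('n))"
  using c1(1) c2(1) z unfolding power_expansion_def by auto
 have "?t c1 i = ?t c2 i" if "i : harm_index TYPE('n)" for i using eq that by (cases i) (auto simp: harm_index_def)
 from has_sum_cong[THEN iffD1, OF this t(1)] t(2) show ?thesis by (rule has_sum_unique)
qed

text \<open>Both factors change by \<open>(- 1) ^ k\<close> under the antipodal map. At the origin
  only \<open>k = 0\<close> can contribute, and there the harmonic is constant. Hence a series in
  these terms defines a function on the quadric.\<close>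

lemma harmonic_term_kd_point:
 assumes l: "l : {1..harm_dim TYPE('n) k}" and e: "kd_point z te = kd_point z' te'" and n: "norm te = 1" "norm te' = 1"
 shows "z ^ (k + 2 * j) * Y k l te = z' ^ (k + 2 * j) * Y k l te'"
proof (rule kd_point_cases[OF e n])
 assume *: "z' = - z" "te' = - te"
 have "Y k l (- te) = (- 1) ^ k * Y k l te" using harmonic_homogeneousD(2)[OF Y_harm[OF Y l], of "- 1" te] by (simp add: scaleR_conv_of_real)
 moreover have "(- z) ^ (k + 2 * j) = (- 1) ^ k * z ^ (k + 2 * j)" by (simp add: power_minus[of z] power_add power_mult)
 ultimately have "z' ^ (k + 2 * j) * Y k l te' = ((- 1) ^ k * (- 1) ^ k) * (z ^ (k + 2 * j) * Y k l te)" unfolding * by (simp only: mult_ac)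
 moreover have "((- 1) ^ k * (- 1) ^ k :: complex) = 1" by (simp add: power_mult_distrib[symmetric])
 ultimately show ?thesis by simp
next
 assume *: "z = 0" "z' = 0"
 show ?thesis
 proof (cases "k = 0")
  case True
  have Y0: "Y k l te = Y k l 0" for te using harmonic_homogeneousD(2)[OF Y_harm[OF Y l], of 0 te] True by simp
  show ?thesis using * by (simp only: Y0[of te] Y0[of te'])
 qed (simp add: *)
qed simp

lemma power_expansion_exists:
 assumes sq: "(%i. (cmod (c i))^2) summable_on harm_index TYPE('n)"
 obtains h where "power_expansion Y h (%k l j. c (k, l, j))"
proof -
 \<comment> \<open>An arbitrary representation of each point of the quadric; by
   \<open>harmonic_term_kd_point\<close> the sum does not depend on it.\<close>
 define p where "p = (%x. SOME (z, te). x = kd_point z te & norm (te::real^'n) = 1)"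
 define h where "h x = (case p x of (z, te) => \<Sum>\<^sub>\<infinity>(k, l, j)\<in>harm_index TYPE('n). c (k, l, j) * z ^ (k + 2 * j) * Y k l te)" for x
 show ?thesis
 proof (rule that[of h], unfold power_expansion_def, intro ballI)
  fix z :: complex and te :: "real^'n" assume "z : ball 0 1" "te : sphere 0 1"
  then have z: "cmod z < 1" "norm te = 1" by auto
  obtain z' te' where p: "p (kd_point z te) = (z', te')" by fastforce
  have "case p (kd_point z te) of (z', te') => kd_point z te = kd_point z' te' & norm te' = 1"
   unfolding p_def by (rule someI[of _ "(z, te)"]) (use z in simp)
  then have e: "kd_point z' te' = kd_point z te" "norm te' = 1" by (simp_all add: p)
  have "h (kd_point z te) = (\<Sum>\<^sub>\<infinity>(k, l, j)\<in>harm_index TYPE('n). c (k, l, j) * z' ^ (k + 2 * j) * Y k l te')" by (simp add: h_def p)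
  also have "... = (\<Sum>\<^sub>\<infinity>(k, l, j)\<in>harm_index TYPE('n). c (k, l, j) * z ^ (k + 2 * j) * Y k l te)"
   by (rule infsum_cong) (use harmonic_term_kd_point[OF _ e z(2)] in "auto simp: harm_index_def mult.assoc")
  finally show "((%(k, l, j). c (k, l, j) * z ^ (k + 2 * j) * Y k l te) has_sum h (kd_point z te)) (harm_index TYPE('n))"
   using has_sum_infsum[OF harmonic_power_has_sum[OF Y sq z]] by simp
 qed
qed

text \<open>Bessel's inequality bounds all finite partial sums by the squared norm of
  \<open>g\<close>.\<close>

lemma riesz_coefficients_square_summable:
 assumes g: "g : l2_circle_sphere"
 shows "(%(k, l, j). (cmod (laplace_fourier_coeff Y g k l (int (k + 2 * j))))^2) summable_on harm_index TYPE('n)"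
proof (rule nonneg_bdd_above_summable_on)
 let ?I = "harm_index TYPE('n)" and ?M = "dM :: (real * (real^'n)) measure"
 let ?B = "(LINT x|?M. (cmod (polar g x))^2) / (2 * pi)"
 have g': "polar g : bmeas ?M" "integrable ?M (%x. (cmod (polar g x))^2)" using g by (auto simp: l2_circle_sphere_iff)
 show "bdd_above (sum (%(k, l, j). (cmod (laplace_fourier_coeff Y g k l (int (k + 2 * j))))^2) ` {F. F <= ?I & finite F})"
 proof (rule bdd_aboveI2[of _ _ ?B])
  fix A assume "A : {F. F <= ?I & finite F}"
  then have A: "A <= ?I" "finite A" by auto
  have "(SUM i:A. (cmod (LINT x|?M. polar g x * cnj (circ_harm Y (to_circ i) x)))^2) <= 2 * pi * (LINT x|?M. (cmod (polar g x))^2)"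
  proof (rule bessel_inequality[OF finite_circle_sphere, where J = ?I and B = "%i. hsup Y (to_circ i)"])
   show "(LINT x|?M. circ_harm Y (to_circ i) x * cnj (circ_harm Y (to_circ j) x)) = (if i = j then of_real (2 * pi) else 0)"
    if "i : ?I" "j : ?I" for i j
    using circle_harmonic_orthonormal[OF Y harm_to_circle_in[OF that(1)] harm_to_circle_in[OF that(2)]] inj_eq[OF inj_harm_to_circle] by simp
  qed (use A circle_harmonic_measurable[OF Y harm_to_circle_in] circle_harmonic_bound[OF Y harm_to_circle_in] harmonic_sup_nonneg[OF Y harm_to_circle_in] g' in auto)
  moreover have "(cmod (LINT x|?M. polar g x * cnj (circ_harm Y (to_circ i) x)))^2
    = (2 * pi)^2 * (case i of (k, l, j) => (cmod (laplace_fourier_coeff Y g k l (int (k + 2 * j))))^2)" if iA: "i : A" for i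
  proof -
   obtain k l j where i: "i = (k, l, j)" "l : {1..harm_dim TYPE('n) k}" using subsetD[OF A(1) iA] by (auto simp: harm_index_def)
   have "(LINT x|?M. polar g x * cnj (circ_harm Y (to_circ i) x)) = of_real (2 * pi) * laplace_fourier_coeff Y g k l (int (k + 2 * j))"
    using laplace_fourier_coeff_polar(1)[OF Y g i(2), of "int (k + 2 * j)"] by (simp add: i(1) to_circ_def)
   then show ?thesis by (simp only: norm_mult norm_of_real power_mult_distrib power2_abs i(1) prod.case)
  qed
  ultimately have "(2 * pi)^2 * (\<Sum>(k, l, j)\<in>A. (cmod (laplace_fourier_coeff Y g k l (int (k + 2 * j))))^2) <= 2 * pi * (LINT x|?M. (cmod (polar g x))^2)"
   by (simp add: sum_distrib_left)
  then have "(2 * pi) * ((2 * pi) * (\<Sum>(k, l, j)\<in>A. (cmod (laplace_fourier_coeff Y g k l (int (k + 2 * j))))^2)) <= (2 * pi) * (LINT x|?M. (cmod (polar g x))^2)"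
   by (simp only: power2_eq_square mult.assoc)
  then have "(2 * pi) * (\<Sum>(k, l, j)\<in>A. (cmod (laplace_fourier_coeff Y g k l (int (k + 2 * j))))^2) <= (LINT x|?M. (cmod (polar g x))^2)"
   by (rule mult_left_le_imp_le) simp
  then show "(\<Sum>(k, l, j)\<in>A. (cmod (laplace_fourier_coeff Y g k l (int (k + 2 * j))))^2) <= ?B"
   by (simp add: pos_le_divide_eq mult.commute)
 qed
qed auto

text \<open>Take the Hardy function whose Taylor coefficients are the Laplace-Fourier coefficients
  of \<open>g\<close>. Its boundary value shares all coefficients with \<open>g\<close>, those of
  excluded frequency being 0 for both, and completeness applies to the difference.\<close>

lemma riesz_boundary_value:
 assumes g: "g : l2_circle_sphere" and rz: "riesz_conditions Y g"
 obtains h where "h : hardy_ball Y" "ae_equal (boundary_value h) g"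
proof -
 define c where "c = (%(k, l, j). laplace_fourier_coeff Y g k l (int (k + 2 * j)))"
 have sq: "(%i. (cmod (c i))^2) summable_on harm_index TYPE('n)"
  using riesz_coefficients_square_summable[OF g] by (simp add: c_def case_prod_unfold)
 obtain h where h: "power_expansion Y h (%k l j. c (k, l, j))" by (rule power_expansion_exists[OF sq])
 let ?M = "dM :: (real * (real^'n)) measure"
 let ?b = "boundary_value h"
 have b: "?b : l2_circle_sphere" by (rule boundary_value_l2[OF h sq])
 have "AE x in ?M. polar ?b x - polar g x = 0"
 proof (rule circle_harmonics_complete[OF Y])
  show "integrable ?M (%x. polar ?b x - polar g x)" by (intro Bochner_Integration.integrable_diff l2_polar_integrable b g)
  fix i assume "i : circle_harm_index TYPE('n)"
  then obtain n k l where i: "i = (n, k, l)" "l : {1..harm_dim TYPE('n) k}" by (auto simp: circle_harm_index_def)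
  have "laplace_fourier_coeff Y ?b k l n = laplace_fourier_coeff Y g k l n"
  proof (cases "n : riesz_indices k")
   case True
   then obtain j where "n = int (k + 2 * j)" by (auto simp: riesz_indices_def)
   then show ?thesis using boundary_value_coefficient(1)[OF h sq i(2), of j] by (simp add: c_def)
  next
   case False
   then show ?thesis using boundary_value_coefficient(2)[OF h sq i(2)] rz i(2) unfolding riesz_conditions_def by metis
  qed
  then have "(LINT x|?M. polar ?b x * cnj (circ_harm Y i x)) = (LINT x|?M. polar g x * cnj (circ_harm Y i x))"
   by (simp add: laplace_fourier_coeff_polar(1)[OF Y b i(2)] laplace_fourier_coeff_polar(1)[OF Y g i(2)] i(1))
  then show "(LINT x|?M. (polar ?b x - polar g x) * cnj (circ_harm Y i x)) = 0"
   unfolding left_diff_distrib i(1)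
   by (subst Bochner_Integration.integral_diff[OF laplace_fourier_coeff_polar(2)[OF Y b i(2)] laplace_fourier_coeff_polar(2)[OF Y g i(2)]]) simp
 qed
 then have "ae_equal ?b g" by (simp add: ae_equal_def case_prod_unfold)
 then show ?thesis by (rule that[OF hardy_ballI[OF Y h sq]])
qed

end

section \<open>Boundary values, the Dirichlet problem and the isometry\<close>

context
 fixes Y :: "nat => nat => real^'n => complex"
 assumes Y: "orthonormal_harmonics Y"
begin

lemma boundary_value_AE_limit:
 assumes h: "h : hardy_ball Y"
 shows "AE x in dM. ((%r. h (kd_point (of_real r * cis (fst x)) (snd x))) \<longlongrightarrow> polar (boundary_value h) x) (at_left 1)"
proof -
 obtain c where c: "power_expansion Y h (%k l j. c (k, l, j))" "(%i. (cmod (c i))^2) summable_on harm_index TYPE('n)" by (rule hardy_ballE[OF Y h])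
 show ?thesis by (rule AE_boundary_value[OF Y c])
qed

lemma hardy_ball_boundary:
 assumes h: "h : hardy_ball Y"
 shows "boundary_value h : l2_circle_sphere" and "riesz_conditions Y (boundary_value h)"
  and "boundary_value h : l2_circle_sphere_Z2"
  and "(hardy_ball_norm Y h)^2 = 1 / (2*pi) * (LINT x|dM. (cmod (polar (boundary_value h) x))^2)"
  and "EX c. power_expansion Y h c"
  and "power_expansion Y h c' ==> laplace_fourier_sums Y c' (boundary_value h)"
proof -
 obtain c where c: "power_expansion Y h (%k l j. c (k, l, j))" "(%i. (cmod (c i))^2) summable_on harm_index TYPE('n)" by (rule hardy_ballE[OF Y h])
 show b: "boundary_value h : l2_circle_sphere" by (rule boundary_value_l2[OF Y c])
 show "riesz_conditions Y (boundary_value h)" by (rule boundary_value_riesz[OF Y c])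
 show "boundary_value h : l2_circle_sphere_Z2"
  unfolding l2_circle_sphere_Z2_def ae_equal_def using b by (simp add: boundary_value_uminus)
 show "(hardy_ball_norm Y h)^2 = 1 / (2*pi) * (LINT x|dM. (cmod (polar (boundary_value h) x))^2)"
  by (rule hardy_ball_norm_boundary[OF Y c])
 show "EX c. power_expansion Y h c" using c(1) by blast
 show "power_expansion Y h c' ==> laplace_fourier_sums Y c' (boundary_value h)" by (rule boundary_value_laplace_fourier[OF Y c])
qed

lemma dilation_integrals:
 assumes h: "h : hardy_ball Y" and g: "g : l2_circle_sphere" and r: "0 <= r" "r < 1"
 shows "integrable dM (%x. (cmod (h (kd_point (of_real r * cis (fst x)) (snd x)) - polar g x))^2)"
  and "(LINT ph|dA. LINT te|dS. (cmod (h (kd_point (of_real r * cis ph) te) - g (cis ph) te))^2)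
   = (LINT x|dM. (cmod (h (kd_point (of_real r * cis (fst x)) (snd x)) - polar g x))^2)"
  and "(LINT te|dS. LINT ph|dA. (cmod (h (kd_point (of_real r * cis ph) te) - g (cis ph) te))^2)
   = (LINT x|dM. (cmod (h (kd_point (of_real r * cis (fst x)) (snd x)) - polar g x))^2)"
proof -
 obtain c where c: "power_expansion Y h (%k l j. c (k, l, j))" "(%i. (cmod (c i))^2) summable_on harm_index TYPE('n)" by (rule hardy_ballE[OF Y h])
 show i: "integrable dM (%x. (cmod (h (kd_point (of_real r * cis (fst x)) (snd x)) - polar g x))^2)"
  using g dilation_measurable[OF Y c r] dilation_square_integrable[OF Y c r] unfolding l2_circle_sphere_iff by (intro integrable_diff_square) auto
 show "(LINT ph|dA. LINT te|dS. (cmod (h (kd_point (of_real r * cis ph) te) - g (cis ph) te))^2)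
   = (LINT x|dM. (cmod (h (kd_point (of_real r * cis (fst x)) (snd x)) - polar g x))^2)"
  using circle_sphere_integral_fst[OF i] by simp
 show "(LINT te|dS. LINT ph|dA. (cmod (h (kd_point (of_real r * cis ph) te) - g (cis ph) te))^2)
   = (LINT x|dM. (cmod (h (kd_point (of_real r * cis (fst x)) (snd x)) - polar g x))^2)"
  using circle_sphere_integral_snd[OF i] by simp
qed

lemma dilation_mean_square:
 assumes h: "h : hardy_ball Y"
 shows "((%r. LINT x|dM. (cmod (h (kd_point (of_real r * cis (fst x)) (snd x)) - polar (boundary_value h) x))^2) \<longlongrightarrow> 0) (at_left 1)"
proof -
 obtain c where c: "power_expansion Y h (%k l j. c (k, l, j))" "(%i. (cmod (c i))^2) summable_on harm_index TYPE('n)" by (rule hardy_ballE[OF Y h])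
 show ?thesis by (rule boundary_value_mean_square[OF Y c])
qed

lemma mean_square_convergence:
 assumes h: "h : hardy_ball Y"
 shows "((%r. 1 / (2*pi) * (LINT ph|dA. LINT te|dS.
    (cmod (h (kd_point (of_real r * cis ph) te) - boundary_value h (cis ph) te))^2)) \<longlongrightarrow> 0) (at_left 1)"
proof -
 have "((%r. 1 / (2*pi) * (LINT x|dM. (cmod (h (kd_point (of_real r * cis (fst x)) (snd x)) - polar (boundary_value h) x))^2)) \<longlongrightarrow> 1 / (2*pi) * 0) (at_left 1)"
  by (intro tendsto_intros dilation_mean_square h)
 then have "((%r. 1 / (2*pi) * (LINT x|dM. (cmod (h (kd_point (of_real r * cis (fst x)) (snd x)) - polar (boundary_value h) x))^2)) \<longlongrightarrow> 0) (at_left 1)" by simp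
 then show ?thesis
  by (rule tendsto_cong[THEN iffD2, OF eventually_at_left_1, rotated]) (simp only: dilation_integrals(2)[OF h hardy_ball_boundary(1)[OF h]])
qed

lemma dirichlet_solution:
 assumes h: "h : hardy_ball Y" and g: "g : l2_circle_sphere" and ae: "ae_equal (boundary_value h) g"
 shows "((%r. LINT te|dS. LINT ph|dA. (cmod (h (kd_point (of_real r * cis ph) te) - g (cis ph) te))^2) \<longlongrightarrow> 0) (at_left 1)"
proof (rule tendsto_cong[THEN iffD2, OF eventually_at_left_1 dilation_mean_square[OF h]])
 fix r :: real assume r: "0 <= r" "r < 1"
 show "(LINT te|dS. LINT ph|dA. (cmod (h (kd_point (of_real r * cis ph) te) - g (cis ph) te))^2)
  = (LINT x|dM. (cmod (h (kd_point (of_real r * cis (fst x)) (snd x)) - polar (boundary_value h) x))^2)"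
  unfolding dilation_integrals(3)[OF h g r]
 proof (rule lint_cong_AE)
  show "AE x in dM. (cmod (h (kd_point (of_real r * cis (fst x)) (snd x)) - polar g x))^2
    = (cmod (h (kd_point (of_real r * cis (fst x)) (snd x)) - polar (boundary_value h) x))^2"
   using ae unfolding ae_equal_def by (simp add: case_prod_unfold) (auto elim: eventually_mono)
 qed (use dilation_integrals(1)[OF h g r] dilation_integrals(1)[OF h hardy_ball_boundary(1)[OF h] r] in auto)
qed

text \<open>The dilations of \<open>h\<close> tend in mean square to both functions, and the squared
  triangle inequality compares these with each other.\<close>

lemma dirichlet_boundary_value:
 assumes h: "h : hardy_ball Y" and g: "g : l2_circle_sphere"
  and lim: "((%r. LINT te|dS. LINT ph|dA. (cmod (h (kd_point (of_real r * cis ph) te) - g (cis ph) te))^2) \<longlongrightarrow> 0) (at_left 1)"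
 shows "ae_equal (boundary_value h) g"
proof -
 let ?M = "dM :: (real * (real^'n)) measure"
 let ?b = "boundary_value h" and ?h = "%r x. h (kd_point (of_real r * cis (fst x)) (snd x))"
 note b = hardy_ball_boundary(1)[OF h]
 have int: "integrable ?M (%x. (cmod (polar ?b x - polar g x))^2)"
  using b g unfolding l2_circle_sphere_iff by (intro integrable_diff_square) auto
 have "(LINT x|?M. (cmod (polar ?b x - polar g x))^2) <= 0"
 proof (rule tendsto_lowerbound)
  show "((%r. 2 * (LINT x|?M. (cmod (?h r x - polar ?b x))^2) + 2 * (LINT te|dS. LINT ph|dA. (cmod (h (kd_point (of_real r * cis ph) te) - g (cis ph) te))^2)) \<longlongrightarrow> 0) (at_left 1)"
   using tendsto_add[OF tendsto_mult_left[OF dilation_mean_square[OF h], of 2] tendsto_mult_left[OF lim, of 2]] by simp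
  show "\<forall>\<^sub>F r in at_left 1. (LINT x|?M. (cmod (polar ?b x - polar g x))^2) \<le>
   2 * (LINT x|?M. (cmod (?h r x - polar ?b x))^2) + 2 * (LINT te|dS. LINT ph|dA. (cmod (h (kd_point (of_real r * cis ph) te) - g (cis ph) te))^2)"
  proof (rule eventually_at_left_1)
   fix r :: real assume r: "0 <= r" "r < 1"
   note i1 = dilation_integrals(1)[OF h b r] and i2 = dilation_integrals(1)[OF h g r]
   have "(LINT x|?M. (cmod (polar ?b x - polar g x))^2) <= (LINT x|?M. 2 * (cmod (?h r x - polar ?b x))^2 + 2 * (cmod (?h r x - polar g x))^2)"
   proof (rule Bochner_Integration.integral_mono[OF int])
    show "integrable ?M (%x. 2 * (cmod (?h r x - polar ?b x))^2 + 2 * (cmod (?h r x - polar g x))^2)" using i1 i2 by simp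
    show "(cmod (polar ?b x - polar g x))^2 <= 2 * (cmod (?h r x - polar ?b x))^2 + 2 * (cmod (?h r x - polar g x))^2" for x
     using norm_diff_square_le[of "polar ?b x" "polar g x" "?h r x"] by (simp only: norm_minus_commute[of "polar ?b x" "?h r x"])
   qed
   also have "... = 2 * (LINT x|?M. (cmod (?h r x - polar ?b x))^2) + 2 * (LINT x|?M. (cmod (?h r x - polar g x))^2)"
    using i1 i2 by (subst Bochner_Integration.integral_add) auto
   finally show "(LINT x|?M. (cmod (polar ?b x - polar g x))^2) \<le>
    2 * (LINT x|?M. (cmod (?h r x - polar ?b x))^2) + 2 * (LINT te|dS. LINT ph|dA. (cmod (h (kd_point (of_real r * cis ph) te) - g (cis ph) te))^2)"
    by (simp only: dilation_integrals(3)[OF h g r])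
  qed
 qed simp
 then have "(LINT x|?M. (cmod (polar ?b x - polar g x))^2) = 0" by (intro antisym Bochner_Integration.integral_nonneg) auto
 then have "AE x in ?M. (cmod (polar ?b x - polar g x))^2 = 0"
  using integral_nonneg_eq_0_iff_AE[OF int] by simp
 then show ?thesis by (simp add: ae_equal_def case_prod_unfold)
qed

text \<open>\<open>g\<close> agrees almost everywhere with a boundary value, which is invariant
  under the antipodal map because it depends on the point \<open>z\<theta>\<close> only; the
  antipodal map carries the exceptional null set to a null set.\<close>

lemma riesz_Z2:
 assumes g: "g : l2_circle_sphere" and rz: "riesz_conditions Y g"
 shows "g : l2_circle_sphere_Z2"
proof -
 obtain h where h: "h : hardy_ball Y" "ae_equal (boundary_value h) g" by (rule riesz_boundary_value[OF Y g rz])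
 let ?b = "boundary_value h"
 have ae: "AE x in dM. polar ?b x = polar g x" using h(2) by (simp add: ae_equal_def case_prod_unfold)
 have gm: "polar g : bmeas dM" "polar ?b : bmeas dM"
  using g hardy_ball_boundary(1)[OF h(1)] by (auto simp: l2_circle_sphere_iff)
 note antipodal_measurable[OF gm(1), measurable] antipodal_measurable[OF gm(2), measurable]
 have "AE x in dM. ?b (- cis (fst x)) (- snd x) = g (- cis (fst x)) (- snd x)"
  by (rule circle_sphere_AE_antipodal[where P = "%z te. ?b z te = g z te", OF ae]) measurable
 with ae have "AE x in dM. g (- cis (fst x)) (- snd x) = polar g x"
  by eventually_elim (simp add: boundary_value_uminus)
 then show ?thesis using g by (simp add: l2_circle_sphere_Z2_def ae_equal_def case_prod_unfold)
qed

text \<open>Linearity of the boundary value is asserted almost everywhere only: where a limit fails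
  to exist, the default value of \<open>Lim\<close> need not respect sums.\<close>

lemma hardy_ball_linear:
 assumes h: "h1 : hardy_ball Y" "h2 : hardy_ball Y"
 shows "(%x. a * h1 x + b * h2 x) : hardy_ball Y"
  and "ae_equal (boundary_value (%x. a * h1 x + b * h2 x)) (%z te. a * boundary_value h1 z te + b * boundary_value h2 z te)"
proof -
 obtain c1 where c1: "power_expansion Y h1 (%k l j. c1 (k, l, j))" "(%i. (cmod (c1 i))^2) summable_on harm_index TYPE('n)" by (rule hardy_ballE[OF Y h(1)])
 obtain c2 where c2: "power_expansion Y h2 (%k l j. c2 (k, l, j))" "(%i. (cmod (c2 i))^2) summable_on harm_index TYPE('n)" by (rule hardy_ballE[OF Y h(2)])
 have "(%i. (cmod (a * c1 i + b * c2 i))^2) summable_on harm_index TYPE('n)"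
 proof (rule summable_on_comparison_test)
  show "(%i. 2 * (cmod a)^2 * (cmod (c1 i))^2 + 2 * (cmod b)^2 * (cmod (c2 i))^2) summable_on harm_index TYPE('n)"
   by (intro summable_on_add summable_on_cmult_right c1(2) c2(2))
  show "(cmod (a * c1 i + b * c2 i))^2 <= 2 * (cmod a)^2 * (cmod (c1 i))^2 + 2 * (cmod b)^2 * (cmod (c2 i))^2" for i
   using norm_diff_square_le[of "a * c1 i" "- (b * c2 i)" 0] by (simp add: norm_mult power_mult_distrib mult.assoc)
 qed simp
 moreover have "power_expansion Y (%x. a * h1 x + b * h2 x) (%k l j. a * c1 (k, l, j) + b * c2 (k, l, j))"
  unfolding power_expansion_def
 proof (intro ballI)
  fix z :: complex and te :: "real^'n" assume z: "z : ball 0 1" "te : sphere 0 1"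
  have "((%(k, l, j). c1 (k, l, j) * z ^ (k + 2*j) * Y k l te) has_sum h1 (kd_point z te)) (harm_index TYPE('n))"
   "((%(k, l, j). c2 (k, l, j) * z ^ (k + 2*j) * Y k l te) has_sum h2 (kd_point z te)) (harm_index TYPE('n))"
   using c1(1) c2(1) z unfolding power_expansion_def by auto
  from has_sum_add[OF has_sum_cmult_right[OF this(1), of a] has_sum_cmult_right[OF this(2), of b]]
  show "((%(k, l, j). (a * c1 (k, l, j) + b * c2 (k, l, j)) * z ^ (k + 2*j) * Y k l te) has_sum (a * h1 (kd_point z te) + b * h2 (kd_point z te))) (harm_index TYPE('n))"
   by (simp add: case_prod_unfold algebra_simps)
 qed
 ultimately show "(%x. a * h1 x + b * h2 x) : hardy_ball Y"
  using hardy_ballI[OF Y, where c = "%i. a * c1 i + b * c2 i"] by blast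
 have "AE x in dM. polar (boundary_value (%x. a * h1 x + b * h2 x)) x = a * polar (boundary_value h1) x + b * polar (boundary_value h2) x"
  using boundary_value_AE_limit[OF h(1)] boundary_value_AE_limit[OF h(2)]
 proof eventually_elim
  case (elim x)
  show ?case unfolding boundary_value_def[of "%x. a * h1 x + b * h2 x"]
   by (rule tendsto_Lim) (simp, intro tendsto_intros elim)
 qed
 then show "ae_equal (boundary_value (%x. a * h1 x + b * h2 x)) (%z te. a * boundary_value h1 z te + b * boundary_value h2 z te)"
  by (simp add: ae_equal_def case_prod_unfold)
qed

lemma boundary_value_isometry:
 assumes h: "h1 : hardy_ball Y" "h2 : hardy_ball Y"
 shows "l2_norm (%z te. boundary_value h1 z te - boundary_value h2 z te) = hardy_ball_norm Y (%x. h1 x - h2 x)"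
proof -
 let ?d = "%x. h1 x - h2 x" and ?b = "%z te. boundary_value h1 z te - boundary_value h2 z te"
 have d: "?d : hardy_ball Y" and ae: "ae_equal (boundary_value ?d) ?b"
  using hardy_ball_linear[OF h, of 1 "- 1"] by simp_all
 have "(l2_norm ?b)^2 = 1 / (2*pi) * (LINT x|dM. (cmod (polar ?b x))^2)" by (rule l2_norm_polar)
 also have "(LINT x|dM. (cmod (polar ?b x))^2) = (LINT x|dM. (cmod (polar (boundary_value ?d) x))^2)"
 proof (rule lint_cong_AE)
  show "AE x in dM. (cmod (polar ?b x))^2 = (cmod (polar (boundary_value ?d) x))^2"
   using ae unfolding ae_equal_def by (simp add: case_prod_unfold) (auto elim: eventually_mono)
 qed (use hardy_ball_boundary(1)[OF h(1)] hardy_ball_boundary(1)[OF h(2)] hardy_ball_boundary(1)[OF d] in "auto simp: l2_circle_sphere_iff")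
 finally have "(l2_norm ?b)^2 = (hardy_ball_norm Y ?d)^2" by (simp only: hardy_ball_boundary(4)[OF d])
 moreover have "0 <= hardy_ball_norm Y ?d"
 proof -
  obtain c where c: "power_expansion Y ?d (%k l j. c (k, l, j))" "(%i. (cmod (c i))^2) summable_on harm_index TYPE('n)" by (rule hardy_ballE[OF Y d])
  show ?thesis unfolding hardy_ball_norm_series[OF Y c] by (simp add: infsum_nonneg)
 qed
 moreover have "0 <= l2_norm ?b" unfolding l2_norm_def by (simp add: case_prod_unfold)
 ultimately show ?thesis by (simp add: power2_eq_iff_nonneg)
qed

text \<open>Conjugation maps the harmonics of degree \<open>k\<close> to themselves, so each
  \<open>Y k l\<close> is a combination of the conjugated \<open>Y k m\<close> and conversely. At
  each frequency the conditions for all \<open>l\<close> together are therefore the same.\<close>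

lemma riesz_conditions_unconjugated:
 assumes g: "g : l2_circle_sphere"
 shows "riesz_conditions Y g \<longleftrightarrow>
     (ALL k. ALL l:{1..harm_dim TYPE('n) k}. ALL j. j ~: riesz_indices k -->
      (LINT ph|dA. LINT te|dS.
        g (cis ph) te * cis (- (of_int j * ph)) * Y k l te) = 0)"
proof -
 let ?M = "dM :: (real * (real^'n)) measure"
 define V where "V k l j = (LINT x|?M. polar g x * cnj (circ_harm Y (j, k, l) x))" for k l j
 define U where "U k l j = (LINT ph|dA. LINT te|dS. g (cis ph) te * cis (- (of_int j * ph)) * Y k l te)" for k l j
 have rV: "riesz_conditions Y g \<longleftrightarrow> (ALL k. ALL l:{1..harm_dim TYPE('n) k}. ALL j. j ~: riesz_indices k --> V k l j = 0)"
  unfolding riesz_conditions_def V_def using laplace_fourier_coeff_polar(1)[OF Y g] by simp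
 have ch: "cnj (circ_harm Y (j, k, l) x) = cis (- (of_int j * fst x)) * cnj (Y k l (snd x))" for j k l x
  by (simp add: circ_harm_def cis_cnj)
 have Vint: "integrable ?M (%x. polar g x * cis (- (of_int j * fst x)) * cnj (Y k l (snd x)))" if "l : {1..harm_dim TYPE('n) k}" for k l j
  using laplace_fourier_coeff_polar(2)[OF Y g that, of j] unfolding ch by (simp only: mult.assoc)
 have Veq: "V k l j = (LINT x|?M. polar g x * cis (- (of_int j * fst x)) * cnj (Y k l (snd x)))" for k l j
  unfolding V_def ch by (simp only: mult.assoc)
 have cl: "EX al. (%x. cnj (Y k l x)) = (%x. SUM m:{1..harm_dim TYPE('n) k}. al m * Y k m x)" if "l : {1..harm_dim TYPE('n) k}" for k l
  by (rule harmonic_expansion_exists[OF Y harmonic_homogeneous_cnj[OF Y_harm[OF Y that]]])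
 have cl': "EX al. Y k l = (%x. SUM m:{1..harm_dim TYPE('n) k}. al m * cnj (Y k m x))" if l: "l : {1..harm_dim TYPE('n) k}" for k l
 proof -
  from cl[OF l] obtain al where "(%x. cnj (Y k l x)) = (%x. SUM m:{1..harm_dim TYPE('n) k}. al m * Y k m x)" ..
  then have "cnj (cnj (Y k l x)) = cnj (SUM m:{1..harm_dim TYPE('n) k}. al m * Y k m x)" for x by (simp add: fun_eq_iff)
  then have "Y k l = (%x. SUM m:{1..harm_dim TYPE('n) k}. cnj (al m) * cnj (Y k m x))" by (simp add: fun_eq_iff)
  then show ?thesis by (rule exI[of _ "%m. cnj (al m)"])
 qed
 have Uint: "integrable ?M (%x. polar g x * cis (- (of_int j * fst x)) * Y k l (snd x))" if l: "l : {1..harm_dim TYPE('n) k}" for k l j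
 proof -
  from cl'[OF l] obtain al where a: "Y k l = (%x. SUM m:{1..harm_dim TYPE('n) k}. al m * cnj (Y k m x))" ..
  have "integrable ?M (%x. SUM m:{1..harm_dim TYPE('n) k}. al m * (polar g x * cis (- (of_int j * fst x)) * cnj (Y k m (snd x))))"
   by (intro Bochner_Integration.integrable_sum integrable_mult_right Vint)
  then show ?thesis by (simp add: a sum_distrib_left mult_ac)
 qed
 have Ueq: "U k l j = (LINT x|?M. polar g x * cis (- (of_int j * fst x)) * Y k l (snd x))" if l: "l : {1..harm_dim TYPE('n) k}" for k l j
  using circle_sphere_integral_fst[OF Uint[OF l, of j]] by (simp add: U_def)
 have UV: "U k l j = 0" if z: "!!m. m : {1..harm_dim TYPE('n) k} ==> V k m j = 0" and l: "l : {1..harm_dim TYPE('n) k}" for k l j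
 proof -
  from cl'[OF l] obtain al where a: "Y k l = (%x. SUM m:{1..harm_dim TYPE('n) k}. al m * cnj (Y k m x))" ..
  have "U k l j = (LINT x|?M. (SUM m:{1..harm_dim TYPE('n) k}. al m * (polar g x * cis (- (of_int j * fst x)) * cnj (Y k m (snd x)))))"
   by (simp add: Ueq[OF l] a sum_distrib_left mult_ac)
  also have "... = (SUM m:{1..harm_dim TYPE('n) k}. al m * V k m j)"
   by (subst lint_sum) (auto simp: Veq intro!: integrable_mult_right Vint)
  finally show ?thesis using z by simp
 qed
 have VU: "V k l j = 0" if z: "!!m. m : {1..harm_dim TYPE('n) k} ==> U k m j = 0" and l: "l : {1..harm_dim TYPE('n) k}" for k l j
 proof -
  from cl[OF l] obtain al where a: "(%x. cnj (Y k l x)) = (%x. SUM m:{1..harm_dim TYPE('n) k}. al m * Y k m x)" ..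
  have "V k l j = (LINT x|?M. (SUM m:{1..harm_dim TYPE('n) k}. al m * (polar g x * cis (- (of_int j * fst x)) * Y k m (snd x))))"
   by (simp add: Veq fun_cong[OF a] sum_distrib_left mult_ac)
  also have "... = (SUM m:{1..harm_dim TYPE('n) k}. al m * (LINT x|?M. polar g x * cis (- (of_int j * fst x)) * Y k m (snd x)))"
   by (subst lint_sum) (auto intro!: integrable_mult_right Uint)
  also have "... = (SUM m:{1..harm_dim TYPE('n) k}. al m * U k m j)" by (rule sum.cong) (simp_all add: Ueq)
  finally show ?thesis using z by simp
 qed
 show ?thesis unfolding rV U_def[symmetric] using UV VU by blast
qed

end

section \<open>Integral formulas\<close>

context
 fixes Y :: "nat => nat => real^'n => complex"
 assumes Y: "orthonormal_harmonics Y"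
begin

definition hpart :: "nat * nat * nat => real^'n => complex" where
 "hpart = (%(k, l, j). Y k l)"

lemma harmonic_part_bound: "i : harm_index TYPE('n) ==> norm te = 1 ==> cmod (hpart i te) <= hsup Y (to_circ i)"
 using hsup(1)[OF Y] by (auto simp: harm_index_def hpart_def to_circ_def)

text \<open>Applying \<open>square_sup_summable\<close> to the root of \<open>s\<close> gives the
  first power of \<open>s\<close> here, as needed when a harmonic enters once at \<open>te'\<close>
  and once as an integrand.\<close>

lemma sup_square_power_summable:
 assumes s: "0 <= s" "s < 1"
 shows "(%i. s ^ hdeg i * (hsup Y (to_circ i))^2) summable_on harm_index TYPE('n)"
proof -
 have "(%i. (sqrt s ^ hdeg i * hsup Y (to_circ i))^2) summable_on harm_index TYPE('n)"
  by (rule square_sup_summable[OF Y]) (use s in auto)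
 moreover have "(sqrt s ^ hdeg i * hsup Y (to_circ i))^2 = s ^ hdeg i * (hsup Y (to_circ i))^2" for i
  unfolding power_mult_distrib using s by (simp add: power_mult[symmetric] mult.commute[of _ 2]) (simp add: power_mult)
 ultimately show ?thesis by simp
qed

lemma kernel_weight_summable:
 assumes te': "norm te' = 1" and s: "0 <= s" "s < 1" and u: "!!i. cmod (u i) <= s ^ hdeg i"
 shows "(%i. cmod (u i * hpart i te') * hsup Y (to_circ i)) summable_on harm_index TYPE('n)"
proof (rule summable_on_comparison_test[OF sup_square_power_summable[OF s]])
 fix i assume i: "i : harm_index TYPE('n)"
 let ?S = "hsup Y (to_circ i)"
 have S0: "0 <= ?S" by (rule harmonic_sup_nonneg[OF Y harm_to_circle_in[OF i]])
 then show "0 <= cmod (u i * hpart i te') * ?S" by simp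
 have "cmod (u i * hpart i te') <= s ^ hdeg i * ?S"
  unfolding norm_mult by (rule mult_mono[OF u harmonic_part_bound[OF i te']]) (use s in auto)
 from mult_right_mono[OF this S0] show "cmod (u i * hpart i te') * ?S <= s ^ hdeg i * ?S^2"
  by (simp only: power2_eq_square mult.assoc)
qed

context
 fixes te' :: "real^'n" and s :: real and u :: "nat * nat * nat => complex" and m :: "nat * nat * nat => int"
 assumes te': "norm te' = 1" and s: "0 <= s" "s < 1" and u: "!!i. cmod (u i) <= s ^ hdeg i"
begin

text \<open>Weights \<open>u\<close> and frequencies \<open>m\<close> are free: with frequency
  \<open>hdeg i\<close> this is the Cauchy kernel, and with \<open>poisson_frequency\<close> it is,
  up to a factor, the term by which the modified Poisson kernel differs from it.\<close>

definition kseries :: "real * (real^'n) => complex" where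
 "kseries x = (\<Sum>\<^sub>\<infinity>i\<in>harm_index TYPE('n). u i * hpart i te' * cnj (circ_harm Y (m i, fst i, fst (snd i)) x))"

lemma kernel_series_facts:
 shows "x : space dM ==>
   ((%i. u i * hpart i te' * cnj (circ_harm Y (m i, fst i, fst (snd i)) x)) has_sum kseries x) (harm_index TYPE('n))"
  and "integrable dM h ==> integrable dM (%x. kseries x * h x)"
  and "integrable dM h ==>
   ((%i. u i * hpart i te' * (LINT x|dM. cnj (circ_harm Y (m i, fst i, fst (snd i)) x) * h x))
    has_sum (LINT x|dM. kseries x * h x)) (harm_index TYPE('n))"
proof -
 let ?M = "dM :: (real * (real^'n)) measure" and ?I = "harm_index TYPE('n)"
 let ?e = "%i x. cnj (circ_harm Y (m i, fst i, fst (snd i)) x)" and ?B = "%i. hsup Y (to_circ i)"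
 note M = finite_circle_sphere[where 'n = 'n] and sm = kernel_weight_summable[OF te' s u]
 have ci: "(m i, fst i, fst (snd i)) : circle_harm_index TYPE('n)" if "i : ?I" for i
  using that by (auto simp: harm_index_def circle_harm_index_def)
 have em: "?e i : bmeas ?M" if "i : ?I" for i
  by (rule borel_measurable_cnj[OF circle_harmonic_measurable[OF Y ci[OF that]]])
 have "hsup Y (m i, fst i, fst (snd i)) = ?B i" for i by (cases i) (simp add: hsup_def to_circ_def)
 then have eB: "cmod (?e i x) <= ?B i" if "i : ?I" "x : space ?M" for i x
  using circle_harmonic_bound[OF Y ci[OF that(1)] that(2)] by simp
 have B0: "0 <= ?B i" if "i : ?I" for i by (rule harmonic_sup_nonneg[OF Y harm_to_circle_in[OF that]])
 show "((%i. u i * hpart i te' * ?e i x) has_sum kseries x) ?I" if "x : space ?M"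
  unfolding kseries_def by (rule has_sum_infsum[OF bounded_series_summable[OF M em eB B0 sm that]])
 have km: "kseries : bmeas ?M"
  unfolding kseries_def[abs_def] by (rule bounded_series_measurable[OF M em eB B0 sm])
 have kB: "cmod (kseries x) <= (\<Sum>\<^sub>\<infinity>i\<in>?I. cmod (u i * hpart i te') * ?B i)" if "x : space ?M" for x
  unfolding kseries_def by (rule bounded_series_bound[OF M em eB B0 sm that])
 assume h: "integrable ?M h"
 show "integrable ?M (%x. kseries x * h x)" by (rule bounded_mult_integrable[OF km kB h])
 show "((%i. u i * hpart i te' * (LINT x|?M. ?e i x * h x)) has_sum (LINT x|?M. kseries x * h x)) ?I"
  unfolding kseries_def by (rule bounded_series_integral[OF M em eB B0 sm h])
qed

end

lemma cauchy_kernel_alt: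
 "cauchy_kernel Y ze te' z te = (\<Sum>\<^sub>\<infinity>i\<in>harm_index TYPE('n). (ze * z) ^ hdeg i * hpart i te' * cnj (hpart i te))"
 unfolding cauchy_kernel_def
proof (rule infsum_cong)
 fix i :: "nat * nat * nat"
 obtain k l j where i: "i = (k, l, j)" by (cases i)
 show "(case i of (k, l, j) => ze ^ (2 * j + k) * Y k l te' * z ^ (2 * j + k) * cnj (Y k l te))
   = (ze * z) ^ hdeg i * hpart i te' * cnj (hpart i te)"
  unfolding i hdeg_def hpart_def prod.case power_mult_distrib add.commute[of "2 * j"] by (simp only: mult_ac)
qed

text \<open>The addition theorem inserted in the generating function of the zonal harmonics.\<close>

lemma harmonic_kernel_sums:
 assumes te: "norm (te::real^'n) = 1" "norm te' = 1" and w: "cmod w < 1"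
 shows "(%k. w ^ k * (\<Sum>l=1..harm_dim TYPE('n) k. Y k l te' * cnj (Y k l te))) sums
  ((1 - w^2) / (of_real (omega CARD('n)) * poisson_denominator w te te'))"
proof -
 have om: "omega CARD('n) ~= 0" using omega_pos[of "CARD('n)"] by simp
 have "(%k. w ^ k * zharm k te te') sums ((1 - w^2) / poisson_denominator w te te')"
  using zonal_harmonic_sums[OF te(2,1) w] by (simp add: poisson_denominator_def inner_commute)
 from sums_mult[OF this, of "1 / of_real (omega CARD('n))"]
 show ?thesis using om by (simp add: zonal_harmonic_kernel[OF Y te(2,1)])
qed

lemma one_minus_square_neq_0: "cmod w < 1 ==> 1 - w^2 ~= (0::complex)"
 using power_less_one_iff[of "cmod w" 2] by (auto simp: norm_power[symmetric])

context
 fixes te' :: "real^'n" and w :: complex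
 assumes te': "norm te' = 1" and w: "cmod w < 1"
begin

text \<open>Summation over \<open>j\<close> gives \<open>1 / (1 - w^2)\<close>, which cancels the
  numerator of the Poisson kernel. Integration against \<open>Y k l\<close> keeps the indices with
  this \<open>k\<close> and \<open>l\<close>, so the same geometric series appears.\<close>

lemma cauchy_series_facts:
 shows "norm te = 1 ==> ((%i. w ^ hdeg i * hpart i te' * cnj (hpart i te)) has_sum
    (1 / (of_real (omega CARD('n)) * poisson_denominator w te te'))) (harm_index TYPE('n))"
  and "l : {1..harm_dim TYPE('n) k} ==>
    (LINT te|dS. (\<Sum>\<^sub>\<infinity>i\<in>harm_index TYPE('n). w ^ hdeg i * hpart i te' * cnj (hpart i te)) * Y k l te)
     = w ^ k / (1 - w^2) * Y k l te'"
  and "(%te. \<Sum>\<^sub>\<infinity>i\<in>harm_index TYPE('n). w ^ hdeg i * hpart i te' * cnj (hpart i te)) : bmeas dS"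
  and "norm te = 1 ==> cmod (\<Sum>\<^sub>\<infinity>i\<in>harm_index TYPE('n). w ^ hdeg i * hpart i te' * cnj (hpart i te))
    <= (\<Sum>\<^sub>\<infinity>i\<in>harm_index TYPE('n). cmod (w ^ hdeg i * hpart i te') * hsup Y (to_circ i))"
proof -
 let ?M = "dS :: (real^'n) measure" and ?I = "harm_index TYPE('n)"
 let ?e = "%i te. cnj (hpart i te)" and ?B = "%i. hsup Y (to_circ i)"
 note M = finite_sphere_measure[where 'n = 'n]
 have sm: "(%i. cmod (w ^ hdeg i * hpart i te') * ?B i) summable_on ?I"
  by (rule kernel_weight_summable[OF te' norm_ge_zero w]) (simp add: norm_power)
 have em: "?e i : bmeas ?M" if "i : ?I" for i
 proof (rule borel_measurable_cnj)
  show "hpart i : bmeas ?M" using that Y_measurable[OF Y] by (auto simp: harm_index_def hpart_def)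
 qed
 have eB: "cmod (?e i te) <= ?B i" if "i : ?I" "te : space ?M" for i te using harmonic_part_bound[OF that(1)] that(2) by simp
 have B0: "0 <= ?B i" if "i : ?I" for i by (rule harmonic_sup_nonneg[OF Y harm_to_circle_in[OF that]])
 have sp: "te : space ?M" if "norm te = 1" for te :: "real^'n" using that by simp
 have w2: "cmod (w^2) < 1" using w by (simp add: norm_power power_less_one_iff)
 show "(%te. \<Sum>\<^sub>\<infinity>i\<in>?I. w ^ hdeg i * hpart i te' * ?e i te) : bmeas ?M"
  by (rule bounded_series_measurable[OF M em eB B0 sm])
 show "cmod (\<Sum>\<^sub>\<infinity>i\<in>?I. w ^ hdeg i * hpart i te' * ?e i te) <= (\<Sum>\<^sub>\<infinity>i\<in>?I. cmod (w ^ hdeg i * hpart i te') * ?B i)" if "norm te = 1"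
  by (rule bounded_series_bound[OF M em eB B0 sm sp[OF that]])
 show "((%i. w ^ hdeg i * hpart i te' * ?e i te) has_sum (1 / (of_real (omega CARD('n)) * poisson_denominator w te te'))) ?I"
  if te: "norm te = 1"
 proof -
  have s: "(%i. w ^ hdeg i * hpart i te' * ?e i te) summable_on ?I"
   by (rule bounded_series_summable[OF M em eB B0 sm sp[OF te]])
  have "((%k. \<Sum>l=1..harm_dim TYPE('n) k. w ^ k / (1 - w^2) * (Y k l te' * cnj (Y k l te))) has_sum
    (\<Sum>\<^sub>\<infinity>i\<in>?I. w ^ hdeg i * hpart i te' * ?e i te)) UNIV"
  proof (rule harm_index_has_sum[OF has_sum_infsum[OF s] _ harm_index_row_summable[OF s]])
   fix k l
   show "((%j. w ^ hdeg (k, l, j) * hpart (k, l, j) te' * cnj (hpart (k, l, j) te)) has_sum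
     (w ^ k / (1 - w^2) * (Y k l te' * cnj (Y k l te)))) UNIV"
   proof -
    have "w ^ hdeg (k, l, j) * hpart (k, l, j) te' * cnj (hpart (k, l, j) te) = w ^ k * (Y k l te' * cnj (Y k l te)) * (w^2) ^ j" for j
     unfolding hdeg_def hpart_def prod.case power_degree by (simp only: mult_ac)
    moreover have "w ^ k * (Y k l te' * cnj (Y k l te)) * (1 / (1 - w^2)) = w ^ k / (1 - w^2) * (Y k l te' * cnj (Y k l te))" by simp
    ultimately show ?thesis
     using has_sum_cmult_right[OF geometric_has_sum[OF w2], of "w ^ k * (Y k l te' * cnj (Y k l te))"] by (simp only:)
   qed
  qed
  from has_sum_imp_sums[OF this]
  have "(%k. 1 / (1 - w^2) * (w ^ k * (\<Sum>l=1..harm_dim TYPE('n) k. Y k l te' * cnj (Y k l te)))) sums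
    (\<Sum>\<^sub>\<infinity>i\<in>?I. w ^ hdeg i * hpart i te' * ?e i te)" by (simp add: sum_distrib_left)
  from sums_unique2[OF this sums_mult[OF harmonic_kernel_sums[OF te te' w], of "1 / (1 - w^2)"]]
  have "(\<Sum>\<^sub>\<infinity>i\<in>?I. w ^ hdeg i * hpart i te' * ?e i te) = 1 / (of_real (omega CARD('n)) * poisson_denominator w te te')"
   using one_minus_square_neq_0[OF w] by simp
  then show ?thesis using has_sum_infsum[OF s] by simp
 qed
 assume l: "l : {1..harm_dim TYPE('n) k}"
 have "((%i. w ^ hdeg i * hpart i te' * (LINT te|?M. ?e i te * Y k l te)) has_sum
   (LINT te|?M. (\<Sum>\<^sub>\<infinity>i\<in>?I. w ^ hdeg i * hpart i te' * ?e i te) * Y k l te)) ?I"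
  by (rule bounded_series_integral[OF M em eB B0 sm integrable_sphere_continuous[OF Y_continuous[OF Y l]]])
 moreover have "((%i. w ^ hdeg i * hpart i te' * (LINT te|?M. ?e i te * Y k l te)) has_sum (w ^ k / (1 - w^2) * Y k l te')) ?I"
 proof -
  have co: "(LINT te|?M. ?e (k', l', j') te * Y k l te) = (if k = k' & l = l' then 1 else 0)" if "l' : {1..harm_dim TYPE('n) k'}" for k' l' j'
   using Y_orthonormal[OF Y l that] by (simp add: hpart_def mult.commute)
  have inj: "inj (%j::nat. (k, l, j))" by (auto simp: inj_def)
  have "((%j. w ^ k * Y k l te' * (w^2) ^ j) has_sum (w ^ k * Y k l te' * (1 / (1 - w^2)))) UNIV"
   by (rule has_sum_cmult_right[OF geometric_has_sum[OF w2]])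
  then have "((%i. w ^ hdeg i * hpart i te' * (LINT te|?M. ?e i te * Y k l te)) has_sum (w ^ k * Y k l te' * (1 / (1 - w^2)))) (range (%j. (k, l, j)))"
  proof -
   have "w ^ hdeg (k, l, j) * hpart (k, l, j) te' * (LINT te|?M. ?e (k, l, j) te * Y k l te) = w ^ k * Y k l te' * (w^2) ^ j" for j
    by (simp only: co[OF l] simp_thms if_True mult_1_right)
     (simp only: hdeg_def hpart_def prod.case power_degree, simp only: mult_ac)
   then have "(%i. w ^ hdeg i * hpart i te' * (LINT te|?M. ?e i te * Y k l te)) \<circ> (%j. (k, l, j)) = (%j. w ^ k * Y k l te' * (w^2) ^ j)"
    by (simp only: o_def)
   then show "((%j. w ^ k * Y k l te' * (w^2) ^ j) has_sum (w ^ k * Y k l te' * (1 / (1 - w^2)))) UNIV ==> ?thesis"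
    by (simp only: has_sum_reindex[OF inj])
  qed
  then have "((%i. w ^ hdeg i * hpart i te' * (LINT te|?M. ?e i te * Y k l te)) has_sum (w ^ k * Y k l te' * (1 / (1 - w^2)))) ?I"
  proof (rule has_sum_cong_neutral[THEN iffD1, rotated -1])
   fix i assume "i : ?I - range (%j. (k, l, j))"
   then obtain k' l' j' where i: "i = (k', l', j')" "l' : {1..harm_dim TYPE('n) k'}" "\<not> (k = k' & l = l')" by (cases i) (auto simp: harm_index_def)
   show "w ^ hdeg i * hpart i te' * (LINT te|?M. ?e i te * Y k l te) = 0" unfolding i(1) co[OF i(2)] using i(3) by auto
  qed (use l in "auto simp: harm_index_def")
  then show ?thesis by simp
 qed
 ultimately show "(LINT te|?M. (\<Sum>\<^sub>\<infinity>i\<in>?I. w ^ hdeg i * hpart i te' * ?e i te) * Y k l te) = w ^ k / (1 - w^2) * Y k l te'"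
  by (rule has_sum_unique)
qed

end

lemma hua_aronszajn_cauchy:
 assumes "norm te = 1" "norm te' = 1" "cmod (ze / z) < 1"
 shows "hua_aronszajn_kernel ze te' z te = 1 / z * cauchy_kernel Y ze te' (1 / z) te"
 using infsumI[OF cauchy_series_facts(1)[OF assms(2,3,1)]]
 unfolding hua_aronszajn_kernel_def cauchy_kernel_alt by simp

context
 fixes f :: "complex^'n => complex" and ze :: complex and te' :: "real^'n"
 assumes f: "f : hardy_ball Y" and ze: "cmod ze < 1" and te': "norm te' = 1"
begin

lemma boundary_integrable: "integrable dM (polar (boundary_value f))"
 by (rule l2_polar_integrable[OF hardy_ball_boundary(1)[OF Y f]])

lemma cauchy_kernel_circle:
 "cauchy_kernel Y ze te' (1 / cis ph) te = kseries te' (%i. ze ^ hdeg i) (%i. int (hdeg i)) (ph, te)"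
 unfolding cauchy_kernel_alt kseries_def[OF te' norm_ge_zero ze eq_refl[OF norm_power]]
proof (rule infsum_cong)
 fix i assume "i : harm_index TYPE('n)"
 have "1 / cis ph = cnj (cis ph)" by (simp add: cis_cnj cis_inverse[symmetric] inverse_eq_divide)
 then have "(1 / cis ph) ^ n = cnj (cis (of_int (int n) * ph))" for n by (simp add: Complex.DeMoivre complex_cnj_power[symmetric] del: complex_cnj_power)
 then have "(ze * (1 / cis ph)) ^ n = ze ^ n * cnj (cis (of_int (int n) * ph))" for n by (simp only: power_mult_distrib)
 then show "(ze * (1 / cis ph)) ^ hdeg i * hpart i te' * cnj (hpart i te)
   = ze ^ hdeg i * hpart i te' * cnj (circ_harm Y (int (hdeg i), fst i, fst (snd i)) (ph, te))"
  by (cases i) (simp add: circ_harm_def hpart_def mult_ac)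
qed

text \<open>Term by term the integral returns the coefficients of the boundary value, which are the
  Taylor coefficients of \<open>f\<close>.\<close>

lemma cauchy_formula:
 shows "integrable dM (%x. cauchy_kernel Y ze te' (1 / cis (fst x)) (snd x) * polar (boundary_value f) x)"
  and "(LINT x|dM. cauchy_kernel Y ze te' (1 / cis (fst x)) (snd x) * polar (boundary_value f) x) = of_real (2 * pi) * f (kd_point ze te')"
proof -
 let ?M = "dM :: (real * (real^'n)) measure"
 let ?b = "boundary_value f"
 note kf = kernel_series_facts[OF te' norm_ge_zero ze eq_refl[OF norm_power], where m = "%i. int (hdeg i)"]
 obtain c where c: "power_expansion Y f (%k l j. c (k, l, j))" "(%i. (cmod (c i))^2) summable_on harm_index TYPE('n)" by (rule hardy_ballE[OF Y f])
 show "integrable ?M (%x. cauchy_kernel Y ze te' (1 / cis (fst x)) (snd x) * polar ?b x)"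
  using kf(2)[OF boundary_integrable] by (simp add: cauchy_kernel_circle)
 have "((%i. ze ^ hdeg i * hpart i te' * (LINT x|?M. cnj (circ_harm Y (int (hdeg i), fst i, fst (snd i)) x) * polar ?b x))
   has_sum (LINT x|?M. cauchy_kernel Y ze te' (1 / cis (fst x)) (snd x) * polar ?b x)) (harm_index TYPE('n))"
  using kf(3)[OF boundary_integrable] by (simp add: cauchy_kernel_circle)
 moreover have "((%i. ze ^ hdeg i * hpart i te' * (LINT x|?M. cnj (circ_harm Y (int (hdeg i), fst i, fst (snd i)) x) * polar ?b x))
   has_sum (of_real (2 * pi) * f (kd_point ze te'))) (harm_index TYPE('n))"
 proof (rule has_sum_cong[THEN iffD1, rotated])
  have "((%(k, l, j). c (k, l, j) * ze ^ (k + 2 * j) * Y k l te') has_sum f (kd_point ze te')) (harm_index TYPE('n))"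
   using c(1) ze te' by (simp add: power_expansion_def)
  from has_sum_cmult_right[OF this, of "of_real (2 * pi)"]
  show "((%i. of_real (2 * pi) * (case i of (k, l, j) => c (k, l, j) * ze ^ (k + 2 * j) * Y k l te')) has_sum (of_real (2 * pi) * f (kd_point ze te'))) (harm_index TYPE('n))" .
  fix i assume "i : harm_index TYPE('n)"
  then obtain k l j where i: "i = (k, l, j)" "l : {1..harm_dim TYPE('n) k}" by (auto simp: harm_index_def)
  have "1 / (2 * pi) * (LINT x|?M. polar ?b x * cnj (circ_harm Y (int (k + 2 * j), k, l) x)) = c (k, l, j)"
   by (simp only: laplace_fourier_coeff_polar(1)[OF Y hardy_ball_boundary(1)[OF Y f] i(2), symmetric] boundary_value_coefficient(1)[OF Y c i(2)])
  then have "(LINT x|?M. polar ?b x * cnj (circ_harm Y (int (k + 2 * j), k, l) x)) = of_real (2 * pi) * c (k, l, j)"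
   by (simp add: field_simps)
  then have "(LINT x|?M. cnj (circ_harm Y (int (k + 2 * j), k, l) x) * polar ?b x) = of_real (2 * pi) * c (k, l, j)"
   by (simp only: mult.commute[of "cnj _"])
  then show "of_real (2 * pi) * (case i of (k, l, j) => c (k, l, j) * ze ^ (k + 2 * j) * Y k l te')
    = ze ^ hdeg i * hpart i te' * (LINT x|?M. cnj (circ_harm Y (int (hdeg i), fst i, fst (snd i)) x) * polar ?b x)"
   by (simp add: i(1) hdeg_def hpart_def mult_ac)
 qed
 ultimately show "(LINT x|?M. cauchy_kernel Y ze te' (1 / cis (fst x)) (snd x) * polar ?b x) = of_real (2 * pi) * f (kd_point ze te')"
  by (rule has_sum_unique)
qed

lemma cauchy_representation:
 "f (kd_point ze te') = 1 / (2*pi) * (LINT ph|dA. LINT te|dS. cauchy_kernel Y ze te' (1 / cis ph) te * boundary_value f (cis ph) te)"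
 using circle_sphere_integral_fst[OF cauchy_formula(1)] cauchy_formula(2) by simp

text \<open>On the circle \<open>dz\<close> is \<open>\<i> * z * d\<phi>\<close>, and the factor
  \<open>1 / z\<close> of the kernel cancels this \<open>z\<close>.\<close>

lemma hua_aronszajn_unit_circle:
 "((%z. LINT te|dS. hua_aronszajn_kernel ze te' z te * boundary_value f z te) has_contour_integral (2 * pi * \<i> * f (kd_point ze te'))) (circlepath 0 1)"
proof -
 let ?K = "%x. cauchy_kernel Y ze te' (1 / cis (fst x)) (snd x) * polar (boundary_value f) x"
 define G where "G ph = (LINT te|dS. ?K (ph, te))" for ph
 interpret P: pair_sigma_finite dA "dS :: (real^'n) measure" by (rule pair_sigma_finite_circle_sphere)
 have iG: "integrable dA G"
  unfolding G_def[abs_def] by (rule P.integrable_fst'[OF cauchy_formula(1)[unfolded circle_sphere_measure_def]])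
 have G: "(LINT ph|dA. G ph) = of_real (2 * pi) * f (kd_point ze te')"
  unfolding G_def using circle_sphere_integral_fst[OF cauchy_formula(1)] cauchy_formula(2) by simp
 have "set_integrable lborel {0..2*pi} G"
  using iG unfolding angle_measure_def set_integrable_def by (subst (asm) integrable_restrict_space) auto
 from set_borel_integral_eq_integral[OF this]
 have "(G has_integral (of_real (2 * pi) * f (kd_point ze te'))) {0..2*pi}"
  using G by (simp add: integral_angle_measure has_integral_iff)
 from has_integral_mult_left[OF this, of \<i>]
 have hi: "((%ph. G ph * \<i>) has_integral (2 * pi * \<i> * f (kd_point ze te'))) {0..2*pi}" by (simp add: mult_ac)
 have eq: "G ph * \<i> = (LINT te|dS. hua_aronszajn_kernel ze te' (cis ph) te * boundary_value f (cis ph) te) * \<i> * cis ph" for ph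
 proof -
  have "(LINT te|dS. hua_aronszajn_kernel ze te' (cis ph) te * boundary_value f (cis ph) te) = (LINT te|dS. 1 / cis ph * ?K (ph, te))"
   by (rule lint_cong[OF refl]) (use ze te' in "simp add: hua_aronszajn_cauchy norm_divide")
  also have "... = 1 / cis ph * G ph" unfolding G_def by (rule integral_mult_right_zero)
  finally show ?thesis by (simp add: cis_neq_zero)
 qed
 have "((%z. LINT te|dS. hua_aronszajn_kernel ze te' z te * boundary_value f z te) has_contour_integral (2 * pi * \<i> * f (kd_point ze te'))) (part_circlepath 0 1 0 (2 * pi))"
  by (subst has_contour_integral_part_circlepath_iff) (use hi in "simp_all add: eq")
 then show ?thesis by (simp add: circlepath_def)
qed

end

text \<open>Doubling the angle and squaring the radius amounts to squaring:
  \<open>r^2 * cis (2*ph - 2*ph')\<close> is \<open>(cnj w)^2\<close>, whence the factorisation of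
  the denominator.\<close>

lemma modified_poisson_kernel:
 fixes w :: complex
 assumes w: "w = of_real r * cis (ph' - ph)" "0 <= r" "r < 1"
 shows "poisson_kernel_2d (r^2) (2*ph - 2*ph') = (1 - w^2 * (cnj w)^2) / ((1 - w^2) * (1 - (cnj w)^2))"
proof -
 have r2: "0 <= r^2" "r^2 < 1" using w by (auto simp: power_less_one_iff)
 have v: "of_real (r^2) * cis (2*ph - 2*ph') = (cnj w)^2"
  by (simp add: w(1) power_mult_distrib cis_cnj Complex.DeMoivre right_diff_distrib)
 have "poisson_kernel_2d (r^2) (2*ph - 2*ph') = of_real (cpoisson (r^2) (2*ph - 2*ph'))"
  unfolding poisson_kernel_2d_def by (rule infsumI[OF circle_poisson_has_sum[OF r2]])
 also have "... = of_real (1 - (r^2)^2) / of_real ((cmod (1 - of_real (r^2) * cis (2*ph - 2*ph')))^2)"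
  unfolding cpoisson_def circle_poisson_denominator by (rule of_real_divide)
 also have "of_real ((cmod (1 - of_real (r^2) * cis (2*ph - 2*ph')))^2) = (1 - w^2) * (1 - (cnj w)^2)"
  unfolding v complex_norm_square by (simp add: mult.commute)
 also have "complex_of_real (1 - (r^2)^2) = 1 - w^2 * (cnj w)^2"
 proof -
  have "w * cnj w = of_real (r^2)" unfolding complex_norm_square[symmetric] using w by (simp add: norm_mult)
  then show ?thesis by (simp add: power_mult_distrib[symmetric])
 qed
 finally show ?thesis .
qed

context
 fixes f :: "complex^'n => complex" and r ph' :: real and te' :: "real^'n"
 assumes f: "f : hardy_ball Y" and r: "0 <= r" "r < 1" and te': "norm te' = 1"
begin

text \<open>Size and phase in \<open>ph'\<close> of \<open>w^k * (cnj w)^(2*j + 2)\<close> for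
  \<open>w = r * cis (ph' - ph)\<close>; the dependence on \<open>ph\<close> is left to
  \<open>poisson_frequency\<close>.\<close>

definition poisson_weight :: "nat * nat * nat => complex" where
 "poisson_weight = (%(k, l, j). of_real r ^ (k + 2 * j + 2) * cis (of_int (int k - 2 * int j - 2) * ph'))"

definition poisson_frequency :: "nat * nat * nat => int" where
 "poisson_frequency = (%(k, l, j). int k - 2 * int j - 2)"

lemma poisson_weight_bound: "cmod (poisson_weight i) <= r ^ hdeg i"
proof -
 obtain k l j where i: "i = (k, l, j)" by (cases i)
 have "r ^ (k + 2 * j + 2) <= r ^ (k + 2 * j)" by (rule power_decreasing) (use r in auto)
 then show ?thesis using r by (simp add: i poisson_weight_def hdeg_def norm_mult norm_power)
qed

text \<open>With \<open>v = (cnj w)^2\<close> the quotient \<open>(1 - w^2 * v) / (1 - v)\<close>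
  equals \<open>1 + v / (1 - v) * (1 - w^2)\<close>. The 1 yields the Cauchy kernel, and the rest,
  expanded in powers of \<open>v\<close>, the series with frequencies
  \<open>k - 2*j - 2\<close>.\<close>

lemma poisson_kernel_split:
 assumes x: "(ph, te) : space dM"
 shows "poisson_kernel_2d (r^2) (2*ph - 2*ph') * complex_poisson_kernel (of_real r * cis ph' / cis ph) te te'
  = of_real (omega CARD('n)) * (cauchy_kernel Y (of_real r * cis ph') te' (1 / cis ph) te + kseries te' poisson_weight poisson_frequency (ph, te))"
proof -
 define w where "w = of_real r * cis (ph' - ph)"
 have w1: "cmod w < 1" using r by (simp add: w_def norm_mult)
 have we: "of_real r * cis ph' / cis ph = w" by (simp add: w_def cis_divide[symmetric])
 have te: "norm te = 1" using x by (simp add: space_circle_sphere)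
 have om: "omega CARD('n) ~= 0" using omega_pos[of "CARD('n)"] by simp
 let ?v = "(cnj w)^2" and ?D = "poisson_denominator w te te'"
 have v1: "cmod ?v < 1" using w1 by (simp add: norm_power power_less_one_iff)
 have nz: "1 - w^2 ~= 0" "1 - ?v ~= 0" using one_minus_square_neq_0[of w] one_minus_square_neq_0[of "cnj w"] w1 by auto
 have ck: "cauchy_kernel Y (of_real r * cis ph') te' (1 / cis ph) te = 1 / (of_real (omega CARD('n)) * ?D)"
  using infsumI[OF cauchy_series_facts(1)[OF te' w1 te]] we unfolding cauchy_kernel_alt by simp
 note hs = kernel_series_facts(1)[OF te' r poisson_weight_bound x, where m = poisson_frequency]
 have "((%k. \<Sum>l=1..harm_dim TYPE('n) k. w ^ k * (?v / (1 - ?v)) * (Y k l te' * cnj (Y k l te))) has_sum kseries te' poisson_weight poisson_frequency (ph, te)) UNIV"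
 proof (rule harm_index_has_sum[OF hs _ harm_index_row_summable])
  show "(%i. poisson_weight i * hpart i te' * cnj (circ_harm Y (poisson_frequency i, fst i, fst (snd i)) (ph, te))) summable_on harm_index TYPE('n)"
   using hs by (auto simp: summable_on_def)
  fix k l
  have "poisson_weight (k, l, j) * hpart (k, l, j) te' * cnj (circ_harm Y (poisson_frequency (k, l, j), fst (k, l, j), fst (snd (k, l, j))) (ph, te))
    = w ^ k * ?v * (Y k l te' * cnj (Y k l te)) * ?v ^ j" for j
  proof -
   have 1: "w ^ k * ?v * ?v ^ j = of_real r ^ (k + 2 * j + 2) * cis (of_int (int k - 2 * int j - 2) * (ph' - ph))"
   proof -
    have "w ^ k * ?v * ?v ^ j = (of_real r ^ k * of_real r ^ 2 * of_real r ^ (2 * j)) * (cis (real k * (ph' - ph)) * cis (2 * - (ph' - ph)) * cis (real (2 * j) * - (ph' - ph)))"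
     unfolding power_mult[symmetric] by (simp add: w_def power_mult_distrib Complex.DeMoivre cis_cnj mult_ac)
    also have "of_real r ^ k * of_real r ^ 2 * of_real r ^ (2 * j) = (of_real r ^ (k + 2 * j + 2) :: complex)" by (simp add: power_add power2_eq_square mult_ac)
    also have "cis (real k * (ph' - ph)) * cis (2 * - (ph' - ph)) * cis (real (2 * j) * - (ph' - ph)) = cis (of_int (int k - 2 * int j - 2) * (ph' - ph))"
     unfolding cis_mult by (simp add: algebra_simps)
    finally show ?thesis .
   qed
   have 2: "cis (of_int (int k - 2 * int j - 2) * (ph' - ph)) = cis (of_int (int k - 2 * int j - 2) * ph') * cnj (cis (of_int (int k - 2 * int j - 2) * ph))"
    by (simp add: cis_cnj cis_mult right_diff_distrib)
   have "poisson_weight (k, l, j) * hpart (k, l, j) te' * cnj (circ_harm Y (poisson_frequency (k, l, j), fst (k, l, j), fst (snd (k, l, j))) (ph, te))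
     = (of_real r ^ (k + 2 * j + 2) * (cis (of_int (int k - 2 * int j - 2) * ph') * cnj (cis (of_int (int k - 2 * int j - 2) * ph)))) * (Y k l te' * cnj (Y k l te))"
    by (simp only: poisson_weight_def poisson_frequency_def hpart_def circ_harm_def prod.case fst_conv snd_conv complex_cnj_mult mult_ac)
   also have "... = (w ^ k * ?v * ?v ^ j) * (Y k l te' * cnj (Y k l te))" by (simp only: 1 2)
   finally show ?thesis by (simp only: mult_ac)
  qed
  note e = this
  have v: "w ^ k * ?v * (Y k l te' * cnj (Y k l te)) * (1 / (1 - ?v)) = w ^ k * (?v / (1 - ?v)) * (Y k l te' * cnj (Y k l te))" by simp
  show "((%j. poisson_weight (k, l, j) * hpart (k, l, j) te' * cnj (circ_harm Y (poisson_frequency (k, l, j), fst (k, l, j), fst (snd (k, l, j))) (ph, te)))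
    has_sum (w ^ k * (?v / (1 - ?v)) * (Y k l te' * cnj (Y k l te)))) UNIV"
   using has_sum_cmult_right[OF geometric_has_sum[OF v1], of "w ^ k * ?v * (Y k l te' * cnj (Y k l te))"] by (simp only: e v)
 qed
 from has_sum_imp_sums[OF this]
 have "(%k. ?v / (1 - ?v) * (w ^ k * (\<Sum>l=1..harm_dim TYPE('n) k. Y k l te' * cnj (Y k l te)))) sums kseries te' poisson_weight poisson_frequency (ph, te)"
  by (simp add: sum_distrib_left mult_ac)
 from sums_unique2[OF this sums_mult[OF harmonic_kernel_sums[OF te te' w1]]]
 have ks: "kseries te' poisson_weight poisson_frequency (ph, te) = ?v / (1 - ?v) * ((1 - w^2) / (of_real (omega CARD('n)) * ?D))" .
 have "poisson_kernel_2d (r^2) (2*ph - 2*ph') * complex_poisson_kernel w te te' = (1 - w^2 * ?v) / (1 - ?v) * (1 / ?D)"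
  unfolding modified_poisson_kernel[OF w_def r] complex_poisson_kernel_def using nz(1) by simp
 also have "(1 - w^2 * ?v) / (1 - ?v) = 1 + ?v / (1 - ?v) * (1 - w^2)"
 proof -
  have "(1 - a * b) / (1 - b) = 1 + b / (1 - b) * (1 - a)" if nz: "1 - b ~= 0" for a b :: complex
  proof -
   have "1 + b / (1 - b) * (1 - a) = ((1 - b) + b * (1 - a)) / (1 - b)" by (simp only: add_divide_distrib divide_self[OF nz] times_divide_eq_left)
   also have "(1 - b) + b * (1 - a) = 1 - a * b" by (simp add: algebra_simps)
   finally show ?thesis ..
  qed
  then show ?thesis using nz(2) .
 qed
 also have "(1 + ?v / (1 - ?v) * (1 - w^2)) * (1 / ?D)
   = of_real (omega CARD('n)) * (1 / (of_real (omega CARD('n)) * ?D) + ?v / (1 - ?v) * ((1 - w^2) / (of_real (omega CARD('n)) * ?D)))"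
  using om by (simp add: distrib_left distrib_right add_divide_distrib)
 finally show ?thesis unfolding we ck ks .
qed

lemma modified_poisson_representation:
 "f (kd_point (of_real r * cis ph') te') =
   1 / (2 * pi * omega CARD('n)) * (LINT ph|dA. poisson_kernel_2d (r^2) (2*ph - 2*ph') *
    (LINT te|dS. complex_poisson_kernel (of_real r * cis ph' / cis ph) te te' * boundary_value f (cis ph) te))"
proof -
 let ?M = "dM :: (real * (real^'n)) measure"
 let ?b = "boundary_value f" and ?ze = "of_real r * cis ph'"
 have ze: "cmod ?ze < 1" using r by (simp add: norm_mult)
 let ?C = "%x. cauchy_kernel Y ?ze te' (1 / cis (fst x)) (snd x) * polar ?b x"
 let ?R = "%x. kseries te' poisson_weight poisson_frequency x * polar ?b x"
 have om: "omega CARD('n) ~= 0" using omega_pos[of "CARD('n)"] by simp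
 note kf = kernel_series_facts[OF te' r poisson_weight_bound, where m = poisson_frequency]
 note bi = boundary_integrable[OF f ze te'] and cf = cauchy_formula[OF f ze te']
 \<comment> \<open>All frequencies of the correction lie below \<open>k\<close>, where the Riesz
   conditions make the coefficients of the boundary value vanish.\<close>
 have R0: "(LINT x|?M. ?R x) = 0"
 proof (rule has_sum_unique[OF kf(3)[OF bi] has_sum_0])
  fix i assume "i : harm_index TYPE('n)"
  then obtain k l j where i: "i = (k, l, j)" "l : {1..harm_dim TYPE('n) k}" by (auto simp: harm_index_def)
  have "poisson_frequency i ~: riesz_indices k" by (auto simp: i poisson_frequency_def riesz_indices_def)
  then have "laplace_fourier_coeff Y ?b k l (poisson_frequency i) = 0"
   using hardy_ball_boundary(2)[OF Y f] i(2) unfolding riesz_conditions_def by blast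
  then have "(LINT x|?M. cnj (circ_harm Y (poisson_frequency i, k, l) x) * polar ?b x) = 0"
   using laplace_fourier_coeff_polar(1)[OF Y hardy_ball_boundary(1)[OF Y f] i(2), of "poisson_frequency i"] by (simp add: mult.commute)
  then show "poisson_weight i * hpart i te' * (LINT x|?M. cnj (circ_harm Y (poisson_frequency i, fst i, fst (snd i)) x) * polar ?b x) = 0"
   by (simp add: i(1))
 qed
 have "(LINT ph|dA. poisson_kernel_2d (r^2) (2*ph - 2*ph') *
    (LINT te|dS. complex_poisson_kernel (?ze / cis ph) te te' * ?b (cis ph) te))
   = (LINT ph|dA. LINT te|dS. of_real (omega CARD('n)) * (?C (ph, te) + ?R (ph, te)))"
 proof (rule lint_cong[OF refl])
  fix ph :: real assume ph: "ph : space dA"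
  have "poisson_kernel_2d (r^2) (2*ph - 2*ph') * (LINT te|dS. complex_poisson_kernel (?ze / cis ph) te te' * ?b (cis ph) te)
   = (LINT te|dS. poisson_kernel_2d (r^2) (2*ph - 2*ph') * (complex_poisson_kernel (?ze / cis ph) te te' * ?b (cis ph) te))"
   by (rule integral_mult_right_zero[symmetric])
  also have "... = (LINT te|dS. of_real (omega CARD('n)) * (?C (ph, te) + ?R (ph, te)))"
  proof (rule lint_cong[OF refl])
   fix te :: "real^'n" assume "te : space dS"
   then have "(ph, te) : space dM" using ph by (simp add: space_circle_sphere)
   from poisson_kernel_split[OF this]
   show "poisson_kernel_2d (r^2) (2*ph - 2*ph') * (complex_poisson_kernel (?ze / cis ph) te te' * ?b (cis ph) te) = of_real (omega CARD('n)) * (?C (ph, te) + ?R (ph, te))"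
    by (simp only: mult.assoc[symmetric] distrib_right fst_conv snd_conv) (simp only: mult.assoc distrib_right distrib_left)
  qed
  finally show "poisson_kernel_2d (r^2) (2*ph - 2*ph') * (LINT te|dS. complex_poisson_kernel (?ze / cis ph) te te' * ?b (cis ph) te)
   = (LINT te|dS. of_real (omega CARD('n)) * (?C (ph, te) + ?R (ph, te)))" .
 qed
 also have "... = (LINT x|?M. of_real (omega CARD('n)) * (?C x + ?R x))"
  by (rule circle_sphere_integral_fst) (intro integrable_mult_right Bochner_Integration.integrable_add cf(1) kf(2)[OF bi])
 also have "... = of_real (omega CARD('n)) * (of_real (2 * pi) * f (kd_point ?ze te'))"
  using Bochner_Integration.integral_add[OF cf(1) kf(2)[OF bi]] cf(2) R0 by simp
 finally show ?thesis using om by simp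
qed

end

section \<open>Contours outside the unit circle\<close>

lemma kd_point_scale: "a *s kd_point z te = kd_point (a * z) te"
 by (simp add: kd_point_def vec_eq_iff)

context
 fixes F :: "complex^'n => complex" and rh :: real and ze :: complex and te' :: "real^'n" and d :: "nat * nat * nat => complex"
 assumes rh: "1 < rh" and pe: "power_expansion Y (%x. F (of_real rh *s x)) (%k l j. d (k, l, j))"
  and sq: "(%i. (cmod (d i))^2) summable_on harm_index TYPE('n)"
  and ze: "cmod ze < 1" and te': "norm te' = 1"
begin

text \<open>Coefficients of \<open>F\<close> itself, the family \<open>d\<close> being that of its
  dilation by \<open>rh\<close>.\<close>

definition scaled_coeff :: "nat * nat * nat => complex" where
 "scaled_coeff i = d i / of_real rh ^ hdeg i"

text \<open>The expansion of \<open>F\<close> with its variable split: \<open>z ^ k\<close> is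
  evaluated at \<open>ze\<close> and the even part \<open>z ^ (2*j)\<close> at the contour variable.
  This is what survives the integration over the sphere.\<close>

definition split_series :: "complex => complex" where
 "split_series z = (\<Sum>\<^sub>\<infinity>(k, l, j)\<in>harm_index TYPE('n). scaled_coeff (k, l, j) * ze ^ k * Y k l te' * (z^2) ^ j)"

lemma scaled_sup_summable:
 assumes t: "0 <= t" "t < rh"
 shows "(%i. cmod (scaled_coeff i) * t ^ hdeg i * hsup Y (to_circ i)) summable_on harm_index TYPE('n)"
proof -
 have "(%i. cmod (d i * of_real (t / rh) ^ hdeg i) * hsup Y (to_circ i)) summable_on harm_index TYPE('n)"
  by (rule sup_summable_power[OF Y sq]) (use t rh in auto)
 moreover have "cmod (d i * of_real (t / rh) ^ hdeg i) = cmod (scaled_coeff i) * t ^ hdeg i" for i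
  using t rh by (simp add: scaled_coeff_def norm_mult norm_divide norm_power power_divide)
 ultimately show ?thesis by simp
qed

lemma scaled_expansion:
 assumes z: "cmod z < rh" and te: "norm te = 1"
 shows "((%i. scaled_coeff i * z ^ hdeg i * hpart i te) has_sum F (kd_point z te)) (harm_index TYPE('n))"
proof -
 have "cmod (z / of_real rh) < 1" using z rh by (simp add: norm_divide)
 then have "((%(k, l, j). d (k, l, j) * (z / of_real rh) ^ (k + 2 * j) * Y k l te) has_sum F (of_real rh *s kd_point (z / of_real rh) te)) (harm_index TYPE('n))"
  using pe te by (simp add: power_expansion_def)
 moreover have "of_real rh *s kd_point (z / of_real rh) te = kd_point z te" using rh by (simp add: kd_point_scale)
 moreover have "(%(k, l, j). d (k, l, j) * (z / of_real rh) ^ (k + 2 * j) * Y k l te) = (%i. scaled_coeff i * z ^ hdeg i * hpart i te)"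
  by (auto simp: fun_eq_iff scaled_coeff_def hdeg_def hpart_def power_divide)
 ultimately show ?thesis by simp
qed

lemma split_series_has_sum:
 assumes z: "cmod z < rh"
 shows "((%(k, l, j). scaled_coeff (k, l, j) * ze ^ k * Y k l te' * (z^2) ^ j) has_sum split_series z) (harm_index TYPE('n))"
 unfolding split_series_def
proof (rule has_sum_infsum, rule abs_summable_summable, rule summable_on_comparison_test)
 \<comment> \<open>One radius below \<open>rh\<close> that dominates both variables of the split
   series.\<close>
 define t where "t = max (cmod ze) (cmod z)"
 have t: "0 <= t" "t < rh" using ze z rh by (auto simp: t_def intro: order_trans[OF norm_ge_zero max.cobounded1])
 show "(%i. cmod (scaled_coeff i) * t ^ hdeg i * hsup Y (to_circ i)) summable_on harm_index TYPE('n)"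
  by (rule scaled_sup_summable[OF t])
 fix i assume i: "i : harm_index TYPE('n)"
 obtain k l j where i': "i = (k, l, j)" by (cases i)
 have "cmod ze ^ k <= t ^ k" "(cmod z ^ 2) ^ j <= (t ^ 2) ^ j" by (auto simp: t_def intro!: power_mono)
 then have "cmod ze ^ k * (cmod z ^ 2) ^ j <= t ^ k * (t ^ 2) ^ j" by (intro mult_mono) (use t in auto)
 also have "t ^ k * (t ^ 2) ^ j = t ^ hdeg i" by (simp only: i' hdeg_def prod.case power_add power_mult)
 finally have "cmod (scaled_coeff i) * (cmod ze ^ k * (cmod z ^ 2) ^ j) * cmod (Y k l te') <= cmod (scaled_coeff i) * t ^ hdeg i * hsup Y (to_circ i)"
  using harmonic_part_bound[OF i te'] t by (intro mult_mono mult_left_mono) (auto simp: i' hpart_def)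
 then show "cmod (case i of (k, l, j) => scaled_coeff (k, l, j) * ze ^ k * Y k l te' * (z^2) ^ j) <= cmod (scaled_coeff i) * t ^ hdeg i * hsup Y (to_circ i)"
  by (simp only: i' prod.case norm_mult norm_power mult_ac)
qed simp

lemma split_series_holomorphic: "split_series holomorphic_on ball 0 rh"
proof -
 define K where "K = (SIGMA k:UNIV. {1..harm_dim TYPE('n) k})"
 define b where "b j = (\<Sum>\<^sub>\<infinity>(k, l)\<in>K. scaled_coeff (k, l, j) * ze ^ k * Y k l te')" for j
 define p where "p = (%(j::nat, k::nat, l::nat). (k, l, j))"
 have p: "inj_on p (UNIV \<times> K)" "p ` (UNIV \<times> K) = harm_index TYPE('n)"
  by (auto simp: inj_on_def p_def K_def harm_index_def image_iff)
 have re: "((%(j, k, l). scaled_coeff (k, l, j) * ze ^ k * Y k l te' * (z^2) ^ j) has_sum split_series z) (UNIV \<times> K)" if "cmod z < rh" for z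
  using split_series_has_sum[OF that] unfolding p(2)[symmetric] has_sum_reindex[OF p(1)] by (simp add: o_def p_def case_prod_unfold)
 have bs: "((%(k, l). scaled_coeff (k, l, j) * ze ^ k * Y k l te') has_sum b j) K" for j
 proof -
  have "(%(j, y). case y of (k, l) => scaled_coeff (k, l, j) * ze ^ k * Y k l te') summable_on UNIV \<times> K"
   using re[of 1] rh by (auto simp: summable_on_def)
  from summable_on_SigmaD1[OF this, of j] show ?thesis unfolding b_def by (intro has_sum_infsum) simp
 qed
 have sums: "(%j. b j * (z^2) ^ j) sums split_series z" if "cmod z < rh" for z
 proof (rule has_sum_imp_sums, rule has_sum_SigmaD[OF re[OF that]])
  show "((%y. case (j, y) of (j, k, l) => scaled_coeff (k, l, j) * ze ^ k * Y k l te' * (z^2) ^ j) has_sum b j * (z^2) ^ j) K" for j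
   using has_sum_cmult_left[OF bs[of j], of "(z^2) ^ j"] by (simp add: case_prod_unfold)
 qed
 \<comment> \<open>The series runs over powers of \<open>z^2\<close>, so holomorphy is proved for
   the series in \<open>y = z^2\<close> on the disc of radius \<open>rh^2\<close>. The choice of a
   root by \<open>csqrt\<close> does not affect the value, which depends on its square.\<close>
 define Ph where "Ph y = split_series (csqrt y)" for y
 have "Ph holomorphic_on ball 0 (rh^2)"
 proof (rule power_series_holomorphic[where a = b])
  fix y :: complex assume "y : ball 0 (rh^2)"
  moreover have "(cmod (csqrt y))^2 = cmod y" by (simp only: norm_power[symmetric] power2_csqrt)
  ultimately have "(cmod (csqrt y))^2 < rh^2" by simp
  then have "cmod (csqrt y) < rh" by (rule power_less_imp_less_base) (use rh in simp)
  from sums[OF this] show "(%j. b j * (y - 0) ^ j) sums Ph y" by (simp add: Ph_def)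
 qed
 moreover have "(%z::complex. z^2) ` ball 0 rh <= ball 0 (rh^2)" by (auto simp: norm_power power_strict_mono simp del: mem_ball)
 moreover have "(%z::complex. z^2) holomorphic_on ball 0 rh" by (intro holomorphic_intros)
 ultimately have "(Ph \<circ> (%z. z^2)) holomorphic_on ball 0 rh" by (intro holomorphic_on_compose_gen)
 then show ?thesis
 proof (rule holomorphic_transform)
  fix z :: complex assume z: "z : ball 0 rh"
  have "(cmod (csqrt (z^2)))^2 = (cmod z)^2" by (simp only: norm_power[symmetric] power2_csqrt)
  then have "cmod (csqrt (z^2)) = cmod z" by (simp only: power2_eq_iff_nonneg norm_ge_zero)
  with z have "(%j. b j * (z^2) ^ j) sums Ph (z^2)" using sums[of "csqrt (z^2)"] by (simp add: Ph_def)
  from sums_unique2[OF this sums] z show "(Ph \<circ> (%z. z^2)) z = split_series z" by simp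
 qed
qed

text \<open>At \<open>z = ze\<close> the split variables recombine to the expansion of
  \<open>F\<close>, and the split series is even in \<open>z\<close>.\<close>

lemma split_series_value: "split_series ze = F (kd_point ze te')" "split_series (- ze) = F (kd_point ze te')"
proof -
 have "cmod ze < rh" using ze rh by simp
 from infsumI[OF scaled_expansion[OF this te']]
 show 1: "split_series ze = F (kd_point ze te')"
  unfolding split_series_def
  by (subst (asm) infsum_cong[where g = "%(k, l, j). scaled_coeff (k, l, j) * ze ^ k * Y k l te' * (ze^2) ^ j"])
    (auto simp: hdeg_def hpart_def power_add power_mult)
 have "split_series (- ze) = split_series ze" unfolding split_series_def by simp
 then show "split_series (- ze) = F (kd_point ze te')" using 1 by simp
qed

text \<open>Integration turns a harmonic of degree \<open>k\<close> into its value at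
  \<open>te'\<close> times \<open>(ze / z)^k / (1 - (ze / z)^2)\<close>, and
  \<open>z ^ (k + 2*j) * (ze / z)^k\<close> is \<open>ze^k * z^(2*j)\<close>.\<close>

lemma hua_aronszajn_sphere_integral:
 assumes z: "1 <= cmod z" "cmod z < rh"
 shows "(LINT te|dS. hua_aronszajn_kernel ze te' z te * F (kd_point z te)) = 1 / z * (1 / (1 - (ze / z)^2)) * split_series z"
proof -
 let ?M = "dS :: (real^'n) measure" and ?I = "harm_index TYPE('n)"
 let ?B = "%i. hsup Y (to_circ i)" and ?a = "%i. scaled_coeff i * z ^ hdeg i"
 define w where "w = ze / z"
 have z0: "z ~= 0" using z by auto
 have w: "cmod w < 1" using ze z z0 by (simp add: w_def norm_divide divide_less_eq)
 define C where "C te = (\<Sum>\<^sub>\<infinity>i\<in>?I. w ^ hdeg i * hpart i te' * cnj (hpart i te))" for te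
 note M = finite_sphere_measure[where 'n = 'n] and cs = cauchy_series_facts[OF te' w, folded C_def]
 have C: "integrable ?M C" by (rule bounded_integrable[OF M _ _ _ cs(3) cs(4), where J = "{}" and e = undefined and B = undefined]) auto
 have em: "hpart i : bmeas ?M" if "i : ?I" for i
  using that Y_measurable[OF Y] by (auto simp: harm_index_def hpart_def)
 have eB: "cmod (hpart i te) <= ?B i" if "i : ?I" "te : space ?M" for i te using harmonic_part_bound[OF that(1)] that(2) by simp
 have B0: "0 <= ?B i" if "i : ?I" for i by (rule harmonic_sup_nonneg[OF Y harm_to_circle_in[OF that]])
 have sm: "(%i. cmod (?a i) * ?B i) summable_on ?I"
  using scaled_sup_summable[OF norm_ge_zero z(2)] by (simp add: norm_mult norm_power)
 have "((%i. ?a i * (LINT te|?M. hpart i te * C te)) has_sum (LINT te|?M. (\<Sum>\<^sub>\<infinity>i\<in>?I. ?a i * hpart i te) * C te)) ?I"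
  by (rule bounded_series_integral[OF M em eB B0 sm C])
 moreover have "((%i. ?a i * (LINT te|?M. hpart i te * C te)) has_sum (1 / (1 - w^2) * split_series z)) ?I"
 proof (rule has_sum_cong[THEN iffD1, OF _ has_sum_cmult_right[OF split_series_has_sum[OF z(2)], of "1 / (1 - w^2)"]])
  fix i assume "i : ?I"
  then obtain k l j where i: "i = (k, l, j)" "l : {1..harm_dim TYPE('n) k}" by (auto simp: harm_index_def)
  have "(LINT te|?M. hpart i te * C te) = w ^ k / (1 - w^2) * Y k l te'"
   unfolding cs(2)[OF i(2), symmetric] i(1) by (simp add: hpart_def mult.commute)
  note L = this
  have "z ^ k * w ^ k = ze ^ k" using z0 by (simp add: w_def power_mult_distrib[symmetric])
  moreover have "z ^ hdeg i * w ^ k = (z^2) ^ j * (z ^ k * w ^ k)" by (simp only: i hdeg_def prod.case power_degree mult.assoc)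
  ultimately have zw: "z ^ hdeg i * w ^ k = (z^2) ^ j * ze ^ k" by simp
  have "?a i * (w ^ k / (1 - w^2) * Y k l te') = scaled_coeff i * (z ^ hdeg i * w ^ k) * Y k l te' * (1 / (1 - w^2))" by simp
  also have "... = 1 / (1 - w^2) * (scaled_coeff i * ze ^ k * Y k l te' * (z^2) ^ j)" unfolding zw by (simp only: mult_ac)
  finally show "1 / (1 - w^2) * (case i of (k, l, j) => scaled_coeff (k, l, j) * ze ^ k * Y k l te' * (z^2) ^ j) = ?a i * (LINT te|?M. hpart i te * C te)"
   unfolding L by (simp only: i(1) prod.case)
 qed
 ultimately have I: "(LINT te|?M. (\<Sum>\<^sub>\<infinity>i\<in>?I. ?a i * hpart i te) * C te) = 1 / (1 - w^2) * split_series z" by (rule has_sum_unique)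
 have "(LINT te|?M. hua_aronszajn_kernel ze te' z te * F (kd_point z te)) = (LINT te|?M. 1 / z * ((\<Sum>\<^sub>\<infinity>i\<in>?I. ?a i * hpart i te) * C te))"
 proof (rule lint_cong[OF refl])
  fix te assume "te : space ?M"
  then have te: "norm te = 1" by simp
  have "cauchy_kernel Y ze te' (1 / z) te = C te" unfolding cauchy_kernel_alt C_def w_def by simp
  then show "hua_aronszajn_kernel ze te' z te * F (kd_point z te) = 1 / z * ((\<Sum>\<^sub>\<infinity>i\<in>?I. ?a i * hpart i te) * C te)"
   using hua_aronszajn_cauchy[OF te te' w[unfolded w_def]] infsumI[OF scaled_expansion[OF z(2) te]] by simp
 qed
 also have "... = 1 / z * (LINT te|?M. (\<Sum>\<^sub>\<infinity>i\<in>?I. ?a i * hpart i te) * C te)" by (rule integral_mult_right_zero)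
 finally show ?thesis unfolding I by (simp only: w_def mult.assoc)
qed

text \<open>Partial fractions write \<open>z / (z^2 - ze^2)\<close> as half the sum of
  \<open>1 / (z - ze)\<close> and \<open>1 / (z + ze)\<close>. The curve avoids the open unit disc,
  so its winding number about \<open>ze\<close> and \<open>- ze\<close> is the same as about
  0.\<close>

lemma hua_aronszajn_contour:
 assumes ga: "valid_path ga" "pathfinish ga = pathstart ga" "path_image ga <= {z. 1 <= cmod z & cmod z < rh}" "winding_number ga 0 = 1"
 shows "((%z. LINT te|dS. hua_aronszajn_kernel ze te' z te * F (kd_point z te)) has_contour_integral (2 * pi * \<i> * F (kd_point ze te'))) ga"
proof -
 have wn: "winding_number ga u = 1" if "cmod u < 1" for u
 proof -
  have "winding_number ga u = winding_number ga 0"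
   by (rule winding_number_eq[OF valid_path_imp_path[OF ga(1)] ga(2), where S = "ball 0 1"]) (use that ga(3) in auto)
  then show ?thesis using ga(4) by simp
 qed
 have C: "((%z. split_series z / (z - u)) has_contour_integral (2 * pi * \<i> * split_series u)) ga" if u: "cmod u < 1" for u
 proof -
  have "((%z. split_series z / (z - u)) has_contour_integral (2 * pi * \<i> * winding_number ga u * split_series u)) ga"
   by (rule Cauchy_integral_formula_convex_simple[OF convex_ball split_series_holomorphic _ ga(1) _ ga(2)]) (use u rh ga(3) in auto)
  then show ?thesis by (simp add: wn[OF u])
 qed
 have half: "1 / 2 * (x + x) = x" for x :: complex by simp
 have "((%z. 1 / 2 * (split_series z / (z - ze) + split_series z / (z - - ze))) has_contour_integral
   (1 / 2 * (2 * pi * \<i> * split_series ze + 2 * pi * \<i> * split_series (- ze)))) ga"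
  by (intro has_contour_integral_lmul has_contour_integral_add C) (use ze in auto)
 then have "((%z. 1 / 2 * (split_series z / (z - ze) + split_series z / (z - - ze))) has_contour_integral (2 * pi * \<i> * F (kd_point ze te'))) ga"
  by (simp only: split_series_value half)
 then show ?thesis
 proof (rule has_contour_integral_eq)
  fix z assume "z : path_image ga"
  then have z: "1 <= cmod z" "cmod z < rh" using ga(3) by auto
  have nz: "z ~= 0" "z - ze ~= 0" "z + ze ~= 0" using z ze by (auto simp: add_eq_0_iff)
  have "1 - (ze / z)^2 = (z^2 - ze^2) / z^2" using nz(1) by (simp add: power_divide diff_divide_distrib)
  then have "1 / z * (1 / (1 - (ze / z)^2)) = z / (z^2 - ze^2)" using nz(1) by (simp add: power2_eq_square)
  also have "z^2 - ze^2 = (z - ze) * (z + ze)" by (simp add: power2_eq_square algebra_simps)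
  also have "z / ((z - ze) * (z + ze)) = 1 / 2 * (1 / (z - ze) + 1 / (z + ze))" by (simp add: add_frac_eq[OF nz(2,3)])
  finally show "1 / 2 * (split_series z / (z - ze) + split_series z / (z - - ze)) = (LINT te|dS. hua_aronszajn_kernel ze te' z te * F (kd_point z te))"
   unfolding hua_aronszajn_sphere_integral[OF z] by (simp add: distrib_right add_divide_distrib)
 qed
qed

end

end

context
 fixes Y :: "nat => nat => real^'n => complex"
 assumes Y: "orthonormal_harmonics Y"
begin

lemma hua_aronszajn_bigger_contour:
 assumes "rh > 1" and F: "(%x. F (of_real rh *s x)) : hardy_ball Y" and Ff: "ALL x:klein_dirac_ball. F x = f x"
  and "valid_path ga" "pathfinish ga = pathstart ga" "path_image ga <= {z. 1 <= cmod z & cmod z < rh}" "winding_number ga 0 = 1"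
  and ze: "ze : ball 0 1" "te' : sphere 0 1"
 shows "((%z. LINT te|dS. hua_aronszajn_kernel ze te' z te * F (kd_point z te)) has_contour_integral (2 * pi * \<i> * f (kd_point ze te'))) ga"
proof -
 obtain d where d: "power_expansion Y (%x. F (of_real rh *s x)) (%k l j. d (k, l, j))" "(%i. (cmod (d i))^2) summable_on harm_index TYPE('n)"
  by (rule hardy_ballE[OF Y F])
 have "F (kd_point ze te') = f (kd_point ze te')" using Ff ze by (auto simp: klein_dirac_ball_def)
 then show ?thesis using hua_aronszajn_contour[OF Y assms(1) d _ _ assms(4-7), of ze te'] ze by simp
qed

text \<open>For uniqueness, the mean square limit determines the boundary value almost everywhere,
  and this determines the function on the ball.\<close>

lemma dirichlet_problem:
 assumes g: "g : l2_circle_sphere" and rz: "riesz_conditions Y g"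
 shows "EX h:hardy_ball Y.
     ((%r. LINT te|dS. LINT ph|dA.
       (cmod (h (kd_point (of_real r * cis ph) te) - g (cis ph) te))^2) \<longlongrightarrow> 0) (at_left 1) &
     (ALL h':hardy_ball Y.
       ((%r. LINT te|dS. LINT ph|dA.
         (cmod (h' (kd_point (of_real r * cis ph) te) - g (cis ph) te))^2) \<longlongrightarrow> 0) (at_left 1) -->
       (ALL x:klein_dirac_ball. h' x = h x))"
proof -
 obtain h where h: "h : hardy_ball Y" "ae_equal (boundary_value h) g" by (rule riesz_boundary_value[OF Y g rz])
 show ?thesis
 proof (rule bexI[OF _ h(1)], intro conjI ballI impI dirichlet_solution[OF Y h(1) g h(2)])
  fix h' :: "complex^'n => complex" and x :: "complex^'n"
  assume h': "h' : hardy_ball Y" and x: "x : klein_dirac_ball"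
   and lim: "((%r. LINT te|dS. LINT ph|dA. (cmod (h' (kd_point (of_real r * cis ph) te) - g (cis ph) te))^2) \<longlongrightarrow> 0) (at_left 1)"
  have "ae_equal (boundary_value h') (boundary_value h)"
   using dirichlet_boundary_value[OF Y h' g lim] h(2) unfolding ae_equal_def by eventually_elim auto
  then show "h' x = h x" by (rule hardy_ball_eqI[OF Y h' h(1) _ x])
 qed
qed

end

theorem theorem18:
  fixes Y :: "nat \<Rightarrow> nat \<Rightarrow> real^'n \<Rightarrow> complex"
    and f :: "complex^'n \<Rightarrow> complex"
  assumes Y: "orthonormal_harmonics Y"
    and f: "f \<in> hardy_ball Y"
  shows "
    \<comment> \<open>1. Fatou type theorem\<close>
    (AE (\<phi>, \<theta>) in circle_sphere_measure.
       ((\<lambda>r. f (kd_point (of_real r * cis \<phi>) \<theta>)) \<longlongrightarrow> boundary_value f (cis \<phi>) \<theta>) (at_left 1)) \<and>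
    boundary_value f \<in> l2_circle_sphere \<and>
    (\<exists>c. power_expansion Y f c) \<and>
    (\<forall>c. power_expansion Y f c \<longrightarrow> laplace_fourier_sums Y c (boundary_value f)) \<and>

    \<comment> \<open>2. Mean square convergence\<close>
    ((\<lambda>r. 1 / (2*pi) * (LINT \<phi>|angle_measure. LINT \<theta>|sphere_measure.
        (cmod (f (kd_point (of_real r * cis \<phi>) \<theta>) - boundary_value f (cis \<phi>) \<theta>))\<^sup>2)) \<longlongrightarrow> 0)
      (at_left 1) \<and>

    \<comment> \<open>3. Riesz type conditions\<close>
    riesz_conditions Y (boundary_value f) \<and>
    (\<forall>g\<in>l2_circle_sphere.
       riesz_conditions Y g \<longleftrightarrow>
         (\<forall>k. \<forall>l\<in>{1..harm_dim TYPE('n) k}. \<forall>j. j \<notin> riesz_indices k \<longrightarrow>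
            (LINT \<phi>|angle_measure. LINT \<theta>|sphere_measure.
               g (cis \<phi>) \<theta> * cis (- (of_int j * \<phi>)) * Y k l \<theta>) = 0)) \<and>

    \<comment> \<open>4. Cauchy--Hua--Aronszajn formula: unit circle, bigger contours, the other two kernels\<close>
    (\<forall>\<zeta>\<in>ball 0 1. \<forall>\<theta>'\<in>sphere 0 1.
       ((\<lambda>z. LINT \<theta>|sphere_measure. hua_aronszajn_kernel \<zeta> \<theta>' z \<theta> * boundary_value f z \<theta>)
          has_contour_integral (2 * pi * \<i> * f (kd_point \<zeta> \<theta>'))) (circlepath 0 1)) \<and>
    (\<forall>\<rho> F \<gamma>. \<rho> > 1 \<and> (\<lambda>x. F (of_real \<rho> *s x)) \<in> hardy_ball Y \<and>
       (\<forall>x\<in>klein_dirac_ball. F x = f x) \<and>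
       valid_path \<gamma> \<and> pathfinish \<gamma> = pathstart \<gamma> \<and>
       path_image \<gamma> \<subseteq> {z. 1 \<le> cmod z \<and> cmod z < \<rho>} \<and> winding_number \<gamma> 0 = 1 \<longrightarrow>
       (\<forall>\<zeta>\<in>ball 0 1. \<forall>\<theta>'\<in>sphere 0 1.
          ((\<lambda>z. LINT \<theta>|sphere_measure. hua_aronszajn_kernel \<zeta> \<theta>' z \<theta> * F (kd_point z \<theta>))
             has_contour_integral (2 * pi * \<i> * f (kd_point \<zeta> \<theta>'))) \<gamma>)) \<and>
    (\<forall>\<zeta>\<in>ball 0 1. \<forall>\<theta>'\<in>sphere 0 1.
       f (kd_point \<zeta> \<theta>') =
         1 / (2*pi) * (LINT \<phi>|angle_measure. LINT \<theta>|sphere_measure.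
           cauchy_kernel Y \<zeta> \<theta>' (1 / cis \<phi>) \<theta> * boundary_value f (cis \<phi>) \<theta>)) \<and>
    (\<forall>r \<phi>'. \<forall>\<theta>'\<in>sphere 0 1. 0 \<le> r \<and> r < 1 \<longrightarrow>
       f (kd_point (of_real r * cis \<phi>') \<theta>') =
         1 / (2 * pi * omega CARD('n)) * (LINT \<phi>|angle_measure.
           poisson_kernel_2d (r\<^sup>2) (2*\<phi> - 2*\<phi>') *
           (LINT \<theta>|sphere_measure.
              complex_poisson_kernel (of_real r * cis \<phi>' / cis \<phi>) \<theta> \<theta>' *
              boundary_value f (cis \<phi>) \<theta>))) \<and>

    \<comment> \<open>5. Dirichlet problem\<close>
    (\<forall>g\<in>l2_circle_sphere. riesz_conditions Y g \<longrightarrow>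
       (\<exists>h\<in>hardy_ball Y.
          ((\<lambda>r. LINT \<theta>|sphere_measure. LINT \<phi>|angle_measure.
              (cmod (h (kd_point (of_real r * cis \<phi>) \<theta>) - g (cis \<phi>) \<theta>))\<^sup>2) \<longlongrightarrow> 0) (at_left 1) \<and>
          (\<forall>h'\<in>hardy_ball Y.
             ((\<lambda>r. LINT \<theta>|sphere_measure. LINT \<phi>|angle_measure.
                 (cmod (h' (kd_point (of_real r * cis \<phi>) \<theta>) - g (cis \<phi>) \<theta>))\<^sup>2) \<longlongrightarrow> 0) (at_left 1) \<longrightarrow>
             (\<forall>x\<in>klein_dirac_ball. h' x = h x)))) \<and>

    \<comment> \<open>6. Isometry onto the subspace given by the Riesz type conditions\<close>
    (\<forall>g\<in>l2_circle_sphere. riesz_conditions Y g \<longrightarrow> g \<in> l2_circle_sphere_Z2) \<and>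
    (\<forall>h\<in>hardy_ball Y.
       boundary_value h \<in> l2_circle_sphere_Z2 \<and> riesz_conditions Y (boundary_value h)) \<and>
    (\<forall>h1\<in>hardy_ball Y. \<forall>h2\<in>hardy_ball Y.
       (\<forall>a b. (\<lambda>x. a * h1 x + b * h2 x) \<in> hardy_ball Y \<and>
          ae_equal (boundary_value (\<lambda>x. a * h1 x + b * h2 x))
            (\<lambda>z \<theta>. a * boundary_value h1 z \<theta> + b * boundary_value h2 z \<theta>)) \<and>
       l2_norm (\<lambda>z \<theta>. boundary_value h1 z \<theta> - boundary_value h2 z \<theta>) =
         hardy_ball_norm Y (\<lambda>x. h1 x - h2 x) \<and>
       (ae_equal (boundary_value h1) (boundary_value h2) \<longrightarrow> (\<forall>x\<in>klein_dirac_ball. h1 x = h2 x))) \<and>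
    (\<forall>g\<in>l2_circle_sphere_Z2. riesz_conditions Y g \<longrightarrow>
       (\<exists>h\<in>hardy_ball Y. ae_equal (boundary_value h) g)) \<and>

    \<comment> \<open>7. Norm formula\<close>
    (hardy_ball_norm Y f)\<^sup>2 =
      1 / (2*pi) * (LINT \<theta>|sphere_measure. LINT \<phi>|angle_measure.
        (cmod (boundary_value f (cis \<phi>) \<theta>))\<^sup>2)"
proof (intro conjI, goal_cases)
 case 1 show ?case using boundary_value_AE_limit[OF Y f] by (simp add: case_prod_unfold)
next
 case 2 show ?case by (rule hardy_ball_boundary(1)[OF Y f])
next
 case 3 show ?case by (rule hardy_ball_boundary(5)[OF Y f])
next
 case 4 show ?case using hardy_ball_boundary(6)[OF Y f] by blast
next
 case 5 show ?case by (rule mean_square_convergence[OF Y f])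
next
 case 6 show ?case by (rule hardy_ball_boundary(2)[OF Y f])
next
 case 7 show ?case by (intro ballI riesz_conditions_unconjugated[OF Y])
next
 case 8 show ?case by (intro ballI hua_aronszajn_unit_circle[OF Y f]) auto
next
 case 9 show ?case by (intro allI impI ballI, elim conjE) (rule hua_aronszajn_bigger_contour[OF Y]; assumption)
next
 case 10 show ?case by (intro ballI cauchy_representation[OF Y f]) auto
next
 case 11 show ?case by (intro allI ballI impI modified_poisson_representation[OF Y f]) auto
next
 case 12 show ?case by (intro ballI impI dirichlet_problem[OF Y])
next
 case 13 show ?case by (intro ballI impI riesz_Z2[OF Y])
next
 case 14 show ?case by (intro ballI conjI hardy_ball_boundary(2,3)[OF Y])
next
 case 15 show ?case
  by (intro ballI allI impI conjI hardy_ball_linear[OF Y] boundary_value_isometry[OF Y]) (assumption | rule hardy_ball_eqI[OF Y])+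
next
 case 16 show ?case using riesz_boundary_value[OF Y] unfolding l2_circle_sphere_Z2_def by blast
next
 case 17
 have "integrable dM (%x. (cmod (polar (boundary_value f) x))^2)"
  using hardy_ball_boundary(1)[OF Y f] by (simp add: l2_circle_sphere_iff)
 from circle_sphere_integral_snd[OF this] show ?case using hardy_ball_boundary(4)[OF Y f] by simp
qed


end
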